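(* Let $p$ be a prime and $n \ge 1$. Let $P_{1}(t), \dots, P_{l}(t) \in \mathbb{Z}_{p}[t]$ be monic polynomials of degree at most $2$ whose images modulo $p$ are distinct and irreducible in $\mathbb{F}_{p}[t]$, and let $q_{j} := p^{\deg(P_{j})}$. For each $1\le j\le l$, let $G_{j}$ be a finite module over $\mathbb{Z}_{p}[t]/(P_{j}(t))$. Then \[ \underset{X \in \mathrm{Mat}_{n}(\mathbb{Z}_{p})}{\mathrm{Prob}}\left( \mathrm{cok}(P_{j}(X)) \simeq G_{j} \text{ for all } 1 \leq j \leq l\right) = \left(\prod_{j=1}^{l}\frac{q_{j}^{r_{q_{j}}(G_{j})^{2}}\prod_{i=1}^{r_{q_{j}}(G_{j})}(1 - q_{j}^{-i})^{2}}{|\mathrm{Aut}_{\mathbb{Z}_{p}[t]/(P_{j}(t))}(G_{j})|}\right) \underset{\bar{X} \in \mathrm{Mat}_{n}(\mathbb{F}_{p})}{\mathrm{Prob}}\left( \mathrm{cok}(P_{j}(\bar{X})) \simeq G_{j}/pG_{j} \text{ for all } 1 \leq j \leq l\right). \]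
   Context: The probability on $\mathrm{Mat}_n(\mathbb{Z}_p)$ is with respect to the Haar probability measure on $\mathrm{Mat}_n(\mathbb{Z}_p)\cong\mathbb{Z}_p^{n^2}$; the probability on $\mathrm{Mat}_n(\mathbb{F}_p)$ is uniform. For a matrix $Y$ over a commutative ring $A$, $\mathrm{cok}(Y)=A^n/YA^n$; $\mathrm{cok}(P_j(X))$ is a $\mathbb{Z}_{p}[t]/(P_{j}(t))$-module with $\bar t$ acting by $X$, and isomorphism is as such modules (equivalently as abelian groups); $\bar X$ reduces $P_j$ modulo $p$. For a monic $P\in\mathbb{Z}_p[t]$ irreducible mod $p$ and a finite $\mathbb{Z}_p[t]/(P(t))$-module $G$, $r_{p^{\deg P}}(G) := \dim_{\mathbb{F}_{p^{\deg(P)}}}(G/pG)$, identifying $\mathbb{F}_{p^{\deg(P)}} = \mathbb{F}_{p}[t]/(P(t))$. $\mathrm{Aut}_R(G)$ is the group of $R$-linear automorphisms of $G$. *)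

theory Defs
  imports "HOL-Algebra.Algebra" "HOL-Number_Theory.Residues" "HOL-Probability.Probability"
begin

definition Zp_ring :: "int \<Rightarrow> (nat \<Rightarrow> int) ring" where
  "Zp_ring p =
     \<lparr>carrier = {z. \<forall>k. 0 \<le> z k \<and> z k < p ^ k \<and> z (Suc k) mod p ^ k = z k},
      monoid.mult = (\<lambda>x y k. (x k * y k) mod p ^ k),
      one = (\<lambda>k. 1 mod p ^ k),
      ring.zero = (\<lambda>k. 0),
      ring.add = (\<lambda>x y k. (x k + y k) mod p ^ k)\<rparr>"

text \<open>Reduction modulo p: Z_p \<rightarrow> F_p (the F_p = residue_ring p component is level 1).\<close>
definition red_p :: "(nat \<Rightarrow> int) \<Rightarrow> int" where
  "red_p z = z 1"

definition Zp_p :: "int \<Rightarrow> (nat \<Rightarrow> int)" where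
  "Zp_p p = (\<lambda>k. p mod p ^ k)"

definition vecs :: "('a, 'm) ring_scheme \<Rightarrow> nat \<Rightarrow> (nat \<Rightarrow> 'a) set" where
  "vecs R n = {v. (\<forall>i<n. v i \<in> carrier R) \<and> (\<forall>i. n \<le> i \<longrightarrow> v i = \<zero>\<^bsub>R\<^esub>)}"

definition mats :: "('a, 'm) ring_scheme \<Rightarrow> nat \<Rightarrow> (nat \<Rightarrow> nat \<Rightarrow> 'a) set" where
  "mats R n = {A. \<forall>i j. (i < n \<and> j < n \<longrightarrow> A i j \<in> carrier R) \<and>
                        (\<not> (i < n \<and> j < n) \<longrightarrow> A i j = \<zero>\<^bsub>R\<^esub>)}"

definition vadd :: "('a, 'm) ring_scheme \<Rightarrow> nat \<Rightarrow> (nat \<Rightarrow> 'a) \<Rightarrow> (nat \<Rightarrow> 'a) \<Rightarrow> nat \<Rightarrow> 'a" where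
  "vadd R n v w = (\<lambda>i. if i < n then v i \<oplus>\<^bsub>R\<^esub> w i else \<zero>\<^bsub>R\<^esub>)"

definition vsmult :: "('a, 'm) ring_scheme \<Rightarrow> nat \<Rightarrow> 'a \<Rightarrow> (nat \<Rightarrow> 'a) \<Rightarrow> nat \<Rightarrow> 'a" where
  "vsmult R n c v = (\<lambda>i. if i < n then c \<otimes>\<^bsub>R\<^esub> v i else \<zero>\<^bsub>R\<^esub>)"

definition mvmult :: "('a, 'm) ring_scheme \<Rightarrow> nat \<Rightarrow> (nat \<Rightarrow> nat \<Rightarrow> 'a) \<Rightarrow> (nat \<Rightarrow> 'a) \<Rightarrow> nat \<Rightarrow> 'a" where
  "mvmult R n A v = (\<lambda>i. if i < n then (\<Oplus>\<^bsub>R\<^esub> j\<in>{..<n}. A i j \<otimes>\<^bsub>R\<^esub> v j) else \<zero>\<^bsub>R\<^esub>)"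

definition mmult :: "('a, 'm) ring_scheme \<Rightarrow> nat \<Rightarrow> (nat \<Rightarrow> nat \<Rightarrow> 'a) \<Rightarrow> (nat \<Rightarrow> nat \<Rightarrow> 'a) \<Rightarrow> nat \<Rightarrow> nat \<Rightarrow> 'a" where
  "mmult R n A B = (\<lambda>i j. if i < n \<and> j < n then (\<Oplus>\<^bsub>R\<^esub> l\<in>{..<n}. A i l \<otimes>\<^bsub>R\<^esub> B l j) else \<zero>\<^bsub>R\<^esub>)"

definition mone :: "('a, 'm) ring_scheme \<Rightarrow> nat \<Rightarrow> nat \<Rightarrow> nat \<Rightarrow> 'a" where
  "mone R n = (\<lambda>i j. if i < n \<and> j < n \<and> i = j then \<one>\<^bsub>R\<^esub> else \<zero>\<^bsub>R\<^esub>)"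

fun mpow :: "('a, 'm) ring_scheme \<Rightarrow> nat \<Rightarrow> (nat \<Rightarrow> nat \<Rightarrow> 'a) \<Rightarrow> nat \<Rightarrow> nat \<Rightarrow> nat \<Rightarrow> 'a" where
  "mpow R n A 0 = mone R n"
| "mpow R n A (Suc k) = mmult R n (mpow R n A k) A"

text \<open>Polynomials are HOL-Algebra lists (leading coefficient first); the coefficient of t^m.\<close>
definition pcoeff :: "'a list \<Rightarrow> nat \<Rightarrow> 'a" where
  "pcoeff P m = P ! (length P - 1 - m)"

definition mpoly_eval :: "('a, 'm) ring_scheme \<Rightarrow> nat \<Rightarrow> 'a list \<Rightarrow> (nat \<Rightarrow> nat \<Rightarrow> 'a) \<Rightarrow> nat \<Rightarrow> nat \<Rightarrow> 'a" where
  "mpoly_eval R n P A = (\<lambda>i j. if i < n \<and> j < n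
       then (\<Oplus>\<^bsub>R\<^esub> m\<in>{..<length P}. pcoeff P m \<otimes>\<^bsub>R\<^esub> mpow R n A m i j) else \<zero>\<^bsub>R\<^esub>)"

record ('a, 'b) tmodule = "('a, 'b) module" + tact :: "'b \<Rightarrow> 'b"

text \<open>M is a module over R[t]/(P(t)): an R-module with an R-linear endomorphism T
  (the action of t) such that P(T) = 0.\<close>
definition poly_tmodule :: "('a, 'm) ring_scheme \<Rightarrow> 'a list \<Rightarrow> ('a, 'b, 'c) tmodule_scheme \<Rightarrow> bool" where
  "poly_tmodule R P M \<longleftrightarrow> module R M \<and>
     tact M \<in> carrier M \<rightarrow> carrier M \<and>
     (\<forall>x\<in>carrier M. \<forall>y\<in>carrier M. tact M (x \<oplus>\<^bsub>M\<^esub> y) = tact M x \<oplus>\<^bsub>M\<^esub> tact M y) \<and>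
     (\<forall>a\<in>carrier R. \<forall>x\<in>carrier M. tact M (module.smult M a x) = module.smult M a (tact M x)) \<and>
     (\<forall>x\<in>carrier M. (\<Oplus>\<^bsub>M\<^esub> m\<in>{..<length P}. module.smult M (pcoeff P m) ((tact M ^^ m) x)) = \<zero>\<^bsub>M\<^esub>)"

definition tmod_iso :: "('a, 'm) ring_scheme \<Rightarrow> ('a, 'b, 'c) tmodule_scheme \<Rightarrow> ('a, 'd, 'e) tmodule_scheme \<Rightarrow> bool" where
  "tmod_iso R M N \<longleftrightarrow> (\<exists>\<phi>. bij_betw \<phi> (carrier M) (carrier N) \<and>
     (\<forall>x\<in>carrier M. \<forall>y\<in>carrier M. \<phi> (x \<oplus>\<^bsub>M\<^esub> y) = \<phi> x \<oplus>\<^bsub>N\<^esub> \<phi> y) \<and>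
     (\<forall>a\<in>carrier R. \<forall>x\<in>carrier M. \<phi> (module.smult M a x) = module.smult N a (\<phi> x)) \<and>
     (\<forall>x\<in>carrier M. \<phi> (tact M x) = tact N (\<phi> x)))"

definition tmod_aut :: "('a, 'm) ring_scheme \<Rightarrow> ('a, 'b, 'c) tmodule_scheme \<Rightarrow> ('b \<Rightarrow> 'b) set" where
  "tmod_aut R M = {\<phi> \<in> carrier M \<rightarrow>\<^sub>E carrier M. bij_betw \<phi> (carrier M) (carrier M) \<and>
     (\<forall>x\<in>carrier M. \<forall>y\<in>carrier M. \<phi> (x \<oplus>\<^bsub>M\<^esub> y) = \<phi> x \<oplus>\<^bsub>M\<^esub> \<phi> y) \<and>
     (\<forall>a\<in>carrier R. \<forall>x\<in>carrier M. \<phi> (module.smult M a x) = module.smult M a (\<phi> x)) \<and>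
     (\<forall>x\<in>carrier M. \<phi> (tact M x) = tact M (\<phi> x))}"

definition cok :: "('a, 'm) ring_scheme \<Rightarrow> nat \<Rightarrow> (nat \<Rightarrow> nat \<Rightarrow> 'a) \<Rightarrow> (nat \<Rightarrow> nat \<Rightarrow> 'a)
                   \<Rightarrow> ('a, (nat \<Rightarrow> 'a) set) tmodule" where
  "cok R n Y A = (let I = mvmult R n Y ` vecs R n in
     \<lparr>carrier = (\<lambda>v. {vadd R n v w | w. w \<in> I}) ` vecs R n,
      monoid.mult = (\<lambda>_ _. I), one = I, ring.zero = I,
      ring.add = (\<lambda>C D. {vadd R n a b | a b. a \<in> C \<and> b \<in> D}),
      module.smult = (\<lambda>c C. {vadd R n (vsmult R n c a) w | a w. a \<in> C \<and> w \<in> I}),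
      tact = (\<lambda>C. {vadd R n (mvmult R n A a) w | a w. a \<in> C \<and> w \<in> I})\<rparr>)"

text \<open>G/pG for a Z_p[t]/(P)-module G, as an F_p[t]/(P mod p)-module (F_p = residue_ring p);
  a in F_p acts through any lift c in Z_p with c mod p = a.\<close>
definition mod_p :: "int \<Rightarrow> ((nat \<Rightarrow> int), 'b, 'c) tmodule_scheme \<Rightarrow> (int, 'b set) tmodule" where
  "mod_p p G = (let pG = {module.smult G (Zp_p p) g | g. g \<in> carrier G} in
     \<lparr>carrier = (\<lambda>g. {g \<oplus>\<^bsub>G\<^esub> h | h. h \<in> pG}) ` carrier G,
      monoid.mult = (\<lambda>_ _. pG), one = pG, ring.zero = pG,
      ring.add = (\<lambda>C D. {a \<oplus>\<^bsub>G\<^esub> b | a b. a \<in> C \<and> b \<in> D}),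
      module.smult = (\<lambda>a C. {module.smult G c g \<oplus>\<^bsub>G\<^esub> h | c g h.
                  c \<in> carrier (Zp_ring p) \<and> red_p c = a \<and> g \<in> C \<and> h \<in> pG}),
      tact = (\<lambda>C. {tact G g \<oplus>\<^bsub>G\<^esub> h | g h. g \<in> C \<and> h \<in> pG})\<rparr>)"

text \<open>Dimension over F_q = F_p[t]/(Pbar) (d = deg Pbar) of an F_p[t]/(Pbar)-module M:
  elements of F_q are represented by polynomials sum_{m<d} a_m t^m, acting by sum a_m T^m.
  The dimension is the size of an F_q-basis.\<close>
definition fq_comb :: "('a, 'b, 'c) tmodule_scheme \<Rightarrow> nat \<Rightarrow> (nat \<Rightarrow> 'b) \<Rightarrow> nat \<Rightarrow> (nat \<Rightarrow> nat \<Rightarrow> 'a) \<Rightarrow> 'b" where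
  "fq_comb M d b r a = (\<Oplus>\<^bsub>M\<^esub> i\<in>{..<r}. \<Oplus>\<^bsub>M\<^esub> m\<in>{..<d}. module.smult M (a i m) ((tact M ^^ m) (b i)))"

definition fq_basis :: "('a, 'm) ring_scheme \<Rightarrow> ('a, 'b, 'c) tmodule_scheme \<Rightarrow> nat \<Rightarrow> (nat \<Rightarrow> 'b) \<Rightarrow> nat \<Rightarrow> bool" where
  "fq_basis K M d b r \<longleftrightarrow> (\<forall>i<r. b i \<in> carrier M) \<and>
     (\<forall>x\<in>carrier M. \<exists>a. (\<forall>i m. a i m \<in> carrier K) \<and> fq_comb M d b r a = x) \<and>
     (\<forall>a. (\<forall>i m. a i m \<in> carrier K) \<and> fq_comb M d b r a = \<zero>\<^bsub>M\<^esub> \<longrightarrow>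
          (\<forall>i<r. \<forall>m<d. a i m = \<zero>\<^bsub>K\<^esub>))"

definition fq_dim :: "('a, 'm) ring_scheme \<Rightarrow> ('a, 'b, 'c) tmodule_scheme \<Rightarrow> nat \<Rightarrow> nat" where
  "fq_dim K M d = (THE r. \<exists>b. fq_basis K M d b r)"

definition r_q :: "int \<Rightarrow> (nat \<Rightarrow> int) list \<Rightarrow> ((nat \<Rightarrow> int), 'b, 'c) tmodule_scheme \<Rightarrow> nat" where
  "r_q p P G = fq_dim (residue_ring p) (mod_p p G) (length P - 1)"

text \<open>Haar measure on Z_p^{n x n}: the p-adic digits of all entries are i.i.d. uniform on {0..<p}.\<close>
definition digit_space :: "int \<Rightarrow> nat \<Rightarrow> (nat \<times> nat \<times> nat \<Rightarrow> int) measure" where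
  "digit_space p n = PiM ({..<n} \<times> {..<n} \<times> UNIV) (\<lambda>_. measure_pmf (pmf_of_set {0..<p}))"

definition mat_of_digits :: "int \<Rightarrow> nat \<Rightarrow> (nat \<times> nat \<times> nat \<Rightarrow> int) \<Rightarrow> nat \<Rightarrow> nat \<Rightarrow> nat \<Rightarrow> int" where
  "mat_of_digits p n d = (\<lambda>i j. if i < n \<and> j < n then (\<lambda>k. \<Sum>m<k. d (i, j, m) * p ^ m) else (\<lambda>k. 0))"

definition haar_prob_mat :: "int \<Rightarrow> nat \<Rightarrow> ((nat \<Rightarrow> nat \<Rightarrow> nat \<Rightarrow> int) \<Rightarrow> bool) \<Rightarrow> real" where
  "haar_prob_mat p n E = measure (digit_space p n) {d \<in> space (digit_space p n). E (mat_of_digits p n d)}"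

definition unif_prob_mat :: "int \<Rightarrow> nat \<Rightarrow> ((nat \<Rightarrow> nat \<Rightarrow> int) \<Rightarrow> bool) \<Rightarrow> real" where
  "unif_prob_mat p n E = real (card {A \<in> mats (residue_ring p) n. E A}) / real (card (mats (residue_ring p) n))"

end

theory Submission
  imports Defs
begin

text \<open>
  Choose \<open>N\<close> such that \<open>p^(N-1)\<close> kills every \<open>G_j\<close>. By completeness of \<open>Z_p\<close> (Nakayama), whether
  \<open>cok(P_j(A))\<close> is isomorphic to \<open>G_j\<close> depends on \<open>A\<close> modulo \<open>p^N\<close> only, and it says that there is a
  surjection \<open>F : Z^n \<rightarrow> G_j\<close> with \<open>F A = t F\<close> and kernel \<open>P_j(A) Z^n + p^N Z^n\<close>. Since \<open>Aut(G_j)\<close> acts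
  simply transitively on these \<open>F\<close>, it suffices to count pairs of a matrix and a family of such surjections,
  modulo \<open>p^N\<close> and modulo \<open>p\<close>.

  Fix a pair \<open>(A', F')\<close> modulo \<open>p\<close>. The lifts \<open>(A, F)\<close> with \<open>F_j A = t F_j\<close> are \<open>|Mat_n(Z/p^N)| / |Mat_n(F_p)|\<close>
  in number, since the joint map of the \<open>F_j\<close> is onto the product of the \<open>G_j\<close> (the \<open>P_j\<close> are pairwise
  comaximal modulo \<open>p\<close>). Such a lift has the right kernels if and only if each connecting map
  \<open>\<delta>_j : ker P_j(A') \<rightarrow> G_j[p]\<close>, \<open>v \<mapsto> F_j(P_j(A) v / p)\<close>, is bijective. Replacing \<open>A\<close> by \<open>A + p E\<close> adds
  \<open>P_j'(t) F_j E\<close> to \<open>\<delta>_j\<close>, and \<open>P_j'\<close> is a unit modulo \<open>(P_j, p)\<close>, so the family of the \<open>\<delta>_j\<close> is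
  equidistributed among all families of homomorphisms. Both source and target of \<open>\<delta>_j\<close> have dimension
  \<open>r_j\<close> over the field with \<open>q_j\<close> elements, whence the factor \<open>|GL_r(q)| / q^(r^2)\<close>; the second factor
  \<open>|GL_r(q)|\<close> is the order of \<open>Aut(G_j / p G_j)\<close>.
\<close>

section \<open>Abelian groups with an endomorphism\<close>

text \<open>Two devices keep the argument elementary. A finite Z_p-module is acted on through
  integers modulo a power of p, so the modules become abelian groups with an endomorphism, that is
  Z[t]-modules. The fields with q_j elements are never constructed: their arithmetic takes place in
  Z[t] modulo the ideal (p, P_j). Here the bound on the degree enters, because a nonzero residue is
  constant or linear and can be inverted by hand.

  The obstacle in the equidistribution step is that E does not commute with A, so P(A + p E) has no
  Taylor formula. One holds after applying F, provided that F E is t-linear on the preimage of ker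
  P(A'). Outside this preimage any additive extension serves, and since F E takes values in G[p],
  the relation F A = t F survives the perturbation.

  The exponent N - 1, one less than that of the modulus p^N, is the price of a division by p: a
  relation modulo p^N becomes one modulo p^(N-1), and G does not see the difference. The kernel
  condition only makes each connecting map onto; injectivity is a matter of cardinality.\<close>

locale tgroup = abelian_group G for G :: "('a, 'b, 'c) tmodule_scheme" (structure) +
  assumes T_closed [simp, intro]: "x \<in> carrier G \<Longrightarrow> tact G x \<in> carrier G"
    and T_add: "\<lbrakk>x \<in> carrier G; y \<in> carrier G\<rbrakk> \<Longrightarrow> tact G (x \<oplus> y) = tact G x \<oplus> tact G y"

text \<open>The structure of Z[t]-module, with t acting by \<open>tact\<close>. The Horner form
  gives one recursion rule for \<open>pCons\<close>, on which the inductions over polynomials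
  run.\<close>

definition act :: "('a, 'b, 'c) tmodule_scheme \<Rightarrow> int poly \<Rightarrow> 'b \<Rightarrow> 'b" where
  "act G Q x = fold_coeffs (\<lambda>a y. add_pow G a x \<oplus>\<^bsub>G\<^esub> tact G y) Q \<zero>\<^bsub>G\<^esub>"

text \<open>Z[t]-linear maps. An additive map commutes with integer multiples, and by
  \<open>Zp_smult_level\<close> a p-adic scalar acts on the finite modules considered as an
  integer.\<close>

definition thom :: "('a, 'b, 'c) tmodule_scheme \<Rightarrow> ('d, 'e, 'f) tmodule_scheme \<Rightarrow> ('b \<Rightarrow> 'e) \<Rightarrow> bool" where
  "thom G H \<phi> \<longleftrightarrow> \<phi> \<in> carrier G \<rightarrow> carrier H \<and>
     (\<forall>x\<in>carrier G. \<forall>y\<in>carrier G. \<phi> (x \<oplus>\<^bsub>G\<^esub> y) = \<phi> x \<oplus>\<^bsub>H\<^esub> \<phi> y) \<and>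
     (\<forall>x\<in>carrier G. \<phi> (tact G x) = tact H (\<phi> x))"

context abelian_group
begin

abbreviation zmul :: "int \<Rightarrow> 'a \<Rightarrow> 'a" (infixr "\<diamondop>" 75) where
  "k \<diamondop> x \<equiv> add_pow G k x"

lemma zm_closed [simp, intro]: "x \<in> carrier G \<Longrightarrow> k \<diamondop> x \<in> carrier G"
  by (rule add.int_pow_closed)

lemma zm_0 [simp]: "0 \<diamondop> x = \<zero>"
  by (simp add: add_pow_def)

lemma zm_1 [simp]: "x \<in> carrier G \<Longrightarrow> 1 \<diamondop> x = x"
  by (rule add.int_pow_1)

lemma zm_zero [simp]: "k \<diamondop> \<zero> = \<zero>"
  by (rule add.int_pow_one)

lemma zm_add: "x \<in> carrier G \<Longrightarrow> (k + l) \<diamondop> x = k \<diamondop> x \<oplus> l \<diamondop> x"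
  by (rule add.int_pow_mult)

lemma zm_neg: "x \<in> carrier G \<Longrightarrow> (- k) \<diamondop> x = \<ominus> (k \<diamondop> x)"
  by (rule add.int_pow_neg)

lemma zm_diff: "x \<in> carrier G \<Longrightarrow> (k - l) \<diamondop> x = k \<diamondop> x \<ominus> l \<diamondop> x"
  unfolding a_minus_def by (rule add.int_pow_diff)

lemma zm_mult: "x \<in> carrier G \<Longrightarrow> (k * l) \<diamondop> x = k \<diamondop> (l \<diamondop> x)"
  by (metis add.int_pow_pow mult.commute)

lemma zm_x_add: "\<lbrakk>x \<in> carrier G; y \<in> carrier G\<rbrakk> \<Longrightarrow> k \<diamondop> (x \<oplus> y) = k \<diamondop> x \<oplus> k \<diamondop> y"
  by (rule add.int_pow_distrib)

lemma zm_x_neg: "x \<in> carrier G \<Longrightarrow> k \<diamondop> (\<ominus> x) = \<ominus> (k \<diamondop> x)"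
  by (simp add: add.int_pow_inv)

lemma add_eq_minus_iff: "\<lbrakk>x \<in> carrier G; y \<in> carrier G; z \<in> carrier G\<rbrakk> \<Longrightarrow> x \<oplus> y = z \<longleftrightarrow> x = z \<ominus> y"
  unfolding a_minus_def by (metis a_inv_closed add.inv_solve_right)

lemma minus_eq_zero_iff: "\<lbrakk>x \<in> carrier G; y \<in> carrier G\<rbrakk> \<Longrightarrow> x \<ominus> y = \<zero> \<longleftrightarrow> x = y"
  by (metis add_eq_minus_iff l_zero zero_closed)

lemma minus_add_cancel: "\<lbrakk>x \<in> carrier G; y \<in> carrier G\<rbrakk> \<Longrightarrow> (x \<ominus> y) \<oplus> y = x"
  by (simp add: add_eq_minus_iff)

lemma add_minus_cancel: "\<lbrakk>x \<in> carrier G; y \<in> carrier G\<rbrakk> \<Longrightarrow> (x \<oplus> y) \<ominus> y = x"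
  by (metis a_closed add_eq_minus_iff)

end

lemma additive_zero:
  assumes "abelian_group G" "abelian_group H" "\<phi> \<in> carrier G \<rightarrow> carrier H"
    and "\<And>x y. \<lbrakk>x \<in> carrier G; y \<in> carrier G\<rbrakk> \<Longrightarrow> \<phi> (x \<oplus>\<^bsub>G\<^esub> y) = \<phi> x \<oplus>\<^bsub>H\<^esub> \<phi> y"
  shows "\<phi> \<zero>\<^bsub>G\<^esub> = \<zero>\<^bsub>H\<^esub>"
    and "x \<in> carrier G \<Longrightarrow> \<phi> (\<ominus>\<^bsub>G\<^esub> x) = \<ominus>\<^bsub>H\<^esub> \<phi> x"
    and "x \<in> carrier G \<Longrightarrow> \<phi> (add_pow G (k::int) x) = add_pow H k (\<phi> x)"
    and "x \<in> carrier G \<Longrightarrow> y \<in> carrier G \<Longrightarrow> \<phi> (x \<ominus>\<^bsub>G\<^esub> y) = \<phi> x \<ominus>\<^bsub>H\<^esub> \<phi> y"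
proof -
  interpret G: abelian_group G by fact
  interpret H: abelian_group H by fact
  interpret h: group_hom "add_monoid G" "add_monoid H" \<phi>
    by (rule group_hom.intro) (use assms in \<open>auto intro!: G.a_group H.a_group group_hom_axioms.intro simp: hom_def\<close>)
  show "\<phi> \<zero>\<^bsub>G\<^esub> = \<zero>\<^bsub>H\<^esub>" using h.hom_one by simp
  show inv: "x \<in> carrier G \<Longrightarrow> \<phi> (\<ominus>\<^bsub>G\<^esub> x) = \<ominus>\<^bsub>H\<^esub> \<phi> x" for x
    using h.hom_inv[of x] by (simp add: a_inv_def)
  show "x \<in> carrier G \<Longrightarrow> \<phi> (add_pow G k x) = add_pow H k (\<phi> x)"
    using h.hom_int_pow[of x k] by (simp add: add_pow_def)
  show "x \<in> carrier G \<Longrightarrow> y \<in> carrier G \<Longrightarrow> \<phi> (x \<ominus>\<^bsub>G\<^esub> y) = \<phi> x \<ominus>\<^bsub>H\<^esub> \<phi> y"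
    using assms inv[of y] by (simp add: a_minus_def)
qed

context tgroup
begin

lemma T_zero [simp]: "tact G \<zero> = \<zero>"
  by (rule additive_zero(1)[OF abelian_group_axioms abelian_group_axioms]) (auto simp: T_add)

lemma T_zm: "x \<in> carrier G \<Longrightarrow> tact G (k \<diamondop> x) = k \<diamondop> tact G x"
  by (rule additive_zero(3)[OF abelian_group_axioms abelian_group_axioms]) (auto simp: T_add)

lemma act_0 [simp]: "act G 0 x = \<zero>"
  by (simp add: act_def)

lemma act_pCons: "x \<in> carrier G \<Longrightarrow> act G (pCons a Q) x = a \<diamondop> x \<oplus> tact G (act G Q x)"
  by (cases "a = 0 \<and> Q = 0") (auto simp: act_def)

lemma act_closed [simp, intro]: "x \<in> carrier G \<Longrightarrow> act G Q x \<in> carrier G"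
  by (induction Q) (auto simp: act_pCons)

lemma act_x_add: "\<lbrakk>x \<in> carrier G; y \<in> carrier G\<rbrakk> \<Longrightarrow> act G Q (x \<oplus> y) = act G Q x \<oplus> act G Q y"
  by (induction Q) (auto simp: act_pCons T_add zm_x_add a_ac)

lemma act_x_zero [simp]: "act G Q \<zero> = \<zero>"
  by (induction Q) (auto simp: act_pCons)

lemma act_T: "x \<in> carrier G \<Longrightarrow> act G Q (tact G x) = tact G (act G Q x)"
  by (induction Q) (auto simp: act_pCons T_add T_zm)

lemma act_x_minus: "\<lbrakk>x \<in> carrier G; y \<in> carrier G\<rbrakk> \<Longrightarrow> act G Q (x \<ominus> y) = act G Q x \<ominus> act G Q y"
  by (rule additive_zero(4)[OF abelian_group_axioms abelian_group_axioms]) (auto simp: act_x_add)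

lemma act_x_zm: "x \<in> carrier G \<Longrightarrow> act G Q (k \<diamondop> x) = k \<diamondop> act G Q x"
  by (rule additive_zero(3)[OF abelian_group_axioms abelian_group_axioms]) (auto simp: act_x_add)

lemma act_add: "x \<in> carrier G \<Longrightarrow> act G (Q + R) x = act G Q x \<oplus> act G R x"
  by (induction Q R rule: poly_induct2) (auto simp: act_pCons T_add zm_add a_ac)

lemma act_smult: "x \<in> carrier G \<Longrightarrow> act G (Polynomial.smult k Q) x = k \<diamondop> act G Q x"
  by (induction Q) (auto simp: act_pCons zm_x_add zm_mult T_zm)

lemma act_mult: "x \<in> carrier G \<Longrightarrow> act G (Q * R) x = act G Q (act G R x)"
  by (induction Q) (auto simp: act_pCons act_add act_smult)

lemma act_const [simp]: "x \<in> carrier G \<Longrightarrow> act G [:k:] x = k \<diamondop> x"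
  by (auto simp: act_pCons)

lemma act_1 [simp]: "x \<in> carrier G \<Longrightarrow> act G 1 x = x"
  by (simp add: one_pCons)

lemma act_diff: "x \<in> carrier G \<Longrightarrow> act G (Q - R) x = act G Q x \<ominus> act G R x"
  using act_add[of x "Q - R" R] by (subst add_eq_minus_iff[symmetric]) auto

lemma T_pow_closed [simp, intro]: "x \<in> carrier G \<Longrightarrow> (tact G ^^ m) x \<in> carrier G"
  by (induction m) auto

lemma act_T_pow: assumes "x \<in> carrier G" shows "act G (Polynomial.monom 1 m) x = (tact G ^^ m) x"
  using assms by (induction m) (auto simp: Polynomial.monom_0 Polynomial.monom_Suc act_pCons simp flip: one_pCons)

lemma act_sum: assumes "x \<in> carrier G" "finite A" shows "act G (\<Sum>i\<in>A. Q i) x = (\<Oplus>i\<in>A. act G (Q i) x)"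
  using assms(2,1) by (induction A rule: finite_induct) (auto simp: act_add finsum_insert)

text \<open>Passes from the Horner form to the sum over powers of t in which
  \<open>poly_tmodule\<close> and \<open>fq_comb\<close> are written. The bound k is free, so that
  it can be the length of a coefficient list.\<close>

lemma act_eq_finsum:
  assumes "x \<in> carrier G" "\<And>m. m \<ge> k \<Longrightarrow> Polynomial.coeff Q m = 0"
  shows "act G Q x = (\<Oplus>m\<in>{..<k}. Polynomial.coeff Q m \<diamondop> (tact G ^^ m) x)"
proof -
  have "Q = (\<Sum>m<k. Polynomial.smult (Polynomial.coeff Q m) (Polynomial.monom 1 m))"
    using assms(2) by (intro poly_eqI) (auto simp: coeff_sum smult_monom intro: leI)
  then have "act G Q x = act G (\<Sum>m<k. Polynomial.smult (Polynomial.coeff Q m) (Polynomial.monom 1 m)) x"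
    by simp
  also have "\<dots> = (\<Oplus>m\<in>{..<k}. Polynomial.coeff Q m \<diamondop> (tact G ^^ m) x)"
    using assms(1) by (subst act_sum) (auto simp: act_smult act_T_pow simp del: smult_monom)
  finally show ?thesis .
qed

end

lemma thomD:
  assumes "thom G H \<phi>"
  shows "x \<in> carrier G \<Longrightarrow> \<phi> x \<in> carrier H"
    and "\<lbrakk>x \<in> carrier G; y \<in> carrier G\<rbrakk> \<Longrightarrow> \<phi> (x \<oplus>\<^bsub>G\<^esub> y) = \<phi> x \<oplus>\<^bsub>H\<^esub> \<phi> y"
    and "x \<in> carrier G \<Longrightarrow> \<phi> (tact G x) = tact H (\<phi> x)"
  using assms by (auto simp: thom_def)

lemma thom_maps:
  assumes "tgroup G" "tgroup H" "thom G H \<phi>"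
  shows "\<phi> \<zero>\<^bsub>G\<^esub> = \<zero>\<^bsub>H\<^esub>"
    and "x \<in> carrier G \<Longrightarrow> \<phi> (\<ominus>\<^bsub>G\<^esub> x) = \<ominus>\<^bsub>H\<^esub> \<phi> x"
    and "x \<in> carrier G \<Longrightarrow> \<phi> (add_pow G (k::int) x) = add_pow H k (\<phi> x)"
    and "x \<in> carrier G \<Longrightarrow> y \<in> carrier G \<Longrightarrow> \<phi> (x \<ominus>\<^bsub>G\<^esub> y) = \<phi> x \<ominus>\<^bsub>H\<^esub> \<phi> y"
    and "x \<in> carrier G \<Longrightarrow> \<phi> (act G Q x) = act H Q (\<phi> x)"
proof -
  interpret G: tgroup G by fact
  interpret H: tgroup H by fact
  note ad = additive_zero[OF G.abelian_group_axioms H.abelian_group_axioms, of \<phi>]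
  have f: "\<phi> \<in> carrier G \<rightarrow> carrier H" using assms by (auto simp: thom_def)
  show z: "\<phi> \<zero>\<^bsub>G\<^esub> = \<zero>\<^bsub>H\<^esub>" using ad(1) f thomD(2)[OF assms(3)] by blast
  show "x \<in> carrier G \<Longrightarrow> \<phi> (\<ominus>\<^bsub>G\<^esub> x) = \<ominus>\<^bsub>H\<^esub> \<phi> x" using ad(2) f thomD(2)[OF assms(3)] by blast
  show s: "x \<in> carrier G \<Longrightarrow> \<phi> (add_pow G (k::int) x) = add_pow H k (\<phi> x)" for k
    using ad(3) f thomD(2)[OF assms(3)] by blast
  show "x \<in> carrier G \<Longrightarrow> y \<in> carrier G \<Longrightarrow> \<phi> (x \<ominus>\<^bsub>G\<^esub> y) = \<phi> x \<ominus>\<^bsub>H\<^esub> \<phi> y"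
    using ad(4) f thomD(2)[OF assms(3)] by blast
  show "x \<in> carrier G \<Longrightarrow> \<phi> (act G Q x) = act H Q (\<phi> x)"
    by (induction Q) (auto simp: G.act_pCons H.act_pCons thomD[OF assms(3)] s z)
qed

lemma (in tgroup) tgroup_sub:
  assumes "S \<subseteq> carrier G" "\<zero> \<in> S"
    "\<And>x y. \<lbrakk>x \<in> S; y \<in> S\<rbrakk> \<Longrightarrow> x \<oplus> y \<in> S" "\<And>x. x \<in> S \<Longrightarrow> \<ominus> x \<in> S"
    "\<And>x. x \<in> S \<Longrightarrow> tact G x \<in> S"
  shows "tgroup (G\<lparr>carrier := S\<rparr>)"
proof (intro tgroup.intro tgroup_axioms.intro abelian_groupI)
  fix x assume "x \<in> carrier (G\<lparr>carrier := S\<rparr>)"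
  then show "\<exists>y\<in>carrier (G\<lparr>carrier := S\<rparr>). y \<oplus>\<^bsub>G\<lparr>carrier := S\<rparr>\<^esub> x = \<zero>\<^bsub>G\<lparr>carrier := S\<rparr>\<^esub>"
    using assms by (intro bexI[of _ "\<ominus> x"]) (auto simp: l_neg subset_iff)
qed (use assms in \<open>auto simp: subset_iff a_ac T_add\<close>)

lemma (in tgroup) sub_ops:
  assumes "tgroup (G\<lparr>carrier := S\<rparr>)" "S \<subseteq> carrier G" "x \<in> S"
  shows "act (G\<lparr>carrier := S\<rparr>) Q x = act G Q x" "add_pow (G\<lparr>carrier := S\<rparr>) (k::int) x = add_pow G k x"
proof -
  have "thom (G\<lparr>carrier := S\<rparr>) G id" using assms(2) by (auto simp: thom_def)
  from thom_maps[OF assms(1) tgroup_axioms this] assms(3)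
  show "act (G\<lparr>carrier := S\<rparr>) Q x = act G Q x" "add_pow (G\<lparr>carrier := S\<rparr>) k x = add_pow G k x"
    by auto
qed

section \<open>Integer vectors and maps out of them\<close>

text \<open>\<open>(Z/m)^n\<close> with \<open>t\<close> acting by \<open>A\<close>. As \<open>x mod 0 = x\<close>, the case \<open>m = 0\<close> is \<open>Z^n\<close>.\<close>
definition VM :: "int \<Rightarrow> nat \<Rightarrow> (nat \<Rightarrow> nat \<Rightarrow> int) \<Rightarrow> (int, nat \<Rightarrow> int) tmodule" where
  "VM m n A = \<lparr>carrier = {v. (\<forall>i\<ge>n. v i = 0) \<and> (\<forall>i. v i mod m = v i)},
     monoid.mult = (\<lambda>_ _ _. 0), one = (\<lambda>_. 0), ring.zero = (\<lambda>_. 0),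
     ring.add = (\<lambda>v w i. (v i + w i) mod m),
     module.smult = (\<lambda>c v i. (c * v i) mod m),
     tact = (\<lambda>v i. if i < n then (\<Sum>k<n. A i k * v k) mod m else 0)\<rparr>"

lemma VM_simps [simp]:
  "carrier (VM m n A) = {v. (\<forall>i\<ge>n. v i = 0) \<and> (\<forall>i. v i mod m = v i)}"
  "\<zero>\<^bsub>VM m n A\<^esub> = (\<lambda>_. 0)"
  "v \<oplus>\<^bsub>VM m n A\<^esub> w = (\<lambda>i. (v i + w i) mod m)"
  "tact (VM m n A) v = (\<lambda>i. if i < n then (\<Sum>k<n. A i k * v k) mod m else 0)"
  by (simp_all add: VM_def)

lemma tgroup_VM: "tgroup (VM m n A)"
proof (intro tgroup.intro tgroup_axioms.intro abelian_groupI)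
  fix v assume v: "v \<in> carrier (VM m n A)"
  show "\<exists>w\<in>carrier (VM m n A). w \<oplus>\<^bsub>VM m n A\<^esub> v = \<zero>\<^bsub>VM m n A\<^esub>"
    using v by (intro bexI[of _ "\<lambda>i. (- v i) mod m"]) (auto simp: mod_simps)
next
  fix v w assume "v \<in> carrier (VM m n A)" "w \<in> carrier (VM m n A)"
  show "tact (VM m n A) (v \<oplus>\<^bsub>VM m n A\<^esub> w) = tact (VM m n A) v \<oplus>\<^bsub>VM m n A\<^esub> tact (VM m n A) w"
  proof
    fix i
    have "(\<Sum>k<n. A i k * ((v k + w k) mod m)) mod m = (\<Sum>k<n. A i k * (v k + w k)) mod m"
      by (subst (1 2) mod_sum_eq[symmetric]) (simp add: mod_mult_right_eq)
    then show "tact (VM m n A) (v \<oplus>\<^bsub>VM m n A\<^esub> w) i = (tact (VM m n A) v \<oplus>\<^bsub>VM m n A\<^esub> tact (VM m n A) w) i"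
      by (simp add: distrib_left sum.distrib mod_simps)
  qed
qed (auto simp: mod_simps algebra_simps)

lemma zm_VM:
  assumes "v \<in> carrier (VM m n A)"
  shows "add_pow (VM m n A) (k::int) v = (\<lambda>i. (k * v i) mod m)"
proof -
  interpret tgroup "VM m n A" by (rule tgroup_VM)
  show ?thesis
  proof (induction k rule: int_induct[where k = 0])
    case (step1 k)
    then show ?case using zm_add[OF assms, of k 1] assms by (auto simp: mod_simps algebra_simps simp del: VM_simps(1))
  next
    case (step2 k)
    define w where "w = add_pow (VM m n A) (k - 1) v"
    have w: "w \<in> carrier (VM m n A)" using assms by (auto simp: w_def simp del: VM_simps)
    \<comment> \<open>Downward induction: the value at k - 1 is recovered from the value at k by
      cancelling v modulo m.\<close>
    have "add_pow (VM m n A) k v = w \<oplus>\<^bsub>VM m n A\<^esub> v"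
      using zm_add[OF assms, of "k - 1" 1] assms by (simp add: w_def del: VM_simps)
    then have "(w i + v i) mod m = (k * v i) mod m" for i
      using step2 by (simp add: fun_eq_iff)
    then have "((w i + v i) - v i) mod m = (k * v i - v i) mod m" for i
      by (metis mod_diff_left_eq)
    then show ?case using w by (auto simp: w_def[symmetric] algebra_simps fun_eq_iff)
  qed simp
qed

abbreviation zvec :: "nat \<Rightarrow> (nat \<Rightarrow> int) set" where
  "zvec n \<equiv> {v. \<forall>i\<ge>n. v i = 0}"

definition red :: "int \<Rightarrow> (nat \<Rightarrow> int) \<Rightarrow> nat \<Rightarrow> int" where
  "red m v = (\<lambda>i. v i mod m)"

lemma thom_red:
  assumes "m dvd m0" "\<And>i k. \<lbrakk>i < n; k < n\<rbrakk> \<Longrightarrow> A i k mod m = A' i k mod m"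
  shows "thom (VM m0 n A) (VM m n A') (red m)"
proof -
  have "(\<Sum>k<n. A i k * v k) mod m0 mod m = (\<Sum>k<n. A' i k * (v k mod m)) mod m" if "i < n" for i v
  proof -
    have "(\<Sum>k<n. A i k * v k) mod m0 mod m = (\<Sum>k<n. (A i k mod m) * v k mod m) mod m"
      by (simp add: mod_mod_cancel assms mod_sum_eq mod_mult_left_eq)
    also have "\<dots> = (\<Sum>k<n. (A' i k mod m) * (v k mod m) mod m) mod m"
      using that by (simp add: assms(2) mod_mult_right_eq)
    finally show ?thesis by (simp add: mod_sum_eq mod_mult_left_eq)
  qed
  then show ?thesis using assms(1)
    by (auto simp: thom_def red_def fun_eq_iff mod_mod_cancel mod_simps)
qed

lemma red_mem: "v \<in> zvec n \<Longrightarrow> red m v \<in> carrier (VM m n A)"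
  by (auto simp: red_def)

definition uv :: "nat \<Rightarrow> nat \<Rightarrow> int" where
  "uv i = (\<lambda>k. if k = i then 1 else 0)"

text \<open>Z^n is generated by the unit vectors. The induction enlarges the range of coordinates
  that may be nonzero; the part along unit vector k is an integer multiple of it, which both maps
  respect by \<open>additive_zero\<close>.\<close>

lemma additive_eqI:
  assumes H: "abelian_group H" and f: "f \<in> zvec n \<rightarrow> carrier H" and g: "g \<in> zvec n \<rightarrow> carrier H"
    and fa: "\<And>v w. \<lbrakk>v \<in> zvec n; w \<in> zvec n\<rbrakk> \<Longrightarrow> f (\<lambda>i. v i + w i) = f v \<oplus>\<^bsub>H\<^esub> f w"
    and ga: "\<And>v w. \<lbrakk>v \<in> zvec n; w \<in> zvec n\<rbrakk> \<Longrightarrow> g (\<lambda>i. v i + w i) = g v \<oplus>\<^bsub>H\<^esub> g w"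
    and eq: "\<And>i. i < n \<Longrightarrow> f (uv i) = g (uv i)" and v: "v \<in> zvec n"
  shows "f v = g v"
proof -
  interpret H: abelian_group H by fact
  let ?V = "VM 0 n (\<lambda>_ _. 0)"
  have V: "abelian_group ?V" by (rule tgroup.axioms[OF tgroup_VM])
  note F = additive_zero[OF V H, of f] and G' = additive_zero[OF V H, of g]
  have "f v = g v" if "v \<in> zvec k" "k \<le> n" for k v
    using that
  proof (induction k arbitrary: v)
    case 0
    then have "v = (\<lambda>_. 0)" by auto
    then show ?case using F(1) G'(1) f g fa ga by auto
  next
    case (Suc k)
    let ?w = "\<lambda>i. if i < k then v i else 0" and ?u = "\<lambda>i. v k * uv k i"
    have *: "v = (\<lambda>i. ?w i + ?u i)" using Suc.prems(1)
      by (auto simp: fun_eq_iff uv_def not_less)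
    have uk: "uv k \<in> carrier ?V" using Suc by (auto simp: uv_def)
    have u: "?u = add_pow ?V (v k) (uv k)" using zm_VM[OF uk] by simp
    have "f ?u = g ?u" unfolding u using F(3)[OF _ _ uk] G'(3)[OF _ _ uk] f g fa ga eq Suc by auto
    moreover have "f ?w = g ?w" using Suc by auto
    moreover have "?w \<in> zvec n" "?u \<in> zvec n" using Suc by (auto simp: uv_def)
    ultimately show ?case by (subst (1 2) *) (simp only: fa ga)
  qed
  then show ?thesis using v by blast
qed

text \<open>The homomorphism from Z^n that sends the i-th unit vector to \<open>g i\<close>.
  Counting the tuples g instead of the maps keeps the sets finite, and reduction to G/pG acts on g
  entrywise.\<close>

definition Fm :: "('a, 'b, 'c) tmodule_scheme \<Rightarrow> nat \<Rightarrow> (nat \<Rightarrow> 'b) \<Rightarrow> (nat \<Rightarrow> int) \<Rightarrow> 'b" where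
  "Fm G n g v = (\<Oplus>\<^bsub>G\<^esub> i\<in>{..<n}. add_pow G (v i) (g i))"

context tgroup
begin

lemma Fm_closed [simp, intro]: "g \<in> {..<n} \<rightarrow> carrier G \<Longrightarrow> Fm G n g v \<in> carrier G"
  by (auto simp: Fm_def intro!: finsum_closed)

lemma Fm_add: "g \<in> {..<n} \<rightarrow> carrier G \<Longrightarrow> Fm G n g (\<lambda>i. v i + w i) = Fm G n g v \<oplus> Fm G n g w"
  unfolding Fm_def using finsum_addf[of "\<lambda>i. v i \<diamondop> g i" "{..<n}" "\<lambda>i. w i \<diamondop> g i"]
    finsum_cong'[of "{..<n}" "{..<n}" "\<lambda>i. v i \<diamondop> g i \<oplus> w i \<diamondop> g i" "\<lambda>i. (v i + w i) \<diamondop> g i"]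
  by (simp add: Pi_iff zm_add)

lemma Fm_zero [simp]: "Fm G n g (\<lambda>i. 0) = \<zero>"
  by (simp add: Fm_def)

lemma Fm_cong: "g \<in> {..<n} \<rightarrow> carrier G \<Longrightarrow> (\<And>i. i < n \<Longrightarrow> v i = w i) \<Longrightarrow> Fm G n g v = Fm G n g w"
  unfolding Fm_def by (rule finsum_cong') auto

lemma Fm_scale: assumes g: "g \<in> {..<n} \<rightarrow> carrier G" shows "Fm G n g (\<lambda>i. k * v i) = k \<diamondop> Fm G n g v"
proof -
  have "(\<Oplus>i\<in>A. (k * v i) \<diamondop> g i) = k \<diamondop> (\<Oplus>i\<in>A. v i \<diamondop> g i)" if "finite A" "A \<subseteq> {..<n}" for A
    using that
  proof (induction A)
    case (insert x A)
    then have "g x \<in> carrier G" "\<And>i. i \<in> A \<Longrightarrow> g i \<in> carrier G" using g by auto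
    then show ?case using insert by (simp add: finsum_insert Pi_iff zm_x_add zm_mult)
  qed simp
  then show ?thesis by (simp add: Fm_def)
qed

lemma Fm_diff: assumes "g \<in> {..<n} \<rightarrow> carrier G" shows "Fm G n g (\<lambda>i. v i - w i) = Fm G n g v \<ominus> Fm G n g w"
  using Fm_add[OF assms, of "\<lambda>i. v i - w i" w] assms by (subst add_eq_minus_iff[symmetric]) auto

lemma Fm_uv: assumes "g \<in> {..<n} \<rightarrow> carrier G" "i < n" shows "Fm G n g (uv i) = g i"
proof -
  have "(\<Oplus>k\<in>{..<n}. uv i k \<diamondop> g k) = (\<Oplus>k\<in>{..<n}. if i = k then g k else \<zero>)"
    using assms by (intro finsum_cong') (auto simp: uv_def Pi_iff)
  also have "\<dots> = g i" using assms by (subst add.finprod_singleton) auto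
  finally show ?thesis by (simp add: Fm_def)
qed

text \<open>If q kills G, the homomorphism factors through (Z/q)^n. This is what lets matrices and
  vectors be replaced by their least residues at will.\<close>

lemma Fm_eq_mod:
  assumes "g \<in> {..<n} \<rightarrow> carrier G" "\<And>x. x \<in> carrier G \<Longrightarrow> q \<diamondop> x = \<zero>"
    "\<And>i. i < n \<Longrightarrow> v i mod q = w i mod q"
  shows "Fm G n g v = Fm G n g w"
proof -
  have "v i \<diamondop> g i = w i \<diamondop> g i" if "i < n" for i
  proof -
    have "q dvd v i - w i" using assms(3)[OF that] by (simp add: mod_eq_dvd_iff)
    then obtain c where c: "v i = w i + c * q" by (metis dvdE diff_add_cancel add.commute mult.commute)
    have "g i \<in> carrier G" using assms that by auto
    then show ?thesis unfolding c by (simp add: zm_add zm_mult assms(2))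
  qed
  then show ?thesis unfolding Fm_def using assms(1) by (intro finsum_cong') auto
qed

lemma Fm_unique:
  assumes f: "f \<in> zvec n \<rightarrow> carrier G"
    and fa: "\<And>v w. \<lbrakk>v \<in> zvec n; w \<in> zvec n\<rbrakk> \<Longrightarrow> f (\<lambda>i. v i + w i) = f v \<oplus> f w"
    and gf: "\<And>i. i < n \<Longrightarrow> g i = f (uv i)" and v: "v \<in> zvec n"
  shows "Fm G n g v = f v"
proof (rule additive_eqI[OF abelian_group_axioms, of _ n])
  have g: "g \<in> {..<n} \<rightarrow> carrier G" using f gf by (auto simp: uv_def)
  show "Fm G n g \<in> zvec n \<rightarrow> carrier G" using g by auto
  show "Fm G n g (uv i) = f (uv i)" if "i < n" for i using Fm_uv[OF g that] gf that by simp
  show "Fm G n g (\<lambda>i. v i + w i) = Fm G n g v \<oplus> Fm G n g w" for v w by (rule Fm_add[OF g])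
qed (use assms in auto)

text \<open>Both F A and t F are additive on Z^n, so F A = t F is a condition on the columns of A,
  one linear equation for each. Matrices can therefore be constructed column by column.\<close>

lemma Fm_thom:
  assumes g: "g \<in> {..<n} \<rightarrow> carrier G"
    and c: "\<And>i. i < n \<Longrightarrow> Fm G n g (\<lambda>k. if k < n then A k i else 0) = tact G (g i)"
  shows "thom (VM 0 n A) G (Fm G n g)"
proof -
  interpret V: tgroup "VM 0 n A" by (rule tgroup_VM)
  have "Fm G n g (tact (VM 0 n A) v) = tact G (Fm G n g v)" if "v \<in> zvec n" for v
  proof (rule additive_eqI[OF abelian_group_axioms, of "\<lambda>v. Fm G n g (tact (VM 0 n A) v)" n "\<lambda>v. tact G (Fm G n g v)", OF _ _ _ _ _ that])
    show "Fm G n g (tact (VM 0 n A) (\<lambda>i. v i + w i)) =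
        Fm G n g (tact (VM 0 n A) v) \<oplus> Fm G n g (tact (VM 0 n A) w)" if "v \<in> zvec n" "w \<in> zvec n" for v w
      using V.T_add[of v w] that Fm_add[OF g, of "tact (VM 0 n A) v" "tact (VM 0 n A) w"] by simp
    show "tact G (Fm G n g (\<lambda>i. v i + w i)) = tact G (Fm G n g v) \<oplus> tact G (Fm G n g w)" for v w
      using g by (simp add: Fm_add T_add)
    show "Fm G n g (tact (VM 0 n A) (uv i)) = tact G (Fm G n g (uv i))" if "i < n" for i
    proof -
      have "tact (VM 0 n A) (uv i) = (\<lambda>k. if k < n then A k i else 0)"
        using that by (auto simp: uv_def fun_eq_iff if_distrib[of "\<lambda>x. _ * x"] sum.delta cong: if_cong)
      then show ?thesis using c[OF that] Fm_uv[OF g that] by simp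
    qed
  qed (use g in auto)
  then show ?thesis using g by (auto simp: thom_def Fm_add)
qed

end

section \<open>Cosets in the set form used by \<open>cok\<close> and \<open>mod_p\<close>\<close>

context abelian_group
begin

lemma add_minus_cancel2: "\<lbrakk>x \<in> carrier G; y \<in> carrier G\<rbrakk> \<Longrightarrow> (y \<oplus> x) \<ominus> y = x"
  by (metis a_comm add_minus_cancel)

definition cl :: "'a set \<Rightarrow> 'a \<Rightarrow> 'a set" where
  "cl I v = {v \<oplus> w | w. w \<in> I}"

definition sgrp :: "'a set \<Rightarrow> bool" where
  "sgrp I \<longleftrightarrow> I \<subseteq> carrier G \<and> \<zero> \<in> I \<and> (\<forall>x\<in>I. \<forall>y\<in>I. x \<oplus> y \<in> I) \<and> (\<forall>x\<in>I. \<ominus> x \<in> I)"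

lemma cl_mem_iff: assumes "sgrp I" "v \<in> carrier G" shows "a \<in> cl I v \<longleftrightarrow> a \<in> carrier G \<and> a \<ominus> v \<in> I"
proof
  assume "a \<in> cl I v"
  then obtain w where w: "a = v \<oplus> w" "w \<in> I" by (auto simp: cl_def)
  with assms show "a \<in> carrier G \<and> a \<ominus> v \<in> I" by (auto simp: sgrp_def add_minus_cancel2 subset_iff)
next
  assume "a \<in> carrier G \<and> a \<ominus> v \<in> I"
  then show "a \<in> cl I v" unfolding cl_def using assms
    by (auto intro!: exI[of _ "a \<ominus> v"] simp: a_comm[of v] minus_add_cancel)
qed

lemma cl_eq_iff: assumes "sgrp I" "v \<in> carrier G" "w \<in> carrier G" shows "cl I v = cl I w \<longleftrightarrow> v \<ominus> w \<in> I"
proof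
  have "v \<in> cl I v" using assms by (simp add: cl_mem_iff sgrp_def minus_eq_zero_iff a_minus_def r_neg)
  moreover assume "cl I v = cl I w"
  ultimately show "v \<ominus> w \<in> I" using assms by (simp add: cl_mem_iff)
next
  assume vw: "v \<ominus> w \<in> I"
  have "a \<ominus> v \<in> I \<longleftrightarrow> a \<ominus> w \<in> I" if a: "a \<in> carrier G" for a
  proof -
    have "a \<ominus> w = (a \<ominus> v) \<oplus> (v \<ominus> w)" using assms a
      by (metis a_assoc minus_add_cancel add_minus_cancel minus_closed a_minus_def a_inv_closed)
    moreover have "a \<ominus> v = (a \<ominus> w) \<oplus> \<ominus> (v \<ominus> w)" using assms a calculation
      by (metis a_minus_def add_minus_cancel minus_closed)
    moreover have "\<ominus> (v \<ominus> w) \<in> I" using assms(1) vw by (simp add: sgrp_def)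
    ultimately show ?thesis using assms(1) vw unfolding sgrp_def by metis
  qed
  then show "cl I v = cl I w" using assms by (auto simp: cl_mem_iff)
qed

lemma cl_self: "sgrp I \<Longrightarrow> v \<in> carrier G \<Longrightarrow> v \<in> cl I v"
  by (simp add: cl_mem_iff sgrp_def a_minus_def r_neg)

lemma cl_zero: assumes "sgrp I" shows "cl I \<zero> = I"
proof -
  have "\<zero> \<oplus> w = w" if "w \<in> I" for w using assms that by (auto simp: sgrp_def)
  then show ?thesis by (force simp: cl_def)
qed

lemma cl_add:
  assumes I: "sgrp I" and v: "v \<in> carrier G" and w: "w \<in> carrier G"
  shows "{a \<oplus> b | a b. a \<in> cl I v \<and> b \<in> cl I w} = cl I (v \<oplus> w)"
proof (intro subset_antisym subsetI)
  fix x assume "x \<in> {a \<oplus> b | a b. a \<in> cl I v \<and> b \<in> cl I w}"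
  then obtain i j where ij: "x = (v \<oplus> i) \<oplus> (w \<oplus> j)" "i \<in> I" "j \<in> I" by (auto simp: cl_def)
  then have "i \<in> carrier G" "j \<in> carrier G" using I by (auto simp: sgrp_def)
  then have "x = (v \<oplus> w) \<oplus> (i \<oplus> j)" using v w ij(1) by (simp add: a_ac)
  then show "x \<in> cl I (v \<oplus> w)" using ij I by (auto simp: cl_def sgrp_def)
next
  fix x assume "x \<in> cl I (v \<oplus> w)"
  then obtain i where i: "x = (v \<oplus> w) \<oplus> i" "i \<in> I" by (auto simp: cl_def)
  then have "x = v \<oplus> (w \<oplus> i)" using v w I by (auto simp: a_ac sgrp_def)
  moreover have "w \<oplus> i \<in> cl I w" using i by (auto simp: cl_def)
  ultimately show "x \<in> {a \<oplus> b | a b. a \<in> cl I v \<and> b \<in> cl I w}" using cl_self[OF I v] by blast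
qed

text \<open>The image of v + I under f is f v + f I, possibly smaller than a coset; the additional
  summand from I fills it up. This is the form in which \<open>cok\<close> and \<open>mod_p\<close>
  define their operations.\<close>

lemma cl_image:
  assumes I: "sgrp I" and v: "v \<in> carrier G" and f: "f \<in> carrier G \<rightarrow> carrier G"
    and fa: "\<And>x y. \<lbrakk>x \<in> carrier G; y \<in> carrier G\<rbrakk> \<Longrightarrow> f (x \<oplus> y) = f x \<oplus> f y" and fI: "f ` I \<subseteq> I"
  shows "{f a \<oplus> w | a w. a \<in> cl I v \<and> w \<in> I} = cl I (f v)"
proof (intro subset_antisym subsetI)
  fix x assume "x \<in> {f a \<oplus> w | a w. a \<in> cl I v \<and> w \<in> I}"
  then obtain i j where ij: "x = f (v \<oplus> i) \<oplus> j" "i \<in> I" "j \<in> I" by (auto simp: cl_def)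
  then have c: "i \<in> carrier G" "j \<in> carrier G" using I by (auto simp: sgrp_def)
  then have "x = f v \<oplus> (f i \<oplus> j)" using v f fa[OF v c(1)] ij(1) by (auto simp: a_assoc Pi_iff)
  moreover have "f i \<oplus> j \<in> I" using ij I fI by (auto simp: sgrp_def)
  ultimately show "x \<in> cl I (f v)" by (auto simp: cl_def)
next
  fix x assume "x \<in> cl I (f v)"
  then show "x \<in> {f a \<oplus> w | a w. a \<in> cl I v \<and> w \<in> I}" using cl_self[OF I v] by (auto simp: cl_def)
qed

end

section \<open>Counting fibres of additive maps\<close>

lemma (in abelian_group) add_minus_cancel_left: "\<lbrakk>x \<in> carrier G; y \<in> carrier G\<rbrakk> \<Longrightarrow> y \<oplus> (x \<ominus> y) = x"
  by (metis a_comm minus_add_cancel minus_closed)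

text \<open>Injections between any two fibres, in both directions, force all fibres to have the same
  size; translations will provide them. The product form avoids division. The equidistribution
  statements \<open>card_lifts\<close>, \<open>card_S\<close> and \<open>card_S_iso\<close> are
  instances.\<close>

lemma equal_fibres_card:
  assumes A: "finite A" and B: "finite B" and f: "f \<in> A \<rightarrow> B" and IB: "I \<subseteq> B"
    and tr: "\<And>b b'. \<lbrakk>b \<in> B; b' \<in> B\<rbrakk> \<Longrightarrow> \<exists>h. inj_on h {a\<in>A. f a = b} \<and> h ` {a\<in>A. f a = b} \<subseteq> {a\<in>A. f a = b'}"
  shows "card {a\<in>A. f a \<in> I} * card B = card A * card I"
proof -
  have le: "card {a\<in>A. f a = b} \<le> card {a\<in>A. f a = b'}" if bb: "b \<in> B" "b' \<in> B" for b b'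
  proof -
    obtain h where "inj_on h {a\<in>A. f a = b}" "h ` {a\<in>A. f a = b} \<subseteq> {a\<in>A. f a = b'}"
      using tr[OF bb] by blast
    then show ?thesis using A by (intro card_inj_on_le[of h]) auto
  qed
  have sum: "card {a\<in>A. f a \<in> K} = (\<Sum>b\<in>K. card {a\<in>A. f a = b})" if "K \<subseteq> B" for K
  proof -
    have "finite K" using that B finite_subset by blast
    then have "card (\<Union>b\<in>K. {a\<in>A. f a = b}) = (\<Sum>b\<in>K. card {a\<in>A. f a = b})"
      using A by (intro card_UN_disjoint) auto
    moreover have "(\<Union>b\<in>K. {a\<in>A. f a = b}) = {a\<in>A. f a \<in> K}" by auto
    ultimately show ?thesis by simp
  qed
  show ?thesis
  proof (cases "B = {}")
    case True
    then show ?thesis using f IB by auto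
  next
    case False
    then obtain b0 where b0: "b0 \<in> B" by auto
    define c where "c = card {a\<in>A. f a = b0}"
    have c: "card {a\<in>A. f a = b} = c" if "b \<in> B" for b
      using le[OF that b0] le[OF b0 that] by (simp add: c_def)
    have "{a\<in>A. f a \<in> B} = A" using f by auto
    then have "card A = card B * c" using sum[of B] c by simp
    moreover have "card {a\<in>A. f a \<in> I} = card I * c" using sum[OF IB] c IB by (simp add: subset_iff)
    ultimately show ?thesis by simp
  qed
qed

text \<open>Translation by x' - x carries the fibre over \<phi> x into the fibre over \<phi>
  x'.\<close>

lemma card_kernel_image:
  assumes G: "abelian_group G" and H: "abelian_group H" and fin: "finite (carrier G)"
    and f: "\<phi> \<in> carrier G \<rightarrow> carrier H"
    and a: "\<And>x y. \<lbrakk>x \<in> carrier G; y \<in> carrier G\<rbrakk> \<Longrightarrow> \<phi> (x \<oplus>\<^bsub>G\<^esub> y) = \<phi> x \<oplus>\<^bsub>H\<^esub> \<phi> y"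
  shows "card {x\<in>carrier G. \<phi> x = \<zero>\<^bsub>H\<^esub>} * card (\<phi> ` carrier G) = card (carrier G)"
proof -
  interpret G: abelian_group G by fact
  interpret H: abelian_group H by fact
  have "card {x\<in>carrier G. \<phi> x \<in> {\<zero>\<^bsub>H\<^esub>}} * card (\<phi> ` carrier G) = card (carrier G) * card {\<zero>\<^bsub>H\<^esub>}"
  proof (rule equal_fibres_card)
    show "{\<zero>\<^bsub>H\<^esub>} \<subseteq> \<phi> ` carrier G"
      using additive_zero(1)[OF G H f a] G.zero_closed by (metis empty_subsetI image_eqI insert_subset)
    fix b b' assume "b \<in> \<phi> ` carrier G" "b' \<in> \<phi> ` carrier G"
    then obtain x x' where x: "x \<in> carrier G" "b = \<phi> x" "x' \<in> carrier G" "b' = \<phi> x'" by auto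
    let ?h = "\<lambda>y. y \<oplus>\<^bsub>G\<^esub> (x' \<ominus>\<^bsub>G\<^esub> x)"
    have d: "\<phi> (x' \<ominus>\<^bsub>G\<^esub> x) = b' \<ominus>\<^bsub>H\<^esub> b" using additive_zero(4)[OF G H f a x(3,1)] x by simp
    have b: "b \<in> carrier H" "b' \<in> carrier H" using x f by auto
    show "\<exists>h. inj_on h {a\<in>carrier G. \<phi> a = b} \<and> h ` {a\<in>carrier G. \<phi> a = b} \<subseteq> {a\<in>carrier G. \<phi> a = b'}"
      using x b by (intro exI[of _ ?h] conjI inj_onI)
        (auto simp: a d H.add_minus_cancel_left)
  qed (use fin in auto)
  then show ?thesis by simp
qed

text \<open>U is a vector space over F_p and V a subspace. A vector x outside V is adjoined and the
  map is extended by zero on x; the complement of the domain shrinks, which drives the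
  induction.\<close>

lemma additive_extension:
  fixes p :: int
  assumes U: "abelian_group U" and W: "abelian_group W" and fin: "finite (carrier U)"
    and p: "Factorial_Ring.prime p"
    and Up: "\<And>x. x \<in> carrier U \<Longrightarrow> add_pow U p x = \<zero>\<^bsub>U\<^esub>"
    and Wc: "f \<in> V \<rightarrow> carrier W"
    and V: "V \<subseteq> carrier U" "\<zero>\<^bsub>U\<^esub> \<in> V" "\<And>x y. \<lbrakk>x \<in> V; y \<in> V\<rbrakk> \<Longrightarrow> x \<oplus>\<^bsub>U\<^esub> y \<in> V"
      "\<And>x. x \<in> V \<Longrightarrow> \<ominus>\<^bsub>U\<^esub> x \<in> V"
    and fa: "\<And>x y. \<lbrakk>x \<in> V; y \<in> V\<rbrakk> \<Longrightarrow> f (x \<oplus>\<^bsub>U\<^esub> y) = f x \<oplus>\<^bsub>W\<^esub> f y"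
  shows "\<exists>e. e \<in> carrier U \<rightarrow> carrier W \<and> (\<forall>v\<in>V. e v = f v) \<and>
    (\<forall>x\<in>carrier U. \<forall>y\<in>carrier U. e (x \<oplus>\<^bsub>U\<^esub> y) = e x \<oplus>\<^bsub>W\<^esub> e y)"
  using Wc V fa
proof (induction "card (carrier U - V)" arbitrary: V f rule: less_induct)
  case less
  interpret U: abelian_group U by fact
  interpret W: abelian_group W by fact
  note V = less.prems(2-5)
  show ?case
  proof (cases "carrier U \<subseteq> V")
    case True
    then show ?thesis using less.prems by (intro exI[of _ f]) (auto simp: subset_iff)
  next
    case False
    then obtain x where x: "x \<in> carrier U" "x \<notin> V" by auto
    have Vz: "add_pow U (k::int) v \<in> V" if "v \<in> V" for k v
    proof (induction k rule: int_induct[where k = 0])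
      case (step1 k) then show ?case using V that U.zm_add[of v k 1] by (auto simp: subset_iff)
    next
      case (step2 k) then show ?case using V that U.zm_diff[of v k 1] by (auto simp: subset_iff a_minus_def)
    qed (use V in simp)
    \<comment> \<open>If k were prime to p, Bezout would write x as a combination of p x = 0 and k
      x, so x would lie in V.\<close>
    have pdvd: "p dvd k" if "add_pow U k x \<in> V" for k
    proof (rule ccontr)
      assume "\<not> p dvd k"
      then have "coprime p k" using p by (simp add: prime_imp_coprime)
      then obtain a b where ab: "a * p + b * k = 1" using bezout_int[of p k] by auto
      have "x = add_pow U (a * p + b * k) x" using x ab by simp
      also have "\<dots> = add_pow U b (add_pow U k x)" using x Up by (simp add: U.zm_add U.zm_mult)
      also have "\<dots> \<in> V" using Vz that by simp
      finally show False using x by simp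
    qed
    define V' where "V' = {v \<oplus>\<^bsub>U\<^esub> add_pow U (k::int) x | v k. v \<in> V}"
    have uniq: "v = v'" if "v \<in> V" "v' \<in> V" "v \<oplus>\<^bsub>U\<^esub> add_pow U k x = v' \<oplus>\<^bsub>U\<^esub> add_pow U k' x" for v v' and k k' :: int
    proof -
      have c: "v \<in> carrier U" "v' \<in> carrier U" using that V by auto
      have e: "add_pow U k x = add_pow U k' x \<oplus>\<^bsub>U\<^esub> (v' \<ominus>\<^bsub>U\<^esub> v)"
      proof -
        have "add_pow U k x \<oplus>\<^bsub>U\<^esub> v = (add_pow U k' x \<oplus>\<^bsub>U\<^esub> (v' \<ominus>\<^bsub>U\<^esub> v)) \<oplus>\<^bsub>U\<^esub> v"
          using that(3) c x U.a_comm[of v "add_pow U k x"] U.a_comm[of v' "add_pow U k' x"] by (simp add: U.a_assoc U.minus_add_cancel)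
        then show ?thesis using c x by (metis U.add.m_closed U.add.r_cancel U.minus_closed U.zm_closed)
      qed
      have "add_pow U (k - k') x = v' \<ominus>\<^bsub>U\<^esub> v"
        using e c x by (simp add: U.zm_diff U.a_comm[of "add_pow U k' x"] U.add_minus_cancel)
      moreover have "v' \<ominus>\<^bsub>U\<^esub> v \<in> V" using that V by (auto simp: a_minus_def)
      ultimately have "p dvd k - k'" using pdvd by simp
      then obtain m where "k - k' = m * p" by (metis dvdE mult.commute)
      then have "add_pow U (k - k') x = \<zero>\<^bsub>U\<^esub>" using x Up by (simp add: U.zm_mult)
      then have "add_pow U k x = add_pow U k' x" using x by (simp add: U.zm_diff U.minus_eq_zero_iff)
      then show ?thesis using that(3) c x by simp
    qed
    \<comment> \<open>Projection to the V component followed by f. By \<open>uniq\<close> this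
      component is well defined: two coefficients of x that lead to the same sum differ by a
      multiple of p.\<close>
    define f' where "f' y = f (THE v. v \<in> V \<and> (\<exists>k::int. y = v \<oplus>\<^bsub>U\<^esub> add_pow U k x))" for y
    have f': "f' (v \<oplus>\<^bsub>U\<^esub> add_pow U k x) = f v" if "v \<in> V" for v and k :: int
    proof -
      have "(THE v'. v' \<in> V \<and> (\<exists>k'::int. v \<oplus>\<^bsub>U\<^esub> add_pow U k x = v' \<oplus>\<^bsub>U\<^esub> add_pow U k' x)) = v"
        using that uniq by (intro the_equality) auto
      then show ?thesis by (simp add: f'_def)
    qed
    have add: "(v \<oplus>\<^bsub>U\<^esub> add_pow U k x) \<oplus>\<^bsub>U\<^esub> (v' \<oplus>\<^bsub>U\<^esub> add_pow U k' x) = (v \<oplus>\<^bsub>U\<^esub> v') \<oplus>\<^bsub>U\<^esub> add_pow U (k + k') x"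
      if "v \<in> V" "v' \<in> V" for v v' and k k' :: int
      using that V x by (simp add: U.zm_add U.a_ac subset_iff)
    have V'c: "V' \<subseteq> carrier U" using V x by (auto simp: V'_def)
    have VV': "V \<subseteq> V'"
    proof
      fix v assume "v \<in> V"
      then show "v \<in> V'" using V by (auto simp: V'_def subset_iff intro!: exI[of _ v] exI[of _ 0])
    qed
    have xV': "x \<in> V'" using V x by (auto simp: V'_def intro!: exI[of _ "\<zero>\<^bsub>U\<^esub>"] exI[of _ 1])
    have "\<exists>e. e \<in> carrier U \<rightarrow> carrier W \<and> (\<forall>v\<in>V'. e v = f' v) \<and>
      (\<forall>x\<in>carrier U. \<forall>y\<in>carrier U. e (x \<oplus>\<^bsub>U\<^esub> y) = e x \<oplus>\<^bsub>W\<^esub> e y)"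
    proof (rule less.hyps)
      show "card (carrier U - V') < card (carrier U - V)"
        using fin VV' xV' x by (intro psubset_card_mono) auto
      show "f' \<in> V' \<rightarrow> carrier W" using less.prems(1) by (auto simp: V'_def f')
      show "\<zero>\<^bsub>U\<^esub> \<in> V'" using VV' V by auto
      show "a \<oplus>\<^bsub>U\<^esub> b \<in> V'" if ab: "a \<in> V'" "b \<in> V'" for a b
      proof -
        obtain v v' and k k' :: int where vk: "a = v \<oplus>\<^bsub>U\<^esub> add_pow U k x" "v \<in> V" "b = v' \<oplus>\<^bsub>U\<^esub> add_pow U k' x" "v' \<in> V"
          using ab by (auto simp: V'_def)
        then have "a \<oplus>\<^bsub>U\<^esub> b = (v \<oplus>\<^bsub>U\<^esub> v') \<oplus>\<^bsub>U\<^esub> add_pow U (k + k') x" using add by simp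
        moreover have "v \<oplus>\<^bsub>U\<^esub> v' \<in> V" using vk V(3) by blast
        ultimately show ?thesis unfolding V'_def by blast
      qed
      show "\<ominus>\<^bsub>U\<^esub> a \<in> V'" if a: "a \<in> V'" for a
      proof -
        obtain v and k :: int where vk: "a = v \<oplus>\<^bsub>U\<^esub> add_pow U k x" "v \<in> V" using a by (auto simp: V'_def)
        then have "\<ominus>\<^bsub>U\<^esub> a = \<ominus>\<^bsub>U\<^esub> v \<oplus>\<^bsub>U\<^esub> add_pow U (- k) x"
          using V x by (auto simp: U.zm_neg U.minus_add subset_iff)
        then show ?thesis using V(4)[OF vk(2)] unfolding V'_def by blast
      qed
      show "f' (a \<oplus>\<^bsub>U\<^esub> b) = f' a \<oplus>\<^bsub>W\<^esub> f' b" if ab: "a \<in> V'" "b \<in> V'" for a b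
      proof -
        obtain v v' and k k' :: int where vk: "a = v \<oplus>\<^bsub>U\<^esub> add_pow U k x" "v \<in> V" "b = v' \<oplus>\<^bsub>U\<^esub> add_pow U k' x" "v' \<in> V"
          using ab by (auto simp: V'_def)
        show ?thesis using vk V less.prems(6) by (simp add: add f')
      qed
    qed (rule V'c)
    moreover have "f' v = f v" if "v \<in> V" for v
      using f'[OF that, of 0] that V by (auto simp: subset_iff)
    ultimately show ?thesis using VV' by (metis subsetD)
  qed
qed

section \<open>Integer polynomials irreducible modulo p\<close>

text \<open>Membership of Q in the ideal (p, P), hence the test for zero in F_p[t]/(P).\<close>

definition inI :: "int \<Rightarrow> int poly \<Rightarrow> int poly \<Rightarrow> bool" where
  "inI p P Q \<longleftrightarrow> (\<exists>A C. Q = A * P + Polynomial.smult p C)"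

text \<open>Q is a unit modulo (p, P), with inverse A. The relation is symmetric in P and Q, so it
  also expresses that two moduli are comaximal.\<close>

definition comax :: "int \<Rightarrow> int poly \<Rightarrow> int poly \<Rightarrow> bool" where
  "comax p P Q \<longleftrightarrow> (\<exists>A B C. A * Q + B * P = 1 + Polynomial.smult p C)"

text \<open>Monic of degree at most 2 and irreducible modulo \<open>p\<close>: in these degrees irreducibility of a
  nonlinear polynomial is the absence of roots.\<close>
definition irr_le2 :: "int \<Rightarrow> int poly \<Rightarrow> bool" where
  "irr_le2 p P \<longleftrightarrow> Polynomial.lead_coeff P = 1 \<and>
     (Polynomial.degree P = 1 \<or> Polynomial.degree P = 2 \<and> (\<forall>a. \<not> p dvd poly P a))"

lemma comax_sym: "comax p P Q \<Longrightarrow> comax p Q P"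
  unfolding comax_def by (metis add.commute)

text \<open>A divisor of a unit is a unit: if A inverts R and R = S Q modulo (p, P), then A S
  inverts Q.\<close>

lemma comax_mult:
  assumes "comax p P R" "inI p P (S * Q - R)"
  shows "comax p P Q"
proof -
  obtain A B C where 1: "A * R + B * P = 1 + Polynomial.smult p C" using assms by (auto simp: comax_def)
  obtain A' C' where 2: "S * Q - R = A' * P + Polynomial.smult p C'" using assms by (auto simp: inI_def)
  have R: "R = S * Q - (A' * P + Polynomial.smult p C')" using 2 by (simp add: algebra_simps)
  have "(A * S) * Q + (B - A * A') * P = (A * R + B * P) + Polynomial.smult p (A * C')"
    unfolding R by (simp add: algebra_simps)
  also have "\<dots> = 1 + Polynomial.smult p (C + A * C')" unfolding 1 by (simp add: smult_add_right)
  finally show ?thesis unfolding comax_def by blast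
qed

lemma inI_smult [simp]: "inI p P (Polynomial.smult p C)"
  unfolding inI_def by (intro exI[of _ 0] exI[of _ C]) simp

lemma inI_mult_P [simp]: "inI p P (A * P)"
  unfolding inI_def by (intro exI[of _ A] exI[of _ 0]) simp

lemma inI_0 [simp]: "inI p P 0"
  using inI_smult[of p P 0] by simp

lemma unit_mod_prime:
  assumes "Factorial_Ring.prime (p::int)" "\<not> p dvd c"
  obtains c' k where "c' * c = 1 + p * k"
proof -
  have "coprime p c" using assms by (simp add: prime_imp_coprime)
  then obtain a b where "a * p + b * c = 1" using bezout_int[of p c] by auto
  then have "b * c = 1 + p * (- a)" by (simp add: algebra_simps)
  then show ?thesis using that by blast
qed

lemma comax_const:
  assumes "Factorial_Ring.prime (p::int)" "\<not> p dvd c"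
  shows "comax p P [:c:]"
proof -
  obtain c' k where "c' * c = 1 + p * k" using unit_mod_prime[OF assms] .
  then have "[:c':] * [:c:] + 0 * P = 1 + Polynomial.smult p [:k:]" by (simp add: one_pCons mult.commute)
  then show ?thesis unfolding comax_def by blast
qed

text \<open>Division of P by t + c leaves the constant P(-c). Modulo P this constant is a multiple
  of t + c, and it is a unit modulo p.\<close>

lemma comax_monic_linear:
  assumes "Factorial_Ring.prime (p::int)" "\<not> p dvd poly P (- c)"
  shows "comax p P [:c, 1:]"
proof -
  have "[:- (- c), 1:] dvd P - [:poly P (- c):]"
    by (subst poly_eq_0_iff_dvd[symmetric]) simp
  then obtain S where S: "P - [:poly P (- c):] = [:c, 1:] * S" by auto
  show ?thesis
  proof (rule comax_mult[OF comax_const[OF assms]])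
    have "(- S) * [:c, 1:] - [:poly P (- c):] = - ([:c, 1:] * S) - [:poly P (- c):]"
      by (simp only: mult.commute[of "- S"] mult_minus_right)
    also have "\<dots> = (- 1) * P" unfolding S[symmetric] by simp
    finally have "(- S) * [:c, 1:] - [:poly P (- c):] = (- 1) * P" .
    then show "inI p P ((- S) * [:c, 1:] - [:poly P (- c):])" by (metis inI_mult_P)
  qed
qed

text \<open>These are the nonzero residues modulo (p, P). If p divides a, the residue is a constant
  prime to p; otherwise P is quadratic without roots, and after scaling by an inverse of a the monic
  case applies. In degree 1 the assumption a = 0 leads to the constants.\<close>

lemma comax_linear:
  assumes p: "Factorial_Ring.prime (p::int)" and P: "irr_le2 p P"
    and nd: "\<not> (p dvd a \<and> p dvd b)" and deg: "Polynomial.degree P = 1 \<Longrightarrow> a = 0"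
  shows "comax p P [:b, a:]"
proof (cases "p dvd a")
  case True
  then obtain k where k: "a = p * k" by auto
  have "comax p P [:b:]" using True nd by (intro comax_const p) auto
  moreover have "inI p P (1 * [:b, a:] - [:b:])"
    using inI_smult[of p P "[:0, k:]"] by (simp add: k)
  ultimately show ?thesis by (rule comax_mult)
next
  case False
  then have nr: "\<not> p dvd poly P x" for x using P deg by (auto simp: irr_le2_def)
  obtain a' k where a': "a' * a = 1 + p * k" using unit_mod_prime[OF p False] .
  have "comax p P [:a' * b, 1:]" by (rule comax_monic_linear[OF p nr])
  moreover have "inI p P ([:a':] * [:b, a:] - [:a' * b, 1:])"
    using inI_smult[of p P "[:0, k:]"] a' by (simp add: mult.commute[of a])
  ultimately show ?thesis by (rule comax_mult)
qed

text \<open>Pseudo-division multiplies by a power of the leading coefficient, here 1.\<close>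

lemma monic_division:
  assumes "Polynomial.lead_coeff (P :: int poly) = 1"
  obtains A R where "Q = A * P + R" "R = 0 \<or> Polynomial.degree R < Polynomial.degree P"
proof -
  obtain A R where AR: "pseudo_divmod Q P = (A, R)" by fastforce
  have "P \<noteq> 0" using assms by auto
  from pseudo_divmod[OF this AR] assms show ?thesis
    by (intro that[of A R]) (simp_all add: mult.commute)
qed

text \<open>The multiplier C can itself be reduced modulo P, to C2. Then R - p C2 is a multiple of
  the monic P and has smaller degree than P, so it vanishes.\<close>

lemma inI_small_degree:
  assumes P: "Polynomial.lead_coeff (P :: int poly) = 1" and R: "inI p P R"
    "R = 0 \<or> Polynomial.degree R < Polynomial.degree P"
  shows "\<exists>C. R = Polynomial.smult p C"
proof -
  obtain A C where AC: "R = A * P + Polynomial.smult p C" using R by (auto simp: inI_def)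
  obtain C1 C2 where C: "C = C1 * P + C2" "C2 = 0 \<or> Polynomial.degree C2 < Polynomial.degree P"
    using monic_division[OF P] .
  have e: "R - Polynomial.smult p C2 = (A + Polynomial.smult p C1) * P"
    unfolding AC C(1) by (simp add: algebra_simps smult_add_right)
  have "A + Polynomial.smult p C1 = 0"
  proof (rule ccontr)
    assume nz: "A + Polynomial.smult p C1 \<noteq> 0"
    have P0: "P \<noteq> 0" using P by auto
    then have deg: "Polynomial.degree (R - Polynomial.smult p C2) \<ge> Polynomial.degree P"
      unfolding e using nz by (simp add: degree_mult_eq)
    have "R - Polynomial.smult p C2 \<noteq> 0" unfolding e using nz P0 by simp
    moreover have "Polynomial.degree R \<le> Polynomial.degree P - 1" "Polynomial.degree (Polynomial.smult p C2) \<le> Polynomial.degree P - 1"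
      using R(2) C(2) by (auto simp: Polynomial.degree_smult_eq)
    then have "Polynomial.degree (R - Polynomial.smult p C2) \<le> Polynomial.degree P - 1"
      by (rule degree_diff_le)
    ultimately have "Polynomial.degree P = 0" using deg by simp
    then have "R = 0" "C2 = 0" using R(2) C(2) by auto
    then show False using \<open>R - Polynomial.smult p C2 \<noteq> 0\<close> by simp
  qed
  then show ?thesis using e by auto
qed

text \<open>Z[t]/(p, P) is a field. The remainder of Q modulo P has the form b + a t because the
  degree is at most 2, and it is either divisible by p or inverted by
  \<open>comax_linear\<close>.\<close>

lemma irr_le2_dichotomy:
  assumes p: "Factorial_Ring.prime (p::int)" and P: "irr_le2 p P"
  shows "inI p P Q \<or> comax p P Q"
proof -
  have l: "Polynomial.lead_coeff P = 1" using P by (simp add: irr_le2_def)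
  obtain A R where Q: "Q = A * P + R" and R: "R = 0 \<or> Polynomial.degree R < Polynomial.degree P"
    using monic_division[OF l] .
  define b a where "b = Polynomial.coeff R 0" and "a = Polynomial.coeff R 1"
  have d2: "Polynomial.degree P \<le> 2" "Polynomial.degree P > 0" using P by (auto simp: irr_le2_def)
  have R': "R = [:b, a:]"
  proof (rule poly_eqI)
    fix m
    show "Polynomial.coeff R m = Polynomial.coeff [:b, a:] m"
      using R d2 by (cases m; cases "m - 1")
        (auto simp: b_def a_def coeff_pCons intro!: coeff_eq_0 split: nat.splits)
  qed
  have a0: "a = 0" if "Polynomial.degree P = 1" using R that by (auto simp: a_def intro!: coeff_eq_0)
  show ?thesis
  proof (cases "p dvd a \<and> p dvd b")
    case True
    then obtain a' b' where "a = p * a'" "b = p * b'" by (auto elim!: dvdE)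
    then have "Q = A * P + Polynomial.smult p [:b', a':]" using Q R' by simp
    then show ?thesis unfolding inI_def by blast
  next
    case False
    have "comax p P R" unfolding R' by (rule comax_linear[OF p P False a0])
    moreover have "inI p P (1 * Q - R)" unfolding Q by simp
    ultimately show ?thesis using comax_mult by blast
  qed
qed

text \<open>For equal degrees the leading terms cancel, so Q is congruent modulo P to the residue Q
  - P of smaller degree, nonzero modulo p. For different degrees the linear polynomial is a unit
  modulo the quadratic one, and comaximality is symmetric.\<close>

lemma comax_distinct:
  assumes p: "Factorial_Ring.prime (p::int)" and P: "irr_le2 p P" and Q: "irr_le2 p Q"
    and nd: "\<not> (\<forall>m. p dvd Polynomial.coeff (P - Q) m)"
  shows "comax p P Q"
proof -
  have p1: "\<not> p dvd 1" using p by (metis not_prime_unit)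
  have lin: "comax p P Q" if "irr_le2 p P" "irr_le2 p Q" "Polynomial.degree P = 2" "Polynomial.degree Q = 1" for P Q
  proof -
    have "Q = [:Polynomial.coeff Q 0, 1:]"
      using that by (auto intro!: poly_eqI simp: irr_le2_def coeff_pCons coeff_eq_0 split: nat.splits)
    moreover have "comax p P [:Polynomial.coeff Q 0, 1:]"
      using that p1 by (intro comax_linear p) auto
    ultimately show ?thesis by simp
  qed
  show ?thesis
  proof (cases "Polynomial.degree P = Polynomial.degree Q")
    case True
    define R b a where "R = Q - P" and "b = Polynomial.coeff R 0" and "a = Polynomial.coeff R 1"
    define d where "d = Polynomial.degree P"
    have d: "d = 1 \<or> d = 2" "Polynomial.coeff P d = 1" "Polynomial.coeff Q d = 1"
      using P Q True by (auto simp: irr_le2_def d_def)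
    have z: "Polynomial.coeff R m = 0" if "m \<ge> d" for m
    proof (cases "m = d")
      case False
      then show ?thesis using that True by (simp add: R_def d_def coeff_eq_0)
    qed (simp add: R_def d)
    have R': "R = [:b, a:]"
    proof (rule poly_eqI)
      fix m
      show "Polynomial.coeff R m = Polynomial.coeff [:b, a:] m"
        using z d by (cases m; cases "m - 1") (auto simp: b_def a_def coeff_pCons split: nat.splits)
    qed
    have "\<not> (p dvd a \<and> p dvd b)"
    proof
      assume ab: "p dvd a \<and> p dvd b"
      have "p dvd Polynomial.coeff R m" for m unfolding R' using ab by (auto simp: coeff_pCons split: nat.splits)
      then have "p dvd Polynomial.coeff (P - Q) m" for m by (simp add: R_def dvd_diff_commute)
      then show False using nd by blast
    qed
    then have "comax p P R" unfolding R' using z by (intro comax_linear p P) (auto simp: a_def d_def)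
    moreover have "inI p P (1 * Q - R)" using inI_mult_P[of p P 1] by (simp add: R_def)
    ultimately show ?thesis using comax_mult by blast
  next
    case False
    then show ?thesis using lin[OF P Q] comax_sym[OF lin[OF Q P]] P Q by (auto simp: irr_le2_def)
  qed
qed

text \<open>Separability of P modulo p. The derivative is a constant or linear residue, so it
  suffices that it is nonzero modulo p.\<close>

lemma comax_pderiv:
  assumes p: "Factorial_Ring.prime (p::int)" and P: "irr_le2 p P"
  shows "comax p P (pderiv P)"
proof -
  have p1: "\<not> p dvd 1" using p by (metis not_prime_unit)
  define c b where "c = Polynomial.coeff P 0" and "b = Polynomial.coeff P 1"
  consider "Polynomial.degree P = 1" | "Polynomial.degree P = 2" "\<forall>a. \<not> p dvd poly P a" using P by (auto simp: irr_le2_def)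
  then show ?thesis
  proof cases
    case 1
    then have "P = [:c, 1:]"
      using P by (auto intro!: poly_eqI simp: c_def irr_le2_def coeff_pCons coeff_eq_0 split: nat.splits)
    then have "pderiv P = [:1:]" by (simp add: pderiv_pCons)
    then show ?thesis using comax_const[OF p p1] by simp
  next
    case 2
    have "P = [:c, b, 1:]"
    proof (rule poly_eqI)
      fix m :: nat
      consider "m = 0" | "m = 1" | "m = 2" | "m > 2" by linarith
      then show "Polynomial.coeff P m = Polynomial.coeff [:c, b, 1:] m"
        using P 2 by cases (auto simp: c_def b_def irr_le2_def coeff_pCons coeff_eq_0 numeral_2_eq_2 split: nat.splits)
    qed
    then have P': "pderiv P = [:b, 2:]" "poly P c = c + c * (b + c)" by (simp_all add: pderiv_pCons)
    \<comment> \<open>If p divided both 2 and b, then P(c) = c * (1 + c) + c * b would vanish modulo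
      p, because c * (1 + c) is even; thus c would be a root.\<close>
    have "\<not> (p dvd 2 \<and> p dvd b)"
    proof
      assume d: "p dvd 2 \<and> p dvd b"
      have "p dvd c * (1 + c)" using d by (metis dvd_trans even_mult_iff even_plus_one_iff add.commute)
      then have "p dvd c * (1 + c) + c * b" using d by simp
      then show False using 2(2) P'(2) by (metis (no_types, opaque_lifting) add.assoc add.commute distrib_left mult.right_neutral)
    qed
    then show ?thesis unfolding P'(1) using 2 by (intro comax_linear p P) auto
  qed
qed

section \<open>Reduced representatives of the residue field Z[t]/(p, P)\<close>

definition Res :: "int \<Rightarrow> nat \<Rightarrow> int poly set" where
  "Res p d = {Q. \<forall>m. 0 \<le> Polynomial.coeff Q m \<and> Polynomial.coeff Q m < p \<and> (m \<ge> d \<longrightarrow> Polynomial.coeff Q m = 0)}"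

definition rpoly :: "nat \<Rightarrow> (nat \<Rightarrow> int) \<Rightarrow> int poly" where
  "rpoly d a = (\<Sum>m<d. Polynomial.monom (a m) m)"

lemma coeff_rpoly: "Polynomial.coeff (rpoly d a) m = (if m < d then a m else 0)"
  by (simp add: rpoly_def coeff_sum if_distrib[of "\<lambda>x. Polynomial.coeff x m"] Polynomial.coeff_monom sum.delta cong: if_cong)

lemma card_Res:
  assumes "p > 0"
  shows "finite (Res p d)" "card (Res p d) = nat p ^ d"
proof -
  have b: "bij_betw (rpoly d) ({..<d} \<rightarrow>\<^sub>E {0..<p}) (Res p d)"
  proof (rule bij_betw_byWitness[where f' = "\<lambda>Q. \<lambda>m\<in>{..<d}. Polynomial.coeff Q m"])
    show "\<forall>a\<in>{..<d} \<rightarrow>\<^sub>E {0..<p}. (\<lambda>m\<in>{..<d}. Polynomial.coeff (rpoly d a) m) = a"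
      by (auto simp: coeff_rpoly fun_eq_iff PiE_def extensional_def)
    show "\<forall>Q\<in>Res p d. rpoly d (\<lambda>m\<in>{..<d}. Polynomial.coeff Q m) = Q"
      by (auto simp: poly_eq_iff coeff_rpoly Res_def)
    show "rpoly d ` ({..<d} \<rightarrow>\<^sub>E {0..<p}) \<subseteq> Res p d"
      using assms by (auto simp: coeff_rpoly Res_def PiE_def Pi_iff)
    show "(\<lambda>Q. \<lambda>m\<in>{..<d}. Polynomial.coeff Q m) ` Res p d \<subseteq> {..<d} \<rightarrow>\<^sub>E {0..<p}"
      by (auto simp: Res_def)
  qed
  have "finite ({..<d} \<rightarrow>\<^sub>E {0..<p})" by (intro finite_PiE) auto
  then show "finite (Res p d)" using b bij_betw_finite by blast
  show "card (Res p d) = nat p ^ d" using bij_betw_same_card[OF b] by (simp add: card_PiE)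
qed

lemma Res_exists:
  assumes P: "Polynomial.lead_coeff P = 1" and p: "p > 0"
  shows "\<exists>R\<in>Res p (Polynomial.degree P). inI p P (Q - R)"
proof -
  obtain A R where AR: "Q = A * P + R" "R = 0 \<or> Polynomial.degree R < Polynomial.degree P" using monic_division[OF P] .
  define d where "d = Polynomial.degree P"
  define R' where "R' = rpoly d (\<lambda>m. Polynomial.coeff R m mod p)"
  have z: "Polynomial.coeff R m = 0" if "m \<ge> d" for m using AR(2) that by (auto simp: d_def coeff_eq_0)
  have "R - R' = Polynomial.smult p (rpoly d (\<lambda>m. Polynomial.coeff R m div p))"
    by (rule poly_eqI) (use z in \<open>auto simp: R'_def coeff_rpoly minus_mod_eq_mult_div\<close>)
  then have "Q - R' = A * P + Polynomial.smult p (rpoly d (\<lambda>m. Polynomial.coeff R m div p))"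
    using AR(1) by (simp add: algebra_simps)
  then have "inI p P (Q - R')" unfolding inI_def by blast
  moreover have "R' \<in> Res p d" using p by (auto simp: Res_def R'_def coeff_rpoly)
  ultimately show ?thesis unfolding d_def by blast
qed

lemma Res_unique:
  assumes P: "Polynomial.lead_coeff P = 1" and R: "R \<in> Res p (Polynomial.degree P)" "R' \<in> Res p (Polynomial.degree P)"
    and i: "inI p P (R - R')"
  shows "R = R'"
proof -
  have "R - R' = 0 \<or> Polynomial.degree (R - R') < Polynomial.degree P"
  proof (rule ccontr)
    assume n: "\<not> ?thesis"
    then have "Polynomial.coeff (R - R') (Polynomial.degree (R - R')) = 0" using R by (auto simp: Res_def)
    then have "R - R' = 0" by (metis leading_coeff_0_iff)
    then show False using n by blast
  qed
  from inI_small_degree[OF P i this] obtain C where C: "R - R' = Polynomial.smult p C" by blast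
  show ?thesis
  proof (rule poly_eqI)
    fix m
    have "Polynomial.coeff R m - Polynomial.coeff R' m = p * Polynomial.coeff C m" using C by (metis coeff_diff coeff_smult)
    then have "Polynomial.coeff R m mod p = Polynomial.coeff R' m mod p" by (simp add: mod_eq_dvd_iff)
    then show "Polynomial.coeff R m = Polynomial.coeff R' m" using R by (simp add: Res_def)
  qed
qed

section \<open>Vector spaces over the field of p^deg P elements\<close>

text \<open>Maps are \<open>undefined\<close> outside the carrier, so that each homomorphism is
  counted once; \<open>tmod_aut\<close> follows the same convention.\<close>

definition THom :: "('a, 'b, 'c) tmodule_scheme \<Rightarrow> ('d, 'e, 'f) tmodule_scheme \<Rightarrow> ('b \<Rightarrow> 'e) set" where
  "THom G H = {\<phi> \<in> carrier G \<rightarrow>\<^sub>E carrier H. thom G H \<phi>}"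

definition TIso :: "('a, 'b, 'c) tmodule_scheme \<Rightarrow> ('d, 'e, 'f) tmodule_scheme \<Rightarrow> ('b \<Rightarrow> 'e) set" where
  "TIso G H = {\<phi> \<in> THom G H. bij_betw \<phi> (carrier G) (carrier H)}"

text \<open>A linear combination over F_p[t]/(P), with scalars given by polynomial
  representatives.\<close>

definition comb :: "('a, 'b, 'c) tmodule_scheme \<Rightarrow> (nat \<Rightarrow> 'b) \<Rightarrow> nat \<Rightarrow> (nat \<Rightarrow> int poly) \<Rightarrow> 'b" where
  "comb G b r A = (\<Oplus>\<^bsub>G\<^esub> i\<in>{..<r}. act G (A i) (b i))"

context tgroup
begin

lemma comb_0 [simp]: "comb G b 0 A = \<zero>"
  by (simp add: comb_def)

lemma comb_Suc:
  assumes "b \<in> {..<Suc r} \<rightarrow> carrier G"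
  shows "comb G b (Suc r) A = comb G b r A \<oplus> act G (A r) (b r)"
proof -
  have c: "(\<lambda>i. act G (A i) (b i)) \<in> {..<r} \<rightarrow> carrier G" "b r \<in> carrier G" using assms by (auto simp: Pi_iff)
  then show ?thesis unfolding comb_def lessThan_Suc
    by (subst finsum_insert) (auto intro!: a_comm finsum_closed simp: Pi_iff)
qed

lemma comb_closed [simp, intro]: "b \<in> {..<r} \<rightarrow> carrier G \<Longrightarrow> comb G b r A \<in> carrier G"
  by (auto simp: comb_def intro!: finsum_closed)

lemma comb_cong:
  "b \<in> {..<r} \<rightarrow> carrier G \<Longrightarrow> (\<And>i. i < r \<Longrightarrow> act G (A i) (b i) = act G (B i) (b i)) \<Longrightarrow> comb G b r A = comb G b r B"
  unfolding comb_def by (rule finsum_cong') auto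

lemma comb_add: "b \<in> {..<r} \<rightarrow> carrier G \<Longrightarrow> comb G b r (\<lambda>i. A i + B i) = comb G b r A \<oplus> comb G b r B"
proof (induction r)
  case (Suc r)
  then have "b \<in> {..<r} \<rightarrow> carrier G" "b r \<in> carrier G" by auto
  then show ?case using Suc by (simp add: comb_Suc act_add a_ac)
qed simp

lemma comb_mult: "b \<in> {..<r} \<rightarrow> carrier G \<Longrightarrow> comb G b r (\<lambda>i. Q * A i) = act G Q (comb G b r A)"
proof (induction r)
  case (Suc r)
  then have "b \<in> {..<r} \<rightarrow> carrier G" "b r \<in> carrier G" by auto
  then show ?case using Suc by (simp add: comb_Suc act_x_add act_mult)
qed simp

lemma comb_diff:
  assumes "b \<in> {..<r} \<rightarrow> carrier G" shows "comb G b r (\<lambda>i. A i - B i) = comb G b r A \<ominus> comb G b r B"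
  using comb_add[OF assms, of "\<lambda>i. A i - B i" B] assms by (subst add_eq_minus_iff[symmetric]) auto

end

lemma thom_comb:
  assumes G: "tgroup G" and H: "tgroup H" and \<phi>: "thom G H \<phi>" and b: "b \<in> {..<r} \<rightarrow> carrier G"
  shows "\<phi> (comb G b r A) = comb H (\<lambda>i. \<phi> (b i)) r A"
  using b
proof (induction r)
  interpret G: tgroup G by fact
  interpret H: tgroup H by fact
  case 0
  show ?case using thom_maps(1)[OF G H \<phi>] by simp
next
  interpret G: tgroup G by fact
  interpret H: tgroup H by fact
  case (Suc r)
  then have b: "b \<in> {..<r} \<rightarrow> carrier G" "b r \<in> carrier G" by auto
  moreover have "(\<lambda>i. \<phi> (b i)) \<in> {..<Suc r} \<rightarrow> carrier H" using Suc thomD(1)[OF \<phi>] by auto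
  ultimately show ?case
    using Suc thomD(2)[OF \<phi>] thom_maps(5)[OF G H \<phi>] by (simp add: G.comb_Suc H.comb_Suc)
qed

text \<open>As p and P act as zero, G is a vector space over the field Z[t]/(p, P). Scalars remain
  polynomials, and \<open>inI\<close> of a difference is their equality.\<close>

locale fqspace = tgroup G for G :: "('a, 'b, 'c) tmodule_scheme" (structure) +
  fixes p :: int and P :: "int poly"
  assumes fin: "finite (carrier G)" and p: "Factorial_Ring.prime p" and irr: "irr_le2 p P"
    and p_tors: "x \<in> carrier G \<Longrightarrow> p \<diamondop> x = \<zero>" and P_tors: "x \<in> carrier G \<Longrightarrow> act G P x = \<zero>"
begin

abbreviation q :: nat where "q \<equiv> nat p ^ Polynomial.degree P"

lemma lead: "Polynomial.lead_coeff P = 1" and deg: "Polynomial.degree P > 0" and p_pos: "p > 0" and q_gt1: "q > 1"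
proof -
  show l: "Polynomial.lead_coeff P = 1" and d: "Polynomial.degree P > 0" using irr by (auto simp: irr_le2_def)
  show "p > 0" using p by (simp add: prime_gt_0_int)
  have "nat p > 1" using prime_gt_1_int[OF p] by simp
  then show "q > 1" using d one_less_power by blast
qed

lemma act_inI: "inI p P Q \<Longrightarrow> x \<in> carrier G \<Longrightarrow> act G Q x = \<zero>"
  unfolding inI_def by (auto simp: act_add act_mult act_smult P_tors p_tors)

lemma act_eq_inI: "inI p P (Q - R) \<Longrightarrow> x \<in> carrier G \<Longrightarrow> act G Q x = act G R x"
  using act_inI[of "Q - R" x] by (simp add: act_diff minus_eq_zero_iff)

lemma act_comax: assumes "comax p P Q" obtains A where "\<And>x. x \<in> carrier G \<Longrightarrow> act G A (act G Q x) = x"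
proof -
  obtain A B C where e: "A * Q + B * P = 1 + Polynomial.smult p C" using assms by (auto simp: comax_def)
  have "act G A (act G Q x) = x" if x: "x \<in> carrier G" for x
  proof -
    have "act G (A * Q + B * P) x = act G A (act G Q x)" using x by (simp add: act_add act_mult P_tors)
    moreover have "act G (1 + Polynomial.smult p C) x = x" using x by (simp add: act_add act_smult p_tors)
    ultimately show ?thesis using e by simp
  qed
  then show ?thesis using that by blast
qed

lemma not_inI_1: "\<not> inI p P 1"
proof
  assume "inI p P 1"
  then have "inI p P (1 - 0)" by simp
  moreover have "1 \<in> Res p (Polynomial.degree P)" "0 \<in> Res p (Polynomial.degree P)"
    using deg prime_gt_1_int[OF p] by (auto simp: Res_def)
  ultimately show False using Res_unique[OF lead] by fastforce
qed

definition indep :: "nat \<Rightarrow> (nat \<Rightarrow> 'b) \<Rightarrow> bool" where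
  "indep r b \<longleftrightarrow> b \<in> {..<r} \<rightarrow> carrier G \<and> (\<forall>A. comb G b r A = \<zero> \<longrightarrow> (\<forall>i<r. inI p P (A i)))"

definition span :: "nat \<Rightarrow> (nat \<Rightarrow> 'b) \<Rightarrow> 'b set" where
  "span r b = range (comb G b r)"

lemma span_closed: "b \<in> {..<r} \<rightarrow> carrier G \<Longrightarrow> span r b \<subseteq> carrier G"
  by (auto simp: span_def)

text \<open>By \<open>irr_le2_dichotomy\<close> the last coefficient of a relation is zero in the
  field or invertible; in the second case the relation can be solved for the last vector, which then
  lies in the span of the others.\<close>

lemma indep_Suc: "indep (Suc r) b \<longleftrightarrow> indep r b \<and> b r \<in> carrier G \<and> b r \<notin> span r b"
proof
  assume I: "indep (Suc r) b"
  then have bS: "b \<in> {..<Suc r} \<rightarrow> carrier G" and b: "b \<in> {..<r} \<rightarrow> carrier G" and br: "b r \<in> carrier G"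
    by (auto simp: indep_def)
  have c: "comb G b r (A(r := Q)) = comb G b r A" for A Q by (rule comb_cong[OF b]) auto
  have "indep r b" unfolding indep_def
  proof (intro conjI allI impI b)
    fix A i assume "comb G b r A = \<zero>" "i < r"
    then have "comb G b (Suc r) (A(r := 0)) = \<zero>" using bS br c by (simp add: comb_Suc)
    then have "\<forall>i<Suc r. inI p P ((A(r := 0)) i)" using I unfolding indep_def by blast
    then show "inI p P (A i)" using \<open>i < r\<close> by (metis fun_upd_other less_SucI nat_neq_iff)
  qed
  moreover have "b r \<notin> span r b"
  proof
    assume "b r \<in> span r b"
    then obtain A where A: "b r = comb G b r A" by (auto simp: span_def)
    let ?B = "(\<lambda>i. - A i)(r := 1)"
    have "comb G b r ?B = \<ominus> b r"
      using comb_mult[OF b, of "- 1" A] br A act_diff[of "b r" 0 1] by (simp add: c a_minus_def)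
    then have "comb G b (Suc r) ?B = \<zero>" using bS br by (simp add: comb_Suc l_neg)
    then have "\<forall>i<Suc r. inI p P (?B i)" using I unfolding indep_def by blast
    then show False using not_inI_1 by (metis fun_upd_same lessI)
  qed
  ultimately show "indep r b \<and> b r \<in> carrier G \<and> b r \<notin> span r b" using br by simp
next
  assume H: "indep r b \<and> b r \<in> carrier G \<and> b r \<notin> span r b"
  then have b: "b \<in> {..<r} \<rightarrow> carrier G" and br: "b r \<in> carrier G" by (auto simp: indep_def)
  then have bS: "b \<in> {..<Suc r} \<rightarrow> carrier G" by (auto simp: less_Suc_eq)
  show "indep (Suc r) b" unfolding indep_def
  proof (intro conjI allI impI bS)
    fix A i assume z: "comb G b (Suc r) A = \<zero>" and i: "i < Suc r"
    have z': "comb G b r A \<oplus> act G (A r) (b r) = \<zero>" using z comb_Suc[OF bS] by simp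
    have "inI p P (A r)"
    proof (rule ccontr)
      assume "\<not> inI p P (A r)"
      then have "comax p P (A r)" using irr_le2_dichotomy[OF p irr] by blast
      then obtain B where B: "\<And>x. x \<in> carrier G \<Longrightarrow> act G B (act G (A r) x) = x" using act_comax by blast
      have "act G (A r) (b r) \<oplus> comb G b r A = \<zero>" using z' b br by (simp add: a_comm)
      then have "act G (A r) (b r) = \<ominus> comb G b r A" using b br by (simp add: add_eq_minus_iff a_minus_def)
      also have "\<dots> = act G (- 1) (comb G b r A)"
        using act_diff[of "comb G b r A" 0 1] b by (simp add: a_minus_def)
      finally have "b r = act G B (act G (- 1) (comb G b r A))" using B br by metis
      also have "\<dots> = comb G b r (\<lambda>i. B * (- 1 * A i))" using comb_mult[OF b] by metis
      finally show False using H by (auto simp: span_def)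
    qed
    moreover from this have "comb G b r A = \<zero>" using z' b br by (simp add: act_inI)
    ultimately show "inI p P (A i)" using H i by (auto simp: indep_def less_Suc_eq)
  qed
qed

lemma comb_eq_iff:
  assumes "indep r b"
  shows "comb G b r A = comb G b r B \<longleftrightarrow> (\<forall>i<r. inI p P (A i - B i))"
proof
  have b: "b \<in> {..<r} \<rightarrow> carrier G" using assms by (simp add: indep_def)
  { assume "comb G b r A = comb G b r B"
    then have "comb G b r (\<lambda>i. A i - B i) = \<zero>" using b by (simp add: comb_diff a_minus_def r_neg)
    then show "\<forall>i<r. inI p P (A i - B i)" using assms unfolding indep_def by blast }
  { assume "\<forall>i<r. inI p P (A i - B i)"
    then show "comb G b r A = comb G b r B" using b by (intro comb_cong) (auto intro!: act_eq_inI) }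
qed

text \<open>Coefficients taken from \<open>Res\<close> represent every scalar exactly once.\<close>

lemma card_span: assumes I: "indep r b" shows "card (span r b) = q ^ r"
proof -
  have b: "b \<in> {..<r} \<rightarrow> carrier G" using I by (simp add: indep_def)
  let ?D = "{..<r} \<rightarrow>\<^sub>E Res p (Polynomial.degree P)"
  have "bij_betw (comb G b r) ?D (span r b)" unfolding bij_betw_def
  proof
    show "inj_on (comb G b r) ?D"
    proof (rule inj_onI)
      fix A B assume AB: "A \<in> ?D" "B \<in> ?D" "comb G b r A = comb G b r B"
      then have "A i = B i" if "i < r" for i
        using that comb_eq_iff[OF I] by (intro Res_unique[OF lead]) auto
      then show "A = B" using AB by (intro PiE_ext) auto
    qed
    show "comb G b r ` ?D = span r b"
    proof
      show "span r b \<subseteq> comb G b r ` ?D"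
      proof
        fix x assume "x \<in> span r b"
        then obtain A where A: "x = comb G b r A" by (auto simp: span_def)
        obtain R where R: "\<And>Q. R Q \<in> Res p (Polynomial.degree P) \<and> inI p P (Q - R Q)"
          using Res_exists[OF lead p_pos] by metis
        have "x = comb G b r (\<lambda>i\<in>{..<r}. R (A i))" unfolding A using R by (simp add: comb_eq_iff[OF I])
        then show "x \<in> comb G b r ` ?D" using R by auto
      qed
    qed (auto simp: span_def)
  qed
  then have "card (span r b) = card ?D" using bij_betw_same_card by fastforce
  then show ?thesis using card_Res[OF p_pos] by (simp add: card_PiE)
qed

text \<open>The next vector must avoid the q^i elements spanned by the i vectors before it. The
  truncated subtraction is harmless: the span lies in G, and once it is all of G the factor is zero,
  as is the number of longer independent tuples.\<close>

lemma card_indep: "card {b \<in> {..<r} \<rightarrow>\<^sub>E carrier G. indep r b} = (\<Prod>i<r. card (carrier G) - q ^ i)"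
proof (induction r)
  case 0
  have "{b \<in> {..<0} \<rightarrow>\<^sub>E carrier G. indep 0 b} = {\<lambda>_. undefined}" by (auto simp: indep_def)
  then show ?case by simp
next
  case (Suc r)
  let ?S = "\<lambda>r. {b \<in> {..<r} \<rightarrow>\<^sub>E carrier G. indep r b}"
  let ?T = "SIGMA b : ?S r. carrier G - span r b"
  have comb_eq: "comb G b r = comb G c r" if "c \<in> {..<r} \<rightarrow> carrier G" "\<And>i. i < r \<Longrightarrow> b i = c i" for b c
    unfolding comb_def fun_eq_iff using that by (intro allI finsum_cong') auto
  have ind_cong: "indep r b \<longleftrightarrow> indep r c" "span r b = span r c"
    if "c \<in> {..<r} \<rightarrow> carrier G" "\<And>i. i < r \<Longrightarrow> b i = c i" for b c
  proof -
    have "b \<in> {..<r} \<rightarrow> carrier G" using that by (auto simp: Pi_iff)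
    then show "indep r b \<longleftrightarrow> indep r c" "span r b = span r c"
      using comb_eq[OF that] that(1) by (simp_all add: indep_def span_def)
  qed
  have "bij_betw (\<lambda>c. (restrict c {..<r}, c r)) (?S (Suc r)) ?T"
  proof (rule bij_betw_byWitness[where f' = "\<lambda>(b, x). b(r := x)"])
    show "\<forall>c\<in>?S (Suc r). (\<lambda>(b, x). b(r := x)) (restrict c {..<r}, c r) = c"
      by (auto simp: fun_eq_iff PiE_def extensional_def)
    show "\<forall>y\<in>?T. (\<lambda>c. (restrict c {..<r}, c r)) ((\<lambda>(b, x). b(r := x)) y) = y"
      by (auto simp: fun_eq_iff PiE_def extensional_def)
    show "(\<lambda>c. (restrict c {..<r}, c r)) ` ?S (Suc r) \<subseteq> ?T"
    proof (rule image_subsetI, elim CollectE conjE)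
      fix c assume c: "c \<in> {..<Suc r} \<rightarrow>\<^sub>E carrier G" "indep (Suc r) c"
      have c': "restrict c {..<r} \<in> {..<r} \<rightarrow>\<^sub>E carrier G" "c \<in> {..<r} \<rightarrow> carrier G"
        using c(1) by (simp_all add: PiE_iff Pi_iff)
      show "(restrict c {..<r}, c r) \<in> ?T"
        using c c' ind_cong[OF c'(2), of "restrict c {..<r}"] by (simp add: indep_Suc)
    qed
    show "(\<lambda>(b, x). b(r := x)) ` ?T \<subseteq> ?S (Suc r)"
    proof clarify
      fix b x assume b: "b \<in> {..<r} \<rightarrow>\<^sub>E carrier G" "indep r b" "x \<in> carrier G" "x \<notin> span r b"
      then have b': "b \<in> {..<r} \<rightarrow> carrier G" by auto
      show "b(r := x) \<in> {..<Suc r} \<rightarrow>\<^sub>E carrier G \<and> indep (Suc r) (b(r := x))"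
        using b ind_cong[OF b', of "b(r := x)"] by (auto simp: indep_Suc PiE_def extensional_def Pi_iff less_Suc_eq)
    qed
  qed
  then have "card (?S (Suc r)) = card ?T" by (rule bij_betw_same_card)
  also have "\<dots> = (\<Sum>b\<in>?S r. card (carrier G - span r b))"
    using fin by (intro card_SigmaI) (auto intro!: finite_subset[OF _ finite_PiE[of "{..<r}" "\<lambda>_. carrier G"]])
  also have "\<dots> = (\<Sum>b\<in>?S r. card (carrier G) - q ^ r)"
  proof (rule sum.cong[OF refl])
    fix b assume "b \<in> ?S r"
    then have "indep r b" by simp
    then have "span r b \<subseteq> carrier G" "card (span r b) = q ^ r" using span_closed card_span indep_def by blast+
    then show "card (carrier G - span r b) = card (carrier G) - q ^ r"
      using fin by (metis card_Diff_subset finite_subset)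
  qed
  also have "\<dots> = card (?S r) * (card (carrier G) - q ^ r)" by simp
  finally show ?case using Suc by simp
qed

text \<open>An independent tuple of maximal length spans. Lengths are bounded since r < q^r = |span|
  \<le> |G|.\<close>

lemma basis_exists: "\<exists>r b. indep r b \<and> span r b = carrier G"
proof -
  have bound: "r \<le> card (carrier G)" if "indep r b" for r b
  proof -
    have "q ^ r \<le> card (carrier G)"
      using that card_span[OF that] span_closed[of b r] fin by (metis card_mono indep_def)
    moreover have "r < q ^ r" using q_gt1 power_gt_expt[of q r] by simp
    ultimately show ?thesis by simp
  qed
  define r where "r = Max {r. \<exists>b. indep r b}"
  have fs: "finite {r. \<exists>b. indep r b}" 
  proof (rule finite_subset)
    show "{r. \<exists>b. indep r b} \<subseteq> {..card (carrier G)}" using bound unfolding subset_iff mem_Collect_eq atMost_iff by blast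
  qed simp
  have "indep 0 (\<lambda>_. \<zero>)" by (simp add: indep_def)
  then have "0 \<in> {r. \<exists>b. indep r b}" by blast
  then have "r \<in> {r. \<exists>b. indep r b}" unfolding r_def using fs by (intro Max_in) auto
  then obtain b where b: "indep r b" by auto
  have "span r b = carrier G"
  proof (rule ccontr)
    assume "span r b \<noteq> carrier G"
    moreover have bc: "b \<in> {..<r} \<rightarrow> carrier G" using b by (simp add: indep_def)
    ultimately obtain x where x: "x \<in> carrier G" "x \<notin> span r b" using span_closed by blast
    let ?c = "b(r := x)"
    have ce: "comb G ?c r = comb G b r"
      unfolding comb_def fun_eq_iff using bc by (intro allI finsum_cong') auto
    have "?c \<in> {..<r} \<rightarrow> carrier G" using bc by (auto simp: Pi_iff)
    then have "indep r ?c" "span r ?c = span r b" using b ce by (simp_all add: indep_def span_def)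
    then have "indep (Suc r) ?c" using x by (simp add: indep_Suc)
    then have "Suc r \<le> r" unfolding r_def using fs by (intro Max_ge) auto
    then show False by simp
  qed
  then show ?thesis using b by blast
qed

lemma fq_dim_unique: "q ^ r = q ^ s \<Longrightarrow> r = s"
  using q_gt1 by (metis power_inject_exp)

end

text \<open>Through \<open>rpoly\<close>, an array of coefficients in F_p is a tuple of polynomials
  of degree below deg P with coefficients in the standard range, and each residue class modulo (p,
  P) contains exactly one such polynomial.\<close>

lemma fq_basis_iff:
  fixes G :: "(int, 'b, 'c) tmodule_scheme" (structure)
  assumes "fqspace G p P"
    and sm: "\<And>a x. \<lbrakk>a \<in> carrier K; x \<in> carrier G\<rbrakk> \<Longrightarrow> module.smult G a x = add_pow G a x"
    and K: "carrier K = {0..<p}" "\<zero>\<^bsub>K\<^esub> = 0"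
  shows "fq_basis K G (Polynomial.degree P) b r \<longleftrightarrow>
    fqspace.indep G p P r b \<and> fqspace.span G r b = carrier G"
proof -
  interpret fqspace G p P by fact
  show ?thesis
proof (cases "b \<in> {..<r} \<rightarrow> carrier G")
  case False
  then show ?thesis by (auto simp: fq_basis_def indep_def)
next
  case b: True
  let ?d = "Polynomial.degree P"
  have comb: "fq_comb G ?d b r a = comb G b r (\<lambda>i. rpoly ?d (a i))" if a: "\<forall>i m. a i m \<in> carrier K" for a
  proof -
    have "(\<Oplus>m\<in>{..<?d}. module.smult G (a i m) ((tact G ^^ m) (b i))) = act G (rpoly ?d (a i)) (b i)" if "i < r" for i
    proof -
      have bi: "b i \<in> carrier G" using b that by auto
      have "act G (rpoly ?d (a i)) (b i) = (\<Oplus>m\<in>{..<?d}. Polynomial.coeff (rpoly ?d (a i)) m \<diamondop> (tact G ^^ m) (b i))"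
        using bi by (intro act_eq_finsum) (auto simp: coeff_rpoly)
      also have "\<dots> = (\<Oplus>m\<in>{..<?d}. module.smult G (a i m) ((tact G ^^ m) (b i)))"
        using bi a sm by (intro finsum_cong') (auto simp: coeff_rpoly)
      finally show ?thesis by simp
    qed
    then show ?thesis unfolding fq_comb_def comb_def using b by (intro finsum_cong') auto
  qed
  have Res: "rpoly ?d a \<in> Res p ?d" if "\<forall>m. a m \<in> carrier K" for a
    using that K p_pos by (auto simp: Res_def coeff_rpoly)
  have zR: "0 \<in> Res p ?d" using p_pos by (simp add: Res_def)
  obtain R where R: "\<And>Q. R Q \<in> Res p ?d \<and> inI p P (Q - R Q)"
    using Res_exists[OF lead p_pos] by metis
  have cR: "comb G b r A = fq_comb G ?d b r (\<lambda>i. Polynomial.coeff (R (A i)))"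
    and kR: "Polynomial.coeff (R (A i)) m \<in> carrier K" for A i m
  proof -
    show kR: "Polynomial.coeff (R (A i)) m \<in> carrier K" for i m using R K by (auto simp: Res_def)
    have "rpoly ?d (Polynomial.coeff (R Q)) = R Q" for Q
      using R by (auto simp: poly_eq_iff coeff_rpoly Res_def)
    then have "fq_comb G ?d b r (\<lambda>i. Polynomial.coeff (R (A i))) = comb G b r (\<lambda>i. R (A i))"
      using kR by (subst comb) auto
    also have "\<dots> = comb G b r A" using b R by (intro comb_cong act_eq_inI[symmetric]) (auto simp: Pi_iff)
    finally show "comb G b r A = fq_comb G ?d b r (\<lambda>i. Polynomial.coeff (R (A i)))" by simp
  qed
  have span: "(\<forall>x\<in>carrier G. \<exists>a. (\<forall>i m. a i m \<in> carrier K) \<and> fq_comb G ?d b r a = x) \<longleftrightarrow> span r b = carrier G"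
  proof
    assume L: "\<forall>x\<in>carrier G. \<exists>a. (\<forall>i m. a i m \<in> carrier K) \<and> fq_comb G ?d b r a = x"
    have "x \<in> span r b" if x: "x \<in> carrier G" for x
    proof -
      obtain a where "\<forall>i m. a i m \<in> carrier K" "fq_comb G ?d b r a = x" using L x by blast
      then show ?thesis using comb[of a] by (auto simp: span_def)
    qed
    then show "span r b = carrier G" using span_closed[OF b] by blast
  next
    assume S: "span r b = carrier G"
    show "\<forall>x\<in>carrier G. \<exists>a. (\<forall>i m. a i m \<in> carrier K) \<and> fq_comb G ?d b r a = x"
    proof
      fix x assume "x \<in> carrier G"
      then obtain A where "x = comb G b r A" unfolding S[symmetric] by (auto simp: span_def)
      then show "\<exists>a. (\<forall>i m. a i m \<in> carrier K) \<and> fq_comb G ?d b r a = x" using cR[of A] kR[of A] by metis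
    qed
  qed
  have ind: "(\<forall>a. (\<forall>i m. a i m \<in> carrier K) \<and> fq_comb G ?d b r a = \<zero> \<longrightarrow> (\<forall>i<r. \<forall>m<?d. a i m = \<zero>\<^bsub>K\<^esub>)) \<longleftrightarrow> indep r b"
  proof
    assume L: "\<forall>a. (\<forall>i m. a i m \<in> carrier K) \<and> fq_comb G ?d b r a = \<zero> \<longrightarrow> (\<forall>i<r. \<forall>m<?d. a i m = \<zero>\<^bsub>K\<^esub>)"
    show "indep r b" unfolding indep_def
    proof (intro conjI allI impI b)
      fix A i assume "comb G b r A = \<zero>" and i: "i < r"
      then have "\<forall>i<r. \<forall>m<?d. Polynomial.coeff (R (A i)) m = 0"
        using L[THEN spec, of "\<lambda>i. Polynomial.coeff (R (A i))"] cR[of A] kR[of A] K(2) by simp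
      then have z: "Polynomial.coeff (R (A i)) m = 0" if "m < ?d" for m using i that by blast
      have "R (A i) \<in> Res p ?d" using R by blast
      then have "Polynomial.coeff (R (A i)) m = 0" if "\<not> m < ?d" for m using that by (simp add: Res_def)
      with z have "R (A i) = 0" by (intro poly_eqI) (metis coeff_0)
      then show "inI p P (A i)" using R[of "A i"] by simp
    qed
  next
    assume I: "indep r b"
    show "\<forall>a. (\<forall>i m. a i m \<in> carrier K) \<and> fq_comb G ?d b r a = \<zero> \<longrightarrow> (\<forall>i<r. \<forall>m<?d. a i m = \<zero>\<^bsub>K\<^esub>)"
    proof (intro allI impI, elim conjE)
      fix a i m assume a: "\<forall>i m. a i m \<in> carrier K" "fq_comb G ?d b r a = \<zero>" and i: "i < r" "m < ?d"
      then have "inI p P (rpoly ?d (a i) - 0)" using comb[of a] I by (auto simp: indep_def)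
      then have "rpoly ?d (a i) = 0" using Res_unique[OF lead Res zR] a(1) by blast
      then show "a i m = \<zero>\<^bsub>K\<^esub>" using coeff_rpoly[of ?d "a i" m] i K by simp
    qed
  qed
  show ?thesis unfolding fq_basis_def span ind using b by (auto simp: Pi_iff)
qed
qed

text \<open>The size r of a basis is determined by q^r = |G|; this also justifies the definite
  description in \<open>fq_dim\<close>.\<close>

lemma card_fq_dim:
  fixes G :: "(int, 'b, 'c) tmodule_scheme" (structure)
  assumes fq: "fqspace G p P"
    and sm: "\<And>a x. \<lbrakk>a \<in> carrier K; x \<in> carrier G\<rbrakk> \<Longrightarrow> module.smult G a x = add_pow G a x"
    and K: "carrier K = {0..<p}" "\<zero>\<^bsub>K\<^esub> = 0"
  shows "card (carrier G) = (nat p ^ Polynomial.degree P) ^ fq_dim K G (Polynomial.degree P)"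
proof -
  interpret fqspace G p P by fact
  obtain r b where rb: "indep r b" "span r b = carrier G" using basis_exists by blast
  have "fq_dim K G (Polynomial.degree P) = r" unfolding fq_dim_def
  proof (rule the_equality)
    show "\<exists>b. fq_basis K G (Polynomial.degree P) b r" using fq_basis_iff[OF fq sm K] rb by blast
    fix s assume "\<exists>b. fq_basis K G (Polynomial.degree P) b s"
    then obtain c where "indep s c" "span s c = carrier G" using fq_basis_iff[OF fq sm K] by blast
    then have "q ^ s = q ^ r" using card_span rb by metis
    then show "s = r" by (rule fq_dim_unique)
  qed
  then show ?thesis using card_span rb by metis
qed

text \<open>A linear map is an arbitrary choice of images for r basis vectors, with q^r
  possibilities for each. It is an isomorphism exactly if the images are independent, and
  \<open>card_indep\<close> counts these.\<close>

lemma card_THom_TIso: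
  assumes G: "fqspace G p P" and H: "fqspace H p P"
    and cG: "card (carrier G) = (nat p ^ Polynomial.degree P) ^ r" and cH: "card (carrier H) = (nat p ^ Polynomial.degree P) ^ r"
  shows "card (THom G H) = (nat p ^ Polynomial.degree P) ^ (r\<^sup>2)"
    and "card (TIso G H) = (\<Prod>i<r. (nat p ^ Polynomial.degree P) ^ r - (nat p ^ Polynomial.degree P) ^ i)"
    and "finite (THom G H)"
proof -
  interpret G: fqspace G p P by fact
  interpret H: fqspace H p P by fact
  note tg = G.tgroup_axioms H.tgroup_axioms
  obtain s b where sb: "G.indep s b" "G.span s b = carrier G" using G.basis_exists by blast
  have "s = r" using G.card_span[OF sb(1)] sb(2) cG G.fq_dim_unique by metis
  with sb have b: "G.indep r b" "G.span r b = carrier G" by auto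
  have bc: "b \<in> {..<r} \<rightarrow> carrier G" using b by (simp add: G.indep_def)
  let ?res = "\<lambda>\<phi>. \<lambda>i\<in>{..<r}. \<phi> (b i)"
  have val: "\<phi> (comb G b r A) = comb H (?res \<phi>) r A" if "\<phi> \<in> THom G H" for \<phi> A
  proof -
    have t: "thom G H \<phi>" using that by (simp add: THom_def)
    have "\<phi> (comb G b r A) = comb H (\<lambda>i. \<phi> (b i)) r A" by (rule thom_comb[OF tg t bc])
    also have "\<dots> = comb H (?res \<phi>) r A" unfolding comb_def
      using bc thomD(1)[OF t] by (intro H.finsum_cong') (auto simp: Pi_iff)
    finally show ?thesis .
  qed
  have bij: "bij_betw ?res (THom G H) ({..<r} \<rightarrow>\<^sub>E carrier H)" unfolding bij_betw_def
  proof
    show "inj_on ?res (THom G H)"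
    proof (rule inj_onI)
      fix \<phi> \<psi> assume h: "\<phi> \<in> THom G H" "\<psi> \<in> THom G H" "?res \<phi> = ?res \<psi>"
      have "\<phi> x = \<psi> x" if "x \<in> carrier G" for x
      proof -
        obtain A where "x = comb G b r A" using \<open>x \<in> carrier G\<close> b(2) by (auto simp: G.span_def)
        then show ?thesis using val[OF h(1)] val[OF h(2)] h(3) by simp
      qed
      then show "\<phi> = \<psi>" using h by (intro PiE_ext[of \<phi> "carrier G" "\<lambda>_. carrier H"]) (auto simp: THom_def)
    qed
    show "?res ` THom G H = {..<r} \<rightarrow>\<^sub>E carrier H"
    proof (intro subset_antisym subsetI)
      fix y assume "y \<in> ?res ` THom G H"
      then obtain \<phi> where h: "y = ?res \<phi>" "thom G H \<phi>" by (auto simp: THom_def)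
      then show "y \<in> {..<r} \<rightarrow>\<^sub>E carrier H" using bc thomD(1)[OF h(2)] by (simp add: Pi_iff)
    next
      fix y assume y: "y \<in> {..<r} \<rightarrow>\<^sub>E carrier H"
      then have yc: "y \<in> {..<r} \<rightarrow> carrier H" by auto
      \<comment> \<open>Coefficients of x are chosen arbitrarily. Two choices differ by elements of
        (p, P), which act as zero on H as well.\<close>
      define \<phi> where "\<phi> = (\<lambda>x\<in>carrier G. comb H y r (SOME A. comb G b r A = x))"
      have \<phi>: "\<phi> (comb G b r A) = comb H y r A" for A
      proof -
        have "comb G b r (SOME B. comb G b r B = comb G b r A) = comb G b r A"
          by (rule someI[of "\<lambda>B. comb G b r B = comb G b r A" A]) simp
        then have "\<forall>i<r. inI p P ((SOME B. comb G b r B = comb G b r A) i - A i)" using G.comb_eq_iff[OF b(1)] by blast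
        then have "comb H y r (SOME B. comb G b r B = comb G b r A) = comb H y r A"
          using yc H.act_eq_inI by (intro H.comb_cong) (auto simp: Pi_iff)
        then show ?thesis using bc by (simp add: \<phi>_def)
      qed
      have rep: "\<exists>A. x = comb G b r A" if "x \<in> carrier G" for x using that b(2) by (auto simp: G.span_def)
      have "thom G H \<phi>" unfolding thom_def
      proof (intro conjI ballI)
        show "\<phi> \<in> carrier G \<rightarrow> carrier H" using yc by (auto simp: \<phi>_def)
        fix x assume "x \<in> carrier G"
        then obtain A where A: "x = comb G b r A" using rep by blast
        have "tact G x = comb G b r (\<lambda>i. [:0, 1:] * A i)"
          using bc by (simp only: G.comb_mult) (simp add: A G.act_pCons one_pCons[symmetric])
        then have "\<phi> (tact G x) = act H [:0, 1:] (\<phi> x)" using H.comb_mult[OF yc] by (simp only: \<phi> A)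
        then show "\<phi> (tact G x) = tact H (\<phi> x)" using A \<phi> yc by (simp add: H.act_pCons)
        fix z assume "z \<in> carrier G"
        then obtain B where B: "z = comb G b r B" using rep by blast
        show "\<phi> (x \<oplus>\<^bsub>G\<^esub> z) = \<phi> x \<oplus>\<^bsub>H\<^esub> \<phi> z"
          unfolding A B using bc yc by (simp add: G.comb_add[symmetric] \<phi> H.comb_add)
      qed
      then have "\<phi> \<in> THom G H" by (auto simp: THom_def \<phi>_def thom_def PiE_def)
      moreover have "?res \<phi> = y"
      proof
        fix i
        show "?res \<phi> i = y i"
        proof (cases "i < r")
          case True
          have e: "b i = comb G b r (\<lambda>k. if i = k then 1 else 0)" "y i = comb H y r (\<lambda>k. if i = k then 1 else 0)"
          proof -
            have "(\<lambda>k. act G (if i = k then 1 else 0) (b k)) = (\<lambda>k. if i = k then act G 1 (b k) else \<zero>\<^bsub>G\<^esub>)" by auto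
            then show "b i = comb G b r (\<lambda>k. if i = k then 1 else 0)" unfolding comb_def
              using True bc by (simp add: G.add.finprod_singleton Pi_iff)
            have "(\<lambda>k. act H (if i = k then 1 else 0) (y k)) = (\<lambda>k. if i = k then act H 1 (y k) else \<zero>\<^bsub>H\<^esub>)" by auto
            then show "y i = comb H y r (\<lambda>k. if i = k then 1 else 0)" unfolding comb_def
              using True yc by (simp add: H.add.finprod_singleton Pi_iff)
          qed
          show ?thesis using True e \<phi> by simp
        qed (use y in \<open>auto simp: PiE_def extensional_def\<close>)
      qed
      ultimately show "y \<in> ?res ` THom G H" by (metis image_eqI)
    qed
  qed
  have fP: "finite ({..<r} \<rightarrow>\<^sub>E carrier H)" using H.fin by (intro finite_PiE) auto
  show "finite (THom G H)" using bij fP bij_betw_finite by blast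
  show "card (THom G H) = (nat p ^ Polynomial.degree P) ^ (r\<^sup>2)"
    using bij_betw_same_card[OF bij] cH by (simp add: card_PiE power2_eq_square power_mult)
  have iso: "\<phi> \<in> TIso G H \<longleftrightarrow> H.indep r (?res \<phi>)" if \<phi>: "\<phi> \<in> THom G H" for \<phi>
  proof
    have t: "thom G H \<phi>" using \<phi> by (simp add: THom_def)
    have rc: "?res \<phi> \<in> {..<r} \<rightarrow> carrier H" using bc thomD(1)[OF t] by auto
    have z: "\<phi> \<zero>\<^bsub>G\<^esub> = \<zero>\<^bsub>H\<^esub>" by (rule thom_maps(1)[OF tg t])
    { assume "\<phi> \<in> TIso G H"
      then have inj: "inj_on \<phi> (carrier G)" by (auto simp: TIso_def bij_betw_def)
      show "H.indep r (?res \<phi>)" unfolding H.indep_def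
      proof (intro conjI allI impI rc)
        fix A i assume "comb H (?res \<phi>) r A = \<zero>\<^bsub>H\<^esub>" "i < r"
        then have "\<phi> (comb G b r A) = \<phi> \<zero>\<^bsub>G\<^esub>" using val[OF \<phi>] z by simp
        then have "comb G b r A = \<zero>\<^bsub>G\<^esub>" using inj bc by (auto dest: inj_onD)
        then show "inI p P (A i)" using b(1) \<open>i < r\<close> by (auto simp: G.indep_def)
      qed }
    { assume I: "H.indep r (?res \<phi>)"
      have "inj_on \<phi> (carrier G)"
      proof (rule inj_onI)
        fix x y assume xy: "x \<in> carrier G" "y \<in> carrier G" "\<phi> x = \<phi> y"
        have "x \<in> range (comb G b r)" "y \<in> range (comb G b r)" using xy b(2) by (simp_all add: G.span_def)
        then obtain A B where "x = comb G b r A" "y = comb G b r B" by blast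
        then show "x = y" using xy(3) val[OF \<phi>] H.comb_eq_iff[OF I] G.comb_eq_iff[OF b(1)] by simp
      qed
      \<comment> \<open>Injectivity suffices because source and target have the same finite
        size.\<close>
      moreover from this have "\<phi> ` carrier G = carrier H"
        using cG cH H.fin thomD(1)[OF t] by (intro card_subset_eq) (auto simp: card_image)
      ultimately show "\<phi> \<in> TIso G H" using \<phi> by (auto simp: TIso_def bij_betw_def) }
  qed
  have "bij_betw ?res (TIso G H) {y \<in> {..<r} \<rightarrow>\<^sub>E carrier H. H.indep r y}"
  proof (rule bij_betw_subset[OF bij])
    show "TIso G H \<subseteq> THom G H" by (auto simp: TIso_def)
    show "?res ` TIso G H = {y \<in> {..<r} \<rightarrow>\<^sub>E carrier H. H.indep r y}"
    proof (intro subset_antisym subsetI)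
      fix y assume "y \<in> ?res ` TIso G H"
      then obtain \<phi> where h: "\<phi> \<in> TIso G H" "y = ?res \<phi>" by auto
      then have "\<phi> \<in> THom G H" by (auto simp: TIso_def)
      then show "y \<in> {y \<in> {..<r} \<rightarrow>\<^sub>E carrier H. H.indep r y}" using h iso bij_betwE[OF bij] by blast
    next
      fix y assume y: "y \<in> {y \<in> {..<r} \<rightarrow>\<^sub>E carrier H. H.indep r y}"
      then obtain \<phi> where "\<phi> \<in> THom G H" "y = ?res \<phi>" using bij_betw_imp_surj_on[OF bij] by blast
      then show "y \<in> ?res ` TIso G H" using iso y by blast
    qed
  qed
  then show "card (TIso G H) = (\<Prod>i<r. (nat p ^ Polynomial.degree P) ^ r - (nat p ^ Polynomial.degree P) ^ i)"
    using H.card_indep[of r] cH by (simp add: bij_betw_same_card)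
qed

section \<open>Good pairs and the connecting map\<close>

text \<open>\<open>g\<close> lists the images of the unit vectors under \<open>F\<close>. Only one inclusion of the kernel condition is
  demanded, since \<open>P\<close> and \<open>q\<close> kill \<open>G\<close> in all applications.\<close>
definition gpair :: "int \<Rightarrow> nat \<Rightarrow> int poly \<Rightarrow> ('a, 'b, 'c) tmodule_scheme \<Rightarrow> (nat \<Rightarrow> nat \<Rightarrow> int) \<Rightarrow> (nat \<Rightarrow> 'b) \<Rightarrow> bool" where
  "gpair q n P G A g \<longleftrightarrow> thom (VM 0 n A) G (Fm G n g) \<and> Fm G n g ` zvec n = carrier G \<and>
     (\<forall>v\<in>zvec n. Fm G n g v = \<zero>\<^bsub>G\<^esub> \<longrightarrow>
        (\<exists>u\<in>zvec n. \<exists>w\<in>zvec n. v = (\<lambda>i. act (VM 0 n A) P u i + q * w i)))"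

lemma VM0_carrier: "carrier (VM 0 n A) = zvec n"
  by simp

lemma VM0_act_closed: "u \<in> zvec n \<Longrightarrow> act (VM 0 n A) P u \<in> zvec n"
  using tgroup.act_closed[OF tgroup_VM, of u 0 n A P] by simp

lemma VM0_act_add: "u \<in> zvec n \<Longrightarrow> v \<in> zvec n \<Longrightarrow> act (VM 0 n A) P (\<lambda>i. u i + v i) = (\<lambda>i. act (VM 0 n A) P u i + act (VM 0 n A) P v i)"
  using tgroup.act_x_add[OF tgroup_VM, of u 0 n A v P] by simp

lemma VM0_act_scale: assumes "u \<in> zvec n" shows "act (VM 0 n A) P (\<lambda>i. k * u i) = (\<lambda>i. k * act (VM 0 n A) P u i)"
proof -
  have u: "u \<in> carrier (VM 0 n A)" using assms by simp
  have au: "act (VM 0 n A) P u \<in> carrier (VM 0 n A)" by (rule tgroup.act_closed[OF tgroup_VM u])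
  have "act (VM 0 n A) P (add_pow (VM 0 n A) k u) = add_pow (VM 0 n A) k (act (VM 0 n A) P u)"
    by (rule tgroup.act_x_zm[OF tgroup_VM u])
  then show ?thesis unfolding zm_VM[OF u] zm_VM[OF au] by simp
qed

lemma VM0_act_pCons: assumes "u \<in> zvec n"
  shows "act (VM 0 n A) (pCons a P) u = (\<lambda>i. a * u i + tact (VM 0 n A) (act (VM 0 n A) P u) i)"
proof -
  have u: "u \<in> carrier (VM 0 n A)" using assms by simp
  show ?thesis unfolding tgroup.act_pCons[OF tgroup_VM u] zm_VM[OF u] by simp
qed

lemma VM0_T_closed: "tact (VM 0 n A) v \<in> zvec n"
  by simp

lemma VM0_T_add: "tact (VM 0 n A) (\<lambda>i. u i + v i) = (\<lambda>i. tact (VM 0 n A) u i + tact (VM 0 n A) v i)"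
  by (auto simp: algebra_simps sum.distrib)

lemma VM0_T_scale: "tact (VM 0 n A) (\<lambda>i. k * v i) = (\<lambda>i. k * tact (VM 0 n A) v i)"
  by (auto simp: algebra_simps sum_distrib_left)

lemma VM_cong_mod:
  assumes "\<And>i k. \<lbrakk>i < n; k < n\<rbrakk> \<Longrightarrow> A i k mod m = B i k mod m"
  shows "VM m n A = VM m n B"
proof -
  have "(\<Sum>k<n. A i k * v k) mod m = (\<Sum>k<n. B i k * v k) mod m" if "i < n" for i v
  proof -
    have "(\<Sum>k<n. A i k * v k) mod m = (\<Sum>k<n. (A i k mod m) * v k mod m) mod m"
      by (simp add: mod_sum_eq mod_mult_left_eq)
    also have "\<dots> = (\<Sum>k<n. (B i k mod m) * v k mod m) mod m" using assms that by simp
    also have "\<dots> = (\<Sum>k<n. B i k * v k) mod m" by (simp add: mod_sum_eq mod_mult_left_eq)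
    finally show ?thesis .
  qed
  then show ?thesis unfolding VM_def by (auto simp: fun_eq_iff)
qed

section \<open>The kernel of P(A) modulo p, the p-torsion of G, and the connecting map\<close>

definition Vset :: "int \<Rightarrow> nat \<Rightarrow> int poly \<Rightarrow> (nat \<Rightarrow> nat \<Rightarrow> int) \<Rightarrow> (nat \<Rightarrow> int) set" where
  "Vset p n P A = {v \<in> carrier (VM p n A). act (VM p n A) P v = (\<lambda>_. 0)}"

definition Vmod :: "int \<Rightarrow> nat \<Rightarrow> int poly \<Rightarrow> (nat \<Rightarrow> nat \<Rightarrow> int) \<Rightarrow> (int, nat \<Rightarrow> int) tmodule" where
  "Vmod p n P A = (VM p n A)\<lparr>carrier := Vset p n P A\<rparr>"

definition Wmod :: "int \<Rightarrow> ('a, 'b, 'c) tmodule_scheme \<Rightarrow> ('a, 'b, 'c) tmodule_scheme" where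
  "Wmod p G = G\<lparr>carrier := {x \<in> carrier G. add_pow G p x = \<zero>\<^bsub>G\<^esub>}\<rparr>"

text \<open>The vector v, with entries from 0 to p - 1, is its own integral lift, and the division
  is exact because P(A) v vanishes modulo p. When F presents G as the cokernel of P(A), source and
  target are two computations of Tor_1(G, F_p), which is why bijectivity is to be expected.\<close>

definition dmap :: "int \<Rightarrow> nat \<Rightarrow> int poly \<Rightarrow> ('a, 'b, 'c) tmodule_scheme \<Rightarrow> (nat \<Rightarrow> 'b) \<Rightarrow> (nat \<Rightarrow> nat \<Rightarrow> int) \<Rightarrow> (nat \<Rightarrow> int) \<Rightarrow> 'b" where
  "dmap p n P G g A = (\<lambda>v\<in>Vset p n P A. Fm G n g (\<lambda>i. act (VM 0 n A) P v i div p))"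

lemma red_act:
  assumes "v \<in> zvec n" shows "red p (act (VM 0 n A) P v) = act (VM p n A) P (red p v)"
  using thom_maps(5)[OF tgroup_VM tgroup_VM thom_red[of p 0 n A A]] assms by simp

lemma red_zero_iff: assumes "v \<in> zvec n" shows "red p v = (\<lambda>_. 0) \<longleftrightarrow> (\<exists>w\<in>zvec n. v = (\<lambda>i. p * w i))"
proof
  assume "red p v = (\<lambda>_. 0)"
  then have "p dvd v i" for i by (simp add: red_def fun_eq_iff mod_eq_0_iff_dvd)
  then have "v = (\<lambda>i. p * (v i div p))" by (simp add: fun_eq_iff)
  then show "\<exists>w\<in>zvec n. v = (\<lambda>i. p * w i)" using assms by (intro bexI[of _ "\<lambda>i. v i div p"]) auto
qed (auto simp: red_def)

lemma red_mem_Vset_iff: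
  assumes v: "v \<in> zvec n"
  shows "red p v \<in> Vset p n P A \<longleftrightarrow> (\<exists>w\<in>zvec n. act (VM 0 n A) P v = (\<lambda>i. p * w i))"
proof -
  have "red p v \<in> carrier (VM p n A)" using red_mem[OF v] .
  then show ?thesis unfolding Vset_def mem_Collect_eq red_act[OF v, symmetric]
    using red_zero_iff[OF VM0_act_closed[OF v]] by blast
qed

lemma red_id: "v \<in> carrier (VM p n A) \<Longrightarrow> red p v = v"
  by (auto simp: red_def)

lemma VM_carrier_iff:
  assumes "m > 0" shows "v \<in> carrier (VM m n A) \<longleftrightarrow> (\<forall>i\<ge>n. v i = 0) \<and> (\<forall>i<n. v i \<in> {0..<m})"
proof -
  have "v i mod m = v i \<longleftrightarrow> v i \<in> {0..<m}" for i
    using assms by (metis atLeastLessThan_iff mod_pos_pos_trivial pos_mod_bound pos_mod_sign)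
  then have "v \<in> carrier (VM m n A) \<longleftrightarrow> (\<forall>i\<ge>n. v i = 0) \<and> (\<forall>i. v i \<in> {0..<m})" by simp
  moreover have "0 \<in> {0..<m}" using assms by simp
  ultimately show ?thesis by (metis not_le)
qed

lemma card_VM:
  assumes "m > 0" shows "finite (carrier (VM m n A))" "card (carrier (VM m n A)) = nat m ^ n"
proof -
  have b: "bij_betw (\<lambda>v. restrict v {..<n}) (carrier (VM m n A)) ({..<n} \<rightarrow>\<^sub>E {0..<m})"
  proof (rule bij_betw_byWitness[where f' = "\<lambda>f i. if i < n then f i else 0"])
    show "\<forall>v\<in>carrier (VM m n A). (\<lambda>i. if i < n then restrict v {..<n} i else 0) = v"
      by (simp add: fun_eq_iff)
    show "\<forall>f\<in>{..<n} \<rightarrow>\<^sub>E {0..<m}. restrict (\<lambda>i. if i < n then f i else 0) {..<n} = f"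
      by (simp add: fun_eq_iff PiE_iff extensional_def)
    show "(\<lambda>v. restrict v {..<n}) ` carrier (VM m n A) \<subseteq> {..<n} \<rightarrow>\<^sub>E {0..<m}"
      by (rule image_subsetI) (simp only: VM_carrier_iff[OF assms] restrict_PiE_iff lessThan_iff, blast)
    show "(\<lambda>f i. if i < n then f i else 0) ` ({..<n} \<rightarrow>\<^sub>E {0..<m}) \<subseteq> carrier (VM m n A)"
      by (rule image_subsetI) (simp only: VM_carrier_iff[OF assms] PiE_iff lessThan_iff, simp)
  qed
  have "finite ({..<n} \<rightarrow>\<^sub>E {0..<m})" by (intro finite_PiE) auto
  then show "finite (carrier (VM m n A))" using b bij_betw_finite by blast
  show "card (carrier (VM m n A)) = nat m ^ n" using bij_betw_same_card[OF b] by (simp add: card_PiE)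
qed

text \<open>One of the modules G_j at a fixed level p^N. Dividing a relation modulo p^N by p leaves
  an error in p^(N-1) Z^n; therefore p^(N-1), and not merely p^N, is assumed to kill G.\<close>

locale sgl = tgroup G for G :: "('a, 'b, 'c) tmodule_scheme" (structure) +
  fixes p :: int and n N :: nat and P :: "int poly"
  assumes fin: "finite (carrier G)" and p: "Factorial_Ring.prime p" and irr: "irr_le2 p P"
    and N: "N \<ge> 1"
    and pN1: "x \<in> carrier G \<Longrightarrow> p ^ (N - 1) \<diamondop> x = \<zero>" and P_tors: "x \<in> carrier G \<Longrightarrow> act G P x = \<zero>"
begin

lemma p_pos: "p > 0"
  using p by (simp add: prime_gt_0_int)

lemma pN: "x \<in> carrier G \<Longrightarrow> p ^ N \<diamondop> x = \<zero>"
proof -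
  assume x: "x \<in> carrier G"
  have "p ^ N = p * p ^ (N - 1)" using N by (cases N) auto
  then show ?thesis using x pN1[OF x] by (simp add: zm_mult)
qed

lemma fq_V: "fqspace (Vmod p n P A) p P"
proof -
  interpret V: tgroup "VM p n A" by (rule tgroup_VM)
  have z: "\<zero>\<^bsub>VM p n A\<^esub> = (\<lambda>_. 0)" by simp
  have S: "tgroup (Vmod p n P A)" unfolding Vmod_def
  proof (rule V.tgroup_sub)
    show "\<ominus>\<^bsub>VM p n A\<^esub> x \<in> Vset p n P A" if "x \<in> Vset p n P A" for x
      using that V.act_x_minus[of "\<zero>\<^bsub>VM p n A\<^esub>" x P] unfolding Vset_def z[symmetric] mem_Collect_eq
      by (auto simp add: a_minus_def simp del: VM_simps)
  qed (auto simp: Vset_def z[symmetric] V.act_x_add V.act_T simp del: VM_simps)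
  have sub: "Vset p n P A \<subseteq> carrier (VM p n A)" by (auto simp: Vset_def)
  note ops = V.sub_ops[OF S[unfolded Vmod_def] sub, folded Vmod_def]
  have c: "carrier (Vmod p n P A) = Vset p n P A" and z': "\<zero>\<^bsub>Vmod p n P A\<^esub> = (\<lambda>_. 0)" by (simp_all add: Vmod_def)
  show ?thesis
  proof (intro fqspace.intro fqspace_axioms.intro S p irr)
    show "finite (carrier (Vmod p n P A))" unfolding c
      by (rule finite_subset[OF sub card_VM(1)[OF p_pos]])
    fix x assume x: "x \<in> carrier (Vmod p n P A)"
    then have x': "x \<in> carrier (VM p n A)" "x \<in> Vset p n P A" using sub c by auto
    show "add_pow (Vmod p n P A) p x = \<zero>\<^bsub>Vmod p n P A\<^esub>" unfolding ops(2)[OF x'(2)] z' zm_VM[OF x'(1)] by simp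
    show "act (Vmod p n P A) P x = \<zero>\<^bsub>Vmod p n P A\<^esub>" unfolding ops(1)[OF x'(2)] z' using x'(2) by (simp add: Vset_def)
  qed
qed

lemma tg_W: "tgroup (Wmod p G)" unfolding Wmod_def
  by (rule tgroup_sub) (auto simp: zm_x_add zm_x_neg T_zm[symmetric])

lemma W_carrier: "carrier (Wmod p G) = {x \<in> carrier G. p \<diamondop> x = \<zero>}"
  by (simp add: Wmod_def)

lemma W_ops:
  assumes "x \<in> carrier (Wmod p G)"
  shows "act (Wmod p G) Q x = act G Q x" "add_pow (Wmod p G) (k::int) x = k \<diamondop> x"
  using sub_ops[OF tg_W[unfolded Wmod_def], of x] assms unfolding Wmod_def by auto

lemma W_simps: "\<zero>\<^bsub>Wmod p G\<^esub> = \<zero>" "x \<oplus>\<^bsub>Wmod p G\<^esub> y = x \<oplus> y" "tact (Wmod p G) = tact G"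
  by (simp_all add: Wmod_def)

lemma fq_W: "fqspace (Wmod p G) p P"
proof (intro fqspace.intro fqspace_axioms.intro tg_W p irr)
  show "finite (carrier (Wmod p G))" using fin by (simp add: W_carrier)
qed (auto simp: W_ops W_simps P_tors W_carrier)

text \<open>Independence of the lift: replacing v by v + p u adds P(A) u to the quotient, and F
  (P(A) u) = P(t) (F u) = 0. So the connecting map can be computed from any integral vector in the
  class.\<close>

lemma delta_red:
  assumes g: "g \<in> {..<n} \<rightarrow> carrier G" and t: "thom (VM 0 n A) G (Fm G n g)"
    and v: "v \<in> zvec n" and w: "w \<in> zvec n" and Pv: "act (VM 0 n A) P v = (\<lambda>i. p * w i)"
  shows "dmap p n P G g A (red p v) = Fm G n g w"
proof -
  let ?u = "\<lambda>i. - (v i div p)"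
  have u: "?u \<in> zvec n" "(\<lambda>i. p * ?u i) \<in> zvec n" using v by auto
  have "red p v = (\<lambda>i. v i + p * ?u i)" by (auto simp: red_def fun_eq_iff minus_mult_div_eq_mod)
  then have "act (VM 0 n A) P (red p v) = (\<lambda>i. p * (w i + act (VM 0 n A) P ?u i))"
    using VM0_act_add[OF v u(2)] VM0_act_scale[OF u(1)] Pv by (simp add: distrib_left)
  then have "(\<lambda>i. act (VM 0 n A) P (red p v) i div p) = (\<lambda>i. w i + act (VM 0 n A) P ?u i)"
    using p_pos by (simp add: fun_eq_iff)
  moreover have "red p v \<in> Vset p n P A" using red_mem_Vset_iff[OF v] w Pv by blast
  moreover have "Fm G n g (act (VM 0 n A) P ?u) = \<zero>"
    using thom_maps(5)[OF tgroup_VM tgroup_axioms t, of ?u P] u g by (simp add: P_tors)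
  ultimately show ?thesis using g by (simp add: dmap_def Fm_add)
qed

lemma Vset_rep:
  assumes "v \<in> Vset p n P A"
  obtains w where "v \<in> zvec n" "red p v = v" "w \<in> zvec n" "act (VM 0 n A) P v = (\<lambda>i. p * w i)"
proof -
  have c: "v \<in> carrier (VM p n A)" using assms by (simp add: Vset_def)
  then have v: "v \<in> zvec n" by simp
  have r: "red p v = v" by (rule red_id[OF c])
  then have "red p v \<in> Vset p n P A" using assms by simp
  then show ?thesis using red_mem_Vset_iff[OF v] v r that by blast
qed

text \<open>The value F w is p-torsion since p F w = F (P(A) v) = P(t) (F v) = 0. Compatibility with
  sums and with t is read off from convenient lifts by \<open>delta_red\<close>.\<close>

lemma dmap_THom:
  assumes g: "g \<in> {..<n} \<rightarrow> carrier G" and t: "thom (VM 0 n A) G (Fm G n g)"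
  shows "dmap p n P G g A \<in> THom (Vmod p n P A) (Wmod p G)"
proof -
  have c: "carrier (Vmod p n P A) = Vset p n P A" by (simp add: Vmod_def)
  have cl: "dmap p n P G g A v \<in> carrier (Wmod p G)" if vV: "v \<in> Vset p n P A" for v
  proof -
    obtain w where w: "v \<in> zvec n" "red p v = v" "w \<in> zvec n" "act (VM 0 n A) P v = (\<lambda>i. p * w i)"
      using Vset_rep[OF vV] .
    have d: "dmap p n P G g A v = Fm G n g w" using delta_red[OF g t w(1,3,4)] w(2) by simp
    have "p \<diamondop> Fm G n g w = Fm G n g (act (VM 0 n A) P v)" unfolding w(4) by (rule Fm_scale[OF g, symmetric])
    also have "\<dots> = \<zero>" using thom_maps(5)[OF tgroup_VM tgroup_axioms t, of v P] w g by (simp add: P_tors)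
    finally show ?thesis using g by (simp add: d W_carrier)
  qed
  have "thom (Vmod p n P A) (Wmod p G) (dmap p n P G g A)" unfolding thom_def c
  proof (intro conjI ballI)
    show "dmap p n P G g A \<in> Vset p n P A \<rightarrow> carrier (Wmod p G)" using cl by auto
    fix v assume "v \<in> Vset p n P A"
    then obtain w where w: "v \<in> zvec n" "red p v = v" "w \<in> zvec n" "act (VM 0 n A) P v = (\<lambda>i. p * w i)"
      using Vset_rep by blast
    have d: "dmap p n P G g A v = Fm G n g w" using delta_red[OF g t w(1,3,4)] w(2) by simp
    { have "tact (Vmod p n P A) v = red p (tact (VM 0 n A) v)" by (auto simp: Vmod_def red_def fun_eq_iff)
      moreover have "act (VM 0 n A) P (tact (VM 0 n A) v) = tact (VM 0 n A) (act (VM 0 n A) P v)"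
        using tgroup.act_T[OF tgroup_VM, of v 0 n A P] w by simp
      then have "act (VM 0 n A) P (tact (VM 0 n A) v) = (\<lambda>i. p * tact (VM 0 n A) w i)"
        unfolding w(4) VM0_T_scale .
      ultimately have "dmap p n P G g A (tact (Vmod p n P A) v) = Fm G n g (tact (VM 0 n A) w)"
        using delta_red[OF g t VM0_T_closed VM0_T_closed] by simp
      then show "dmap p n P G g A (tact (Vmod p n P A) v) = tact (Wmod p G) (dmap p n P G g A v)"
        using thomD(3)[OF t, of w] w by (simp add: W_simps d) }
    fix v' assume "v' \<in> Vset p n P A"
    then obtain w' where w': "v' \<in> zvec n" "red p v' = v'" "w' \<in> zvec n" "act (VM 0 n A) P v' = (\<lambda>i. p * w' i)"
      using Vset_rep by blast
    have d': "dmap p n P G g A v' = Fm G n g w'" using delta_red[OF g t w'(1,3,4)] w'(2) by simp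
    have "v \<oplus>\<^bsub>Vmod p n P A\<^esub> v' = red p (\<lambda>i. v i + v' i)" by (simp add: Vmod_def red_def)
    moreover have "act (VM 0 n A) P (\<lambda>i. v i + v' i) = (\<lambda>i. p * (w i + w' i))"
      unfolding VM0_act_add[OF w(1) w'(1)] w(4) w'(4) by (simp add: distrib_left)
    ultimately have "dmap p n P G g A (v \<oplus>\<^bsub>Vmod p n P A\<^esub> v') = Fm G n g (\<lambda>i. w i + w' i)"
      using delta_red[OF g t, of "\<lambda>i. v i + v' i" "\<lambda>i. w i + w' i"] w w' by simp
    then show "dmap p n P G g A (v \<oplus>\<^bsub>Vmod p n P A\<^esub> v') = dmap p n P G g A v \<oplus>\<^bsub>Wmod p G\<^esub> dmap p n P G g A v'"
      using g by (simp add: W_simps d d' Fm_add)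
  qed
  then show ?thesis using cl by (auto simp: THom_def c dmap_def PiE_def)
qed

text \<open>A and E need not commute, so Q(A + p E) itself has no Taylor expansion; seen through F
  it has one of first order, on an A-stable lattice L where F E is t-linear. The induction on Q is
  the product rule (t Q)' = Q + t Q'.\<close>

lemma perturb_act:
  assumes g: "g \<in> {..<n} \<rightarrow> carrier G" and t: "thom (VM 0 n A) G (Fm G n g)" and t': "thom (VM 0 n A') G (Fm G n g)"
    and A': "\<And>i k. \<lbrakk>i < n; k < n\<rbrakk> \<Longrightarrow> A' i k = A i k + p * E i k"
    and L: "L \<subseteq> zvec n" "\<And>u v. \<lbrakk>u \<in> L; v \<in> L\<rbrakk> \<Longrightarrow> (\<lambda>i. u i + v i) \<in> L" "\<And>u k. u \<in> L \<Longrightarrow> (\<lambda>i. k * u i) \<in> L"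
      "\<And>u. u \<in> L \<Longrightarrow> tact (VM 0 n A) u \<in> L"
    and LE: "\<And>u. u \<in> L \<Longrightarrow> Fm G n g (tact (VM 0 n E) (tact (VM 0 n A) u)) = tact G (Fm G n g (tact (VM 0 n E) u))"
    and v: "v \<in> L"
  shows "\<exists>R\<in>zvec n. act (VM 0 n A') Q v = (\<lambda>i. act (VM 0 n A) Q v i + p * R i) \<and>
    Fm G n g R = act G (pderiv Q) (Fm G n g (tact (VM 0 n E) v))"
proof -
  let ?F = "Fm G n g" and ?E = "tact (VM 0 n E)" and ?A = "tact (VM 0 n A)"
  have T': "tact (VM 0 n A') u = (\<lambda>i. ?A u i + p * ?E u i)" for u
  proof
    fix i
    have "(\<Sum>k<n. A' i k * u k) = (\<Sum>k<n. A i k * u k + p * (E i k * u k))" if i: "i < n"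
    proof (rule sum.cong[OF refl])
      fix k assume "k \<in> {..<n}"
      then have "A' i k = A i k + p * E i k" using A'[OF i] by simp
      then show "A' i k * u k = A i k * u k + p * (E i k * u k)" by (simp only: distrib_right mult.assoc)
    qed
    then have "(\<Sum>k<n. A' i k * u k) = (\<Sum>k<n. A i k * u k) + p * (\<Sum>k<n. E i k * u k)" if "i < n"
      using that by (simp only: sum.distrib sum_distrib_left)
    then show "tact (VM 0 n A') u i = ?A u i + p * ?E u i"
      unfolding VM_simps by (cases "i < n") simp_all
  qed
  \<comment> \<open>On L the map F E intertwines Q(A) with Q(t), by Horner recursion from the case
    of t.\<close>
  have QL: "act (VM 0 n A) Q u \<in> L \<and> ?F (?E (act (VM 0 n A) Q u)) = act G Q (?F (?E u))" if u: "u \<in> L" for Q u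
  proof (induction Q)
    case 0
    have "(\<lambda>i. 0 * u i) \<in> L" by (rule L(3)[OF u])
    moreover have "act (VM 0 n A) 0 u = (\<lambda>_. 0)" using tgroup.act_0[OF tgroup_VM, of 0 n A u] by simp
    moreover have "?E (\<lambda>_. 0) = (\<lambda>_. 0)" by auto
    ultimately show ?case by simp
  next
    case (pCons a Q)
    have uz: "u \<in> zvec n" using u L(1) by blast
    let ?y = "act (VM 0 n A) Q u"
    have y: "?y \<in> L" "?F (?E ?y) = act G Q (?F (?E u))" using pCons by auto
    have e: "act (VM 0 n A) (pCons a Q) u = (\<lambda>i. a * u i + ?A ?y i)" by (rule VM0_act_pCons[OF uz])
    have "?F (?E (act (VM 0 n A) (pCons a Q) u)) = a \<diamondop> ?F (?E u) \<oplus> ?F (?E (?A ?y))"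
      unfolding e VM0_T_add VM0_T_scale Fm_add[OF g] Fm_scale[OF g] ..
    also have "\<dots> = act G (pCons a Q) (?F (?E u))" using LE[OF y(1)] y(2) g by (simp add: act_pCons)
    finally show ?case unfolding e using L(2)[OF L(3)[OF u] L(4)[OF y(1)]] by simp
  qed
  have vz: "v \<in> zvec n" using v L(1) by blast
  show ?thesis
  proof (induction Q)
    case 0
    have "act (VM 0 n B) 0 v = (\<lambda>_. 0)" for B using tgroup.act_0[OF tgroup_VM, of 0 n B v] by simp
    then show ?case by (intro bexI[of _ "\<lambda>_. 0"]) auto
  next
    case (pCons a Q)
    then obtain R where R: "R \<in> zvec n" "act (VM 0 n A') Q v = (\<lambda>i. act (VM 0 n A) Q v i + p * R i)"
      "?F R = act G (pderiv Q) (?F (?E v))" by blast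
    let ?y = "act (VM 0 n A) Q v"
    \<comment> \<open>The old error is propagated by \<open>A'\<close> instead of \<open>A\<close>.
      This makes the identity exact, without separate terms of higher order, and F A' = t F turns
      the second summand into t Q'(t) F E v.\<close>
    let ?R = "\<lambda>i. ?E ?y i + tact (VM 0 n A') R i"
    have "act (VM 0 n A') (pCons a Q) v = (\<lambda>i. a * v i + tact (VM 0 n A') (\<lambda>i. ?y i + p * R i) i)"
      unfolding VM0_act_pCons[OF vz] R(2) ..
    also have "\<dots> = (\<lambda>i. act (VM 0 n A) (pCons a Q) v i + p * ?R i)"
      unfolding VM0_T_add VM0_T_scale VM0_act_pCons[OF vz] T'[of ?y] by (simp add: algebra_simps)
    finally have 1: "act (VM 0 n A') (pCons a Q) v = (\<lambda>i. act (VM 0 n A) (pCons a Q) v i + p * ?R i)" .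
    have "?F ?R = ?F (?E ?y) \<oplus> ?F (tact (VM 0 n A') R)" by (rule Fm_add[OF g])
    also have "\<dots> = act G Q (?F (?E v)) \<oplus> tact G (act G (pderiv Q) (?F (?E v)))"
      using QL[OF v] thomD(3)[OF t', of R] R by simp
    also have "\<dots> = act G (pderiv (pCons a Q)) (?F (?E v))"
      using g by (simp add: pderiv_pCons act_add act_pCons)
    finally have 2: "?F ?R = act G (pderiv (pCons a Q)) (?F (?E v))" .
    have 3: "?R \<in> zvec n" by simp
    show ?case by (intro bexI[of _ ?R] conjI) (rule 1 2 3)+
  qed
qed

end

section \<open>Equidistribution of the connecting map\<close>

lemma VM0_T_uv: "i < n \<Longrightarrow> tact (VM 0 n A) (uv i) = (\<lambda>k. if k < n then A k i else 0)"
  by (auto simp: uv_def fun_eq_iff if_distrib[of "\<lambda>x. _ * x"] sum.delta cong: if_cong)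

lemma uv_zvec: "i < n \<Longrightarrow> uv i \<in> zvec n"
  by (auto simp: uv_def)

lemma red_add: "red m (\<lambda>i. u i + v i) = (\<lambda>i. (red m u i + red m v i) mod m)"
  by (simp add: red_def mod_simps)

context sgl
begin

text \<open>Transitivity behind the equidistribution. Only the values y of F E on the unit vectors
  are produced, and they depend on c and c' but not on the lift A. A matrix E that realizes them for
  all j at once is found by \<open>columns_exist\<close>, and it serves the whole fibre over
  c.\<close>

lemma perturb_exists:
  assumes g: "g \<in> {..<n} \<rightarrow> carrier G"
    and c: "c \<in> THom (Vmod p n P Ab) (Wmod p G)" and c': "c' \<in> THom (Vmod p n P Ab) (Wmod p G)"
  shows "\<exists>y\<in>{..<n} \<rightarrow> carrier (Wmod p G). \<forall>A E A'.
    (\<forall>i<n. \<forall>k<n. A i k mod p = Ab i k mod p) \<and> thom (VM 0 n A) G (Fm G n g) \<and> dmap p n P G g A = c \<and>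
    (\<forall>i<n. Fm G n g (\<lambda>k. if k < n then E k i else 0) = y i) \<and> (\<forall>i<n. \<forall>k<n. A' i k = A i k + p * E i k) \<longrightarrow>
    thom (VM 0 n A') G (Fm G n g) \<and> dmap p n P G g A' = c'"
proof -
  interpret W: fqspace "Wmod p G" p P by (rule fq_W)
  interpret V: fqspace "Vmod p n P Ab" p P by (rule fq_V)
  interpret U: tgroup "VM p n Ab" by (rule tgroup_VM)
  have Vc: "carrier (Vmod p n P Ab) = Vset p n P Ab" by (simp add: Vmod_def)
  have Vo: "x \<oplus>\<^bsub>Vmod p n P Ab\<^esub> y = x \<oplus>\<^bsub>VM p n Ab\<^esub> y" "tact (Vmod p n P Ab) = tact (VM p n Ab)"
    "\<zero>\<^bsub>Vmod p n P Ab\<^esub> = \<zero>\<^bsub>VM p n Ab\<^esub>" for x y by (simp_all add: Vmod_def)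
  have t: "thom (Vmod p n P Ab) (Wmod p G) c" "thom (Vmod p n P Ab) (Wmod p G) c'"
    using c c' by (auto simp: THom_def)
  note ct = thomD[OF t(1), unfolded Vc] thomD[OF t(2), unfolded Vc]
  obtain D where D: "\<And>x. x \<in> carrier (Wmod p G) \<Longrightarrow> act (Wmod p G) D (act (Wmod p G) (pderiv P) x) = x"
    using W.act_comax[OF comax_pderiv[OF p irr]] by blast
  have D': "act (Wmod p G) (pderiv P) (act (Wmod p G) D x) = x" if "x \<in> carrier (Wmod p G)" for x
    using D[OF that] W.act_mult[OF that] by (metis mult.commute)
  \<comment> \<open>Adding p E changes the connecting map by P'(t) F E, so F E has to be
    \<open>D\<close> applied to c' - c, where \<open>D\<close> inverts P' on G[p].\<close>
  define h where "h v = act (Wmod p G) D (c' v \<ominus>\<^bsub>Wmod p G\<^esub> c v)" for v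
  have hc: "h v \<in> carrier (Wmod p G)" if "v \<in> Vset p n P Ab" for v
    unfolding h_def using ct that by (intro W.act_closed W.minus_closed)
  have ha: "h (x \<oplus>\<^bsub>VM p n Ab\<^esub> y) = h x \<oplus>\<^bsub>Wmod p G\<^esub> h y" if "x \<in> Vset p n P Ab" "y \<in> Vset p n P Ab" for x y
  proof -
    have cc: "c x \<in> carrier (Wmod p G)" "c y \<in> carrier (Wmod p G)" "c' x \<in> carrier (Wmod p G)" "c' y \<in> carrier (Wmod p G)"
      using ct that by auto
    have "c' (x \<oplus>\<^bsub>VM p n Ab\<^esub> y) \<ominus>\<^bsub>Wmod p G\<^esub> c (x \<oplus>\<^bsub>VM p n Ab\<^esub> y) =
       (c' x \<ominus>\<^bsub>Wmod p G\<^esub> c x) \<oplus>\<^bsub>Wmod p G\<^esub> (c' y \<ominus>\<^bsub>Wmod p G\<^esub> c y)"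
      using cc ct(2)[OF that] ct(5)[OF that] unfolding Vo
      by (simp add: a_minus_def W.minus_add W.a_ac)
    then show ?thesis unfolding h_def using cc by (simp add: W.act_x_add)
  qed
  have hT: "h (tact (VM p n Ab) x) = tact G (h x)" if "x \<in> Vset p n P Ab" for x
  proof -
    have cc: "c x \<in> carrier (Wmod p G)" "c' x \<in> carrier (Wmod p G)" using ct that by auto
    have "c' (tact (VM p n Ab) x) \<ominus>\<^bsub>Wmod p G\<^esub> c (tact (VM p n Ab) x) = tact (Wmod p G) (c' x \<ominus>\<^bsub>Wmod p G\<^esub> c x)"
      using ct(3)[OF that] ct(6)[OF that] cc additive_zero(4)[OF W.abelian_group_axioms W.abelian_group_axioms, of "tact (Wmod p G)"]
      unfolding Vo by (simp add: W.T_add)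
    then have "h (tact (VM p n Ab) x) = act (Wmod p G) D (tact (Wmod p G) (c' x \<ominus>\<^bsub>Wmod p G\<^esub> c x))"
      unfolding h_def by (simp only:)
    also have "\<dots> = tact (Wmod p G) (h x)" unfolding h_def using cc by (intro W.act_T W.minus_closed)
    finally show ?thesis unfolding W_simps(3) .
  qed
  \<comment> \<open>The extension from the kernel to (Z/p)^n is merely additive. The Taylor formula
    asks for t-linearity only on the kernel, where \<open>hT\<close> provides it.\<close>
  have "\<exists>e. e \<in> carrier (VM p n Ab) \<rightarrow> carrier (Wmod p G) \<and> (\<forall>v\<in>Vset p n P Ab. e v = h v) \<and>
    (\<forall>x\<in>carrier (VM p n Ab). \<forall>y\<in>carrier (VM p n Ab). e (x \<oplus>\<^bsub>VM p n Ab\<^esub> y) = e x \<oplus>\<^bsub>Wmod p G\<^esub> e y)"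
  proof (rule additive_extension[OF U.abelian_group_axioms W.abelian_group_axioms card_VM(1)[OF p_pos] p])
    show "add_pow (VM p n Ab) p x = \<zero>\<^bsub>VM p n Ab\<^esub>" if "x \<in> carrier (VM p n Ab)" for x
      unfolding zm_VM[OF that] by simp
    show "h \<in> Vset p n P Ab \<rightarrow> carrier (Wmod p G)" using hc by auto
    show "Vset p n P Ab \<subseteq> carrier (VM p n Ab)" by (auto simp: Vset_def)
    show "\<zero>\<^bsub>VM p n Ab\<^esub> \<in> Vset p n P Ab" using V.zero_closed unfolding Vc Vo .
    show "x \<oplus>\<^bsub>VM p n Ab\<^esub> y \<in> Vset p n P Ab" if "x \<in> Vset p n P Ab" "y \<in> Vset p n P Ab" for x y
      using V.a_closed[of x y] that unfolding Vc Vo by blast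
    show "\<ominus>\<^bsub>VM p n Ab\<^esub> x \<in> Vset p n P Ab" if "x \<in> Vset p n P Ab" for x
    proof -
      have xc: "x \<in> carrier (VM p n Ab)" using that by (simp add: Vset_def)
      have "\<ominus>\<^bsub>Vmod p n P Ab\<^esub> x \<in> Vset p n P Ab" using V.a_inv_closed[of x] that unfolding Vc by blast
      moreover have "\<ominus>\<^bsub>Vmod p n P Ab\<^esub> x = \<ominus>\<^bsub>VM p n Ab\<^esub> x"
      proof (rule sym, rule U.minus_equality)
        show "\<ominus>\<^bsub>Vmod p n P Ab\<^esub> x \<oplus>\<^bsub>VM p n Ab\<^esub> x = \<zero>\<^bsub>VM p n Ab\<^esub>"
          using V.l_neg[of x] that unfolding Vc Vo by blast
        show "\<ominus>\<^bsub>Vmod p n P Ab\<^esub> x \<in> carrier (VM p n Ab)" using calculation by (simp add: Vset_def)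
      qed (rule xc)
      ultimately show ?thesis by simp
    qed
  qed (rule ha)
  then obtain e where E: "e \<in> carrier (VM p n Ab) \<rightarrow> carrier (Wmod p G)" "\<forall>v\<in>Vset p n P Ab. e v = h v"
    "\<forall>x\<in>carrier (VM p n Ab). \<forall>y\<in>carrier (VM p n Ab). e (x \<oplus>\<^bsub>VM p n Ab\<^esub> y) = e x \<oplus>\<^bsub>Wmod p G\<^esub> e y"
    by (elim exE conjE)
  have ec: "\<And>v. v \<in> carrier (VM p n Ab) \<Longrightarrow> e v \<in> carrier (Wmod p G)"
    and eh: "\<And>v. v \<in> Vset p n P Ab \<Longrightarrow> e v = h v"
    and ea: "\<And>x y. \<lbrakk>x \<in> carrier (VM p n Ab); y \<in> carrier (VM p n Ab)\<rbrakk> \<Longrightarrow> e (x \<oplus>\<^bsub>VM p n Ab\<^esub> y) = e x \<oplus>\<^bsub>Wmod p G\<^esub> e y"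
    using E by blast+
  define y where "y i = e (red p (uv i))" for i
  have rc: "red p v \<in> carrier (VM p n Ab)" if "v \<in> zvec n" for v by (rule red_mem[OF that])
  have yc: "y i \<in> carrier (Wmod p G)" if "i < n" for i
    unfolding y_def using uv_zvec[OF that] rc ec by blast
  have WG: "x \<in> carrier G" if "x \<in> carrier (Wmod p G)" for x using that by (simp add: W_carrier)
  show ?thesis
  proof (intro bexI[of _ y] allI impI)
    show "y \<in> {..<n} \<rightarrow> carrier (Wmod p G)" using yc by auto
    fix A E A' assume as: "(\<forall>i<n. \<forall>k<n. A i k mod p = Ab i k mod p) \<and> thom (VM 0 n A) G (Fm G n g) \<and> dmap p n P G g A = c \<and>
      (\<forall>i<n. Fm G n g (\<lambda>k. if k < n then E k i else 0) = y i) \<and> (\<forall>i<n. \<forall>k<n. A' i k = A i k + p * E i k)"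
    then have AAb: "\<And>i k. \<lbrakk>i < n; k < n\<rbrakk> \<Longrightarrow> A i k mod p = Ab i k mod p" and tA: "thom (VM 0 n A) G (Fm G n g)"
      and dA: "dmap p n P G g A = c" and Ey: "\<And>i. i < n \<Longrightarrow> Fm G n g (\<lambda>k. if k < n then E k i else 0) = y i"
      and A': "\<And>i k. \<lbrakk>i < n; k < n\<rbrakk> \<Longrightarrow> A' i k = A i k + p * E i k" by blast+
    have VA: "VM p n A = VM p n Ab" by (rule VM_cong_mod[OF AAb])
    have VA': "VM p n A' = VM p n Ab" using A' AAb by (intro VM_cong_mod) simp
    have VsA: "Vset p n P A = Vset p n P Ab" "Vset p n P A' = Vset p n P Ab" unfolding Vset_def VA VA' by simp_all
    \<comment> \<open>The values \<open>y i\<close> are p-torsion, so the columns of p E contribute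
      nothing and F A' = t F persists.\<close>
    have tA': "thom (VM 0 n A') G (Fm G n g)"
    proof (rule Fm_thom[OF g])
      fix i assume i: "i < n"
      have "Fm G n g (\<lambda>k. if k < n then A' k i else 0) =
        Fm G n g (\<lambda>k. (if k < n then A k i else 0) + p * (if k < n then E k i else 0))"
        using g i by (intro Fm_cong) (auto simp: A')
      also have "\<dots> = Fm G n g (tact (VM 0 n A) (uv i)) \<oplus> p \<diamondop> y i"
        unfolding Fm_add[OF g] Fm_scale[OF g] Ey[OF i] VM0_T_uv[OF i] ..
      also have "\<dots> = tact G (g i)"
        using thomD(3)[OF tA, of "uv i"] uv_zvec[OF i] Fm_uv[OF g i] yc[OF i] g i by (simp add: W_carrier Pi_iff)
      finally show "Fm G n g (\<lambda>k. if k < n then A' k i else 0) = tact G (g i)" .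
    qed
    have FE: "Fm G n g (tact (VM 0 n E) v) = e (red p v)" if v: "v \<in> zvec n" for v
    proof (rule additive_eqI[OF abelian_group_axioms, of "\<lambda>v. Fm G n g (tact (VM 0 n E) v)" n "\<lambda>v. e (red p v)", OF _ _ _ _ _ v])
      show "(\<lambda>v. Fm G n g (tact (VM 0 n E) v)) \<in> zvec n \<rightarrow> carrier G" using g by auto
      show "(\<lambda>v. e (red p v)) \<in> zvec n \<rightarrow> carrier G" using rc ec WG by blast
      show "Fm G n g (tact (VM 0 n E) (\<lambda>i. v i + w i)) = Fm G n g (tact (VM 0 n E) v) \<oplus> Fm G n g (tact (VM 0 n E) w)" for v w
        unfolding VM0_T_add Fm_add[OF g] ..
      show "e (red p (\<lambda>i. v i + w i)) = e (red p v) \<oplus> e (red p w)" if "v \<in> zvec n" "w \<in> zvec n" for v w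
        using ea[OF rc[OF that(1)] rc[OF that(2)]] unfolding W_simps red_add VM_simps .
      show "Fm G n g (tact (VM 0 n E) (uv i)) = e (red p (uv i))" if "i < n" for i
        using Ey[OF that] unfolding VM0_T_uv[OF that] y_def .
    qed
    \<comment> \<open>The preimage in Z^n of the kernel modulo p; there F E agrees with the t-linear
      map \<open>h\<close> of the reduction.\<close>
    define L where "L = {v \<in> zvec n. red p v \<in> Vset p n P Ab}"
    have L_iff: "v \<in> L \<longleftrightarrow> v \<in> zvec n \<and> (\<exists>w\<in>zvec n. act (VM 0 n A) P v = (\<lambda>i. p * w i))" for v
      unfolding L_def VsA(1)[symmetric] mem_Collect_eq[of v "\<lambda>v. v \<in> zvec n \<and> _ v"]
      using red_mem_Vset_iff[of v n p P A] by argo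
    have pert: "\<exists>R\<in>zvec n. act (VM 0 n A') P v = (\<lambda>i. act (VM 0 n A) P v i + p * R i) \<and>
      Fm G n g R = act G (pderiv P) (Fm G n g (tact (VM 0 n E) v))" if "v \<in> L" for v
    proof (rule perturb_act[OF g tA tA' A' _ _ _ _ _ that])
      show "L \<subseteq> zvec n" by (auto simp: L_def)
      show "(\<lambda>i. u i + v i) \<in> L" if uv: "u \<in> L" "v \<in> L" for u v
      proof -
        obtain w w' where w: "w \<in> zvec n" "act (VM 0 n A) P u = (\<lambda>i. p * w i)" "w' \<in> zvec n" "act (VM 0 n A) P v = (\<lambda>i. p * w' i)"
          using uv unfolding L_iff by (elim conjE bexE)
        have z: "u \<in> zvec n" "v \<in> zvec n" by (rule uv(1)[unfolded L_iff, THEN conjunct1], rule uv(2)[unfolded L_iff, THEN conjunct1])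
        have "act (VM 0 n A) P (\<lambda>i. u i + v i) = (\<lambda>i. p * (w i + w' i))"
          unfolding VM0_act_add[OF z] w(2,4) by (simp add: distrib_left)
        then show ?thesis unfolding L_iff using w(1,3) z by (intro conjI bexI[of _ "\<lambda>i. w i + w' i"]) auto
      qed
      show "(\<lambda>i. k * u i) \<in> L" if u: "u \<in> L" for u k
      proof -
        obtain w where w: "w \<in> zvec n" "act (VM 0 n A) P u = (\<lambda>i. p * w i)" using u unfolding L_iff by (elim conjE bexE)
        have z: "u \<in> zvec n" by (rule u[unfolded L_iff, THEN conjunct1])
        have "act (VM 0 n A) P (\<lambda>i. k * u i) = (\<lambda>i. p * (k * w i))"
          unfolding VM0_act_scale[OF z] w(2) by (simp add: mult.left_commute)
        then show ?thesis unfolding L_iff using w(1) z by (intro conjI bexI[of _ "\<lambda>i. k * w i"]) auto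
      qed
      show "tact (VM 0 n A) u \<in> L" if u: "u \<in> L" for u
      proof -
        obtain w where w: "w \<in> zvec n" "act (VM 0 n A) P u = (\<lambda>i. p * w i)" using u unfolding L_iff by (elim conjE bexE)
        have z: "u \<in> carrier (VM 0 n A)" unfolding VM0_carrier by (rule u[unfolded L_iff, THEN conjunct1])
        have "act (VM 0 n A) P (tact (VM 0 n A) u) = (\<lambda>i. p * tact (VM 0 n A) w i)"
          unfolding tgroup.act_T[OF tgroup_VM z] w(2) VM0_T_scale ..
        then show ?thesis unfolding L_iff by (intro conjI bexI[of _ "tact (VM 0 n A) w"] VM0_T_closed)
      qed
      show "Fm G n g (tact (VM 0 n E) (tact (VM 0 n A) u)) = tact G (Fm G n g (tact (VM 0 n E) u))" if u: "u \<in> L" for u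
      proof -
        have z: "u \<in> zvec n" "red p u \<in> Vset p n P Ab" using u by (auto simp: L_def)
        have r: "red p (tact (VM 0 n A) u) = tact (VM p n Ab) (red p u)"
          using thomD(3)[OF thom_red[of p 0 n A A], of u] z unfolding VA by simp
        have TV: "tact (VM p n Ab) (red p u) \<in> Vset p n P Ab"
          using V.T_closed[of "red p u"] z unfolding Vc Vo by blast
        show ?thesis unfolding FE[OF VM0_T_closed] FE[OF z(1)] r eh[OF TV] eh[OF z(2)] by (rule hT[OF z(2)])
      qed
    qed
    have "dmap p n P G g A' = c'"
    proof
      fix v
      show "dmap p n P G g A' v = c' v"
      proof (cases "v \<in> Vset p n P Ab")
        case False
        then have "c' v = undefined" using c' by (auto simp: THom_def PiE_def extensional_def Vc)
        then show ?thesis using False by (simp add: dmap_def VsA)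
      next
        case True
        then have "v \<in> Vset p n P A" by (simp add: VsA)
        then obtain w where w: "v \<in> zvec n" "red p v = v" "w \<in> zvec n" "act (VM 0 n A) P v = (\<lambda>i. p * w i)"
          using Vset_rep by blast
        have vL: "v \<in> L" using w True by (auto simp: L_def)
        obtain R where R: "R \<in> zvec n" "act (VM 0 n A') P v = (\<lambda>i. act (VM 0 n A) P v i + p * R i)"
          "Fm G n g R = act G (pderiv P) (Fm G n g (tact (VM 0 n E) v))" using pert[OF vL] by (elim bexE conjE)
        have cc: "c v \<in> carrier (Wmod p G)" "c' v \<in> carrier (Wmod p G)" using ct True by auto
        have "Fm G n g R = act G (pderiv P) (h v)" unfolding R(3) FE[OF w(1)] w(2) eh[OF True] ..
        also have "\<dots> = act (Wmod p G) (pderiv P) (h v)" using W_ops(1)[OF hc[OF True]] by simp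
        also have "\<dots> = c' v \<ominus>\<^bsub>Wmod p G\<^esub> c v" unfolding h_def using cc by (intro D') blast
        finally have FR: "Fm G n g R = c' v \<ominus>\<^bsub>Wmod p G\<^esub> c v" .
        have Fw: "Fm G n g w = c v" using delta_red[OF g tA w(1,3,4)] unfolding dA w(2) by simp
        have "act (VM 0 n A') P v = (\<lambda>i. p * (w i + R i))" unfolding R(2) w(4) by (simp add: distrib_left)
        then have "dmap p n P G g A' (red p v) = Fm G n g (\<lambda>i. w i + R i)"
          using w R by (intro delta_red[OF g tA']) auto
        also have "\<dots> = c v \<oplus>\<^bsub>Wmod p G\<^esub> (c' v \<ominus>\<^bsub>Wmod p G\<^esub> c v)"
          unfolding Fm_add[OF g] Fw FR W_simps ..
        also have "\<dots> = c' v" using cc by (rule W.add_minus_cancel_left[rotated])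
        finally show ?thesis unfolding w(2) .
      qed
    qed
    with tA' show "thom (VM 0 n A') G (Fm G n g) \<and> dmap p n P G g A' = c'" by blast
  qed
qed

end

text \<open>The quotient G/pG enters through a surjection \<kappa> with kernel pG, so that the
  counting does not depend on how \<open>mod_p\<close> encodes cosets.\<close>

locale sglq = sgl G p n N P for G :: "('a, 'b, 'c) tmodule_scheme" (structure) and p n N P +
  fixes Gb :: "('d, 'e, 'f) tmodule_scheme" and \<kappa> :: "'b \<Rightarrow> 'e"
  assumes tg_Gb: "tgroup Gb" and \<kappa>: "thom G Gb \<kappa>" and \<kappa>_surj: "\<kappa> ` carrier G = carrier Gb"
    and \<kappa>_ker: "x \<in> carrier G \<Longrightarrow> \<kappa> x = \<zero>\<^bsub>Gb\<^esub> \<longleftrightarrow> (\<exists>y\<in>carrier G. x = p \<diamondop> y)"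
begin

lemma Gb_p: "x \<in> carrier Gb \<Longrightarrow> add_pow Gb p x = \<zero>\<^bsub>Gb\<^esub>"
proof -
  assume "x \<in> carrier Gb"
  then obtain y where y: "y \<in> carrier G" "x = \<kappa> y" using \<kappa>_surj by blast
  then have "add_pow Gb p x = \<kappa> (p \<diamondop> y)" using thom_maps(3)[OF tgroup_axioms tg_Gb \<kappa>] by simp
  then show ?thesis using \<kappa>_ker[of "p \<diamondop> y"] y by auto
qed

lemma fq_Gb: "fqspace Gb p P"
proof (intro fqspace.intro fqspace_axioms.intro tg_Gb p irr Gb_p)
  show "finite (carrier Gb)" using fin \<kappa>_surj by (metis finite_imageI)
  fix x assume "x \<in> carrier Gb"
  then obtain y where y: "y \<in> carrier G" "x = \<kappa> y" using \<kappa>_surj by blast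
  then show "act Gb P x = \<zero>\<^bsub>Gb\<^esub>"
    using thom_maps(5)[OF tgroup_axioms tg_Gb \<kappa> y(1), of P] thom_maps(1)[OF tgroup_axioms tg_Gb \<kappa>] P_tors by simp
qed

lemma Fm_Gb:
  assumes g: "g \<in> {..<n} \<rightarrow> carrier G" and gb: "\<And>i. i < n \<Longrightarrow> gb i = \<kappa> (g i)" and v: "v \<in> zvec n"
  shows "Fm Gb n gb v = \<kappa> (Fm G n g v)"
proof -
  interpret B: tgroup Gb by (rule tg_Gb)
  show ?thesis
  proof (rule B.Fm_unique[of "\<lambda>v. \<kappa> (Fm G n g v)", OF _ _ _ v])
    show "(\<lambda>v. \<kappa> (Fm G n g v)) \<in> zvec n \<rightarrow> carrier Gb" using g thomD(1)[OF \<kappa>] by auto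
    show "\<kappa> (Fm G n g (\<lambda>i. v i + w i)) = \<kappa> (Fm G n g v) \<oplus>\<^bsub>Gb\<^esub> \<kappa> (Fm G n g w)" for v w
      using g thomD(2)[OF \<kappa>] by (simp add: Fm_add)
    show "gb i = \<kappa> (Fm G n g (uv i))" if "i < n" for i using Fm_uv[OF g that] gb[OF that] by simp
  qed
qed

text \<open>G[p] and pG are the kernel and the image of multiplication by p, while pG and G/pG are
  the kernel and the image of \<kappa>. Comparing the two factorizations of |G| gives the
  claim.\<close>

lemma card_W: "card (carrier (Wmod p G)) = card (carrier Gb)"
proof -
  interpret B: tgroup Gb by (rule tg_Gb)
  let ?k = "card {x \<in> carrier G. \<kappa> x = \<zero>\<^bsub>Gb\<^esub>}"
  have "?k * card (\<kappa> ` carrier G) = card (carrier G)"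
    by (rule card_kernel_image[OF abelian_group_axioms B.abelian_group_axioms fin])
      (simp_all add: thomD[OF \<kappa>] Pi_iff)
  then have 1: "?k * card (carrier Gb) = card (carrier G)" unfolding \<kappa>_surj .
  have "{x \<in> carrier G. \<kappa> x = \<zero>\<^bsub>Gb\<^esub>} = (\<lambda>x. p \<diamondop> x) ` carrier G"
  proof (intro subset_antisym subsetI)
    fix x assume "x \<in> {x \<in> carrier G. \<kappa> x = \<zero>\<^bsub>Gb\<^esub>}"
    then have "\<exists>y\<in>carrier G. x = p \<diamondop> y" using \<kappa>_ker[of x] by blast
    then show "x \<in> (\<lambda>x. p \<diamondop> x) ` carrier G" by blast
  next
    fix x assume "x \<in> (\<lambda>x. p \<diamondop> x) ` carrier G"
    then have "x \<in> carrier G" "\<exists>y\<in>carrier G. x = p \<diamondop> y" by blast+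
    then show "x \<in> {x \<in> carrier G. \<kappa> x = \<zero>\<^bsub>Gb\<^esub>}" using \<kappa>_ker by simp
  qed
  moreover have "card {x \<in> carrier G. p \<diamondop> x = \<zero>} * card ((\<lambda>x. p \<diamondop> x) ` carrier G) = card (carrier G)"
    by (rule card_kernel_image[OF abelian_group_axioms abelian_group_axioms fin])
      (simp_all add: zm_x_add Pi_iff)
  ultimately have 2: "card (carrier (Wmod p G)) * ?k = card (carrier G)" by (simp add: W_carrier)
  have "\<kappa> \<zero> = \<zero>\<^bsub>Gb\<^esub>" by (rule thom_maps(1)[OF tgroup_axioms tg_Gb \<kappa>])
  then have "\<zero> \<in> {x \<in> carrier G. \<kappa> x = \<zero>\<^bsub>Gb\<^esub>}" by simp
  then have "?k > 0" using fin by (intro card_gt_0_iff[THEN iffD2] conjI) (blast, simp)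
  moreover have "?k * card (carrier (Wmod p G)) = ?k * card (carrier Gb)" using 1 2 by (simp add: mult.commute)
  ultimately show ?thesis by simp
qed

text \<open>An endomorphism of the finite group (Z/p)^n has a kernel as large as its cokernel, and
  the good pair identifies the cokernel of P(\<open>Ab\<close>) with G/pG.\<close>

lemma card_V:
  assumes gp: "gpair p n P Gb Ab gb" and gb: "gb \<in> {..<n} \<rightarrow> carrier Gb"
  shows "card (Vset p n P Ab) = card (carrier Gb)"
proof -
  interpret B: tgroup Gb by (rule tg_Gb)
  interpret U: tgroup "VM p n Ab" by (rule tgroup_VM)
  let ?F = "Fm Gb n gb" and ?U = "VM p n Ab"
  have fU: "finite (carrier ?U)" by (rule card_VM(1)[OF p_pos])
  have Fred: "?F (red p v) = ?F v" for v
    by (rule B.Fm_eq_mod[OF gb Gb_p]) (simp_all add: red_def)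
  have FP: "?F (act (VM 0 n Ab) P u) = \<zero>\<^bsub>Gb\<^esub>" if "u \<in> zvec n" for u
    using gp thom_maps(5)[OF tgroup_VM tg_Gb, of 0 n Ab ?F u P] fqspace.P_tors[OF fq_Gb] that gb
    by (simp add: gpair_def)
  have 1: "card {x \<in> carrier ?U. act ?U P x = \<zero>\<^bsub>?U\<^esub>} * card (act ?U P ` carrier ?U) = card (carrier ?U)"
    by (rule card_kernel_image[OF U.abelian_group_axioms U.abelian_group_axioms fU]) (auto simp: U.act_x_add simp del: VM_simps)
  have Fa: "?F (x \<oplus>\<^bsub>?U\<^esub> y) = ?F x \<oplus>\<^bsub>Gb\<^esub> ?F y" for x y
    using Fred[of "\<lambda>i. x i + y i"] B.Fm_add[OF gb, of x y] by (simp add: red_def)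
  have 2: "card {x \<in> carrier ?U. ?F x = \<zero>\<^bsub>Gb\<^esub>} * card (?F ` carrier ?U) = card (carrier ?U)"
    using gb Fa by (intro card_kernel_image[OF U.abelian_group_axioms B.abelian_group_axioms fU]) auto
  have im: "?F ` carrier ?U = carrier Gb"
  proof (intro subset_antisym subsetI)
    fix x assume "x \<in> carrier Gb"
    then obtain v where v: "v \<in> zvec n" "x = ?F v" using gp unfolding gpair_def by blast
    then have "x = ?F (red p v)" using Fred by simp
    then show "x \<in> ?F ` carrier ?U" using red_mem[OF v(1)] by blast
  qed (use gb in auto)
  have "act ?U P ` carrier ?U = {x \<in> carrier ?U. ?F x = \<zero>\<^bsub>Gb\<^esub>}"
  proof (intro subset_antisym subsetI)
    fix x assume "x \<in> act ?U P ` carrier ?U"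
    then obtain u where u: "u \<in> carrier ?U" "x = act ?U P u" by blast
    then have uz: "u \<in> zvec n" by simp
    have "x = red p (act (VM 0 n Ab) P u)" using red_act[OF uz] red_id[OF u(1)] u(2) by simp
    then have "?F x = \<zero>\<^bsub>Gb\<^esub>" using Fred FP[OF uz] by simp
    moreover have "x \<in> carrier ?U" using u U.act_closed by blast
    ultimately show "x \<in> {x \<in> carrier ?U. ?F x = \<zero>\<^bsub>Gb\<^esub>}" by blast
  next
    fix x assume x: "x \<in> {x \<in> carrier ?U. ?F x = \<zero>\<^bsub>Gb\<^esub>}"
    then have "x \<in> zvec n" "?F x = \<zero>\<^bsub>Gb\<^esub>" by auto
    then have "\<exists>u\<in>zvec n. \<exists>w\<in>zvec n. x = (\<lambda>i. act (VM 0 n Ab) P u i + p * w i)"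
      using gp unfolding gpair_def by simp
    then obtain u w where uw: "u \<in> zvec n" "w \<in> zvec n" "x = (\<lambda>i. act (VM 0 n Ab) P u i + p * w i)"
      by (elim bexE)
    have "x = red p x" using x red_id[of x p n Ab] by simp
    also have "\<dots> = red p (act (VM 0 n Ab) P u)" unfolding uw(3) by (simp add: red_def)
    finally have "x = act ?U P (red p u)" using red_act[OF uw(1)] by simp
    then show "x \<in> act ?U P ` carrier ?U" using red_mem[OF uw(1)] by blast
  qed
  moreover have "{x \<in> carrier ?U. act ?U P x = \<zero>\<^bsub>?U\<^esub>} = Vset p n P Ab" by (simp add: Vset_def)
  ultimately have e: "card (Vset p n P Ab) * card (act ?U P ` carrier ?U) = card (carrier Gb) * card (act ?U P ` carrier ?U)"
    using 1 2 im by (simp add: mult.commute)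
  have "card (act ?U P ` carrier ?U) > 0" using fU U.zero_closed by (auto simp: card_gt_0_iff simp del: VM_simps)
  then show ?thesis using e by simp
qed

section \<open>Comparison of good pairs modulo p^N and modulo p\<close>

lemma act_cong_mod:
  assumes "u \<in> zvec n" "\<And>i k. \<lbrakk>i < n; k < n\<rbrakk> \<Longrightarrow> A i k mod p = Ab i k mod p"
  shows "\<exists>w\<in>zvec n. act (VM 0 n A) Q u = (\<lambda>i. act (VM 0 n Ab) Q u i + p * w i)"
proof -
  let ?a = "act (VM 0 n A) Q u" and ?b = "act (VM 0 n Ab) Q u"
  have "VM p n A = VM p n Ab" by (rule VM_cong_mod[OF assms(2)])
  then have "red p ?a = red p ?b" using red_act[OF assms(1)] by simp
  then have "?a i mod p = ?b i mod p" for i by (metis red_def)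
  then have "p dvd ?a i - ?b i" for i by (simp add: mod_eq_dvd_iff)
  then have "?a = (\<lambda>i. ?b i + p * ((?a i - ?b i) div p))" by (simp add: fun_eq_iff)
  moreover have "(\<lambda>i. (?a i - ?b i) div p) \<in> zvec n" using VM0_act_closed[OF assms(1)] by simp
  ultimately show ?thesis by (rule bexI)
qed

lemma thom_Gb:
  assumes g: "g \<in> {..<n} \<rightarrow> carrier G" and gb: "\<And>i. i < n \<Longrightarrow> gb i = \<kappa> (g i)"
    and A: "\<And>i k. \<lbrakk>i < n; k < n\<rbrakk> \<Longrightarrow> A i k mod p = Ab i k mod p" and t: "thom (VM 0 n A) G (Fm G n g)"
  shows "thom (VM 0 n Ab) Gb (Fm Gb n gb)"
proof -
  interpret B: tgroup Gb by (rule tg_Gb)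
  have gbc: "gb \<in> {..<n} \<rightarrow> carrier Gb" using g gb thomD(1)[OF \<kappa>] by (simp add: Pi_iff)
  show ?thesis
  proof (rule B.Fm_thom[OF gbc])
    fix i assume i: "i < n"
    have "Fm Gb n gb (\<lambda>k. if k < n then Ab k i else 0) = Fm Gb n gb (tact (VM 0 n A) (uv i))"
      unfolding VM0_T_uv[OF i] by (rule B.Fm_eq_mod[OF gbc Gb_p]) (simp_all add: A i)
    also have "\<dots> = \<kappa> (Fm G n g (tact (VM 0 n A) (uv i)))" by (rule Fm_Gb[OF g gb VM0_T_closed])
    also have "\<dots> = tact Gb (gb i)"
      using thomD(3)[OF t, of "uv i"] uv_zvec[OF i] Fm_uv[OF g i] thomD(3)[OF \<kappa>, of "g i"] g i gb[OF i] by (simp add: Pi_iff)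
    finally show "Fm Gb n gb (\<lambda>k. if k < n then Ab k i else 0) = tact Gb (gb i)" .
  qed
qed

lemma p_pow_N: "p ^ N = p * p ^ (N - 1)"
  using N by (cases N) auto

text \<open>The kernel condition modulo p^N makes the connecting map surjective; injectivity follows
  since \<open>card_V\<close> and \<open>card_W\<close> give source and target the same
  size.\<close>

lemma gpair_reduce:
  assumes g: "g \<in> {..<n} \<rightarrow> carrier G" and gb: "\<And>i. i < n \<Longrightarrow> gb i = \<kappa> (g i)"
    and A: "\<And>i k. \<lbrakk>i < n; k < n\<rbrakk> \<Longrightarrow> A i k mod p = Ab i k mod p"
    and gp: "gpair (p ^ N) n P G A g"
  shows "gpair p n P Gb Ab gb" and "dmap p n P G g A \<in> TIso (Vmod p n P Ab) (Wmod p G)"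
proof -
  interpret B: tgroup Gb by (rule tg_Gb)
  let ?F = "Fm G n g" and ?B = "Fm Gb n gb"
  have gbc: "gb \<in> {..<n} \<rightarrow> carrier Gb" using g gb thomD(1)[OF \<kappa>] by (simp add: Pi_iff)
  have t: "thom (VM 0 n A) G ?F" and sF: "?F ` zvec n = carrier G" using gp by (simp_all add: gpair_def)
  have kF: "\<exists>u\<in>zvec n. \<exists>w\<in>zvec n. v = (\<lambda>i. act (VM 0 n A) P u i + p ^ N * w i)"
    if "v \<in> zvec n" "?F v = \<zero>" for v using gp that by (simp add: gpair_def)
  have BF: "?B v = \<kappa> (?F v)" if "v \<in> zvec n" for v by (rule Fm_Gb[OF g gb that])
  show gpb: "gpair p n P Gb Ab gb" unfolding gpair_def
  proof (intro conjI ballI impI)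
    show "thom (VM 0 n Ab) Gb ?B" by (rule thom_Gb[OF g gb A t])
    have "?B ` zvec n = \<kappa> ` ?F ` zvec n" unfolding image_image by (rule image_cong[OF refl BF])
    then show "?B ` zvec n = carrier Gb" unfolding sF \<kappa>_surj .
    fix v assume v: "v \<in> zvec n" and 0: "?B v = \<zero>\<^bsub>Gb\<^esub>"
    have "\<kappa> (?F v) = \<zero>\<^bsub>Gb\<^esub>" using 0 BF[OF v] by simp
    then obtain y where y: "y \<in> carrier G" "?F v = p \<diamondop> y" using \<kappa>_ker[of "?F v"] g by auto
    then obtain u where u: "u \<in> zvec n" "y = ?F u" using sF by blast
    \<comment> \<open>Only the class of F v in G/pG vanishes. Subtracting p u moves v into the
      kernel of F itself, at the cost of a term absorbed by the modulus p.\<close>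
    have "?F (\<lambda>i. v i - p * u i) = \<zero>"
      using y u g by (simp add: Fm_diff Fm_scale minus_eq_zero_iff)
    moreover have "(\<lambda>i. v i - p * u i) \<in> zvec n" using v u by simp
    ultimately obtain u' w where uw: "u' \<in> zvec n" "w \<in> zvec n"
      "(\<lambda>i. v i - p * u i) = (\<lambda>i. act (VM 0 n A) P u' i + p ^ N * w i)"
      using kF by (elim bexE[OF kF[rotated]]) blast+
    have "\<exists>w\<in>zvec n. act (VM 0 n A) P u' = (\<lambda>i. act (VM 0 n Ab) P u' i + p * w i)"
      by (rule act_cong_mod[OF uw(1) A])
    then obtain w' where w': "w' \<in> zvec n" "act (VM 0 n A) P u' = (\<lambda>i. act (VM 0 n Ab) P u' i + p * w' i)"
      by (elim bexE)
    let ?w = "\<lambda>i. u i + w' i + p ^ (N - 1) * w i"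
    have "v i = act (VM 0 n Ab) P u' i + p * ?w i" for i
      using fun_cong[OF uw(3), of i] unfolding w'(2) p_pow_N by (simp add: algebra_simps)
    then have "v = (\<lambda>i. act (VM 0 n Ab) P u' i + p * ?w i)" by (rule ext)
    moreover have "?w \<in> zvec n" using u w' uw by simp
    ultimately show "\<exists>u\<in>zvec n. \<exists>w\<in>zvec n. v = (\<lambda>i. act (VM 0 n Ab) P u i + p * w i)"
      by (intro bexI[OF _ uw(1)] bexI[of _ ?w])
  qed
  have VM: "VM p n A = VM p n Ab" by (rule VM_cong_mod[OF A])
  then have Vs: "Vset p n P A = Vset p n P Ab" "Vmod p n P A = Vmod p n P Ab" by (simp_all add: Vset_def Vmod_def)
  have dT: "dmap p n P G g A \<in> THom (Vmod p n P Ab) (Wmod p G)" using dmap_THom[OF g t] unfolding Vs .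
  have Vc: "carrier (Vmod p n P Ab) = Vset p n P Ab" by (simp add: Vmod_def)
  have sub: "dmap p n P G g A ` Vset p n P Ab \<subseteq> carrier (Wmod p G)"
    using dT unfolding THom_def thom_def Vc by blast
  moreover have "y \<in> dmap p n P G g A ` Vset p n P Ab" if y: "y \<in> carrier (Wmod p G)" for y
  proof -
    have y': "y \<in> carrier G" "p \<diamondop> y = \<zero>" using y by (simp_all add: W_carrier)
    then obtain w where w: "w \<in> zvec n" "y = ?F w" using sF by blast
    \<comment> \<open>For p-torsion y = F w the vector p w lies in the kernel of F, hence p w = P(A)
      u + p^N w'. So P(A) u is divisible by p, and F sends the quotient to F w = y, because p^(N-1)
      kills G.\<close>
    have "?F (\<lambda>i. p * w i) = \<zero>" using w y' g by (simp add: Fm_scale)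
    moreover have "(\<lambda>i. p * w i) \<in> zvec n" using w by simp
    ultimately obtain u w' where uw: "u \<in> zvec n" "w' \<in> zvec n"
      "(\<lambda>i. p * w i) = (\<lambda>i. act (VM 0 n A) P u i + p ^ N * w' i)"
      using kF by (elim bexE[OF kF[rotated]]) blast+
    let ?z = "\<lambda>i. w i - p ^ (N - 1) * w' i"
    have "act (VM 0 n A) P u i = p * ?z i" for i
      using fun_cong[OF uw(3), of i] unfolding p_pow_N by (simp add: algebra_simps)
    then have e: "act (VM 0 n A) P u = (\<lambda>i. p * ?z i)" by (rule ext)
    have z: "?z \<in> zvec n" using w uw by simp
    have "dmap p n P G g A (red p u) = ?F ?z" by (rule delta_red[OF g t uw(1) z e])
    also have "\<dots> = y" using w g pN1 by (simp add: Fm_diff Fm_scale a_minus_def)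
    finally have "dmap p n P G g A (red p u) = y" .
    moreover have "red p u \<in> Vset p n P Ab" unfolding Vs(1)[symmetric] red_mem_Vset_iff[OF uw(1)]
      by (rule bexI[of _ ?z]) (rule e z)+
    ultimately show ?thesis by blast
  qed
  ultimately have im: "dmap p n P G g A ` Vset p n P Ab = carrier (Wmod p G)" by blast
  have "inj_on (dmap p n P G g A) (Vset p n P Ab)"
  proof (rule eq_card_imp_inj_on)
    show "finite (Vset p n P Ab)" using fqspace.fin[OF fq_V, of Ab] unfolding Vc .
    show "card (dmap p n P G g A ` Vset p n P Ab) = card (Vset p n P Ab)"
      unfolding im card_W card_V[OF gpb gbc] ..
  qed
  then show "dmap p n P G g A \<in> TIso (Vmod p n P Ab) (Wmod p G)"
    using dT im by (simp add: TIso_def bij_betw_def Vc)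
qed

text \<open>Successive approximation: each round writes a vector of ker F as P(A) u plus p times
  another vector of ker F, so N rounds reach the modulus p^N. Surjectivity of the connecting map is
  what keeps the remainder in ker F.\<close>

lemma gpair_lift:
  assumes g: "g \<in> {..<n} \<rightarrow> carrier G" and gb: "\<And>i. i < n \<Longrightarrow> gb i = \<kappa> (g i)"
    and A: "\<And>i k. \<lbrakk>i < n; k < n\<rbrakk> \<Longrightarrow> A i k mod p = Ab i k mod p"
    and t: "thom (VM 0 n A) G (Fm G n g)" and sF: "Fm G n g ` zvec n = carrier G"
    and gpb: "gpair p n P Gb Ab gb" and iso: "dmap p n P G g A \<in> TIso (Vmod p n P Ab) (Wmod p G)"
  shows "gpair (p ^ N) n P G A g"
proof -
  interpret B: tgroup Gb by (rule tg_Gb)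
  let ?F = "Fm G n g" and ?B = "Fm Gb n gb"
  have BF: "?B v = \<kappa> (?F v)" if "v \<in> zvec n" for v by (rule Fm_Gb[OF g gb that])
  have VM: "VM p n A = VM p n Ab" by (rule VM_cong_mod[OF A])
  then have Vs: "Vset p n P A = Vset p n P Ab" by (simp add: Vset_def)
  have Vc: "carrier (Vmod p n P Ab) = Vset p n P Ab" by (simp add: Vmod_def)
  have im: "dmap p n P G g A ` Vset p n P A = carrier (Wmod p G)"
    using iso by (simp add: TIso_def bij_betw_def Vc Vs)
  have step: "\<exists>u\<in>zvec n. \<exists>v'\<in>zvec n. ?F v' = \<zero> \<and> v = (\<lambda>i. act (VM 0 n A) P u i + p * v' i)"
    if v: "v \<in> zvec n" "?F v = \<zero>" for v
  proof -
    have "?B v = \<zero>\<^bsub>Gb\<^esub>" using BF[OF v(1)] v(2) thom_maps(1)[OF tgroup_axioms tg_Gb \<kappa>] by simp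
    then have "\<exists>u\<in>zvec n. \<exists>w\<in>zvec n. v = (\<lambda>i. act (VM 0 n Ab) P u i + p * w i)"
      using gpb v(1) unfolding gpair_def by simp
    then obtain u w where uw: "u \<in> zvec n" "w \<in> zvec n" "v = (\<lambda>i. act (VM 0 n Ab) P u i + p * w i)" by (elim bexE)
    have "\<exists>w\<in>zvec n. act (VM 0 n A) P u = (\<lambda>i. act (VM 0 n Ab) P u i + p * w i)"
      by (rule act_cong_mod[OF uw(1) A])
    then obtain w' where w': "w' \<in> zvec n" "act (VM 0 n A) P u = (\<lambda>i. act (VM 0 n Ab) P u i + p * w' i)"
      by (elim bexE)
    let ?y = "\<lambda>i. w i - w' i"
    have vy: "v = (\<lambda>i. act (VM 0 n A) P u i + p * ?y i)" unfolding uw(3) w'(2) by (simp add: algebra_simps)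
    have y: "?y \<in> zvec n" using uw w' by simp
    have "?F (act (VM 0 n A) P u) = \<zero>"
      using thom_maps(5)[OF tgroup_VM tgroup_axioms t, of u P] uw(1) g by (simp add: P_tors)
    then have "?F v = p \<diamondop> ?F ?y" unfolding vy Fm_add[OF g] Fm_scale[OF g] using g by simp
    \<comment> \<open>The approximation modulo p leaves p y with p F y = 0. Some v0 in the kernel of
      P(A) modulo p has the connecting value F y; moving it into u leaves the remainder y - w0,
      which F kills.\<close>
    then have "?F ?y \<in> carrier (Wmod p G)" using v(2) g by (simp add: W_carrier)
    then obtain v0 where v0: "v0 \<in> Vset p n P A" "dmap p n P G g A v0 = ?F ?y" unfolding im[symmetric] by auto
    obtain w0 where w0: "v0 \<in> zvec n" "red p v0 = v0" "w0 \<in> zvec n" "act (VM 0 n A) P v0 = (\<lambda>i. p * w0 i)"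
      using Vset_rep[OF v0(1)] .
    have "?F w0 = ?F ?y" using delta_red[OF g t w0(1,3,4)] v0(2) w0(2) by simp
    then have F0: "?F (\<lambda>i. ?y i - w0 i) = \<zero>" using g unfolding Fm_diff[OF g, of ?y w0] by (simp add: minus_eq_zero_iff)
    have "v = (\<lambda>i. act (VM 0 n A) P (\<lambda>i. u i + v0 i) i + p * (?y i - w0 i))"
      unfolding VM0_act_add[OF uw(1) w0(1)] w0(4) vy by (simp add: algebra_simps)
    moreover have "(\<lambda>i. u i + v0 i) \<in> zvec n" "(\<lambda>i. ?y i - w0 i) \<in> zvec n" using uw w0 y by simp_all
    ultimately show ?thesis using F0 by (intro bexI[of _ "\<lambda>i. u i + v0 i"] bexI[of _ "\<lambda>i. ?y i - w0 i"] conjI)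
  qed
  have iter: "\<exists>u\<in>zvec n. \<exists>v'\<in>zvec n. ?F v' = \<zero> \<and> v = (\<lambda>i. act (VM 0 n A) P u i + p ^ k * v' i)"
    if v: "v \<in> zvec n" "?F v = \<zero>" for v k
  proof (induction k)
    case 0
    have "act (VM 0 n A) P (\<lambda>_. 0) = (\<lambda>_. 0)" using tgroup.act_x_zero[OF tgroup_VM, of 0 n A P] by simp
    then show ?case using v by (intro bexI[of _ "\<lambda>_. 0"] bexI[of _ v]) simp_all
  next
    case (Suc k)
    then obtain u v' where u: "u \<in> zvec n" "v' \<in> zvec n" "?F v' = \<zero>" "v = (\<lambda>i. act (VM 0 n A) P u i + p ^ k * v' i)"
      by (elim bexE conjE)
    obtain u' v'' where u': "u' \<in> zvec n" "v'' \<in> zvec n" "?F v'' = \<zero>" "v' = (\<lambda>i. act (VM 0 n A) P u' i + p * v'' i)"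
      using step[OF u(2,3)] by (elim bexE conjE)
    have z: "(\<lambda>i. p ^ k * u' i) \<in> zvec n" using u'(1) by simp
    have "v = (\<lambda>i. act (VM 0 n A) P (\<lambda>i. u i + p ^ k * u' i) i + p ^ Suc k * v'' i)"
      unfolding VM0_act_add[OF u(1) z] VM0_act_scale[OF u'(1)] u(4) u'(4) by (simp add: algebra_simps)
    moreover have "(\<lambda>i. u i + p ^ k * u' i) \<in> zvec n" using u u' by simp
    ultimately show ?case using u'(2,3) by (intro bexI[of _ "\<lambda>i. u i + p ^ k * u' i"] bexI[of _ v''] conjI)
  qed
  show ?thesis unfolding gpair_def
  proof (intro conjI ballI impI t sF)
    fix v assume "v \<in> zvec n" "?F v = \<zero>"
    from iter[OF this, of N] obtain u v' where "u \<in> zvec n" "v' \<in> zvec n" "v = (\<lambda>i. act (VM 0 n A) P u i + p ^ N * v' i)"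
      by (elim bexE conjE)
    then show "\<exists>u\<in>zvec n. \<exists>w\<in>zvec n. v = (\<lambda>i. act (VM 0 n A) P u i + p ^ N * w i)"
      by (intro bexI[of _ u] bexI[of _ v'])
  qed
qed

end

section \<open>Several polynomials at once\<close>

lemma comax_times:
  assumes "comax p P Q" "comax p P R" shows "comax p P (Q * R)"
proof -
  obtain A B C where e: "A * Q + B * P = 1 + Polynomial.smult p C" using assms(1) by (auto simp: comax_def)
  have "A * (Q * R) - R = (A * Q + B * P) * R - R - B * P * R" by (simp add: algebra_simps)
  also have "\<dots> = (- B * R) * P + Polynomial.smult p (C * R)" unfolding e by (simp add: algebra_simps)
  finally have "inI p P (A * (Q * R) - R)" unfolding inI_def by blast
  then show ?thesis using comax_mult[OF assms(2)] by blast
qed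

lemma comax_prod: "finite K \<Longrightarrow> (\<And>i. i \<in> K \<Longrightarrow> comax p P (Q i)) \<Longrightarrow> comax p P (\<Prod>i\<in>K. Q i)"
proof (induction K rule: finite_induct)
  case empty
  show ?case unfolding comax_def by (intro exI[of _ 1] exI[of _ 0]) simp
qed (simp add: comax_times)

definition col :: "nat \<Rightarrow> (nat \<Rightarrow> nat \<Rightarrow> int) \<Rightarrow> nat \<Rightarrow> nat \<Rightarrow> int" where
  "col n A i = (\<lambda>k. if k < n then A k i else 0)"

text \<open>Matrices over Z/m in least residues. For m = p they are literally the matrices over
  \<open>residue_ring p\<close>, see \<open>mats_residue\<close>.\<close>

definition IM :: "int \<Rightarrow> nat \<Rightarrow> (nat \<Rightarrow> nat \<Rightarrow> int) set" where
  "IM m n = {A. \<forall>i k. (i < n \<and> k < n \<longrightarrow> 0 \<le> A i k \<and> A i k < m) \<and> (\<not> (i < n \<and> k < n) \<longrightarrow> A i k = 0)}"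

lemma card_IM: assumes "m > 0" shows "finite (IM m n)" "card (IM m n) = nat m ^ (n * n)"
proof -
  let ?D = "({..<n} \<times> {..<n}) \<rightarrow>\<^sub>E {0..<m}"
  have b: "bij_betw (\<lambda>A. restrict (\<lambda>(i, k). A i k) ({..<n} \<times> {..<n})) (IM m n) ?D"
  proof (rule bij_betw_byWitness[where f' = "\<lambda>f i k. if i < n \<and> k < n then f (i, k) else 0"])
    show "\<forall>A\<in>IM m n. (\<lambda>i k. if i < n \<and> k < n then restrict (\<lambda>(i, k). A i k) ({..<n} \<times> {..<n}) (i, k) else 0) = A"
      by (simp add: fun_eq_iff IM_def)
    show "\<forall>f\<in>?D. restrict (\<lambda>(i, k). if i < n \<and> k < n then f (i, k) else 0) ({..<n} \<times> {..<n}) = f"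
      by (simp add: fun_eq_iff PiE_iff extensional_def)
    show "(\<lambda>A. restrict (\<lambda>(i, k). A i k) ({..<n} \<times> {..<n})) ` IM m n \<subseteq> ?D"
      by (rule image_subsetI) (auto simp: IM_def)
    show "(\<lambda>f i k. if i < n \<and> k < n then f (i, k) else 0) ` ?D \<subseteq> IM m n"
      by (rule image_subsetI) (simp add: IM_def PiE_iff)
  qed
  have "finite ?D" by (intro finite_PiE) auto
  then show "finite (IM m n)" using b bij_betw_finite by blast
  show "card (IM m n) = nat m ^ (n * n)" using bij_betw_same_card[OF b] by (simp add: card_PiE card_cartesian_product)
qed

lemma (in tgroup) thom_iff_col:
  assumes g: "g \<in> {..<n} \<rightarrow> carrier G"
  shows "thom (VM 0 n A) G (Fm G n g) \<longleftrightarrow> (\<forall>i<n. Fm G n g (col n A i) = tact G (g i))"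
proof
  assume t: "thom (VM 0 n A) G (Fm G n g)"
  show "\<forall>i<n. Fm G n g (col n A i) = tact G (g i)"
  proof (intro allI impI)
    fix i assume i: "i < n"
    show "Fm G n g (col n A i) = tact G (g i)"
      using thomD(3)[OF t, of "uv i"] uv_zvec[OF i] Fm_uv[OF g i] unfolding VM0_T_uv[OF i] col_def VM0_carrier by simp
  qed
next
  assume "\<forall>i<n. Fm G n g (col n A i) = tact G (g i)"
  then show "thom (VM 0 n A) G (Fm G n g)" by (intro Fm_thom[OF g]) (simp add: col_def)
qed

locale multi =
  fixes p :: int and n N :: nat and J :: "nat set"
    and G :: "nat \<Rightarrow> ('a, 'b, 'c) tmodule_scheme" and P :: "nat \<Rightarrow> int poly"
    and Gb :: "nat \<Rightarrow> ('d, 'e, 'f) tmodule_scheme" and \<kappa> :: "nat \<Rightarrow> 'b \<Rightarrow> 'e"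
  assumes J: "finite J" and p: "Factorial_Ring.prime p" and N: "N \<ge> 1"
    and sq: "j \<in> J \<Longrightarrow> sglq (G j) p N (P j) (Gb j) (\<kappa> j)"
    and cop: "\<lbrakk>i \<in> J; j \<in> J; i \<noteq> j\<rbrakk> \<Longrightarrow> comax p (P j) (P i)"
begin

lemma p_pos: "p > 0" "p ^ N > 0" "p ^ k > 0"
  using prime_gt_0_int[OF p] by simp_all

text \<open>Chinese remainder argument: the product of the other P_i acts as a unit on the component
  j0 and as zero on all others, so there are vectors with a prescribed value at j0 that vanish
  elsewhere. Their sums reach every family.\<close>

lemma joint_mod_p:
  assumes gb: "\<And>j. j \<in> J \<Longrightarrow> gb j \<in> {..<n} \<rightarrow> carrier (Gb j)"
    and gp: "\<And>j. j \<in> J \<Longrightarrow> gpair p n (P j) (Gb j) Ab (gb j)"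
    and y: "\<And>j. j \<in> J \<Longrightarrow> y j \<in> carrier (Gb j)"
  shows "\<exists>v\<in>zvec n. \<forall>j\<in>J. Fm (Gb j) n (gb j) v = y j"
proof -
  have one: "\<exists>v\<in>zvec n. \<forall>j\<in>J. Fm (Gb j) n (gb j) v = (if j = j0 then y j else \<zero>\<^bsub>Gb j\<^esub>)" if j0: "j0 \<in> J" for j0
  proof -
    interpret S: sglq "G j0" p n N "P j0" "Gb j0" "\<kappa> j0" by (rule sq[OF j0])
    interpret B: fqspace "Gb j0" p "P j0" by (rule S.fq_Gb)
    let ?Q = "\<Prod>i\<in>J - {j0}. P i"
    have "comax p (P j0) ?Q" using J cop j0 by (intro comax_prod) auto
    then obtain D where D: "\<And>x. x \<in> carrier (Gb j0) \<Longrightarrow> act (Gb j0) D (act (Gb j0) ?Q x) = x"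
      using B.act_comax by blast
    have y0: "y j0 \<in> carrier (Gb j0)" by (rule y[OF j0])
    have D': "act (Gb j0) ?Q (act (Gb j0) D (y j0)) = y j0" using D[OF y0] B.act_mult[OF y0] by (metis mult.commute)
    have "act (Gb j0) D (y j0) \<in> Fm (Gb j0) n (gb j0) ` zvec n"
      using gp[OF j0] B.act_closed[OF y0] by (simp add: gpair_def)
    then obtain u where u: "act (Gb j0) D (y j0) = Fm (Gb j0) n (gb j0) u" "u \<in> zvec n" by (rule imageE)
    let ?v = "act (VM 0 n Ab) ?Q u"
    have F: "Fm (Gb j) n (gb j) ?v = act (Gb j) ?Q (Fm (Gb j) n (gb j) u)" if j: "j \<in> J" for j
      using thom_maps(5)[OF tgroup_VM sglq.tg_Gb[OF sq[OF j]], of 0 n Ab "Fm (Gb j) n (gb j)" u ?Q] gp[OF j] u(2)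
      by (simp add: gpair_def)
    have "Fm (Gb j) n (gb j) ?v = (if j = j0 then y j else \<zero>\<^bsub>Gb j\<^esub>)" if j: "j \<in> J" for j
    proof (cases "j = j0")
      case True
      then show ?thesis using F[OF j] D' u(1) by simp
    next
      case False
      interpret B': fqspace "Gb j" p "P j" by (rule sglq.fq_Gb[OF sq[OF j]])
      have c: "Fm (Gb j) n (gb j) u \<in> carrier (Gb j)" by (rule B'.Fm_closed[OF gb[OF j]])
      have "?Q = (\<Prod>i\<in>J - {j0} - {j}. P i) * P j"
        using J j False by (subst prod.remove[of _ j]) (auto simp: mult.commute)
      then have "act (Gb j) ?Q (Fm (Gb j) n (gb j) u) = \<zero>\<^bsub>Gb j\<^esub>"
        using c by (simp add: B'.act_mult B'.P_tors)
      then show ?thesis using F[OF j] False by simp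
    qed
    then show ?thesis using VM0_act_closed[OF u(2)] by (intro bexI[of _ ?v] ballI)
  qed
  have "\<exists>v\<in>zvec n. \<forall>j\<in>J. Fm (Gb j) n (gb j) v = (if j \<in> K then y j else \<zero>\<^bsub>Gb j\<^esub>)" if "finite K" "K \<subseteq> J" for K
    using that
  proof (induction K rule: finite_induct)
    case empty
    have "Fm (Gb j) n (gb j) (\<lambda>_. 0) = \<zero>\<^bsub>Gb j\<^esub>" if "j \<in> J" for j
      by (rule tgroup.Fm_zero[OF sglq.tg_Gb[OF sq[OF that]]])
    then show ?case by (intro bexI[of _ "\<lambda>_. 0"]) simp_all
  next
    case (insert k K)
    then obtain v where v: "v \<in> zvec n" "\<forall>j\<in>J. Fm (Gb j) n (gb j) v = (if j \<in> K then y j else \<zero>\<^bsub>Gb j\<^esub>)" by auto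
    obtain w where w: "w \<in> zvec n" "\<forall>j\<in>J. Fm (Gb j) n (gb j) w = (if j = k then y j else \<zero>\<^bsub>Gb j\<^esub>)"
      using one[of k] insert by auto
    have "Fm (Gb j) n (gb j) (\<lambda>i. v i + w i) = (if j \<in> insert k K then y j else \<zero>\<^bsub>Gb j\<^esub>)" if j: "j \<in> J" for j
    proof -
      interpret B: tgroup "Gb j" by (rule sglq.tg_Gb[OF sq[OF j]])
      have "\<zero>\<^bsub>Gb j\<^esub> \<oplus>\<^bsub>Gb j\<^esub> y j = y j" "y j \<oplus>\<^bsub>Gb j\<^esub> \<zero>\<^bsub>Gb j\<^esub> = y j" "\<zero>\<^bsub>Gb j\<^esub> \<oplus>\<^bsub>Gb j\<^esub> \<zero>\<^bsub>Gb j\<^esub> = \<zero>\<^bsub>Gb j\<^esub>"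
        using y[OF j] by simp_all
      then show ?thesis using v(2) w(2) j insert.hyps(2) unfolding B.Fm_add[OF gb[OF j]] by auto
    qed
    moreover have "(\<lambda>i. v i + w i) \<in> zvec n" using v w by simp
    ultimately show ?case by (intro bexI[of _ "\<lambda>i. v i + w i"] ballI)
  qed
  from this[OF J subset_refl] show ?thesis by auto
qed

text \<open>Nakayama for the finite p-groups G_j: values are matched modulo p, the error p y' is
  treated in the same way, and after N rounds the error p^N y' is zero.\<close>

lemma joint_surj:
  assumes g: "\<And>j. j \<in> J \<Longrightarrow> g j \<in> {..<n} \<rightarrow> carrier (G j)"
    and gb: "\<And>j i. \<lbrakk>j \<in> J; i < n\<rbrakk> \<Longrightarrow> gb j i = \<kappa> j (g j i)"
    and gp: "\<And>j. j \<in> J \<Longrightarrow> gpair p n (P j) (Gb j) Ab (gb j)"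
    and y: "\<And>j. j \<in> J \<Longrightarrow> y j \<in> carrier (G j)"
  shows "\<exists>v\<in>zvec n. \<forall>j\<in>J. Fm (G j) n (g j) v = y j"
proof -
  have gbc: "gb j \<in> {..<n} \<rightarrow> carrier (Gb j)" if "j \<in> J" for j
    using g[OF that] gb[OF that] thomD(1)[OF sglq.\<kappa>[OF sq[OF that]]] by (simp add: Pi_iff)
  have step: "\<exists>v\<in>zvec n. \<exists>y'. \<forall>j\<in>J. y' j \<in> carrier (G j) \<and> y j = Fm (G j) n (g j) v \<oplus>\<^bsub>G j\<^esub> add_pow (G j) p (y' j)"
    if y: "\<And>j. j \<in> J \<Longrightarrow> y j \<in> carrier (G j)" for y
  proof -
    have "\<exists>v\<in>zvec n. \<forall>j\<in>J. Fm (Gb j) n (gb j) v = \<kappa> j (y j)"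
      by (rule joint_mod_p[OF gbc gp]) (use y thomD(1)[OF sglq.\<kappa>[OF sq]] in blast)+
    then obtain v where v: "v \<in> zvec n" "\<forall>j\<in>J. Fm (Gb j) n (gb j) v = \<kappa> j (y j)" by (elim bexE)
    have "\<exists>z. z \<in> carrier (G j) \<and> y j = Fm (G j) n (g j) v \<oplus>\<^bsub>G j\<^esub> add_pow (G j) p z" if j: "j \<in> J" for j
    proof -
      interpret S: sglq "G j" p n N "P j" "Gb j" "\<kappa> j" by (rule sq[OF j])
      interpret B: tgroup "Gb j" by (rule S.tg_Gb)
      let ?f = "Fm (G j) n (g j) v"
      have f: "?f \<in> carrier (G j)" by (rule S.Fm_closed[OF g[OF j]])
      have "\<kappa> j ?f = \<kappa> j (y j)" using v j S.Fm_Gb[OF g[OF j] gb[OF j] v(1)] by simp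
      then have "\<kappa> j (y j \<ominus>\<^bsub>G j\<^esub> ?f) = \<zero>\<^bsub>Gb j\<^esub>"
        using thom_maps(4)[OF S.tgroup_axioms S.tg_Gb S.\<kappa> y[OF j] f] thomD(1)[OF S.\<kappa> y[OF j]]
        by (simp add: B.minus_eq_zero_iff)
      then obtain z where z: "z \<in> carrier (G j)" "y j \<ominus>\<^bsub>G j\<^esub> ?f = add_pow (G j) p z"
        using S.\<kappa>_ker[of "y j \<ominus>\<^bsub>G j\<^esub> ?f"] y[OF j] f by auto
      have "y j = ?f \<oplus>\<^bsub>G j\<^esub> add_pow (G j) p z" unfolding z(2)[symmetric] using y[OF j] f by (simp add: S.add_minus_cancel_left)
      then show ?thesis using z(1) by blast
    qed
    then obtain y' where "\<forall>j\<in>J. y' j \<in> carrier (G j) \<and> y j = Fm (G j) n (g j) v \<oplus>\<^bsub>G j\<^esub> add_pow (G j) p (y' j)" by metis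
    then show ?thesis using v(1) by (intro bexI[of _ v] exI[of _ y'])
  qed
  have "\<exists>v\<in>zvec n. \<exists>y'. \<forall>j\<in>J. y' j \<in> carrier (G j) \<and> y j = Fm (G j) n (g j) v \<oplus>\<^bsub>G j\<^esub> add_pow (G j) (p ^ k) (y' j)" for k
  proof (induction k)
    case 0
    have "y j = Fm (G j) n (g j) (\<lambda>_. 0) \<oplus>\<^bsub>G j\<^esub> add_pow (G j) (p ^ 0) (y j)" if j: "j \<in> J" for j
    proof -
      interpret S: sglq "G j" p n N "P j" "Gb j" "\<kappa> j" by (rule sq[OF j])
      show ?thesis using y[OF j] by simp
    qed
    then show ?case using y by (intro bexI[of _ "\<lambda>_. 0"] exI[of _ y]) auto
  next
    case (Suc k)
    then obtain v y' where v: "v \<in> zvec n"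
      "\<forall>j\<in>J. y' j \<in> carrier (G j) \<and> y j = Fm (G j) n (g j) v \<oplus>\<^bsub>G j\<^esub> add_pow (G j) (p ^ k) (y' j)"
      by (elim bexE exE)
    have "\<exists>w\<in>zvec n. \<exists>y''. \<forall>j\<in>J. y'' j \<in> carrier (G j) \<and> y' j = Fm (G j) n (g j) w \<oplus>\<^bsub>G j\<^esub> add_pow (G j) p (y'' j)"
      by (rule step) (use v in blast)
    then obtain w y'' where w: "w \<in> zvec n"
      "\<forall>j\<in>J. y'' j \<in> carrier (G j) \<and> y' j = Fm (G j) n (g j) w \<oplus>\<^bsub>G j\<^esub> add_pow (G j) p (y'' j)"
      by (elim bexE exE)
    let ?v = "\<lambda>i. v i + p ^ k * w i"
    have "y'' j \<in> carrier (G j) \<and> y j = Fm (G j) n (g j) ?v \<oplus>\<^bsub>G j\<^esub> add_pow (G j) (p ^ Suc k) (y'' j)" if j: "j \<in> J" for j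
    proof -
      interpret S: sglq "G j" p n N "P j" "Gb j" "\<kappa> j" by (rule sq[OF j])
      have c: "y'' j \<in> carrier (G j)" "Fm (G j) n (g j) v \<in> carrier (G j)" "Fm (G j) n (g j) w \<in> carrier (G j)"
        using w(2) j S.Fm_closed[OF g[OF j]] by auto
      have "y j = Fm (G j) n (g j) v \<oplus>\<^bsub>G j\<^esub> add_pow (G j) (p ^ k) (Fm (G j) n (g j) w \<oplus>\<^bsub>G j\<^esub> add_pow (G j) p (y'' j))"
        using v(2) w(2) j by metis
      also have "\<dots> = Fm (G j) n (g j) ?v \<oplus>\<^bsub>G j\<^esub> add_pow (G j) (p ^ Suc k) (y'' j)"
        unfolding S.Fm_add[OF g[OF j]] S.Fm_scale[OF g[OF j]] power_Suc mult.commute[of p]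
        using c by (simp add: S.zm_x_add S.zm_mult S.a_assoc)
      finally show ?thesis using c by blast
    qed
    moreover have "?v \<in> zvec n" using v(1) w(1) by simp
    ultimately show ?case by (intro bexI[of _ ?v] exI[of _ y''] ballI)
  qed
  then obtain v y' where v: "v \<in> zvec n"
      "\<forall>j\<in>J. y' j \<in> carrier (G j) \<and> y j = Fm (G j) n (g j) v \<oplus>\<^bsub>G j\<^esub> add_pow (G j) (p ^ N) (y' j)"
    by (elim meta_allE[of _ N] bexE exE)
  have "Fm (G j) n (g j) v = y j" if j: "j \<in> J" for j
  proof -
    interpret S: sglq "G j" p n N "P j" "Gb j" "\<kappa> j" by (rule sq[OF j])
    have c: "y' j \<in> carrier (G j)" "y j = Fm (G j) n (g j) v \<oplus>\<^bsub>G j\<^esub> add_pow (G j) (p ^ N) (y' j)" using v(2) j by auto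
    show ?thesis using c(2) S.Fm_closed[OF g[OF j]] unfolding S.pN[OF c(1)] by simp
  qed
  then show ?thesis using v(1) by (intro bexI[of _ v] ballI)
qed

text \<open>Translation by E on the matrices over Z/p^N. It supplies the injections between fibres
  that \<open>equal_fibres_card\<close> asks for.\<close>

definition tr :: "(nat \<Rightarrow> nat \<Rightarrow> int) \<Rightarrow> (nat \<Rightarrow> nat \<Rightarrow> int) \<Rightarrow> nat \<Rightarrow> nat \<Rightarrow> int" where
  "tr E A = (\<lambda>i k. if i < n \<and> k < n then (A i k + E i k) mod p ^ N else 0)"

lemma tr_IM: "tr E A \<in> IM (p ^ N) n"
  using p_pos(2) by (simp add: IM_def tr_def)

lemma tr_inj: "inj_on (tr E) (IM (p ^ N) n)"
proof (rule inj_onI)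
  fix A B assume AB: "A \<in> IM (p ^ N) n" "B \<in> IM (p ^ N) n" "tr E A = tr E B"
  have "A i k = B i k" for i k
  proof (cases "i < n \<and> k < n")
    case True
    then have "(A i k + E i k) mod p ^ N = (B i k + E i k) mod p ^ N" using fun_cong[OF fun_cong[OF AB(3), of i], of k] by (simp add: tr_def)
    then have "(A i k + E i k - E i k) mod p ^ N = (B i k + E i k - E i k) mod p ^ N" by (metis mod_diff_left_eq)
    then show ?thesis using AB(1,2) True by (simp add: IM_def)
  qed (use AB in \<open>simp add: IM_def\<close>)
  then show "A = B" by (intro ext)
qed

lemma p_dvd_pN: "p dvd p ^ N"
  using N by (simp add: dvd_power)

lemma tr_mod: "i < n \<Longrightarrow> k < n \<Longrightarrow> tr E A i k mod p = (A i k + E i k) mod p"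
  by (simp add: tr_def mod_mod_cancel[OF p_dvd_pN])

lemma card_lifts:
  assumes "Ab \<in> IM p n"
  shows "card {A \<in> IM (p ^ N) n. \<forall>i k. A i k mod p = Ab i k} * card (IM p n) = card (IM (p ^ N) n)"
proof -
  let ?f = "\<lambda>A i k. A i k mod p"
  have fe: "?f A = B \<longleftrightarrow> (\<forall>i k. A i k mod p = B i k)" for A B by (simp add: fun_eq_iff)
  have "card {A \<in> IM (p ^ N) n. ?f A \<in> {Ab}} * card (IM p n) = card (IM (p ^ N) n) * card {Ab}"
  proof (rule equal_fibres_card)
    show "?f \<in> IM (p ^ N) n \<rightarrow> IM p n" using p_pos(1) by (simp add: IM_def Pi_iff)
    fix B B' assume B: "B \<in> IM p n" "B' \<in> IM p n"
    let ?h = "tr (\<lambda>i k. B' i k - B i k)"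
    have "?f (?h A) = B'" if A: "A \<in> IM (p ^ N) n" "?f A = B" for A
    proof (intro ext)
      fix i k
      show "?h A i k mod p = B' i k"
      proof (cases "i < n \<and> k < n")
        case True
        have "A i k mod p = B i k" using A(2) by (simp add: fun_eq_iff)
        moreover have "?h A i k mod p = (A i k mod p + (B' i k - B i k)) mod p"
          using True by (simp add: tr_mod mod_add_left_eq)
        ultimately show ?thesis using B True by (simp add: IM_def)
      next
        case False
        then have "?h A i k = 0" "B' i k = 0" using B(2) by (simp_all only: tr_def IM_def if_False mem_Collect_eq not_False_eq_True simp_thms)
        then show ?thesis by simp
      qed
    qed
    then show "\<exists>h. inj_on h {A \<in> IM (p ^ N) n. ?f A = B} \<and> h ` {A \<in> IM (p ^ N) n. ?f A = B} \<subseteq> {A \<in> IM (p ^ N) n. ?f A = B'}"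
      using tr_inj tr_IM by (intro exI[of _ ?h] conjI) (auto intro: inj_on_subset)
  qed (use card_IM p_pos assms in auto)
  then show ?thesis by (simp add: fe)
qed

lemma Fm_col_tr:
  assumes j: "j \<in> J" and g: "g \<in> {..<n} \<rightarrow> carrier (G j)" and i: "i < n"
  shows "Fm (G j) n g (col n (tr (\<lambda>i k. p * E i k) A) i) =
    Fm (G j) n g (col n A i) \<oplus>\<^bsub>G j\<^esub> add_pow (G j) p (Fm (G j) n g (col n E i))"
proof -
  interpret S: sglq "G j" p n N "P j" "Gb j" "\<kappa> j" by (rule sq[OF j])
  have "Fm (G j) n g (col n (tr (\<lambda>i k. p * E i k) A) i) = Fm (G j) n g (\<lambda>k. col n A i k + p * col n E i k)"
    by (rule S.Fm_eq_mod[OF g S.pN]) (simp_all add: col_def tr_def i)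
  then show ?thesis unfolding S.Fm_add[OF g] S.Fm_scale[OF g] .
qed

text \<open>\<open>tr\<close> reduces modulo p^N, whereas \<open>perturb_exists\<close> wants A' = A
  + p E over the integers. The discrepancy, a multiple of p^N, is moved into E as a multiple of
  p^(N-1), to which every F is blind.\<close>

lemma tr_diff:
  assumes A: "A \<in> IM (p ^ N) n"
  obtains E' where "\<And>i k. \<lbrakk>i < n; k < n\<rbrakk> \<Longrightarrow> tr (\<lambda>i k. p * E i k) A i k = A i k + p * E' i k"
    "\<And>j g i. \<lbrakk>j \<in> J; g \<in> {..<n} \<rightarrow> carrier (G j); i < n\<rbrakk> \<Longrightarrow> Fm (G j) n g (col n E' i) = Fm (G j) n g (col n E i)"
proof -
  define E' where "E' i k = E i k - p ^ (N - 1) * ((A i k + p * E i k) div p ^ N)" for i k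
  have pN: "p ^ N = p * p ^ (N - 1)" using N by (cases N) auto
  have "tr (\<lambda>i k. p * E i k) A i k = A i k + p * E' i k" if "i < n" "k < n" for i k
  proof -
    have "tr (\<lambda>i k. p * E i k) A i k = A i k + p * E i k - p ^ N * ((A i k + p * E i k) div p ^ N)"
      using that by (simp add: tr_def minus_mult_div_eq_mod)
    then show ?thesis unfolding E'_def right_diff_distrib mult.assoc[symmetric] pN[symmetric] by simp
  qed
  moreover have "Fm (G j) n g (col n E' i) = Fm (G j) n g (col n E i)" if j: "j \<in> J" "g \<in> {..<n} \<rightarrow> carrier (G j)" "i < n" for j g i
  proof -
    interpret S: sglq "G j" p n N "P j" "Gb j" "\<kappa> j" by (rule sq[OF j(1)])
    show ?thesis by (rule S.Fm_eq_mod[OF j(2) S.pN1]) (simp_all add: col_def E'_def mod_eq_dvd_iff)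
  qed
  ultimately show ?thesis using that by blast
qed

end

section \<open>Counting good pairs\<close>

definition goods :: "int \<Rightarrow> nat \<Rightarrow> nat set \<Rightarrow> (nat \<Rightarrow> int poly) \<Rightarrow> (nat \<Rightarrow> ('a, 'b, 'c) tmodule_scheme)
    \<Rightarrow> ((nat \<Rightarrow> nat \<Rightarrow> int) \<times> (nat \<Rightarrow> nat \<Rightarrow> 'b)) set" where
  "goods m n J P G = {(A, g). A \<in> IM m n \<and> g \<in> (\<Pi>\<^sub>E j\<in>J. {..<n} \<rightarrow>\<^sub>E carrier (G j)) \<and>
     (\<forall>j\<in>J. gpair m n (P j) (G j) A (g j))}"

text \<open>All admissible F have the same kernel P(A) Z^n + m Z^n, so each differs from the given
  F0 by exactly one automorphism of G.\<close>

lemma card_gpair: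
  assumes G: "tgroup G" and m: "\<And>x. x \<in> carrier G \<Longrightarrow> add_pow G m x = \<zero>\<^bsub>G\<^esub>"
    and P: "\<And>x. x \<in> carrier G \<Longrightarrow> act G P x = \<zero>\<^bsub>G\<^esub>"
    and g0: "g0 \<in> {..<n} \<rightarrow>\<^sub>E carrier G" "gpair m n P G A g0"
  shows "card {g \<in> {..<n} \<rightarrow>\<^sub>E carrier G. gpair m n P G A g} = card (TIso G G)"
proof -
  interpret G: tgroup G by fact
  have g0c: "g0 \<in> {..<n} \<rightarrow> carrier G" using g0(1) by (simp add: PiE_iff Pi_iff)
  let ?S = "{g \<in> {..<n} \<rightarrow>\<^sub>E carrier G. gpair m n P G A g}"
  let ?res = "\<lambda>\<alpha>. \<lambda>i\<in>{..<n}. \<alpha> (g0 i)"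
  have F0s: "Fm G n g0 ` zvec n = carrier G" and F0t: "thom (VM 0 n A) G (Fm G n g0)"
    using g0(2) by (simp_all add: gpair_def)
  have rep: "\<exists>v\<in>zvec n. x = Fm G n g0 v" if "x \<in> carrier G" for x
    using that unfolding F0s[symmetric] by (elim imageE) blast
  have val: "Fm G n (?res \<alpha>) v = \<alpha> (Fm G n g0 v)" if a: "thom G G \<alpha>" and v: "v \<in> zvec n" for \<alpha> v
  proof (rule G.Fm_unique[of "\<lambda>v. \<alpha> (Fm G n g0 v)", OF _ _ _ v])
    show "(\<lambda>v. \<alpha> (Fm G n g0 v)) \<in> zvec n \<rightarrow> carrier G" using thomD(1)[OF a G.Fm_closed[OF g0c]] by blast
    show "\<alpha> (Fm G n g0 (\<lambda>i. v i + w i)) = \<alpha> (Fm G n g0 v) \<oplus>\<^bsub>G\<^esub> \<alpha> (Fm G n g0 w)" for v w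
      unfolding G.Fm_add[OF g0c] by (rule thomD(2)[OF a G.Fm_closed[OF g0c] G.Fm_closed[OF g0c]])
    show "?res \<alpha> i = \<alpha> (Fm G n g0 (uv i))" if "i < n" for i using that G.Fm_uv[OF g0c that] by simp
  qed
  have kz: "Fm G n g v = \<zero>\<^bsub>G\<^esub> \<longleftrightarrow> (\<exists>u\<in>zvec n. \<exists>w\<in>zvec n. v = (\<lambda>i. act (VM 0 n A) P u i + m * w i))"
    if g: "g \<in> {..<n} \<rightarrow> carrier G" "gpair m n P G A g" and v: "v \<in> zvec n" for g v
  proof
    assume "Fm G n g v = \<zero>\<^bsub>G\<^esub>"
    then show "\<exists>u\<in>zvec n. \<exists>w\<in>zvec n. v = (\<lambda>i. act (VM 0 n A) P u i + m * w i)"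
      using g(2) v unfolding gpair_def by simp
  next
    assume "\<exists>u\<in>zvec n. \<exists>w\<in>zvec n. v = (\<lambda>i. act (VM 0 n A) P u i + m * w i)"
    then obtain u w where uw: "u \<in> zvec n" "w \<in> zvec n" "v = (\<lambda>i. act (VM 0 n A) P u i + m * w i)" by (elim bexE)
    have t: "thom (VM 0 n A) G (Fm G n g)" using g(2) by (simp add: gpair_def)
    have "Fm G n g (act (VM 0 n A) P u) = \<zero>\<^bsub>G\<^esub>"
      using thom_maps(5)[OF tgroup_VM G t, of u P] uw(1) G.Fm_closed[OF g(1)] P by simp
    then show "Fm G n g v = \<zero>\<^bsub>G\<^esub>" unfolding uw(3) G.Fm_add[OF g(1)] G.Fm_scale[OF g(1)]
      using m[OF G.Fm_closed[OF g(1)]] by simp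
  qed
  have "bij_betw ?res (TIso G G) ?S" unfolding bij_betw_def
  proof
    show "inj_on ?res (TIso G G)"
    proof (rule inj_onI)
      fix \<alpha> \<beta> assume h: "\<alpha> \<in> TIso G G" "\<beta> \<in> TIso G G" "?res \<alpha> = ?res \<beta>"
      have t: "thom G G \<alpha>" "thom G G \<beta>" "\<alpha> \<in> extensional (carrier G)" "\<beta> \<in> extensional (carrier G)"
        using h(1,2)
        by (simp_all add: TIso_def THom_def PiE_iff)
      have "\<alpha> x = \<beta> x" if x: "x \<in> carrier G" for x
      proof -
        obtain v where v: "v \<in> zvec n" "x = Fm G n g0 v" using rep[OF x] by (elim bexE)
        show ?thesis unfolding v(2) val[OF t(1) v(1), symmetric] val[OF t(2) v(1), symmetric] h(3) ..
      qed
      then show "\<alpha> = \<beta>" using t(3,4) by (metis extensionalityI)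
    qed
    show "?res ` TIso G G = ?S"
    proof (intro subset_antisym subsetI)
      fix g assume "g \<in> ?res ` TIso G G"
      then obtain \<alpha> where a: "g = ?res \<alpha>" "\<alpha> \<in> TIso G G" by (rule imageE)
      then have t: "thom G G \<alpha>" and b: "bij_betw \<alpha> (carrier G) (carrier G)" by (simp_all add: TIso_def THom_def)
      have v: "Fm G n g v = \<alpha> (Fm G n g0 v)" if "v \<in> zvec n" for v unfolding a(1) by (rule val[OF t that])
      have gc: "g \<in> {..<n} \<rightarrow>\<^sub>E carrier G" unfolding a(1) using thomD(1)[OF t] g0(1) by (simp add: PiE_iff Pi_iff)
      have g': "g \<in> {..<n} \<rightarrow> carrier G" using gc by (simp add: PiE_iff Pi_iff)
      have "gpair m n P G A g" unfolding gpair_def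
      proof (intro conjI ballI impI)
        show "thom (VM 0 n A) G (Fm G n g)" unfolding thom_def
        proof (intro conjI ballI)
          show "Fm G n g \<in> carrier (VM 0 n A) \<rightarrow> carrier G" using G.Fm_closed[OF g'] by blast
          show "Fm G n g (x \<oplus>\<^bsub>VM 0 n A\<^esub> y) = Fm G n g x \<oplus>\<^bsub>G\<^esub> Fm G n g y" for x y
            using G.Fm_add[OF g', of x y] by simp
          fix x assume "x \<in> carrier (VM 0 n A)"
          then have x: "x \<in> zvec n" by simp
          show "Fm G n g (tact (VM 0 n A) x) = tact G (Fm G n g x)"
            unfolding v[OF x] v[OF VM0_T_closed] using thomD(3)[OF F0t, of x] x thomD(3)[OF t G.Fm_closed[OF g0c]] by simp
        qed
        have "Fm G n g ` zvec n = \<alpha> ` Fm G n g0 ` zvec n" unfolding image_image by (rule image_cong[OF refl v])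
        then show "Fm G n g ` zvec n = carrier G" unfolding F0s using b by (simp add: bij_betw_def)
        fix w assume w: "w \<in> zvec n" "Fm G n g w = \<zero>\<^bsub>G\<^esub>"
        then have "\<alpha> (Fm G n g0 w) = \<alpha> \<zero>\<^bsub>G\<^esub>" using v thom_maps(1)[OF G G t] by simp
        then have "Fm G n g0 w = \<zero>\<^bsub>G\<^esub>" using b G.Fm_closed[OF g0c] unfolding bij_betw_def by (metis G.zero_closed inj_onD)
        then show "\<exists>u\<in>zvec n. \<exists>z\<in>zvec n. w = (\<lambda>i. act (VM 0 n A) P u i + m * z i)"
          using kz[OF g0c g0(2) w(1)] by simp
      qed
      then show "g \<in> ?S" using gc by blast
    next
      fix g assume "g \<in> ?S"
      then have gc: "g \<in> {..<n} \<rightarrow>\<^sub>E carrier G" and gp: "gpair m n P G A g" by auto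
      have g': "g \<in> {..<n} \<rightarrow> carrier G" using gc by (simp add: PiE_iff Pi_iff)
      have t: "thom (VM 0 n A) G (Fm G n g)" and s: "Fm G n g ` zvec n = carrier G" using gp by (simp_all add: gpair_def)
      have eqiff: "Fm G n g v = Fm G n g w \<longleftrightarrow> Fm G n g0 v = Fm G n g0 w" if "v \<in> zvec n" "w \<in> zvec n" for v w
      proof -
        have z: "(\<lambda>i. v i - w i) \<in> zvec n" using that by simp
        have "Fm G n g v = Fm G n g w \<longleftrightarrow> Fm G n g (\<lambda>i. v i - w i) = \<zero>\<^bsub>G\<^esub>"
          unfolding G.Fm_diff[OF g'] using G.minus_eq_zero_iff[OF G.Fm_closed[OF g'] G.Fm_closed[OF g']] by simp
        also have "\<dots> \<longleftrightarrow> Fm G n g0 (\<lambda>i. v i - w i) = \<zero>\<^bsub>G\<^esub>" unfolding kz[OF g' gp z] kz[OF g0c g0(2) z] ..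
        also have "\<dots> \<longleftrightarrow> Fm G n g0 v = Fm G n g0 w"
          unfolding G.Fm_diff[OF g0c] using G.minus_eq_zero_iff[OF G.Fm_closed[OF g0c] G.Fm_closed[OF g0c]] by simp
        finally show ?thesis .
      qed
      \<comment> \<open>F composed with a choice of preimages under F0; the equality of the kernels,
        in the form of \<open>eqiff\<close>, makes the choice immaterial.\<close>
      define \<alpha> where "\<alpha> = (\<lambda>x\<in>carrier G. Fm G n g (SOME v. v \<in> zvec n \<and> x = Fm G n g0 v))"
      have av: "\<alpha> (Fm G n g0 v) = Fm G n g v" if v: "v \<in> zvec n" for v
      proof -
        let ?w = "SOME w. w \<in> zvec n \<and> Fm G n g0 v = Fm G n g0 w"
        have "?w \<in> zvec n \<and> Fm G n g0 v = Fm G n g0 ?w" 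
          by (rule someI[of "\<lambda>w. w \<in> zvec n \<and> Fm G n g0 v = Fm G n g0 w" v]) (rule conjI[OF v refl])
        then have "Fm G n g ?w = Fm G n g v" using eqiff[of ?w v] v by simp
        then show ?thesis using G.Fm_closed[OF g0c] by (simp add: \<alpha>_def)
      qed
      have ta: "thom G G \<alpha>" unfolding thom_def
      proof (intro conjI ballI)
        show "\<alpha> \<in> carrier G \<rightarrow> carrier G" using G.Fm_closed[OF g'] by (simp add: \<alpha>_def Pi_iff)
        fix x assume x: "x \<in> carrier G"
        obtain v where v: "v \<in> zvec n" "x = Fm G n g0 v" using rep[OF x] by (elim bexE)
        have "tact G x = Fm G n g0 (tact (VM 0 n A) v)" unfolding v(2) using thomD(3)[OF F0t, of v] v(1) by simp
        then show "\<alpha> (tact G x) = tact G (\<alpha> x)" using av[OF VM0_T_closed] av[OF v(1)] thomD(3)[OF t, of v] v by simp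
        fix y assume y: "y \<in> carrier G"
        obtain w where w: "w \<in> zvec n" "y = Fm G n g0 w" using rep[OF y] by (elim bexE)
        have z: "(\<lambda>i. v i + w i) \<in> zvec n" using v(1) w(1) by simp
        show "\<alpha> (x \<oplus>\<^bsub>G\<^esub> y) = \<alpha> x \<oplus>\<^bsub>G\<^esub> \<alpha> y"
          unfolding v(2) w(2) G.Fm_add[OF g0c, symmetric] av[OF z] av[OF v(1)] av[OF w(1)] by (rule G.Fm_add[OF g'])
      qed
      have "bij_betw \<alpha> (carrier G) (carrier G)" unfolding bij_betw_def
      proof
        show "inj_on \<alpha> (carrier G)"
        proof (rule inj_onI)
          fix x y assume xy: "x \<in> carrier G" "y \<in> carrier G" "\<alpha> x = \<alpha> y"
          obtain v where v: "v \<in> zvec n" "x = Fm G n g0 v" using rep[OF xy(1)] by (elim bexE)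
          obtain w where w: "w \<in> zvec n" "y = Fm G n g0 w" using rep[OF xy(2)] by (elim bexE)
          show "x = y" using xy(3) unfolding v(2) w(2) av[OF v(1)] av[OF w(1)] eqiff[OF v(1) w(1)] .
        qed
        have "\<alpha> ` carrier G = Fm G n g ` zvec n" unfolding F0s[symmetric] image_image by (rule image_cong[OF refl av])
        then show "\<alpha> ` carrier G = carrier G" unfolding s .
      qed
      then have "\<alpha> \<in> TIso G G" using ta unfolding TIso_def THom_def thom_def
        by (simp add: PiE_def) (simp add: \<alpha>_def)
      moreover have "?res \<alpha> = g"
      proof
        fix i
        show "?res \<alpha> i = g i"
        proof (cases "i < n")
          case True
          then show ?thesis using av[OF uv_zvec[OF True]] G.Fm_uv[OF g0c True] G.Fm_uv[OF g' True] by simp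
        next
          case False
          then show ?thesis using gc by (simp add: PiE_iff extensional_def)
        qed
      qed
      ultimately show "g \<in> ?res ` TIso G G" by (metis image_eqI)
    qed
  qed
  then show ?thesis using bij_betw_same_card by fastforce
qed

text \<open>Pairs are grouped by their matrix. Over a matrix that admits an F for every j, the
  families form a product of sets of size |Aut(G_j)|; over any other matrix some factor is
  empty.\<close>

lemma card_goods:
  assumes J: "finite J" and m: "m > 0"
    and G: "\<And>j. j \<in> J \<Longrightarrow> tgroup (G j) \<and> finite (carrier (G j))"
    and mG: "\<And>j x. \<lbrakk>j \<in> J; x \<in> carrier (G j)\<rbrakk> \<Longrightarrow> add_pow (G j) m x = \<zero>\<^bsub>G j\<^esub>"
    and PG: "\<And>j x. \<lbrakk>j \<in> J; x \<in> carrier (G j)\<rbrakk> \<Longrightarrow> act (G j) (P j) x = \<zero>\<^bsub>G j\<^esub>"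
  shows "card (goods m n J P G) =
    card {A \<in> IM m n. \<forall>j\<in>J. \<exists>g\<in>{..<n} \<rightarrow>\<^sub>E carrier (G j). gpair m n (P j) (G j) A g} * (\<Prod>j\<in>J. card (TIso (G j) (G j)))"
proof -
  let ?S = "\<lambda>A j. {g \<in> {..<n} \<rightarrow>\<^sub>E carrier (G j). gpair m n (P j) (G j) A g}"
  let ?E = "{A \<in> IM m n. \<forall>j\<in>J. \<exists>g\<in>{..<n} \<rightarrow>\<^sub>E carrier (G j). gpair m n (P j) (G j) A g}"
  have "goods m n J P G = (SIGMA A : IM m n. \<Pi>\<^sub>E j\<in>J. ?S A j)"
  proof (rule Set.set_eqI)
    fix x :: "(nat \<Rightarrow> nat \<Rightarrow> int) \<times> (nat \<Rightarrow> nat \<Rightarrow> 'a)"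
    obtain A g where x: "x = (A, g)" by (cases x)
    show "x \<in> goods m n J P G \<longleftrightarrow> x \<in> (SIGMA A : IM m n. \<Pi>\<^sub>E j\<in>J. ?S A j)"
      unfolding x goods_def mem_Collect_eq prod.case mem_Sigma_iff PiE_iff[of g J] ball_conj_distrib by argo
  qed
  then have "card (goods m n J P G) = (\<Sum>A\<in>IM m n. card (\<Pi>\<^sub>E j\<in>J. ?S A j))"
  proof (simp, intro card_SigmaI ballI finite_PiE J)
    show "finite (IM m n)" by (rule card_IM(1)[OF m])
    fix A j assume "j \<in> J"
    then have "finite ({..<n} \<rightarrow>\<^sub>E carrier (G j))" using G by (intro finite_PiE) auto
    then show "finite (?S A j)" by simp
  qed
  also have "\<dots> = (\<Sum>A\<in>IM m n. \<Prod>j\<in>J. card (?S A j))" using J by (simp add: card_PiE)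
  also have "\<dots> = (\<Sum>A\<in>?E. \<Prod>j\<in>J. card (?S A j))"
  proof (rule sum.mono_neutral_right)
    show "finite (IM m n)" by (rule card_IM(1)[OF m])
    show "\<forall>A\<in>IM m n - ?E. (\<Prod>j\<in>J. card (?S A j)) = 0"
    proof
      fix A assume "A \<in> IM m n - ?E"
      then obtain j where j: "j \<in> J" "\<forall>g\<in>{..<n} \<rightarrow>\<^sub>E carrier (G j). \<not> gpair m n (P j) (G j) A g" by blast
      have "?S A j = {}"
      proof (rule equals0I)
        fix g assume "g \<in> ?S A j"
        then have "g \<in> {..<n} \<rightarrow>\<^sub>E carrier (G j)" "gpair m n (P j) (G j) A g" by simp_all
        then show False using bspec[OF j(2), of g] by simp
      qed
      then have "card (?S A j) = 0" by (simp only: card.empty)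
      then show "(\<Prod>j\<in>J. card (?S A j)) = 0" using J j(1) by (simp only: prod_zero_iff) blast
    qed
  qed blast
  also have "\<dots> = (\<Sum>A\<in>?E. \<Prod>j\<in>J. card (TIso (G j) (G j)))"
  proof (intro sum.cong prod.cong refl)
    fix A j assume A: "A \<in> ?E" and j: "j \<in> J"
    then have "\<exists>g\<in>{..<n} \<rightarrow>\<^sub>E carrier (G j). gpair m n (P j) (G j) A g" by simp
    then obtain g where "g \<in> {..<n} \<rightarrow>\<^sub>E carrier (G j)" "gpair m n (P j) (G j) A g" by (elim bexE)
    then show "card (?S A j) = card (TIso (G j) (G j))"
      by (intro card_gpair[OF G[OF j, THEN conjunct1] mG[OF j] PG[OF j]])
  qed
  finally show ?thesis by simp
qed

context multi
begin

lemma gb_closed: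
  assumes "gb \<in> (\<Pi>\<^sub>E j\<in>J. {..<n} \<rightarrow>\<^sub>E carrier (Gb j))" "j \<in> J" shows "gb j \<in> {..<n} \<rightarrow> carrier (Gb j)"
  using assms by (simp add: PiE_iff Pi_iff)

text \<open>The columns of E can be chosen independently; each is a simultaneous preimage given by
  \<open>joint_surj\<close>.\<close>

lemma columns_exist:
  assumes g: "\<And>j. j \<in> J \<Longrightarrow> g j \<in> {..<n} \<rightarrow> carrier (G j)"
    and gb: "\<And>j i. \<lbrakk>j \<in> J; i < n\<rbrakk> \<Longrightarrow> gb j i = \<kappa> j (g j i)"
    and gp: "\<And>j. j \<in> J \<Longrightarrow> gpair p n (P j) (Gb j) Ab (gb j)"
    and y: "\<And>j i. \<lbrakk>j \<in> J; i < n\<rbrakk> \<Longrightarrow> y j i \<in> carrier (G j)"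
  shows "\<exists>E. \<forall>i<n. \<forall>j\<in>J. Fm (G j) n (g j) (col n E i) = y j i"
proof -
  have "\<exists>v. v \<in> zvec n \<and> (\<forall>j\<in>J. Fm (G j) n (g j) v = y j i)" if "i < n" for i
    using joint_surj[OF g gb gp, of "\<lambda>j. y j i"] y that by (simp add: Bex_def)
  then have "\<forall>i\<in>{..<n}. \<exists>v. v \<in> zvec n \<and> (\<forall>j\<in>J. Fm (G j) n (g j) v = y j i)" by (intro ballI) (simp only: lessThan_iff)
  from bchoice[OF this] obtain z where z0: "\<forall>i\<in>{..<n}. z i \<in> zvec n \<and> (\<forall>j\<in>J. Fm (G j) n (g j) (z i) = y j i)" by (elim exE)
  have z: "z i \<in> zvec n \<and> (\<forall>j\<in>J. Fm (G j) n (g j) (z i) = y j i)" if "i < n" for i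
    by (rule bspec[OF z0]) (simp add: that)
  have "col n (\<lambda>k i. z i k) i = z i" if "i < n" for i
    using z[OF that] by (auto simp: col_def fun_eq_iff)
  then show ?thesis using z by (intro exI[of _ "\<lambda>k i. z i k"]) simp
qed

lemma card_kappa_fibre:
  assumes "j \<in> J" "y \<in> carrier (Gb j)"
  shows "card {x \<in> carrier (G j). \<kappa> j x = y} = card {x \<in> carrier (G j). \<kappa> j x = \<zero>\<^bsub>Gb j\<^esub>}"
proof -
  interpret S: sglq "G j" p n N "P j" "Gb j" "\<kappa> j" by (rule sq[OF assms(1)])
  interpret B: tgroup "Gb j" by (rule S.tg_Gb)
  obtain x0 where x0: "x0 \<in> carrier (G j)" "y = \<kappa> j x0" using assms(2) unfolding S.\<kappa>_surj[symmetric] by blast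
  note k = thomD[OF S.\<kappa>] thom_maps[OF S.tgroup_axioms S.tg_Gb S.\<kappa>]
  have "bij_betw (\<lambda>x. x \<oplus>\<^bsub>G j\<^esub> x0) {x \<in> carrier (G j). \<kappa> j x = \<zero>\<^bsub>Gb j\<^esub>} {x \<in> carrier (G j). \<kappa> j x = y}"
  proof (rule bij_betw_byWitness[where f' = "\<lambda>x. x \<ominus>\<^bsub>G j\<^esub> x0"])
    show "\<forall>x\<in>{x \<in> carrier (G j). \<kappa> j x = \<zero>\<^bsub>Gb j\<^esub>}. x \<oplus>\<^bsub>G j\<^esub> x0 \<ominus>\<^bsub>G j\<^esub> x0 = x" using x0 by (simp add: S.add_minus_cancel)
    show "\<forall>x\<in>{x \<in> carrier (G j). \<kappa> j x = y}. x \<ominus>\<^bsub>G j\<^esub> x0 \<oplus>\<^bsub>G j\<^esub> x0 = x" using x0 by (simp add: S.minus_add_cancel)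
    show "(\<lambda>x. x \<oplus>\<^bsub>G j\<^esub> x0) ` {x \<in> carrier (G j). \<kappa> j x = \<zero>\<^bsub>Gb j\<^esub>} \<subseteq> {x \<in> carrier (G j). \<kappa> j x = y}"
      using x0 assms(2) by (intro image_subsetI) (simp add: k(2))
    show "(\<lambda>x. x \<ominus>\<^bsub>G j\<^esub> x0) ` {x \<in> carrier (G j). \<kappa> j x = y} \<subseteq> {x \<in> carrier (G j). \<kappa> j x = \<zero>\<^bsub>Gb j\<^esub>}"
      using x0 assms(2) by (intro image_subsetI) (simp add: k(7) B.minus_eq_zero_iff)
  qed
  then show ?thesis using bij_betw_same_card by fastforce
qed

end

section \<open>Lifts of one fixed good pair modulo p\<close>

locale fib = multi p n N J G P Gb \<kappa>
  for p :: int and n N :: nat and J :: "nat set"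
    and G :: "nat \<Rightarrow> ('a, 'b, 'c) tmodule_scheme" and P :: "nat \<Rightarrow> int poly"
    and Gb :: "nat \<Rightarrow> ('d, 'e, 'f) tmodule_scheme" and \<kappa> :: "nat \<Rightarrow> 'b \<Rightarrow> 'e" +
  fixes Ab :: "nat \<Rightarrow> nat \<Rightarrow> int" and gb :: "nat \<Rightarrow> nat \<Rightarrow> 'e"
  assumes good: "(Ab, gb) \<in> goods p n J P Gb"
begin

definition LA where "LA = {A \<in> IM (p ^ N) n. \<forall>i k. A i k mod p = Ab i k}"
definition LG where "LG = (\<Pi>\<^sub>E j\<in>J. \<Pi>\<^sub>E i\<in>{..<n}. {x \<in> carrier (G j). \<kappa> j x = gb j i})"
text \<open>Families of n-tuples in the groups p G_j. They are the possible values of the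
  obstruction F A - t F for lifts of the fixed pair and, up to translation, also the lifts of
  \<open>gb\<close>.\<close>

definition B0 where "B0 = (\<Pi>\<^sub>E j\<in>J. \<Pi>\<^sub>E i\<in>{..<n}. {x \<in> carrier (G j). \<kappa> j x = \<zero>\<^bsub>Gb j\<^esub>})"
definition S where "S g = {A \<in> LA. \<forall>j\<in>J. thom (VM 0 n A) (G j) (Fm (G j) n (g j))}"
definition TH where "TH j = THom (Vmod p n (P j) Ab) (Wmod p (G j))"
definition TI where "TI j = TIso (Vmod p n (P j) Ab) (Wmod p (G j))"

lemma Ab: "Ab \<in> IM p n" and gbE: "gb \<in> (\<Pi>\<^sub>E j\<in>J. {..<n} \<rightarrow>\<^sub>E carrier (Gb j))"
  and gp: "j \<in> J \<Longrightarrow> gpair p n (P j) (Gb j) Ab (gb j)"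
  using good by (simp_all add: goods_def)

lemma gbc: "j \<in> J \<Longrightarrow> gb j \<in> {..<n} \<rightarrow> carrier (Gb j)"
  by (rule gb_closed[OF gbE])

lemma gbi: "j \<in> J \<Longrightarrow> i < n \<Longrightarrow> gb j i \<in> carrier (Gb j)"
  using gbc by (simp add: Pi_iff)

lemma LGD:
  assumes "g \<in> LG" "j \<in> J"
  shows "g j \<in> {..<n} \<rightarrow> carrier (G j)" "i < n \<Longrightarrow> gb j i = \<kappa> j (g j i)" "i < n \<Longrightarrow> g j i \<in> carrier (G j)"
proof -
  have "g j \<in> (\<Pi>\<^sub>E i\<in>{..<n}. {x \<in> carrier (G j). \<kappa> j x = gb j i})" using assms unfolding LG_def by (rule PiE_mem)
  then have *: "g j i \<in> {x \<in> carrier (G j). \<kappa> j x = gb j i}" if "i < n" for i using that by (simp add: PiE_iff)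
  show "g j \<in> {..<n} \<rightarrow> carrier (G j)" using * by (simp add: Pi_iff)
  show "i < n \<Longrightarrow> gb j i = \<kappa> j (g j i)" "i < n \<Longrightarrow> g j i \<in> carrier (G j)" using *[of i] by simp_all
qed

lemma LAD:
  assumes "A \<in> LA"
  shows "A \<in> IM (p ^ N) n" "A i k mod p = Ab i k" "A i k mod p = Ab i k mod p"
  using assms p_pos(1) Ab unfolding LA_def by (simp_all) (metis mod_mod_trivial)

lemma finLA: "finite LA"
  unfolding LA_def using card_IM(1)[OF p_pos(2)] by simp

lemma finS: "finite (S g)"
  unfolding S_def using finLA by simp

lemma finG: "j \<in> J \<Longrightarrow> finite (carrier (G j))"
  using sgl.fin[OF sglq.axioms(1)[OF sq]] .

lemma finB0: "finite B0"
  unfolding B0_def by (intro finite_PiE J) (simp_all add: finG)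

lemma finLG: "finite LG"
  unfolding LG_def by (intro finite_PiE J) (simp_all add: finG)

lemma card_LG: "card LG = card B0"
  unfolding LG_def B0_def using J by (simp add: card_PiE card_kappa_fibre gbi)

lemma B0_pos: "card B0 > 0"
proof -
  have "(\<lambda>j\<in>J. \<lambda>i\<in>{..<n}. \<zero>\<^bsub>G j\<^esub>) \<in> B0" unfolding B0_def
  proof (intro restrict_PiE_iff[THEN iffD2] ballI CollectI conjI)
    fix j i assume j: "j \<in> J"
    interpret S: sglq "G j" p n N "P j" "Gb j" "\<kappa> j" by (rule sq[OF j])
    show "\<zero>\<^bsub>G j\<^esub> \<in> carrier (G j)" by simp
    show "\<kappa> j \<zero>\<^bsub>G j\<^esub> = \<zero>\<^bsub>Gb j\<^esub>" by (rule thom_maps(1)[OF S.tgroup_axioms S.tg_Gb S.\<kappa>])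
  qed
  then show ?thesis using finB0 by (metis card_gt_0_iff empty_iff)
qed

lemma tr_LA: "A \<in> LA \<Longrightarrow> tr (\<lambda>i k. p * E i k) A \<in> LA"
proof -
  assume A: "A \<in> LA"
  let ?T = "tr (\<lambda>i k. p * E i k) A"
  have "?T i k mod p = Ab i k" for i k
  proof (cases "i < n \<and> k < n")
    case True
    then show ?thesis using LAD(2)[OF A, of i k] by (simp add: tr_mod)
  next
    case False
    then have "?T i k = 0" "Ab i k = 0" using Ab by (simp_all only: tr_def IM_def if_False mem_Collect_eq not_False_eq_True simp_thms)
    then show ?thesis by simp
  qed
  then show ?thesis unfolding LA_def using tr_IM by simp
qed

text \<open>The obstruction F A - t F lies in \<open>B0\<close>, because it vanishes modulo p.
  Adding p E shifts it by p F E, and F E is arbitrary by joint surjectivity; so every value in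
  \<open>B0\<close> occurs equally often, in particular zero.\<close>

lemma card_S:
  assumes g: "g \<in> LG"
  shows "card (S g) * card B0 = card LA"
proof -
  let ?f = "\<lambda>A. \<lambda>j\<in>J. \<lambda>i\<in>{..<n}. Fm (G j) n (g j) (col n A i) \<ominus>\<^bsub>G j\<^esub> tact (G j) (g j i)"
  let ?z = "\<lambda>j\<in>J. \<lambda>i\<in>{..<n}. \<zero>\<^bsub>G j\<^esub>"
  have fe: "?f A j i = Fm (G j) n (g j) (col n A i) \<ominus>\<^bsub>G j\<^esub> tact (G j) (g j i)" if "j \<in> J" "i < n" for A j i
    using that by simp
  have "{A \<in> LA. ?f A \<in> {?z}} = S g"
  proof -
    have "?f A = ?z \<longleftrightarrow> (\<forall>j\<in>J. thom (VM 0 n A) (G j) (Fm (G j) n (g j)))" for A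
    proof -
      have "?f A = ?z \<longleftrightarrow> (\<forall>j\<in>J. \<forall>i<n. Fm (G j) n (g j) (col n A i) \<ominus>\<^bsub>G j\<^esub> tact (G j) (g j i) = \<zero>\<^bsub>G j\<^esub>)"
      proof
        assume e: "?f A = ?z"
        show "\<forall>j\<in>J. \<forall>i<n. Fm (G j) n (g j) (col n A i) \<ominus>\<^bsub>G j\<^esub> tact (G j) (g j i) = \<zero>\<^bsub>G j\<^esub>"
        proof (intro ballI allI impI)
          fix j i assume "j \<in> J" "i < n"
          then show "Fm (G j) n (g j) (col n A i) \<ominus>\<^bsub>G j\<^esub> tact (G j) (g j i) = \<zero>\<^bsub>G j\<^esub>"
            using fun_cong[OF fun_cong[OF e, of j], of i] by simp
        qed
      qed (simp add: fun_eq_iff restrict_def)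
      also have "\<dots> \<longleftrightarrow> (\<forall>j\<in>J. thom (VM 0 n A) (G j) (Fm (G j) n (g j)))"
      proof (rule ball_cong[OF refl])
        fix j assume j: "j \<in> J"
        interpret S: sglq "G j" p n N "P j" "Gb j" "\<kappa> j" by (rule sq[OF j])
        have "Fm (G j) n (g j) (col n A i) \<ominus>\<^bsub>G j\<^esub> tact (G j) (g j i) = \<zero>\<^bsub>G j\<^esub> \<longleftrightarrow> Fm (G j) n (g j) (col n A i) = tact (G j) (g j i)"
          if "i < n" for i
          using LGD[OF g j] that by (intro S.minus_eq_zero_iff) auto
        then show "(\<forall>i<n. Fm (G j) n (g j) (col n A i) \<ominus>\<^bsub>G j\<^esub> tact (G j) (g j i) = \<zero>\<^bsub>G j\<^esub>) \<longleftrightarrow>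
           thom (VM 0 n A) (G j) (Fm (G j) n (g j))" unfolding S.thom_iff_col[OF LGD(1)[OF g j]] by simp
      qed
      finally show ?thesis .
    qed
    then show ?thesis unfolding S_def by simp
  qed
  moreover have "card {A \<in> LA. ?f A \<in> {?z}} * card B0 = card LA * card {?z}"
  proof (rule equal_fibres_card[OF finLA finB0])
    show "?f \<in> LA \<rightarrow> B0"
    proof
      fix A assume A: "A \<in> LA"
      show "?f A \<in> B0" unfolding B0_def
      proof (intro restrict_PiE_iff[THEN iffD2] ballI CollectI conjI)
        fix j i assume j: "j \<in> J" and "i \<in> {..<n}"
        then have i: "i < n" by simp
        interpret S: sglq "G j" p n N "P j" "Gb j" "\<kappa> j" by (rule sq[OF j])
        interpret B: tgroup "Gb j" by (rule S.tg_Gb)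
        have c: "Fm (G j) n (g j) (col n A i) \<in> carrier (G j)" "tact (G j) (g j i) \<in> carrier (G j)"
          using LGD[OF g j] i by auto
        then show "Fm (G j) n (g j) (col n A i) \<ominus>\<^bsub>G j\<^esub> tact (G j) (g j i) \<in> carrier (G j)" by simp
        have z: "col n A i \<in> zvec n" "col n Ab i \<in> zvec n" by (simp_all add: col_def)
        have "\<kappa> j (Fm (G j) n (g j) (col n A i)) = Fm (Gb j) n (gb j) (col n A i)"
          by (rule S.Fm_Gb[OF LGD(1)[OF g j] LGD(2)[OF g j] z(1), symmetric])
        also have "\<dots> = Fm (Gb j) n (gb j) (col n Ab i)"
          by (rule B.Fm_eq_mod[OF gbc[OF j] S.Gb_p]) (simp_all add: col_def LAD(3)[OF A])
        also have "\<dots> = tact (Gb j) (gb j i)"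
          using gp[OF j] B.thom_iff_col[OF gbc[OF j]] i by (simp add: gpair_def)
        also have "\<dots> = \<kappa> j (tact (G j) (g j i))"
          using thomD(3)[OF S.\<kappa> LGD(3)[OF g j i]] LGD(2)[OF g j i] by simp
        finally show "\<kappa> j (Fm (G j) n (g j) (col n A i) \<ominus>\<^bsub>G j\<^esub> tact (G j) (g j i)) = \<zero>\<^bsub>Gb j\<^esub>"
          using thom_maps(4)[OF S.tgroup_axioms S.tg_Gb S.\<kappa> c] thomD(1)[OF S.\<kappa> c(2)] by (simp add: B.minus_eq_zero_iff)
      qed
    qed
    show "{?z} \<subseteq> B0"
    proof -
      have "?z \<in> B0" unfolding B0_def
      proof (intro restrict_PiE_iff[THEN iffD2] ballI CollectI conjI)
        fix j i assume j: "j \<in> J"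
        interpret S: sglq "G j" p n N "P j" "Gb j" "\<kappa> j" by (rule sq[OF j])
        show "\<zero>\<^bsub>G j\<^esub> \<in> carrier (G j)" by simp
        show "\<kappa> j \<zero>\<^bsub>G j\<^esub> = \<zero>\<^bsub>Gb j\<^esub>" by (rule thom_maps(1)[OF S.tgroup_axioms S.tg_Gb S.\<kappa>])
      qed
      then show ?thesis by simp
    qed
    fix b b' assume b: "b \<in> B0" "b' \<in> B0"
    have bm: "c j i \<in> carrier (G j) \<and> \<kappa> j (c j i) = \<zero>\<^bsub>Gb j\<^esub>" if "c \<in> B0" "j \<in> J" "i < n" for c j i
    proof -
      have "c j \<in> (\<Pi>\<^sub>E i\<in>{..<n}. {x \<in> carrier (G j). \<kappa> j x = \<zero>\<^bsub>Gb j\<^esub>})" by (rule PiE_mem[OF that(1)[unfolded B0_def] that(2)])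
      then have "c j i \<in> {x \<in> carrier (G j). \<kappa> j x = \<zero>\<^bsub>Gb j\<^esub>}" using that(3) by (simp add: PiE_iff)
      then show ?thesis by simp
    qed
    \<comment> \<open>Both b and b' have entries in p G_j, so they differ by some p e, and e
      prescribes the columns of F E.\<close>
    have "\<exists>e. e \<in> carrier (G j) \<and> b' j i = b j i \<oplus>\<^bsub>G j\<^esub> add_pow (G j) p e" if ji: "j \<in> J" "i < n" for j i
    proof -
      interpret S: sglq "G j" p n N "P j" "Gb j" "\<kappa> j" by (rule sq[OF ji(1)])
      interpret B: tgroup "Gb j" by (rule S.tg_Gb)
      note bb = bm[OF b(1) ji] bm[OF b(2) ji]
      have c: "b' j i \<ominus>\<^bsub>G j\<^esub> b j i \<in> carrier (G j)" using bb by simp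
      have "\<kappa> j (b' j i \<ominus>\<^bsub>G j\<^esub> b j i) = \<zero>\<^bsub>Gb j\<^esub>"
        using thom_maps(4)[OF S.tgroup_axioms S.tg_Gb S.\<kappa>, of "b' j i" "b j i"] bb by (simp add: B.minus_eq_zero_iff)
      then obtain e where e: "e \<in> carrier (G j)" "b' j i \<ominus>\<^bsub>G j\<^esub> b j i = add_pow (G j) p e"
        unfolding S.\<kappa>_ker[OF c] by (elim bexE)
      have "b' j i = b j i \<oplus>\<^bsub>G j\<^esub> add_pow (G j) p e" unfolding e(2)[symmetric] using bb by (simp add: S.add_minus_cancel_left)
      then show ?thesis using e(1) by blast
    qed
    then obtain e where e: "\<And>j i. \<lbrakk>j \<in> J; i < n\<rbrakk> \<Longrightarrow> e j i \<in> carrier (G j) \<and> b' j i = b j i \<oplus>\<^bsub>G j\<^esub> add_pow (G j) p (e j i)"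
      by metis
    obtain E where E: "\<And>i j. \<lbrakk>i < n; j \<in> J\<rbrakk> \<Longrightarrow> Fm (G j) n (g j) (col n E i) = e j i"
      using columns_exist[OF LGD(1)[OF g] LGD(2)[OF g] gp, of e] e by blast
    let ?h = "tr (\<lambda>i k. p * E i k)"
    have "?f (?h A) = b'" if A: "A \<in> LA" "?f A = b" for A
    proof (intro ext)
      fix j i
      show "?f (?h A) j i = b' j i"
      proof (cases "j \<in> J \<and> i < n")
        case True
        then have ji: "j \<in> J" "i < n" by auto
        interpret S: sglq "G j" p n N "P j" "Gb j" "\<kappa> j" by (rule sq[OF ji(1)])
        have c: "Fm (G j) n (g j) (col n A i) \<in> carrier (G j)" "tact (G j) (g j i) \<in> carrier (G j)" "e j i \<in> carrier (G j)"
          using LGD[OF g ji(1)] ji e[OF ji] by auto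
        have "?f (?h A) j i = (Fm (G j) n (g j) (col n A i) \<oplus>\<^bsub>G j\<^esub> add_pow (G j) p (e j i)) \<ominus>\<^bsub>G j\<^esub> tact (G j) (g j i)"
          unfolding fe[OF ji] Fm_col_tr[OF ji(1) LGD(1)[OF g ji(1)] ji(2)] E[OF ji(2,1)] ..
        also have "\<dots> = (Fm (G j) n (g j) (col n A i) \<ominus>\<^bsub>G j\<^esub> tact (G j) (g j i)) \<oplus>\<^bsub>G j\<^esub> add_pow (G j) p (e j i)"
          using c by (simp add: a_minus_def S.a_ac)
        also have "\<dots> = b' j i" using fe[OF ji, of A] A(2) e[OF ji] by metis
        finally show ?thesis .
      next
        case False
        have "b' \<in> B0" by (rule b(2))
        \<comment> \<open>Outside the index ranges both sides are the default values of
          \<open>PiE\<close>.\<close>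
        then have "b' j i = ?z j i" using False unfolding B0_def by (cases "j \<in> J") (auto simp: PiE_iff extensional_def)
        then show ?thesis using False by (simp add: restrict_def)
      qed
    qed
    then have "?h ` {A \<in> LA. ?f A = b} \<subseteq> {A \<in> LA. ?f A = b'}" using tr_LA by blast
    moreover have "inj_on ?h {A \<in> LA. ?f A = b}" by (rule inj_on_subset[OF tr_inj]) (auto simp: LA_def)
    ultimately show "\<exists>h. inj_on h {A \<in> LA. ?f A = b} \<and> h ` {A \<in> LA. ?f A = b} \<subseteq> {A \<in> LA. ?f A = b'}" by blast
  qed
  ultimately show ?thesis by simp
qed

text \<open>For each j, \<open>perturb_exists\<close> prescribes the columns of F_j E, and one
  matrix E realizes them for all j. Translation by p E then moves the fibre over one family of
  connecting maps into the fibre over any other.\<close>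

lemma card_S_iso:
  assumes g: "g \<in> LG" and fT: "\<And>j. j \<in> J \<Longrightarrow> finite (TH j)"
  shows "card {A \<in> S g. \<forall>j\<in>J. dmap p n (P j) (G j) (g j) A \<in> TI j} * (\<Prod>j\<in>J. card (TH j)) = card (S g) * (\<Prod>j\<in>J. card (TI j))"
proof -
  let ?f = "\<lambda>A. \<lambda>j\<in>J. dmap p n (P j) (G j) (g j) A"
  have SD: "A \<in> LA" "j \<in> J \<Longrightarrow> thom (VM 0 n A) (G j) (Fm (G j) n (g j))" if "A \<in> S g" for A j
    using that by (simp_all add: S_def)
  have V: "Vmod p n (P j) A = Vmod p n (P j) Ab" if "A \<in> LA" for A j
  proof -
    have "VM p n A = VM p n Ab" using LAD(3)[OF that] by (intro VM_cong_mod)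
    then show ?thesis by (simp add: Vmod_def Vset_def)
  qed
  have "card {A \<in> S g. ?f A \<in> (\<Pi>\<^sub>E j\<in>J. TI j)} * card (\<Pi>\<^sub>E j\<in>J. TH j) = card (S g) * card (\<Pi>\<^sub>E j\<in>J. TI j)"
  proof (rule equal_fibres_card[OF finS])
    show "finite (\<Pi>\<^sub>E j\<in>J. TH j)" by (intro finite_PiE J fT)
    show "(\<Pi>\<^sub>E j\<in>J. TI j) \<subseteq> (\<Pi>\<^sub>E j\<in>J. TH j)" by (rule PiE_mono) (simp add: TI_def TH_def TIso_def)
    show "?f \<in> S g \<rightarrow> (\<Pi>\<^sub>E j\<in>J. TH j)"
    proof (intro funcsetI restrict_PiE_iff[THEN iffD2] ballI)
      fix A j assume A: "A \<in> S g" and j: "j \<in> J"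
      interpret S: sglq "G j" p n N "P j" "Gb j" "\<kappa> j" by (rule sq[OF j])
      show "dmap p n (P j) (G j) (g j) A \<in> TH j"
        using S.dmap_THom[OF LGD(1)[OF g j] SD(2)[OF A j]] unfolding TH_def V[OF SD(1)[OF A]] .
    qed
    fix c c' assume c: "c \<in> (\<Pi>\<^sub>E j\<in>J. TH j)" "c' \<in> (\<Pi>\<^sub>E j\<in>J. TH j)"
    let ?Q = "\<lambda>j y. \<forall>A E A'.
      (\<forall>i<n. \<forall>k<n. A i k mod p = Ab i k mod p) \<and> thom (VM 0 n A) (G j) (Fm (G j) n (g j)) \<and> dmap p n (P j) (G j) (g j) A = c j \<and>
      (\<forall>i<n. Fm (G j) n (g j) (\<lambda>k. if k < n then E k i else 0) = y i) \<and> (\<forall>i<n. \<forall>k<n. A' i k = A i k + p * E i k) \<longrightarrow>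
      thom (VM 0 n A') (G j) (Fm (G j) n (g j)) \<and> dmap p n (P j) (G j) (g j) A' = c' j"
    have "\<forall>j\<in>J. \<exists>y. y \<in> {..<n} \<rightarrow> carrier (Wmod p (G j)) \<and> ?Q j y"
    proof
      fix j assume j: "j \<in> J"
      interpret S: sglq "G j" p n N "P j" "Gb j" "\<kappa> j" by (rule sq[OF j])
      have "c j \<in> THom (Vmod p n (P j) Ab) (Wmod p (G j))" "c' j \<in> THom (Vmod p n (P j) Ab) (Wmod p (G j))"
        using PiE_mem[OF c(1) j] PiE_mem[OF c(2) j] unfolding TH_def .
      from S.perturb_exists[OF LGD(1)[OF g j] this]
      show "\<exists>y. y \<in> {..<n} \<rightarrow> carrier (Wmod p (G j)) \<and> ?Q j y" unfolding Bex_def .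
    qed
    from bchoice[OF this] obtain y where y: "\<forall>j\<in>J. y j \<in> {..<n} \<rightarrow> carrier (Wmod p (G j)) \<and> ?Q j (y j)" by (elim exE)
    have yc: "y j i \<in> carrier (G j)" if "j \<in> J" "i < n" for j i
    proof -
      have "y j i \<in> carrier (Wmod p (G j))" using bspec[OF y that(1)] that(2) by (simp add: Pi_iff)
      then show ?thesis by (simp add: Wmod_def)
    qed
    have "\<exists>E. \<forall>i<n. \<forall>j\<in>J. Fm (G j) n (g j) (col n E i) = y j i"
      by (rule columns_exist[OF LGD(1)[OF g] LGD(2)[OF g] gp yc])
    then obtain E where E: "\<forall>i<n. \<forall>j\<in>J. Fm (G j) n (g j) (col n E i) = y j i" by (elim exE)
    let ?h = "tr (\<lambda>i k. p * E i k)"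
    have "?h A \<in> S g \<and> ?f (?h A) = c'" if A: "A \<in> S g" "?f A = c" for A
    proof -
      have AL: "A \<in> LA" by (rule SD(1)[OF A(1)])
      \<comment> \<open>The translate by \<open>tr\<close> equals A + p E' over the integers, and E'
        has the same values as E under every F_j.\<close>
      obtain E' where E': "\<And>i k. \<lbrakk>i < n; k < n\<rbrakk> \<Longrightarrow> ?h A i k = A i k + p * E' i k"
        "\<And>j g i. \<lbrakk>j \<in> J; g \<in> {..<n} \<rightarrow> carrier (G j); i < n\<rbrakk> \<Longrightarrow> Fm (G j) n g (col n E' i) = Fm (G j) n g (col n E i)"
        by (rule tr_diff[OF LAD(1)[OF AL], of E]) blast
      have *: "thom (VM 0 n (?h A)) (G j) (Fm (G j) n (g j)) \<and> dmap p n (P j) (G j) (g j) (?h A) = c' j" if j: "j \<in> J" for j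
      proof -
        have Q: "?Q j (y j)" by (rule conjunct2[OF bspec[OF y j]])
        have "dmap p n (P j) (G j) (g j) A = c j" using fun_cong[OF A(2), of j] j by simp
        moreover have "Fm (G j) n (g j) (\<lambda>k. if k < n then E' k i else 0) = y j i" if "i < n" for i
          using E'(2)[OF j LGD(1)[OF g j] that] E that j unfolding col_def by simp
        ultimately show ?thesis
          using Q[rule_format, of A E' "?h A"] LAD(3)[OF AL] SD(2)[OF A(1) j] E'(1) by simp
      qed
      have "?f (?h A) = c'"
      proof
        fix j show "?f (?h A) j = c' j"
        proof (cases "j \<in> J")
          case True then show ?thesis using * by simp
        next
          case False
          then have "c' j = undefined" by (rule PiE_arb[OF c(2)])
          then show ?thesis using False by simp
        qed
      qed
      moreover have "?h A \<in> S g" unfolding S_def mem_Collect_eq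
        by (intro conjI ballI tr_LA[OF AL] *[THEN conjunct1])
      ultimately show ?thesis by (intro conjI)
    qed
    then have "?h ` {A \<in> S g. ?f A = c} \<subseteq> {A \<in> S g. ?f A = c'}" by blast
    moreover have "inj_on ?h {A \<in> S g. ?f A = c}" by (rule inj_on_subset[OF tr_inj]) (auto simp: S_def LA_def)
    ultimately show "\<exists>h. inj_on h {A \<in> S g. ?f A = c} \<and> h ` {A \<in> S g. ?f A = c} \<subseteq> {A \<in> S g. ?f A = c'}" by blast
  qed
  moreover have "?f A \<in> (\<Pi>\<^sub>E j\<in>J. TI j) \<longleftrightarrow> (\<forall>j\<in>J. dmap p n (P j) (G j) (g j) A \<in> TI j)" for A
    by (simp only: restrict_PiE_iff)
  ultimately show ?thesis using J by (simp add: card_PiE)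
qed

text \<open>For each lift g of \<open>gb\<close> the compatible lifts A number |\<open>LA\<close>| /
  |\<open>B0\<close>|, and the proportion of good ones among them is the product of the
  |\<open>TI j\<close>| / |\<open>TH j\<close>|. The |\<open>B0\<close>| choices of g cancel the
  denominator.\<close>

lemma card_fibre:
  assumes fT: "\<And>j. j \<in> J \<Longrightarrow> finite (TH j)"
  shows "card {(A, g). A \<in> LA \<and> g \<in> LG \<and> (\<forall>j\<in>J. gpair (p ^ N) n (P j) (G j) A (g j))} * (\<Prod>j\<in>J. card (TH j)) =
    card LA * (\<Prod>j\<in>J. card (TI j))"
proof -
  let ?X = "{(A, g). A \<in> LA \<and> g \<in> LG \<and> (\<forall>j\<in>J. gpair (p ^ N) n (P j) (G j) A (g j))}"
  let ?I = "\<lambda>g. {A \<in> S g. \<forall>j\<in>J. dmap p n (P j) (G j) (g j) A \<in> TI j}"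
  have eq: "(\<forall>j\<in>J. gpair (p ^ N) n (P j) (G j) A (g j)) \<longleftrightarrow> A \<in> ?I g" if A: "A \<in> LA" and g: "g \<in> LG" for A g
  proof
    assume a: "\<forall>j\<in>J. gpair (p ^ N) n (P j) (G j) A (g j)"
    have "dmap p n (P j) (G j) (g j) A \<in> TI j" if j: "j \<in> J" for j
    proof -
      interpret S: sglq "G j" p n N "P j" "Gb j" "\<kappa> j" by (rule sq[OF j])
      show ?thesis unfolding TI_def
        by (rule S.gpair_reduce(2)[OF LGD(1)[OF g j] LGD(2)[OF g j] LAD(3)[OF A] bspec[OF a j]])
    qed
    then show "A \<in> ?I g" using a A by (simp add: S_def gpair_def)
  next
    assume a: "A \<in> ?I g"
    show "\<forall>j\<in>J. gpair (p ^ N) n (P j) (G j) A (g j)"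
    proof
      fix j assume j: "j \<in> J"
      interpret S: sglq "G j" p n N "P j" "Gb j" "\<kappa> j" by (rule sq[OF j])
      have t: "thom (VM 0 n A) (G j) (Fm (G j) n (g j))" "dmap p n (P j) (G j) (g j) A \<in> TIso (Vmod p n (P j) Ab) (Wmod p (G j))"
        using a j by (simp_all add: S_def TI_def)
      \<comment> \<open>Surjectivity of F_j is joint surjectivity with zero prescribed in the other
        components.\<close>
      have "x \<in> Fm (G j) n (g j) ` zvec n" if x: "x \<in> carrier (G j)" for x
      proof -
        have "\<exists>v\<in>zvec n. \<forall>k\<in>J. Fm (G k) n (g k) v = (if k = j then x else \<zero>\<^bsub>G k\<^esub>)"
        proof (rule joint_surj[OF LGD(1)[OF g] LGD(2)[OF g] gp])
          fix k assume k: "k \<in> J"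
          interpret S': sglq "G k" p n N "P k" "Gb k" "\<kappa> k" by (rule sq[OF k])
          show "(if k = j then x else \<zero>\<^bsub>G k\<^esub>) \<in> carrier (G k)" using x by simp
        qed
        then obtain v where v: "v \<in> zvec n" "\<forall>k\<in>J. Fm (G k) n (g k) v = (if k = j then x else \<zero>\<^bsub>G k\<^esub>)" by (elim bexE)
        then have "x = Fm (G j) n (g j) v" using j by simp
        then show ?thesis using v(1) by (rule image_eqI)
      qed
      then have s: "Fm (G j) n (g j) ` zvec n = carrier (G j)" using S.Fm_closed[OF LGD(1)[OF g j]] by blast
      show "gpair (p ^ N) n (P j) (G j) A (g j)"
        by (rule S.gpair_lift[OF LGD(1)[OF g j] LGD(2)[OF g j] LAD(3)[OF A] t(1) s gp[OF j] t(2)])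
    qed
  qed
  have "bij_betw prod.swap (SIGMA g : LG. ?I g) ?X"
  proof (rule bij_betw_byWitness[where f' = prod.swap])
    show "prod.swap ` (SIGMA g : LG. ?I g) \<subseteq> ?X"
    proof (rule image_subsetI)
      fix x assume "x \<in> (SIGMA g : LG. ?I g)"
      then obtain g A where x: "x = (g, A)" "g \<in> LG" "A \<in> ?I g" by (rule SigmaE)
      then have "A \<in> LA" by (simp add: S_def)
      then show "prod.swap x \<in> ?X" using eq[of A g] x by simp
    qed
    show "prod.swap ` ?X \<subseteq> (SIGMA g : LG. ?I g)"
    proof (rule image_subsetI)
      fix x assume "x \<in> ?X"
      then obtain A g where x: "x = (A, g)" "A \<in> LA" "g \<in> LG" "\<forall>j\<in>J. gpair (p ^ N) n (P j) (G j) A (g j)" by blast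
      then have "A \<in> ?I g" using eq[OF x(2,3)] by blast
      then show "prod.swap x \<in> (SIGMA g : LG. ?I g)" unfolding x(1) swap_simp using x(3) by (intro SigmaI)
    qed
  qed simp_all
  then have "card ?X = card (SIGMA g : LG. ?I g)" by (rule bij_betw_same_card[symmetric])
  also have "\<dots> = (\<Sum>g\<in>LG. card (?I g))" using finLG finS by (intro card_SigmaI) auto
  \<comment> \<open>Multiplied by |\<open>B0\<close>|, so that the count for each g becomes an
    identity between natural numbers.\<close>
  finally have "card ?X * (\<Prod>j\<in>J. card (TH j)) * card B0 = (\<Sum>g\<in>LG. card (?I g) * (\<Prod>j\<in>J. card (TH j)) * card B0)"
    by (simp add: sum_distrib_right)
  also have "\<dots> = (\<Sum>g\<in>LG. card LA * (\<Prod>j\<in>J. card (TI j)))"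
  proof (rule sum.cong[OF refl])
    fix g assume g: "g \<in> LG"
    show "card (?I g) * (\<Prod>j\<in>J. card (TH j)) * card B0 = card LA * (\<Prod>j\<in>J. card (TI j))"
    proof -
      have "card (?I g) * (\<Prod>j\<in>J. card (TH j)) * card B0 = card (S g) * (\<Prod>j\<in>J. card (TI j)) * card B0"
        using card_S_iso[OF g fT] by simp
      also have "\<dots> = card (S g) * card B0 * (\<Prod>j\<in>J. card (TI j))" by (simp only: mult_ac)
      finally show ?thesis unfolding card_S[OF g] .
    qed
  qed
  also have "\<dots> = card LA * (\<Prod>j\<in>J. card (TI j)) * card B0" by (simp add: card_LG)
  finally show ?thesis using B0_pos by simp
qed

end

context multi
begin

text \<open>Reduction maps good pairs modulo p^N to good pairs modulo p, and its fibres all have the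
  size computed in \<open>card_fibre\<close>. For each j the two products are the numbers of all and
  of bijective linear maps between spaces of dimension r_j.\<close>

lemma card_goods_ratio:
  assumes cG: "\<And>j. j \<in> J \<Longrightarrow> card (carrier (Gb j)) = (nat p ^ Polynomial.degree (P j)) ^ r j"
  defines "q \<equiv> \<lambda>j. nat p ^ Polynomial.degree (P j)"
  shows "card (goods (p ^ N) n J P G) * (\<Prod>j\<in>J. q j ^ ((r j)\<^sup>2)) * card (IM p n) =
    card (goods p n J P Gb) * card (IM (p ^ N) n) * (\<Prod>j\<in>J. \<Prod>i<r j. q j ^ r j - q j ^ i)"
proof -
  let ?X = "\<lambda>Ab gb. {(A, g). A \<in> fib.LA p n N Ab \<and> g \<in> fib.LG n J G \<kappa> gb \<and> (\<forall>j\<in>J. gpair (p ^ N) n (P j) (G j) A (g j))}"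
  let ?h = "\<Prod>j\<in>J. q j ^ ((r j)\<^sup>2)" and ?i = "\<Prod>j\<in>J. \<Prod>i<r j. q j ^ r j - q j ^ i"
  have fibre: "card (?X Ab gb) * ?h * card (IM p n) = card (IM (p ^ N) n) * ?i" if ag: "(Ab, gb) \<in> goods p n J P Gb" for Ab gb
  proof -
    interpret fib p n N J G P Gb \<kappa> Ab gb by unfold_locales (rule ag)
    have T: "card (TH j) = q j ^ ((r j)\<^sup>2) \<and> card (TI j) = (\<Prod>i<r j. q j ^ r j - q j ^ i) \<and> finite (TH j)" if j: "j \<in> J" for j
    proof -
      interpret S: sglq "G j" p n N "P j" "Gb j" "\<kappa> j" by (rule sq[OF j])
      have "card (carrier (Vmod p n (P j) Ab)) = card (carrier (Gb j))"
        using S.card_V[OF gp[OF j] gbc[OF j]] by (simp add: Vmod_def)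
      then have cV: "card (carrier (Vmod p n (P j) Ab)) = (nat p ^ Polynomial.degree (P j)) ^ r j" using cG[OF j] by simp
      have cW: "card (carrier (Wmod p (G j))) = (nat p ^ Polynomial.degree (P j)) ^ r j" using cG[OF j] S.card_W by simp
      show ?thesis unfolding TH_def TI_def q_def using card_THom_TIso[OF S.fq_V S.fq_W cV cW] by blast
    qed
    have "card (?X Ab gb) * (\<Prod>j\<in>J. card (TH j)) = card LA * (\<Prod>j\<in>J. card (TI j))"
      by (rule card_fibre) (use T in blast)
    then have "card (?X Ab gb) * ?h = card LA * ?i" using T by simp
    then have "card (?X Ab gb) * ?h * card (IM p n) = (card LA * card (IM p n)) * ?i" by (simp only: mult_ac)
    then show ?thesis unfolding LA_def card_lifts[OF Ab] .
  qed
  have fin1: "finite (goods p n J P Gb)" 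
  proof -
    have "finite (\<Pi>\<^sub>E j\<in>J. {..<n} \<rightarrow>\<^sub>E carrier (Gb j))"
      using fqspace.fin[OF sglq.fq_Gb[OF sq]] by (intro finite_PiE J) auto
    then have "finite (IM p n \<times> (\<Pi>\<^sub>E j\<in>J. {..<n} \<rightarrow>\<^sub>E carrier (Gb j)))" using card_IM(1)[OF p_pos(1)] by simp
    then show ?thesis by (rule finite_subset[rotated]) (auto simp: goods_def)
  qed
  let ?\<pi> = "\<lambda>(A, g). ((\<lambda>i k. A i k mod p), (\<lambda>j\<in>J. \<lambda>i\<in>{..<n}. \<kappa> j (g j i)))"
  have fibE: "(A, g) \<in> goods (p ^ N) n J P G \<and> ?\<pi> (A, g) = (Ab, gb) \<longleftrightarrow> (A, g) \<in> ?X Ab gb"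
    if ag: "(Ab, gb) \<in> goods p n J P Gb" for A g Ab gb
  proof -
    interpret fib p n N J G P Gb \<kappa> Ab gb by unfold_locales (rule ag)
    have "g \<in> LG \<longleftrightarrow> g \<in> (\<Pi>\<^sub>E j\<in>J. {..<n} \<rightarrow>\<^sub>E carrier (G j)) \<and> (\<lambda>j\<in>J. \<lambda>i\<in>{..<n}. \<kappa> j (g j i)) = gb"
    proof
      assume g: "g \<in> LG"
      have "g \<in> (\<Pi>\<^sub>E j\<in>J. {..<n} \<rightarrow>\<^sub>E carrier (G j))" using g unfolding LG_def by (auto simp: PiE_iff)
      moreover have "(\<lambda>j\<in>J. \<lambda>i\<in>{..<n}. \<kappa> j (g j i)) j i = gb j i" for j i
      proof (cases "j \<in> J \<and> i < n")
        case True then show ?thesis using LGD(2)[OF g, of j i] by simp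
      next
        case False
        then show ?thesis using gbE by (cases "j \<in> J") (auto simp: PiE_iff extensional_def)
      qed
      ultimately show "g \<in> (\<Pi>\<^sub>E j\<in>J. {..<n} \<rightarrow>\<^sub>E carrier (G j)) \<and> (\<lambda>j\<in>J. \<lambda>i\<in>{..<n}. \<kappa> j (g j i)) = gb"
        by (intro conjI ext)
    next
      assume g: "g \<in> (\<Pi>\<^sub>E j\<in>J. {..<n} \<rightarrow>\<^sub>E carrier (G j)) \<and> (\<lambda>j\<in>J. \<lambda>i\<in>{..<n}. \<kappa> j (g j i)) = gb"
      have "\<kappa> j (g j i) = gb j i" if "j \<in> J" "i < n" for j i
        using fun_cong[OF fun_cong[OF conjunct2[OF g], of j], of i] that by simp
      then show "g \<in> LG" using conjunct1[OF g] unfolding LG_def by (simp add: PiE_iff)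
    qed
    moreover have "A \<in> LA \<longleftrightarrow> A \<in> IM (p ^ N) n \<and> (\<lambda>i k. A i k mod p) = Ab" by (simp add: LA_def fun_eq_iff)
    ultimately show ?thesis unfolding goods_def by simp blast
  qed
  have into: "?\<pi> (A, g) \<in> goods p n J P Gb" if ag: "(A, g) \<in> goods (p ^ N) n J P G" for A g
  proof -
    have a: "A \<in> IM (p ^ N) n" "g \<in> (\<Pi>\<^sub>E j\<in>J. {..<n} \<rightarrow>\<^sub>E carrier (G j))" "\<And>j. j \<in> J \<Longrightarrow> gpair (p ^ N) n (P j) (G j) A (g j)"
      using ag by (auto simp: goods_def)
    have gc: "g j \<in> {..<n} \<rightarrow> carrier (G j)" if "j \<in> J" for j using a(2) that by (simp add: PiE_iff Pi_iff)
    have "(\<lambda>i k. A i k mod p) \<in> IM p n" using a(1) p_pos(1) by (simp add: IM_def)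
    moreover have "(\<lambda>j\<in>J. \<lambda>i\<in>{..<n}. \<kappa> j (g j i)) \<in> (\<Pi>\<^sub>E j\<in>J. {..<n} \<rightarrow>\<^sub>E carrier (Gb j))"
      using gc thomD(1)[OF sglq.\<kappa>[OF sq]] by (simp add: restrict_PiE_iff Pi_iff)
    moreover have "gpair p n (P j) (Gb j) (\<lambda>i k. A i k mod p) ((\<lambda>j\<in>J. \<lambda>i\<in>{..<n}. \<kappa> j (g j i)) j)" if j: "j \<in> J" for j
    proof -
      interpret S: sglq "G j" p n N "P j" "Gb j" "\<kappa> j" by (rule sq[OF j])
      show ?thesis by (rule S.gpair_reduce(1)[OF gc[OF j] _ _ a(3)[OF j]]) (use j in simp_all)
    qed
    ultimately show ?thesis by (simp add: goods_def)
  qed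
  have Xfin: "finite (?X Ab gb)" if ag: "(Ab, gb) \<in> goods p n J P Gb" for Ab gb
  proof -
    interpret fib p n N J G P Gb \<kappa> Ab gb by unfold_locales (rule ag)
    have "?X Ab gb \<subseteq> LA \<times> LG" by auto
    then show ?thesis by (rule finite_subset) (intro finite_cartesian_product finLA finLG)
  qed
  have "goods (p ^ N) n J P G = (\<Union>y\<in>goods p n J P Gb. ?X (fst y) (snd y))"
  proof (intro subset_antisym subsetI)
    fix x assume x: "x \<in> goods (p ^ N) n J P G"
    obtain A g where xe: "x = (A, g)" by (cases x)
    obtain Ab gb where y: "?\<pi> (A, g) = (Ab, gb)" by (rule prod.exhaust)
    have x': "(A, g) \<in> goods (p ^ N) n J P G" using x unfolding xe .
    have ag: "(Ab, gb) \<in> goods p n J P Gb" using into[OF x'] unfolding y .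
    have "x \<in> ?X Ab gb" unfolding xe by (rule fibE[OF ag, THEN iffD1, OF conjI[OF x' y]])
    then show "x \<in> (\<Union>y\<in>goods p n J P Gb. ?X (fst y) (snd y))" by (intro UN_I[OF ag]) simp
  next
    fix x assume "x \<in> (\<Union>y\<in>goods p n J P Gb. ?X (fst y) (snd y))"
    then obtain y where y: "y \<in> goods p n J P Gb" "x \<in> ?X (fst y) (snd y)" by blast
    obtain A g where xe: "x = (A, g)" by (cases x)
    have ag: "(fst y, snd y) \<in> goods p n J P Gb" using y(1) by simp
    show "x \<in> goods (p ^ N) n J P G" unfolding xe by (rule fibE[OF ag, THEN iffD2, THEN conjunct1]) (rule y(2)[unfolded xe])
  qed
  moreover have "card (\<Union>y\<in>goods p n J P Gb. ?X (fst y) (snd y)) = (\<Sum>y\<in>goods p n J P Gb. card (?X (fst y) (snd y)))"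
  proof (rule card_UN_disjoint[OF fin1])
    show "\<forall>y\<in>goods p n J P Gb. finite (?X (fst y) (snd y))"
    proof
      fix y assume "y \<in> goods p n J P Gb"
      then have "(fst y, snd y) \<in> goods p n J P Gb" by simp
      then show "finite (?X (fst y) (snd y))" by (rule Xfin)
    qed
    show "\<forall>y\<in>goods p n J P Gb. \<forall>z\<in>goods p n J P Gb. y \<noteq> z \<longrightarrow> ?X (fst y) (snd y) \<inter> ?X (fst z) (snd z) = {}"
    proof (intro ballI impI, rule ccontr)
      fix y z assume yz: "y \<in> goods p n J P Gb" "z \<in> goods p n J P Gb" "y \<noteq> z" "?X (fst y) (snd y) \<inter> ?X (fst z) (snd z) \<noteq> {}"
      then obtain x where x: "x \<in> ?X (fst y) (snd y)" "x \<in> ?X (fst z) (snd z)" by blast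
      obtain A g where xe: "x = (A, g)" by (cases x)
      have y': "(fst y, snd y) \<in> goods p n J P Gb" and z': "(fst z, snd z) \<in> goods p n J P Gb" using yz(1,2) by simp_all
      have "?\<pi> (A, g) = (fst y, snd y)" "?\<pi> (A, g) = (fst z, snd z)"
        by (rule fibE[OF y', THEN iffD2, THEN conjunct2, OF x(1)[unfolded xe]])
          (rule fibE[OF z', THEN iffD2, THEN conjunct2, OF x(2)[unfolded xe]])
      then have "(fst y, snd y) = (fst z, snd z)" by (rule subst)
      then have "y = z" by (simp only: prod.collapse)
      then show False using yz(3) by simp
    qed
  qed
  ultimately have c: "card (goods (p ^ N) n J P G) = (\<Sum>y\<in>goods p n J P Gb. card (?X (fst y) (snd y)))" by simp
  have "card (goods (p ^ N) n J P G) * ?h * card (IM p n) = (\<Sum>y\<in>goods p n J P Gb. card (?X (fst y) (snd y)) * ?h * card (IM p n))"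
    unfolding c by (simp add: sum_distrib_right)
  also have "\<dots> = (\<Sum>y\<in>goods p n J P Gb. card (IM (p ^ N) n) * ?i)"
  proof (rule sum.cong[OF refl])
    fix y assume "y \<in> goods p n J P Gb"
    then have "(fst y, snd y) \<in> goods p n J P Gb" by simp
    then show "card (?X (fst y) (snd y)) * ?h * card (IM p n) = card (IM (p ^ N) n) * ?i" by (rule fibre)
  qed
  finally show ?thesis by simp
qed

end

section \<open>Cokernels and good pairs\<close>

lemma (in tgroup) quotient_tgroup:
  fixes M :: "('d, 'b set, 'e) tmodule_scheme"
  assumes I: "sgrp I" and TI: "tact G ` I \<subseteq> I"
    and M: "carrier M = cl I ` carrier G" "\<zero>\<^bsub>M\<^esub> = I" "\<And>C D. C \<oplus>\<^bsub>M\<^esub> D = {a \<oplus> b | a b. a \<in> C \<and> b \<in> D}"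
      "\<And>C. tact M C = {tact G a \<oplus> w | a w. a \<in> C \<and> w \<in> I}"
  shows "tgroup M" "thom G M (cl I)"
proof -
  have add: "cl I x \<oplus>\<^bsub>M\<^esub> cl I y = cl I (x \<oplus> y)" if "x \<in> carrier G" "y \<in> carrier G" for x y
    unfolding M(3) by (rule cl_add[OF I that])
  have T: "tact M (cl I x) = cl I (tact G x)" if "x \<in> carrier G" for x
    unfolding M(4) by (rule cl_image[OF I that]) (auto simp: T_add TI[THEN subsetD])
  have z: "\<zero>\<^bsub>M\<^esub> = cl I \<zero>" unfolding M(2) cl_zero[OF I] ..
  show "tgroup M"
  proof (intro tgroup.intro tgroup_axioms.intro abelian_groupI)
    show "\<zero>\<^bsub>M\<^esub> \<in> carrier M" unfolding z M(1) by simp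
    fix x assume "x \<in> carrier M"
    then obtain a where a: "a \<in> carrier G" "x = cl I a" unfolding M(1) by auto
    show "\<zero>\<^bsub>M\<^esub> \<oplus>\<^bsub>M\<^esub> x = x" unfolding z a(2) add[OF zero_closed a(1)] using a by simp
    show "\<exists>y\<in>carrier M. y \<oplus>\<^bsub>M\<^esub> x = \<zero>\<^bsub>M\<^esub>" unfolding a(2) z M(1)
      using a add[of "\<ominus> a" a] by (intro bexI[of _ "cl I (\<ominus> a)"]) (simp_all add: l_neg)
    show "tact M x \<in> carrier M" unfolding a(2) T[OF a(1)] M(1) using a by simp
    fix y assume "y \<in> carrier M"
    then obtain b where b: "b \<in> carrier G" "y = cl I b" unfolding M(1) by auto
    show "x \<oplus>\<^bsub>M\<^esub> y \<in> carrier M" unfolding a(2) b(2) add[OF a(1) b(1)] M(1) using a b by simp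
    show "x \<oplus>\<^bsub>M\<^esub> y = y \<oplus>\<^bsub>M\<^esub> x" unfolding a(2) b(2) using a b by (simp add: add a_comm)
    show "tact M (x \<oplus>\<^bsub>M\<^esub> y) = tact M x \<oplus>\<^bsub>M\<^esub> tact M y" unfolding a(2) b(2) using a b by (simp add: add T T_add)
    fix w assume "w \<in> carrier M"
    then obtain c where c: "c \<in> carrier G" "w = cl I c" unfolding M(1) by auto
    show "x \<oplus>\<^bsub>M\<^esub> y \<oplus>\<^bsub>M\<^esub> w = x \<oplus>\<^bsub>M\<^esub> (y \<oplus>\<^bsub>M\<^esub> w)" unfolding a(2) b(2) c(2) using a b c by (simp add: add a_assoc)
  qed
  show "thom G M (cl I)" unfolding thom_def using add T M(1) by auto
qed

section \<open>Polynomials in a matrix, over the integers and over a coefficient ring\<close>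

fun ipow :: "nat \<Rightarrow> (nat \<Rightarrow> nat \<Rightarrow> int) \<Rightarrow> nat \<Rightarrow> nat \<Rightarrow> nat \<Rightarrow> int" where
  "ipow n A 0 i j = (if i = j then 1 else 0)"
| "ipow n A (Suc k) i j = (\<Sum>l<n. ipow n A k i l * A l j)"

lemma T_pow_ipow:
  assumes "v \<in> zvec n" "i < n"
  shows "(tact (VM 0 n A) ^^ m) v i = (\<Sum>j<n. ipow n A m i j * v j)"
  using assms
proof (induction m arbitrary: v)
  case 0
  then show ?case by (simp add: if_distrib[of "\<lambda>x. x * _"] sum.delta' cong: if_cong)
next
  case (Suc m)
  have "(tact (VM 0 n A) ^^ Suc m) v i = (tact (VM 0 n A) ^^ m) (tact (VM 0 n A) v) i"
    by (simp only: funpow_Suc_right comp_apply)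
  also have "\<dots> = (\<Sum>j<n. ipow n A m i j * (\<Sum>l<n. A j l * v l))"
    unfolding Suc.IH[OF VM0_T_closed Suc.prems(2)] by (intro sum.cong refl) simp
  also have "\<dots> = (\<Sum>l<n. \<Sum>j<n. ipow n A m i j * A j l * v l)"
    by (subst sum.swap) (simp add: sum_distrib_left mult.assoc)
  finally show ?case unfolding ipow.simps sum_distrib_right .
qed

lemma finsum_VM0:
  fixes k :: nat
  assumes "\<And>m. m < k \<Longrightarrow> f m \<in> zvec n"
  shows "(\<Oplus>\<^bsub>VM 0 n A\<^esub> m\<in>{..<k}. f m) = (\<lambda>i. \<Sum>m<k. f m i)"
proof -
  interpret V: tgroup "VM 0 n A" by (rule tgroup_VM)
  show ?thesis using assms
  proof (induction k)
    case 0
    then show ?case using V.finsum_empty by simp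
  next
    case (Suc k)
    have "(\<Oplus>\<^bsub>VM 0 n A\<^esub> m\<in>insert k {..<k}. f m) = f k \<oplus>\<^bsub>VM 0 n A\<^esub> (\<Oplus>\<^bsub>VM 0 n A\<^esub> m\<in>{..<k}. f m)"
      using Suc.prems by (intro V.finsum_insert) (simp_all add: Pi_iff)
    then show ?case using Suc by (simp add: lessThan_Suc add.commute)
  qed
qed

text \<open>Connects the action of Z[t] with explicit powers of the matrix, the form in which
  \<open>mpoly_eval\<close> is defined.\<close>

lemma act_VM0_sum:
  assumes v: "v \<in> zvec n" and i: "i < n" and Q: "\<And>m. m \<ge> k \<Longrightarrow> Polynomial.coeff Q m = 0"
  shows "act (VM 0 n A) Q v i = (\<Sum>m<k. Polynomial.coeff Q m * (\<Sum>j<n. ipow n A m i j * v j))"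
proof -
  interpret V: tgroup "VM 0 n A" by (rule tgroup_VM)
  have vc: "v \<in> carrier (VM 0 n A)" using v by simp
  have pc: "(tact (VM 0 n A) ^^ m) v \<in> carrier (VM 0 n A)" for m by (rule V.T_pow_closed[OF vc])
  have "act (VM 0 n A) Q v = (\<Oplus>\<^bsub>VM 0 n A\<^esub> m\<in>{..<k}. add_pow (VM 0 n A) (Polynomial.coeff Q m) ((tact (VM 0 n A) ^^ m) v))"
    by (rule V.act_eq_finsum[OF vc Q])
  also have "\<dots> = (\<lambda>i. \<Sum>m<k. add_pow (VM 0 n A) (Polynomial.coeff Q m) ((tact (VM 0 n A) ^^ m) v) i)"
    by (rule finsum_VM0) (use V.zm_closed[OF pc] in simp)
  finally show ?thesis using T_pow_ipow[OF v i] zm_VM[OF pc] by simp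
qed

text \<open>Common abstraction of \<open>Z_p\<close> (with \<open>\<rho>\<close> the reduction modulo \<open>q = p^N\<close>) and \<open>F_p\<close> (with \<open>q = p\<close>).\<close>
locale aring = cring R for R :: "('a, 'm) ring_scheme" (structure) +
  fixes q :: int and \<rho> :: "'a \<Rightarrow> int" and \<iota> :: "int \<Rightarrow> 'a" and n :: nat
  assumes q: "q > 0"
    and \<rho>_range: "a \<in> carrier R \<Longrightarrow> 0 \<le> \<rho> a \<and> \<rho> a < q"
    and \<rho>_add: "\<lbrakk>a \<in> carrier R; b \<in> carrier R\<rbrakk> \<Longrightarrow> \<rho> (a \<oplus> b) = (\<rho> a + \<rho> b) mod q"
    and \<rho>_mult: "\<lbrakk>a \<in> carrier R; b \<in> carrier R\<rbrakk> \<Longrightarrow> \<rho> (a \<otimes> b) = (\<rho> a * \<rho> b) mod q"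
    and \<iota>_closed [simp]: "\<iota> k \<in> carrier R"
    and \<iota>_add: "\<iota> (k + l) = \<iota> k \<oplus> \<iota> l"
    and \<iota>_mult: "\<iota> (k * l) = \<iota> k \<otimes> \<iota> l"
    and \<iota>_1: "\<iota> 1 = \<one>"
    and \<rho>\<iota>: "\<rho> (\<iota> k) = k mod q"
    and split: "a \<in> carrier R \<Longrightarrow> \<exists>b\<in>carrier R. a = \<iota> (\<rho> a) \<oplus> \<iota> q \<otimes> b"
begin

lemma \<iota>_0 [simp]: "\<iota> 0 = \<zero>"
  using \<iota>_add[of 0 0] by (metis \<iota>_closed add.l_cancel_one add_0)

lemma \<rho>_0 [simp]: "\<rho> \<zero> = 0"
  using \<rho>\<iota>[of 0] by simp

lemma \<rho>_1: "\<rho> \<one> = 1 mod q"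
  using \<rho>\<iota>[of 1] by (simp add: \<iota>_1)

lemma \<rho>_mod [simp]: "a \<in> carrier R \<Longrightarrow> \<rho> a mod q = \<rho> a"
  using \<rho>_range[of a] by simp

lemma \<rho>_finsum: "finite A \<Longrightarrow> f \<in> A \<rightarrow> carrier R \<Longrightarrow> \<rho> (\<Oplus>i\<in>A. f i) = (\<Sum>i\<in>A. \<rho> (f i)) mod q"
proof (induction A rule: finite_induct)
  case (insert x A)
  then show ?case by (simp add: finsum_insert \<rho>_add mod_add_right_eq finsum_closed)
qed simp

lemma \<rho>_eq_iff:
  assumes "a \<in> carrier R" "b \<in> carrier R" "\<rho> a = \<rho> b"
  shows "\<exists>c\<in>carrier R. a = b \<oplus> \<iota> q \<otimes> c"
proof -
  obtain x y where x: "x \<in> carrier R" "a = \<iota> (\<rho> a) \<oplus> \<iota> q \<otimes> x" and y: "y \<in> carrier R" "b = \<iota> (\<rho> b) \<oplus> \<iota> q \<otimes> y"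
    using split assms by metis
  have "b \<oplus> \<iota> q \<otimes> (x \<ominus> y) = (\<iota> (\<rho> b) \<oplus> \<iota> q \<otimes> y) \<oplus> \<iota> q \<otimes> (x \<ominus> y)"
    by (rule arg_cong[where f = "\<lambda>z. z \<oplus> \<iota> q \<otimes> (x \<ominus> y)", OF y(2)])
  also have "\<dots> = \<iota> (\<rho> b) \<oplus> \<iota> q \<otimes> (y \<oplus> (x \<ominus> y))" using x(1) y(1) by (simp add: r_distr a_assoc)
  also have "y \<oplus> (x \<ominus> y) = x" using x(1) y(1) by (simp add: add_minus_cancel_left)
  also have "\<iota> (\<rho> b) \<oplus> \<iota> q \<otimes> x = a" unfolding assms(3)[symmetric] by (rule x(2)[symmetric])
  finally have "a = b \<oplus> \<iota> q \<otimes> (x \<ominus> y)" by (rule sym)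
  then show ?thesis using minus_closed[OF x(1) y(1)] by (rule bexI)
qed

definition VG where
  "VG A = \<lparr>carrier = vecs R n, monoid.mult = (\<lambda>_ _ _. \<zero>), one = (\<lambda>_. \<zero>), ring.zero = (\<lambda>_. \<zero>),
     ring.add = vadd R n, module.smult = vsmult R n, tact = mvmult R n A\<rparr>"

lemma VG_simps [simp]:
  "carrier (VG A) = vecs R n" "\<zero>\<^bsub>VG A\<^esub> = (\<lambda>_. \<zero>)" "v \<oplus>\<^bsub>VG A\<^esub> w = vadd R n v w" "tact (VG A) = mvmult R n A"
  "module.smult (VG A) = vsmult R n"
  by (simp_all add: VG_def)

lemma vecsD: "v \<in> vecs R n \<Longrightarrow> v i \<in> carrier R" "v \<in> vecs R n \<Longrightarrow> \<not> i < n \<Longrightarrow> v i = \<zero>"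
  by (cases "i < n") (simp_all add: vecs_def)

lemma matsD: "A \<in> mats R n \<Longrightarrow> A i j \<in> carrier R"
  by (cases "i < n \<and> j < n") (auto simp add: mats_def)

lemma vecsI: "(\<And>i. i < n \<Longrightarrow> v i \<in> carrier R) \<Longrightarrow> (\<And>i. \<not> i < n \<Longrightarrow> v i = \<zero>) \<Longrightarrow> v \<in> vecs R n"
  by (simp add: vecs_def)

lemma mv_closed: "A \<in> mats R n \<Longrightarrow> v \<in> vecs R n \<Longrightarrow> mvmult R n A v \<in> vecs R n"
  by (rule vecsI) (auto simp: mvmult_def matsD vecsD intro!: finsum_closed)

lemma vs_closed: "c \<in> carrier R \<Longrightarrow> v \<in> vecs R n \<Longrightarrow> vsmult R n c v \<in> vecs R n"
  by (rule vecsI) (auto simp: vsmult_def vecsD)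

lemma va_closed: "v \<in> vecs R n \<Longrightarrow> w \<in> vecs R n \<Longrightarrow> vadd R n v w \<in> vecs R n"
  by (rule vecsI) (auto simp: vadd_def vecsD)

lemma vec_eqI: "v \<in> vecs R n \<Longrightarrow> w \<in> vecs R n \<Longrightarrow> (\<And>i. i < n \<Longrightarrow> v i = w i) \<Longrightarrow> v = w"
  by (rule ext) (metis vecsD(2))

lemma mv_add:
  assumes "A \<in> mats R n" "v \<in> vecs R n" "w \<in> vecs R n"
  shows "mvmult R n A (vadd R n v w) = vadd R n (mvmult R n A v) (mvmult R n A w)"
proof (rule vec_eqI)
  fix i assume i: "i < n"
  have "(\<Oplus>j\<in>{..<n}. A i j \<otimes> vadd R n v w j) = (\<Oplus>j\<in>{..<n}. A i j \<otimes> v j \<oplus> A i j \<otimes> w j)"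
    using assms by (intro finsum_cong') (auto simp: vadd_def r_distr matsD vecsD)
  also have "\<dots> = (\<Oplus>j\<in>{..<n}. A i j \<otimes> v j) \<oplus> (\<Oplus>j\<in>{..<n}. A i j \<otimes> w j)"
    using assms by (intro finsum_addf) (auto simp: matsD vecsD)
  finally show "mvmult R n A (vadd R n v w) i = vadd R n (mvmult R n A v) (mvmult R n A w) i"
    using i by (simp add: mvmult_def vadd_def)
qed (use assms in \<open>auto intro!: mv_closed va_closed\<close>)

lemma mv_smult:
  assumes "A \<in> mats R n" "v \<in> vecs R n" "c \<in> carrier R"
  shows "mvmult R n A (vsmult R n c v) = vsmult R n c (mvmult R n A v)"
proof (rule vec_eqI)
  fix i assume i: "i < n"
  have "(\<Oplus>j\<in>{..<n}. A i j \<otimes> vsmult R n c v j) = (\<Oplus>j\<in>{..<n}. c \<otimes> (A i j \<otimes> v j))"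
    using assms by (intro finsum_cong') (auto simp: vsmult_def matsD vecsD m_lcomm)
  also have "\<dots> = c \<otimes> (\<Oplus>j\<in>{..<n}. A i j \<otimes> v j)"
    using assms by (intro finsum_rdistr[symmetric]) (auto simp: matsD vecsD)
  finally show "mvmult R n A (vsmult R n c v) i = vsmult R n c (mvmult R n A v) i"
    using i by (simp add: mvmult_def vsmult_def)
qed (use assms in \<open>auto intro!: mv_closed vs_closed\<close>)

lemma tgroup_VG: assumes A: "A \<in> mats R n" shows "tgroup (VG A)"
proof (intro tgroup.intro tgroup_axioms.intro abelian_groupI)
  fix v assume v: "v \<in> carrier (VG A)"
  let ?w = "\<lambda>i. if i < n then \<ominus> v i else \<zero>"
  have "?w \<in> vecs R n" using v by (intro vecsI) (auto simp: vecsD)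
  moreover have "vadd R n ?w v = (\<lambda>_. \<zero>)" using v by (auto simp: vadd_def fun_eq_iff vecsD l_neg)
  ultimately show "\<exists>w\<in>carrier (VG A). w \<oplus>\<^bsub>VG A\<^esub> v = \<zero>\<^bsub>VG A\<^esub>" by (intro bexI[of _ ?w]) simp_all
  show "\<zero>\<^bsub>VG A\<^esub> \<oplus>\<^bsub>VG A\<^esub> v = v" using v by (auto simp: vadd_def fun_eq_iff vecsD)
next
  fix u v w assume "u \<in> carrier (VG A)" "v \<in> carrier (VG A)" "w \<in> carrier (VG A)"
  then show "u \<oplus>\<^bsub>VG A\<^esub> v \<oplus>\<^bsub>VG A\<^esub> w = u \<oplus>\<^bsub>VG A\<^esub> (v \<oplus>\<^bsub>VG A\<^esub> w)"
    by (auto simp: vadd_def fun_eq_iff vecsD a_assoc)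
next
  fix v w assume "v \<in> carrier (VG A)" "w \<in> carrier (VG A)"
  then show "v \<oplus>\<^bsub>VG A\<^esub> w = w \<oplus>\<^bsub>VG A\<^esub> v" by (auto simp: vadd_def fun_eq_iff vecsD a_comm)
qed (use A vecsI[of "\<lambda>_. \<zero>"] in \<open>auto simp: mv_add va_closed mv_closed\<close>)

definition rv :: "(nat \<Rightarrow> 'a) \<Rightarrow> nat \<Rightarrow> int" where "rv v = (\<lambda>i. \<rho> (v i))"
definition lv :: "(nat \<Rightarrow> int) \<Rightarrow> nat \<Rightarrow> 'a" where "lv v = (\<lambda>i. \<iota> (v i))"
definition rm :: "(nat \<Rightarrow> nat \<Rightarrow> 'a) \<Rightarrow> nat \<Rightarrow> nat \<Rightarrow> int" where "rm A = (\<lambda>i j. \<rho> (A i j))"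

lemma rv_zvec: "v \<in> vecs R n \<Longrightarrow> rv v \<in> zvec n"
  by (simp add: rv_def vecsD)

lemma lv_vecs: "v \<in> zvec n \<Longrightarrow> lv v \<in> vecs R n"
  by (rule vecsI) (simp_all add: lv_def)

lemma rv_lv: "rv (lv v) = red q v"
  by (simp add: rv_def lv_def red_def \<rho>\<iota>)

lemma lv_add: "lv (\<lambda>i. v i + w i) = vadd R n (lv v) (lv w)" if "v \<in> zvec n" "w \<in> zvec n"
  using that by (auto simp: lv_def vadd_def fun_eq_iff \<iota>_add)

lemma rv_add: "v \<in> vecs R n \<Longrightarrow> w \<in> vecs R n \<Longrightarrow> rv (vadd R n v w) = red q (\<lambda>i. rv v i + rv w i)"
  by (auto simp: rv_def vadd_def red_def fun_eq_iff vecsD \<rho>_add)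

lemma rv_smult: "v \<in> vecs R n \<Longrightarrow> c \<in> carrier R \<Longrightarrow> rv (vsmult R n c v) = red q (\<lambda>i. \<rho> c * rv v i)"
  by (auto simp: rv_def vsmult_def red_def fun_eq_iff vecsD \<rho>_mult)

lemma rv_mv: "A \<in> mats R n \<Longrightarrow> v \<in> vecs R n \<Longrightarrow> rv (mvmult R n A v) = red q (tact (VM 0 n (rm A)) (rv v))"
proof
  fix i assume A: "A \<in> mats R n" and v: "v \<in> vecs R n"
  have "\<rho> (\<Oplus>j\<in>{..<n}. A i j \<otimes> v j) = (\<Sum>j<n. \<rho> (A i j \<otimes> v j)) mod q"
    using A v by (intro \<rho>_finsum) (auto simp: matsD vecsD)
  also have "\<dots> = (\<Sum>j<n. \<rho> (A i j) * \<rho> (v j)) mod q"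
    using A v by (simp add: \<rho>_mult matsD vecsD mod_sum_eq)
  finally show "rv (mvmult R n A v) i = red q (tact (VM 0 n (rm A)) (rv v)) i"
    by (simp add: rv_def mvmult_def red_def rm_def)
qed

lemma rv_eq:
  assumes "v \<in> vecs R n" "w \<in> vecs R n" "rv v = rv w"
  shows "\<exists>u\<in>vecs R n. v = vadd R n w (vsmult R n (\<iota> q) u)"
proof -
  have "\<exists>c. c \<in> carrier R \<and> v i = w i \<oplus> \<iota> q \<otimes> c" for i
    using \<rho>_eq_iff[of "v i" "w i"] fun_cong[OF assms(3), of i] assms by (simp add: rv_def vecsD Bex_def)
  then obtain c where c: "\<And>i. c i \<in> carrier R \<and> v i = w i \<oplus> \<iota> q \<otimes> c i" by metis
  let ?u = "\<lambda>i. if i < n then c i else \<zero>"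
  have u: "?u \<in> vecs R n" using c by (intro vecsI) auto
  have "v = vadd R n w (vsmult R n (\<iota> q) ?u)"
    using assms c u by (intro vec_eqI va_closed vs_closed) (auto simp: vadd_def vsmult_def)
  then show ?thesis using u by (rule bexI)
qed

lemma mpow_mats: "A \<in> mats R n \<Longrightarrow> mpow R n A k \<in> mats R n"
  by (induction k) (auto simp: mats_def mone_def mmult_def intro!: finsum_closed)

lemma \<rho>_mpow:
  assumes A: "A \<in> mats R n" and ij: "i < n" "j < n"
  shows "\<rho> (mpow R n A k i j) = ipow n (rm A) k i j mod q"
  using ij
proof (induction k arbitrary: j)
  case 0
  then show ?case by (simp add: mone_def \<rho>_1)
next
  case (Suc k)
  have "\<rho> (mpow R n A (Suc k) i j) = (\<Sum>l<n. \<rho> (mpow R n A k i l \<otimes> A l j)) mod q"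
    using Suc.prems A by (simp add: mmult_def) (intro \<rho>_finsum, auto simp: matsD mpow_mats)
  also have "\<dots> = (\<Sum>l<n. (ipow n (rm A) k i l mod q) * \<rho> (A l j) mod q) mod q"
    using Suc A by (intro arg_cong[where f = "\<lambda>x. x mod q"] sum.cong) (simp_all add: \<rho>_mult matsD mpow_mats)
  finally show ?case by (simp add: mod_sum_eq mod_mult_left_eq rm_def)
qed

lemma mpoly_mats:
  assumes A: "A \<in> mats R n" and P: "\<And>m. m < length P \<Longrightarrow> pcoeff P m \<in> carrier R"
  shows "mpoly_eval R n P A \<in> mats R n"
  unfolding mats_def mpoly_eval_def using P matsD[OF mpow_mats[OF A]] by (auto intro!: finsum_closed)

text \<open>Sums and products commute with \<rho> modulo q, so on residues the matrix P(A) acts like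
  any integral polynomial Q congruent to P. Here the argument passes from \<open>mpoly_eval\<close>
  to \<open>act\<close>.\<close>

lemma rv_mpoly:
  assumes A: "A \<in> mats R n" and P: "\<And>m. m < length P \<Longrightarrow> pcoeff P m \<in> carrier R" and v: "v \<in> vecs R n"
    and Q: "\<And>m. m < length P \<Longrightarrow> Polynomial.coeff Q m mod q = \<rho> (pcoeff P m)" "\<And>m. m \<ge> length P \<Longrightarrow> Polynomial.coeff Q m = 0"
  shows "rv (mvmult R n (mpoly_eval R n P A) v) = red q (act (VM 0 n (rm A)) Q (rv v))"
proof
  fix i
  show "rv (mvmult R n (mpoly_eval R n P A) v) i = red q (act (VM 0 n (rm A)) Q (rv v)) i"
  proof (cases "i < n")
    case False
    then show ?thesis using VM0_act_closed[OF rv_zvec[OF v], of "rm A" Q] by (simp add: rv_def mvmult_def red_def)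
  next
    case i: True
    let ?L = "length P"
    have e: "rm (mpoly_eval R n P A) i j mod q = (\<Sum>m<?L. Polynomial.coeff Q m * ipow n (rm A) m i j) mod q" if j: "j < n" for j
    proof -
      have "\<rho> (mpoly_eval R n P A i j) = (\<Sum>m<?L. \<rho> (pcoeff P m \<otimes> mpow R n A m i j)) mod q"
        using i j P A by (simp add: mpoly_eval_def) (intro \<rho>_finsum, auto simp: matsD mpow_mats)
      also have "\<dots> = (\<Sum>m<?L. (Polynomial.coeff Q m mod q) * (ipow n (rm A) m i j mod q) mod q) mod q"
        using i j P A Q(1) by (intro arg_cong[where f = "\<lambda>x. x mod q"] sum.cong) (simp_all add: \<rho>_mult \<rho>_mpow matsD mpow_mats)
      finally show ?thesis by (simp add: rm_def mod_sum_eq mod_mult_eq)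
    qed
    have "rv (mvmult R n (mpoly_eval R n P A) v) i = (\<Sum>j<n. rm (mpoly_eval R n P A) i j * rv v j) mod q"
      using rv_mv[OF mpoly_mats[OF A P] v] i by (simp add: red_def)
    also have "\<dots> = (\<Sum>j<n. (rm (mpoly_eval R n P A) i j mod q) * rv v j mod q) mod q"
      by (simp add: mod_sum_eq mod_mult_left_eq)
    also have "\<dots> = (\<Sum>j<n. ((\<Sum>m<?L. Polynomial.coeff Q m * ipow n (rm A) m i j) mod q) * rv v j mod q) mod q"
      by (intro arg_cong[where f = "\<lambda>x. x mod q"] sum.cong refl) (simp add: e)
    also have "\<dots> = (\<Sum>j<n. (\<Sum>m<?L. Polynomial.coeff Q m * ipow n (rm A) m i j) * rv v j) mod q"
      by (simp add: mod_sum_eq mod_mult_left_eq)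
    also have "(\<Sum>j<n. (\<Sum>m<?L. Polynomial.coeff Q m * ipow n (rm A) m i j) * rv v j) =
       (\<Sum>m<?L. Polynomial.coeff Q m * (\<Sum>j<n. ipow n (rm A) m i j * rv v j))"
      unfolding sum_distrib_right sum_distrib_left by (subst sum.swap) (simp add: mult.assoc)
    also have "\<dots> = act (VM 0 n (rm A)) Q (rv v) i"
      by (rule act_VM0_sum[OF rv_zvec[OF v] i Q(2), symmetric])
    finally show ?thesis by (simp add: red_def)
  qed
qed

end

text \<open>B stands for P(Y). Two properties of P(Y) are retained: it commutes with Y, and modulo q
  it acts like Q, an integral representative of P.\<close>

locale coksit = aring R q \<rho> \<iota> n for R :: "('a, 'm) ring_scheme" (structure) and q \<rho> \<iota> n +
  fixes Y B :: "nat \<Rightarrow> nat \<Rightarrow> 'a" and Q :: "int poly"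
  assumes Y: "Y \<in> mats R n" and B: "B \<in> mats R n"
    and comm: "v \<in> vecs R n \<Longrightarrow> mvmult R n Y (mvmult R n B v) = mvmult R n B (mvmult R n Y v)"
    and rvB: "v \<in> vecs R n \<Longrightarrow> rv (mvmult R n B v) = red q (act (VM 0 n (rm Y)) Q (rv v))"
begin

definition I where "I = mvmult R n B ` vecs R n"
abbreviation C where "C \<equiv> cok R n B Y"

sublocale V: tgroup "VG Y"
  by (rule tgroup_VG[OF Y])

definition k :: "(nat \<Rightarrow> 'a) \<Rightarrow> (nat \<Rightarrow> 'a) set" where
  "k v = {vadd R n v w | w. w \<in> I}"

lemma k_cl: "V.cl I v = k v"
  by (simp add: V.cl_def k_def)

lemma sgrp_I: "V.sgrp I"
proof -
  have sub: "I \<subseteq> vecs R n" unfolding I_def using mv_closed[OF B] by blast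
  have z0: "(\<lambda>_. \<zero>) \<in> vecs R n" by (rule vecsI) simp_all
  have zB: "mvmult R n B (\<lambda>_. \<zero>) = (\<lambda>_. \<zero>)"
    using additive_zero(1)[OF V.abelian_group_axioms V.abelian_group_axioms, of "mvmult R n B"] mv_add[OF B] mv_closed[OF B] by auto
  have z: "(\<lambda>_. \<zero>) \<in> I" unfolding I_def using z0 zB by (metis image_eqI)
  have a: "vadd R n x y \<in> I" if "x \<in> I" "y \<in> I" for x y
  proof -
    obtain v w where v: "v \<in> vecs R n" "x = mvmult R n B v" "w \<in> vecs R n" "y = mvmult R n B w"
      using \<open>x \<in> I\<close> \<open>y \<in> I\<close> unfolding I_def by blast
    have "vadd R n x y = mvmult R n B (vadd R n v w)" unfolding v(2,4) mv_add[OF B v(1,3)] ..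
    then show ?thesis unfolding I_def using va_closed[OF v(1,3)] by blast
  qed
  have m: "\<ominus>\<^bsub>VG Y\<^esub> x \<in> I" if "x \<in> I" for x
  proof -
    obtain v where v: "v \<in> vecs R n" "x = mvmult R n B v" using \<open>x \<in> I\<close> unfolding I_def by blast
    have "\<ominus>\<^bsub>VG Y\<^esub> x = mvmult R n B (\<ominus>\<^bsub>VG Y\<^esub> v)"
      unfolding v(2) using additive_zero(2)[OF V.abelian_group_axioms V.abelian_group_axioms, of "mvmult R n B" v] mv_add[OF B] mv_closed[OF B] v(1) by auto
    moreover have "\<ominus>\<^bsub>VG Y\<^esub> v \<in> vecs R n" using V.a_inv_closed[of v] v(1) by simp
    ultimately show ?thesis unfolding I_def by blast
  qed
  show ?thesis unfolding V.sgrp_def VG_simps using sub z a m by blast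
qed

lemma C_carrier: "carrier C = k ` vecs R n"
  by (simp add: cok_def Let_def k_def I_def image_def)

lemma k_eq_iff: "v \<in> vecs R n \<Longrightarrow> w \<in> vecs R n \<Longrightarrow> k v = k w \<longleftrightarrow> v \<ominus>\<^bsub>VG Y\<^esub> w \<in> I"
  using V.cl_eq_iff[OF sgrp_I, of v w] by (simp add: k_cl)

lemma C_add: "v \<in> vecs R n \<Longrightarrow> w \<in> vecs R n \<Longrightarrow> k v \<oplus>\<^bsub>C\<^esub> k w = k (vadd R n v w)"
  using V.cl_add[OF sgrp_I, of v w] by (simp add: k_cl cok_def Let_def)

lemma C_smult:
  assumes c: "c \<in> carrier R" and v: "v \<in> vecs R n"
  shows "module.smult C c (k v) = k (vsmult R n c v)"
proof -
  have "{vsmult R n c a \<oplus>\<^bsub>VG Y\<^esub> w | a w. a \<in> V.cl I v \<and> w \<in> I} = V.cl I (vsmult R n c v)"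
  proof (rule V.cl_image[OF sgrp_I])
    show "vsmult R n c \<in> carrier (VG Y) \<rightarrow> carrier (VG Y)" using vs_closed[OF c] by simp
    show "vsmult R n c ` I \<subseteq> I"
    proof (rule image_subsetI)
      fix x assume "x \<in> I"
      then obtain u where u: "u \<in> vecs R n" "x = mvmult R n B u" unfolding I_def by blast
      then have "vsmult R n c x = mvmult R n B (vsmult R n c u)" by (simp add: mv_smult[OF B u(1) c])
      then show "vsmult R n c x \<in> I" unfolding I_def using vs_closed[OF c u(1)] by blast
    qed
    show "vsmult R n c (x \<oplus>\<^bsub>VG Y\<^esub> y) = vsmult R n c x \<oplus>\<^bsub>VG Y\<^esub> vsmult R n c y"
      if "x \<in> carrier (VG Y)" "y \<in> carrier (VG Y)" for x y
      using that c by (auto simp: vsmult_def vadd_def fun_eq_iff r_distr vecsD)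
  qed (use v in simp)
  then show ?thesis unfolding k_cl VG_simps by (simp add: cok_def Let_def flip: I_def)
qed

lemma C_tact:
  assumes v: "v \<in> vecs R n"
  shows "tact C (k v) = k (mvmult R n Y v)"
proof -
  have "{mvmult R n Y a \<oplus>\<^bsub>VG Y\<^esub> w | a w. a \<in> V.cl I v \<and> w \<in> I} = V.cl I (mvmult R n Y v)"
  proof (rule V.cl_image[OF sgrp_I])
    show "mvmult R n Y \<in> carrier (VG Y) \<rightarrow> carrier (VG Y)" using mv_closed[OF Y] by simp
    show "mvmult R n Y ` I \<subseteq> I"
    proof (rule image_subsetI)
      fix x assume "x \<in> I"
      then obtain u where u: "u \<in> vecs R n" "x = mvmult R n B u" unfolding I_def by blast
      then have "mvmult R n Y x = mvmult R n B (mvmult R n Y u)" by (simp add: comm)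
      then show "mvmult R n Y x \<in> I" unfolding I_def using mv_closed[OF Y u(1)] by blast
    qed
  qed (use v mv_add[OF Y] in simp_all)
  then show ?thesis unfolding k_cl VG_simps by (simp add: cok_def Let_def flip: I_def)
qed

lemma rv_minus:
  assumes "v \<in> vecs R n" "w \<in> vecs R n"
  shows "rv (v \<ominus>\<^bsub>VG Y\<^esub> w) i mod q = (rv v i - rv w i) mod q"
proof -
  let ?d = "v \<ominus>\<^bsub>VG Y\<^esub> w"
  have d: "?d \<in> vecs R n" using V.minus_closed[of v w] assms by simp
  have "vadd R n ?d w = v" using V.minus_add_cancel[of v w] assms by simp
  then have "rv v i = (rv ?d i + rv w i) mod q" using rv_add[OF d assms(2)] by (metis red_def)
  then have "(rv v i - rv w i) mod q = (rv ?d i + rv w i - rv w i) mod q" by (simp add: mod_diff_left_eq)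
  then show ?thesis by simp
qed

text \<open>F is the composite Z^n \<rightarrow> R^n \<rightarrow> cok \<rightarrow> G. It depends
  on residues modulo q only, since \<open>\<iota> q\<close> acts on G through
  \<open>\<rho> (\<iota> q)\<close>, which is 0; its kernel consists of the image of B read modulo
  q.\<close>

lemma iso_imp_gpair:
  assumes G: "tgroup G" and sm: "\<And>a x. \<lbrakk>a \<in> carrier R; x \<in> carrier G\<rbrakk> \<Longrightarrow> module.smult G a x = add_pow G (\<rho> a) x"
    and iso: "tmod_iso R C G"
  shows "\<exists>g\<in>{..<n} \<rightarrow>\<^sub>E carrier G. gpair q n Q G (rm Y) g"
proof -
  interpret G: tgroup G by fact
  obtain \<phi> where bij: "bij_betw \<phi> (carrier C) (carrier G)"
    and pa: "\<forall>x\<in>carrier C. \<forall>y\<in>carrier C. \<phi> (x \<oplus>\<^bsub>C\<^esub> y) = \<phi> x \<oplus>\<^bsub>G\<^esub> \<phi> y"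
    and ps: "\<forall>a\<in>carrier R. \<forall>x\<in>carrier C. \<phi> (module.smult C a x) = module.smult G a (\<phi> x)"
    and pt: "\<forall>x\<in>carrier C. \<phi> (tact C x) = tact G (\<phi> x)"
    using iso unfolding tmod_iso_def by (elim exE conjE)
  have kC: "k v \<in> carrier C" if "v \<in> vecs R n" for v using that by (simp add: C_carrier)
  define f where "f v = \<phi> (k v)" for v
  have fc: "f v \<in> carrier G" if "v \<in> vecs R n" for v unfolding f_def using kC[OF that] bij by (rule bij_betw_apply[rotated])
  have fa: "f (vadd R n v w) = f v \<oplus>\<^bsub>G\<^esub> f w" if "v \<in> vecs R n" "w \<in> vecs R n" for v w
    unfolding f_def C_add[OF that, symmetric] using pa kC that by blast
  have fs: "f (vsmult R n c v) = add_pow G (\<rho> c) (f v)" if "c \<in> carrier R" "v \<in> vecs R n" for c v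
    unfolding f_def C_smult[OF that, symmetric] using ps kC that sm fc[unfolded f_def] by simp
  have ft: "f (mvmult R n Y v) = tact G (f v)" if "v \<in> vecs R n" for v
    unfolding f_def C_tact[OF that, symmetric] using pt kC that by blast
  have feq: "f v = f w" if vw: "v \<in> vecs R n" "w \<in> vecs R n" "rv v = rv w" for v w
  proof -
    obtain u where u: "u \<in> vecs R n" "v = vadd R n w (vsmult R n (\<iota> q) u)" using rv_eq[OF vw] by (elim bexE)
    have "f v = f w \<oplus>\<^bsub>G\<^esub> add_pow G (\<rho> (\<iota> q)) (f u)" unfolding u(2) fa[OF vw(2) vs_closed[OF \<iota>_closed u(1)]] fs[OF \<iota>_closed u(1)] ..
    then show ?thesis using fc[OF vw(2)] by (simp add: \<rho>\<iota>)
  qed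
  define g where "g = (\<lambda>i\<in>{..<n}. f (lv (uv i)))"
  have F: "Fm G n g v = f (lv v)" if v: "v \<in> zvec n" for v
  proof (rule G.Fm_unique[of "\<lambda>v. f (lv v)", OF _ _ _ v])
    show "(\<lambda>v. f (lv v)) \<in> zvec n \<rightarrow> carrier G" using fc[OF lv_vecs] by (rule funcsetI)
    show "f (lv (\<lambda>i. v i + w i)) = f (lv v) \<oplus>\<^bsub>G\<^esub> f (lv w)" if "v \<in> zvec n" "w \<in> zvec n" for v w
      unfolding lv_add[OF that] by (rule fa[OF lv_vecs[OF that(1)] lv_vecs[OF that(2)]])
    show "g i = f (lv (uv i))" if "i < n" for i using that by (simp add: g_def)
  qed
  have gE: "g \<in> {..<n} \<rightarrow>\<^sub>E carrier G" unfolding g_def using fc[OF lv_vecs[OF uv_zvec]] by simp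
  then have gc: "g \<in> {..<n} \<rightarrow> carrier G" by (simp add: PiE_iff Pi_iff)
  have "gpair q n Q G (rm Y) g" unfolding gpair_def
  proof (intro conjI ballI impI)
    show "thom (VM 0 n (rm Y)) G (Fm G n g)" unfolding thom_def
    proof (intro conjI ballI)
      show "Fm G n g \<in> carrier (VM 0 n (rm Y)) \<rightarrow> carrier G" using G.Fm_closed[OF gc] by (intro funcsetI)
      show "Fm G n g (x \<oplus>\<^bsub>VM 0 n (rm Y)\<^esub> y) = Fm G n g x \<oplus>\<^bsub>G\<^esub> Fm G n g y" for x y
        using G.Fm_add[OF gc, of x y] by simp
      fix v assume "v \<in> carrier (VM 0 n (rm Y))"
      then have v: "v \<in> zvec n" by simp
      have "f (lv (tact (VM 0 n (rm Y)) v)) = f (mvmult R n Y (lv v))"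
      proof (rule feq[OF lv_vecs[OF VM0_T_closed] mv_closed[OF Y lv_vecs[OF v]]])
        have "red q (tact (VM 0 n (rm Y)) v) = tact (VM q n (rm Y)) (red q v)"
          using thomD(3)[OF thom_red[of q 0 n "rm Y" "rm Y"], of v] v by simp
        moreover have "red q (tact (VM 0 n (rm Y)) (red q v)) = tact (VM q n (rm Y)) (red q (red q v))"
          using thomD(3)[OF thom_red[of q 0 n "rm Y" "rm Y"], of "red q v"] v by (simp add: red_def)
        moreover have "red q (red q v) = red q v" by (simp add: red_def)
        ultimately show "rv (lv (tact (VM 0 n (rm Y)) v)) = rv (mvmult R n Y (lv v))"
          unfolding rv_mv[OF Y lv_vecs[OF v]] rv_lv by simp
      qed
      then show "Fm G n g (tact (VM 0 n (rm Y)) v) = tact G (Fm G n g v)"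
        unfolding F[OF v] F[OF VM0_T_closed] ft[OF lv_vecs[OF v]] .
    qed
    show "Fm G n g ` zvec n = carrier G"
    proof (intro subset_antisym subsetI)
      fix x assume "x \<in> carrier G"
      then have "x \<in> \<phi> ` carrier C" using bij by (simp add: bij_betw_def)
      then obtain v where v: "v \<in> vecs R n" "x = f v" unfolding C_carrier f_def by blast
      have "f v = f (lv (rv v))"
        using v(1) by (intro feq lv_vecs rv_zvec) (simp_all add: rv_lv, simp add: rv_def red_def vecsD)
      then have "x = Fm G n g (rv v)" using F[OF rv_zvec[OF v(1)]] v(2) by simp
      then show "x \<in> Fm G n g ` zvec n" using rv_zvec[OF v(1)] by (rule image_eqI)
    qed (use G.Fm_closed[OF gc] in blast)
    fix v assume v: "v \<in> zvec n" and z: "Fm G n g v = \<zero>\<^bsub>G\<^esub>"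
    have z0: "(\<lambda>_. \<zero>) \<in> vecs R n" by (rule vecsI) simp_all
    have "f (\<lambda>_. \<zero>) \<oplus>\<^bsub>G\<^esub> f (\<lambda>_. \<zero>) = f (\<lambda>_. \<zero>)"
    proof -
      have "vadd R n (\<lambda>_. \<zero>) (\<lambda>_. \<zero>) = (\<lambda>_. \<zero>)" by (simp add: vadd_def fun_eq_iff)
      then show ?thesis using fa[OF z0 z0] by simp
    qed
    then have "f (\<lambda>_. \<zero>) = \<zero>\<^bsub>G\<^esub>" using fc[OF z0] by (metis G.add.l_cancel_one)
    then have "\<phi> (k (lv v)) = \<phi> (k (\<lambda>_. \<zero>))" using z F[OF v] by (simp add: f_def)
    then have "k (lv v) = k (\<lambda>_. \<zero>)" using bij kC[OF lv_vecs[OF v]] kC[OF z0] unfolding bij_betw_def by (meson inj_onD)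
    then have "lv v \<ominus>\<^bsub>VG Y\<^esub> (\<lambda>_. \<zero>) \<in> I" using k_eq_iff[OF lv_vecs[OF v] z0] by simp
    moreover have "lv v \<ominus>\<^bsub>VG Y\<^esub> \<zero>\<^bsub>VG Y\<^esub> = lv v"
      using V.add_minus_cancel[of "lv v" "\<zero>\<^bsub>VG Y\<^esub>"] V.r_zero[of "lv v"] V.zero_closed lv_vecs[OF v]
      by (simp del: VG_simps(2,3))
    ultimately have "lv v \<in> I" by simp
    then obtain U where U: "U \<in> vecs R n" "lv v = mvmult R n B U" unfolding I_def by blast
    let ?a = "act (VM 0 n (rm Y)) Q (rv U)"
    have "red q v = red q ?a" using rvB[OF U(1)] U(2) rv_lv by metis
    then have "v i mod q = ?a i mod q" for i by (metis red_def)
    then have "q dvd v i - ?a i" for i by (simp add: mod_eq_dvd_iff)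
    then have "v = (\<lambda>i. ?a i + q * ((v i - ?a i) div q))" by (simp add: fun_eq_iff)
    moreover have "(\<lambda>i. (v i - ?a i) div q) \<in> zvec n" using VM0_act_closed[OF rv_zvec[OF U(1)], of "rm Y" Q] v by simp
    ultimately show "\<exists>u\<in>zvec n. \<exists>w\<in>zvec n. v = (\<lambda>i. act (VM 0 n (rm Y)) Q u i + q * w i)"
      using rv_zvec[OF U(1)] by (intro bexI[of _ "rv U"] bexI[of _ "\<lambda>i. (v i - ?a i) div q"])
  qed
  then show ?thesis using gE by (rule bexI)
qed

text \<open>The good pair gives a relation for the residues of d, and residues determine d up to q
  R^n; this is the origin of the summand with U.\<close>

lemma gpair_kernel:
  assumes gp: "gpair q n Q G (rm Y) g" and d: "d \<in> vecs R n" "Fm G n g (rv d) = \<zero>\<^bsub>G\<^esub>"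
  shows "\<exists>a\<in>vecs R n. \<exists>U\<in>vecs R n. d = vadd R n (mvmult R n B a) (vsmult R n (\<iota> q) U)"
proof -
  have "\<exists>u\<in>zvec n. \<exists>w\<in>zvec n. rv d = (\<lambda>i. act (VM 0 n (rm Y)) Q u i + q * w i)"
    using gp rv_zvec[OF d(1)] d(2) unfolding gpair_def by simp
  then obtain u w where uw: "u \<in> zvec n" "w \<in> zvec n" "rv d = (\<lambda>i. act (VM 0 n (rm Y)) Q u i + q * w i)" by (elim bexE)
  have B': "mvmult R n B (lv u) \<in> vecs R n" by (rule mv_closed[OF B lv_vecs[OF uw(1)]])
  have ru: "red q u \<in> zvec n" using uw(1) by (simp add: red_def)
  have "rv d = red q (rv d)" using d(1) by (simp add: rv_def red_def vecsD)
  also have "\<dots> = red q (act (VM 0 n (rm Y)) Q u)" unfolding uw(3) by (simp add: red_def)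
  also have "\<dots> = red q (act (VM 0 n (rm Y)) Q (red q u))"
    unfolding red_act[OF uw(1)] red_act[OF ru] by (simp add: red_def)
  also have "\<dots> = rv (mvmult R n B (lv u))" unfolding rvB[OF lv_vecs[OF uw(1)]] rv_lv ..
  finally have "rv d = rv (mvmult R n B (lv u))" .
  from rv_eq[OF d(1) B' this] obtain U where "U \<in> vecs R n" "d = vadd R n (mvmult R n B (lv u)) (vsmult R n (\<iota> q) U)"
    by (elim bexE)
  then show ?thesis using lv_vecs[OF uw(1)] by (intro bexI[of _ "lv u"] bexI[of _ U])
qed

text \<open>By \<open>gpair_kernel\<close> the kernel of R^n \<rightarrow> G is the image of B plus
  q R^n, and \<open>qI\<close> absorbs the second summand in the first. Over F_p the assumption
  \<open>qI\<close> is trivial, over Z_p it comes from Nakayama's lemma.\<close>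

lemma gpair_imp_iso:
  assumes G: "tgroup G" and sm: "\<And>a x. \<lbrakk>a \<in> carrier R; x \<in> carrier G\<rbrakk> \<Longrightarrow> module.smult G a x = add_pow G (\<rho> a) x"
    and qG: "\<And>x. x \<in> carrier G \<Longrightarrow> add_pow G q x = \<zero>\<^bsub>G\<^esub>"
    and QG: "\<And>x. x \<in> carrier G \<Longrightarrow> act G Q x = \<zero>\<^bsub>G\<^esub>"
    and g: "g \<in> {..<n} \<rightarrow> carrier G" and gp: "gpair q n Q G (rm Y) g"
    and qI: "\<And>u. u \<in> vecs R n \<Longrightarrow> vsmult R n (\<iota> q) u \<in> I"
  shows "tmod_iso R C G"
proof -
  interpret G: tgroup G by fact
  let ?F = "Fm G n g"
  have t: "thom (VM 0 n (rm Y)) G ?F" and s: "?F ` zvec n = carrier G" using gp by (simp_all add: gpair_def)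
  have Fred: "?F (red q v) = ?F v" for v by (rule G.Fm_eq_mod[OF g qG]) (simp_all add: red_def)
  have FI: "?F (rv w) = \<zero>\<^bsub>G\<^esub>" if "w \<in> I" for w
  proof -
    obtain u where u: "u \<in> vecs R n" "w = mvmult R n B u" using \<open>w \<in> I\<close> unfolding I_def by blast
    have "?F (rv w) = ?F (act (VM 0 n (rm Y)) Q (rv u))" unfolding u(2) rvB[OF u(1)] Fred ..
    also have "\<dots> = act G Q (?F (rv u))"
      using thom_maps(5)[OF tgroup_VM G t, of "rv u" Q] rv_zvec[OF u(1)] by simp
    finally show ?thesis using QG[OF G.Fm_closed[OF g]] by simp
  qed
  have Ivec: "I \<subseteq> vecs R n" unfolding I_def using mv_closed[OF B] by blast
  have Fadd: "?F (rv (vadd R n v w)) = ?F (rv v) \<oplus>\<^bsub>G\<^esub> ?F (rv w)" if "v \<in> vecs R n" "w \<in> vecs R n" for v w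
    unfolding rv_add[OF that] Fred by (rule G.Fm_add[OF g])
  \<comment> \<open>Any representative of the coset serves, because F kills
    \<open>I\<close>.\<close>
  define \<phi> where "\<phi> D = ?F (rv (SOME v. v \<in> D))" for D
  have \<phi>: "\<phi> (k v) = ?F (rv v)" if v: "v \<in> vecs R n" for v
  proof -
    have "v \<in> k v" using V.cl_self[OF sgrp_I, of v] v by (simp add: k_cl)
    then have "(SOME v'. v' \<in> k v) \<in> k v" by (rule someI[of "\<lambda>v'. v' \<in> k v"])
    then obtain w where w: "w \<in> I" "(SOME v'. v' \<in> k v) = vadd R n v w" unfolding k_def by blast
    have "?F (rv (vadd R n v w)) = ?F (rv v)" using Fadd[OF v, of w] FI[OF w(1)] Ivec w(1) G.Fm_closed[OF g] by auto
    then show ?thesis unfolding \<phi>_def w(2) .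
  qed
  have inI: "d \<in> I" if d: "d \<in> vecs R n" "?F (rv d) = \<zero>\<^bsub>G\<^esub>" for d
  proof -
    obtain a U where aU: "a \<in> vecs R n" "U \<in> vecs R n" "d = vadd R n (mvmult R n B a) (vsmult R n (\<iota> q) U)"
      using gpair_kernel[OF gp d] by (elim bexE)
    have "mvmult R n B a \<in> I" unfolding I_def using aU(1) by (rule imageI)
    then show ?thesis unfolding aU(3) using qI[OF aU(2)] sgrp_I unfolding V.sgrp_def VG_simps by blast
  qed
  show ?thesis unfolding tmod_iso_def C_carrier
  proof (intro exI[of _ \<phi>] conjI ballI)
    show "bij_betw \<phi> (k ` vecs R n) (carrier G)" unfolding bij_betw_def
    proof
      show "inj_on \<phi> (k ` vecs R n)"
      proof (rule inj_onI)
        fix x y assume xy: "x \<in> k ` vecs R n" "y \<in> k ` vecs R n" "\<phi> x = \<phi> y"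
        then obtain v w where v: "v \<in> vecs R n" "x = k v" and w: "w \<in> vecs R n" "y = k w" by blast
        have e: "?F (rv v) = ?F (rv w)" using xy(3) unfolding v(2) w(2) \<phi>[OF v(1)] \<phi>[OF w(1)] .
        have d: "v \<ominus>\<^bsub>VG Y\<^esub> w \<in> vecs R n" using V.minus_closed[of v w] v w by simp
        have "?F (rv (v \<ominus>\<^bsub>VG Y\<^esub> w)) = ?F (\<lambda>i. rv v i - rv w i)"
          by (rule G.Fm_eq_mod[OF g qG]) (simp_all add: rv_minus[OF v(1) w(1)])
        also have "\<dots> = \<zero>\<^bsub>G\<^esub>" unfolding G.Fm_diff[OF g] e using G.Fm_closed[OF g] by (simp add: G.minus_eq_zero_iff)
        finally show "x = y" unfolding v(2) w(2) k_eq_iff[OF v(1) w(1)] by (rule inI[OF d])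
      qed
      show "\<phi> ` k ` vecs R n = carrier G"
      proof (intro subset_antisym subsetI)
        fix x assume "x \<in> \<phi> ` k ` vecs R n"
        then obtain v where "v \<in> vecs R n" "x = \<phi> (k v)" by blast
        then show "x \<in> carrier G" using \<phi> G.Fm_closed[OF g] by simp
      next
        fix x assume "x \<in> carrier G"
        then have "x \<in> ?F ` zvec n" unfolding s .
        then obtain v where v: "x = ?F v" "v \<in> zvec n" by (rule imageE)
        have "\<phi> (k (lv v)) = x" unfolding \<phi>[OF lv_vecs[OF v(2)]] rv_lv Fred v(1) ..
        then show "x \<in> \<phi> ` k ` vecs R n" using lv_vecs[OF v(2)] by blast
      qed
    qed
    fix x assume "x \<in> k ` vecs R n"
    then obtain v where v: "v \<in> vecs R n" "x = k v" by blast
    show "\<phi> (tact C x) = tact G (\<phi> x)"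
      unfolding v(2) C_tact[OF v(1)] \<phi>[OF v(1)] \<phi>[OF mv_closed[OF Y v(1)]] rv_mv[OF Y v(1)] Fred
      using thomD(3)[OF t, of "rv v"] rv_zvec[OF v(1)] by simp
    show "\<phi> (module.smult C a x) = module.smult G a (\<phi> x)" if a: "a \<in> carrier R" for a
      unfolding v(2) C_smult[OF a v(1)] \<phi>[OF v(1)] \<phi>[OF vs_closed[OF a v(1)]] rv_smult[OF v(1) a] Fred
        G.Fm_scale[OF g] sm[OF a G.Fm_closed[OF g]] ..
    fix y assume "y \<in> k ` vecs R n"
    then obtain w where w: "w \<in> vecs R n" "y = k w" by blast
    show "\<phi> (x \<oplus>\<^bsub>C\<^esub> y) = \<phi> x \<oplus>\<^bsub>G\<^esub> \<phi> y"
      unfolding v(2) w(2) C_add[OF v(1) w(1)] \<phi>[OF v(1)] \<phi>[OF w(1)] \<phi>[OF va_closed[OF v(1) w(1)]] by (rule Fadd[OF v(1) w(1)])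
  qed
qed

end

section \<open>The p-adic integers\<close>

lemma Zp_simps:
  "z \<in> carrier (Zp_ring p) \<longleftrightarrow> (\<forall>k. 0 \<le> z k \<and> z k < p ^ k \<and> z (Suc k) mod p ^ k = z k)"
  "x \<otimes>\<^bsub>Zp_ring p\<^esub> y = (\<lambda>k. (x k * y k) mod p ^ k)"
  "x \<oplus>\<^bsub>Zp_ring p\<^esub> y = (\<lambda>k. (x k + y k) mod p ^ k)"
  "\<one>\<^bsub>Zp_ring p\<^esub> = (\<lambda>k. 1 mod p ^ k)" "\<zero>\<^bsub>Zp_ring p\<^esub> = (\<lambda>k. 0)"
  by (simp_all add: Zp_ring_def)

lemma Zp_compat:
  assumes z: "z \<in> carrier (Zp_ring p)" and "l \<le> m" shows "z m mod p ^ l = z l"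
  using \<open>l \<le> m\<close>
proof (induction m rule: dec_induct)
  case base
  then show ?case using z by (simp add: Zp_simps)
next
  case (step m)
  have "z (Suc m) mod p ^ l = z (Suc m) mod p ^ m mod p ^ l" using step by (simp add: mod_mod_cancel le_imp_power_dvd)
  then show ?case using step z by (simp add: Zp_simps)
qed

text \<open>The canonical map from Z to Z_p.\<close>

definition iz :: "int \<Rightarrow> int \<Rightarrow> nat \<Rightarrow> int" where
  "iz p k = (\<lambda>i. k mod p ^ i)"

lemma iz_closed: "p > 0 \<Longrightarrow> iz p k \<in> carrier (Zp_ring p)"
  by (simp add: Zp_simps iz_def mod_mod_cancel)

text \<open>Division by p^N shifts the levels: level i of the quotient b is read off from level N +
  i of a.\<close>

lemma Zp_split:
  assumes p: "p > 0" and a: "a \<in> carrier (Zp_ring p)"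
  shows "\<exists>b\<in>carrier (Zp_ring p). a = iz p (a N) \<oplus>\<^bsub>Zp_ring p\<^esub> iz p (p ^ N) \<otimes>\<^bsub>Zp_ring p\<^esub> b"
proof -
  define b where "b i = a (N + i) div p ^ N" for i
  have pN: "p ^ N > 0" using p by simp
  have "0 \<le> b i \<and> b i < p ^ i \<and> b (Suc i) mod p ^ i = b i" for i
  proof (intro conjI)
    have ai: "0 \<le> a (N + i)" "a (N + i) < p ^ (N + i)" using a by (simp_all add: Zp_simps)
    show "0 \<le> b i" unfolding b_def using ai(1) pN by (simp add: pos_imp_zdiv_nonneg_iff)
    have "a (N + i) < p ^ i * p ^ N" using ai(2) by (simp add: power_add mult.commute)
    moreover have "a (N + i) div p ^ N * p ^ N \<le> a (N + i)"
      using pos_mod_sign[OF pN, of "a (N + i)"] minus_mod_eq_div_mult[of "a (N + i)" "p ^ N"] by linarith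
    ultimately have "b i * p ^ N < p ^ i * p ^ N" unfolding b_def by linarith
    then show "b i < p ^ i" using pN by (simp add: mult_less_cancel_right)
    have "a (N + i) = a (N + Suc i) mod (p ^ N * p ^ i)" using Zp_compat[OF a, of "N + i" "N + Suc i"] by (simp add: power_add)
    also have "\<dots> = p ^ N * (a (N + Suc i) div p ^ N mod p ^ i) + a (N + Suc i) mod p ^ N"
      using p by (intro zmod_zmult2_eq) simp
    finally have "b i = (p ^ N * (b (Suc i) mod p ^ i) + a (N + Suc i) mod p ^ N) div p ^ N" unfolding b_def by simp
    also have "\<dots> = b (Suc i) mod p ^ i + a (N + Suc i) mod p ^ N div p ^ N"
      by (rule div_mult_self4) (use pN in linarith)
    also have "\<dots> = b (Suc i) mod p ^ i" by (simp only: mod_div_trivial add_0_right)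
    finally show "b (Suc i) mod p ^ i = b i" by simp
  qed
  then have bc: "b \<in> carrier (Zp_ring p)" by (simp add: Zp_simps)
  have "a i = ((a N mod p ^ i) + ((p ^ N mod p ^ i) * b i) mod p ^ i) mod p ^ i" for i
  proof -
    have "a i = a (N + i) mod p ^ i" using Zp_compat[OF a, of i "N + i"] by simp
    also have "a (N + i) = a (N + i) mod p ^ N + p ^ N * (a (N + i) div p ^ N)" by simp
    also have "a (N + i) mod p ^ N = a N" using Zp_compat[OF a, of N "N + i"] by simp
    finally show ?thesis by (simp add: b_def mod_simps)
  qed
  then have "a = iz p (a N) \<oplus>\<^bsub>Zp_ring p\<^esub> iz p (p ^ N) \<otimes>\<^bsub>Zp_ring p\<^esub> b"
    unfolding Zp_simps iz_def by (intro ext)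
  then show ?thesis using bc by (rule bexI)
qed

lemma aring_Zp:
  assumes p: "p > 0" and R: "cring (Zp_ring p)"
  shows "aring (Zp_ring p) (p ^ N) (\<lambda>z. z N) (iz p)"
proof (intro aring.intro aring_axioms.intro R)
  show "\<exists>b\<in>carrier (Zp_ring p). a = iz p (a N) \<oplus>\<^bsub>Zp_ring p\<^esub> iz p (p ^ N) \<otimes>\<^bsub>Zp_ring p\<^esub> b" if "a \<in> carrier (Zp_ring p)" for a
    by (rule Zp_split[OF p that])
  show "iz p k \<in> carrier (Zp_ring p)" for k by (rule iz_closed[OF p])
qed (use p in \<open>auto simp: Zp_simps iz_def fun_eq_iff mod_simps\<close>)

lemma aring_res:
  assumes p: "p > 1"
  shows "aring (residue_ring p) p (\<lambda>z. z) (\<lambda>k. k mod p)"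
proof -
  interpret residues p "residue_ring p" by (simp add: residues_def p)
  show ?thesis
  proof (intro aring.intro aring_axioms.intro)
    show "cring (residue_ring p)" by (rule cring)
    fix a assume a: "a \<in> carrier (residue_ring p)"
    then have "a = a mod p \<oplus>\<^bsub>residue_ring p\<^esub> (p mod p) \<otimes>\<^bsub>residue_ring p\<^esub> 0" by (simp add: residue_ring_def)
    moreover have "0 \<in> carrier (residue_ring p)" using p by (simp add: residue_ring_def)
    ultimately show "\<exists>b\<in>carrier (residue_ring p). a = a mod p \<oplus>\<^bsub>residue_ring p\<^esub> (p mod p) \<otimes>\<^bsub>residue_ring p\<^esub> b"
      by (rule bexI)
  qed (use p in \<open>auto simp: residue_ring_def mod_simps pos_mod_bound zle_diff1_eq\<close>)
qed

lemma red_T_red: "v \<in> zvec n \<Longrightarrow> red q (tact (VM 0 n A) (red q v)) = red q (tact (VM 0 n A) v)"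
proof -
  assume v: "v \<in> zvec n"
  have rv: "red q v \<in> zvec n" using v by (simp add: red_def)
  have "red q (tact (VM 0 n A) v) = tact (VM q n A) (red q v)"
    using thomD(3)[OF thom_red[of q 0 n A A], of v] v by simp
  moreover have "red q (tact (VM 0 n A) (red q v)) = tact (VM q n A) (red q (red q v))"
    using thomD(3)[OF thom_red[of q 0 n A A], of "red q v"] rv by simp
  moreover have "red q (red q v) = red q v" by (simp add: red_def)
  ultimately show ?thesis by simp
qed

lemma red_act_red: "v \<in> zvec n \<Longrightarrow> red q (act (VM 0 n A) Q (red q v)) = red q (act (VM 0 n A) Q v)"
proof -
  assume v: "v \<in> zvec n"
  have rv: "red q v \<in> zvec n" using v by (simp add: red_def)
  show ?thesis unfolding red_act[OF v] red_act[OF rv] by (simp add: red_def)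
qed

lemma (in aring) rv_comm:
  assumes A: "A \<in> mats R n" and P: "\<And>m. m < length P \<Longrightarrow> pcoeff P m \<in> carrier R" and v: "v \<in> vecs R n"
  shows "rv (mvmult R n A (mvmult R n (mpoly_eval R n P A) v)) = rv (mvmult R n (mpoly_eval R n P A) (mvmult R n A v))"
proof -
  define Q where "Q = rpoly (length P) (\<lambda>m. \<rho> (pcoeff P m))"
  have Q: "\<And>m. m < length P \<Longrightarrow> Polynomial.coeff Q m mod q = \<rho> (pcoeff P m)" "\<And>m. m \<ge> length P \<Longrightarrow> Polynomial.coeff Q m = 0"
    using P by (simp_all add: Q_def coeff_rpoly)
  let ?B = "mpoly_eval R n P A" and ?T = "tact (VM 0 n (rm A))" and ?a = "act (VM 0 n (rm A)) Q"
  have vz: "rv v \<in> zvec n" by (rule rv_zvec[OF v])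
  have B: "?B \<in> mats R n" by (rule mpoly_mats[OF A P])
  have "rv (mvmult R n A (mvmult R n ?B v)) = red q (?T (red q (?a (rv v))))"
  proof -
    have "rv (mvmult R n ?B v) = red q (?a (rv v))" by (rule rv_mpoly[OF A P v Q])
    then show ?thesis unfolding rv_mv[OF A mv_closed[OF B v]] by simp
  qed
  also have "\<dots> = red q (?T (?a (rv v)))" by (rule red_T_red[OF VM0_act_closed[OF vz]])
  also have "\<dots> = red q (?a (?T (rv v)))" using tgroup.act_T[OF tgroup_VM, of "rv v" 0 n "rm A" Q] vz by simp
  also have "\<dots> = red q (?a (red q (?T (rv v))))" by (rule red_act_red[OF VM0_T_closed, symmetric])
  also have "\<dots> = rv (mvmult R n ?B (mvmult R n A v))"
  proof -
    have "rv (mvmult R n ?B (mvmult R n A v)) = red q (?a (rv (mvmult R n A v)))" by (rule rv_mpoly[OF A P mv_closed[OF A v] Q])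
    then show ?thesis unfolding rv_mv[OF A v] by simp
  qed
  finally show ?thesis .
qed

text \<open>An equation in Z_p may be checked at every level p^t. There it says that t commutes with
  an integral polynomial in t, which is \<open>rv_comm\<close>.\<close>

lemma Zp_comm:
  assumes p: "p > 0" and R: "cring (Zp_ring p)" and A: "A \<in> mats (Zp_ring p) n"
    and P: "\<And>m. m < length P \<Longrightarrow> pcoeff P m \<in> carrier (Zp_ring p)" and v: "v \<in> vecs (Zp_ring p) n"
  shows "mvmult (Zp_ring p) n A (mvmult (Zp_ring p) n (mpoly_eval (Zp_ring p) n P A) v) =
    mvmult (Zp_ring p) n (mpoly_eval (Zp_ring p) n P A) (mvmult (Zp_ring p) n A v)"
proof (intro ext)
  fix i t
  interpret aring "Zp_ring p" "p ^ t" "\<lambda>z. z t" "iz p" n by (rule aring_Zp[OF p R])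
  show "mvmult (Zp_ring p) n A (mvmult (Zp_ring p) n (mpoly_eval (Zp_ring p) n P A) v) i t =
    mvmult (Zp_ring p) n (mpoly_eval (Zp_ring p) n P A) (mvmult (Zp_ring p) n A v) i t"
    using fun_cong[OF rv_comm[OF A P v], of i] unfolding rv_def .
qed

text \<open>Completeness of Z_p: applying \<open>H\<close> again and again to the remainder gives
  p^k V = B (a_0 + p a_1 + p^2 a_2 + ...), and the series converges p-adically.\<close>

lemma Zp_nakayama:
  assumes p: "p > 0" and R: "cring (Zp_ring p)" and B: "B \<in> mats (Zp_ring p) n"
    and H: "\<And>V. V \<in> vecs (Zp_ring p) n \<Longrightarrow> \<exists>a\<in>vecs (Zp_ring p) n. \<exists>b\<in>vecs (Zp_ring p) n.
      vsmult (Zp_ring p) n (iz p (p ^ k)) V =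
      vadd (Zp_ring p) n (mvmult (Zp_ring p) n B a) (vsmult (Zp_ring p) n (iz p (p ^ Suc k)) b)"
    and V: "V \<in> vecs (Zp_ring p) n"
  shows "vsmult (Zp_ring p) n (iz p (p ^ k)) V \<in> mvmult (Zp_ring p) n B ` vecs (Zp_ring p) n"
proof -
  let ?R = "Zp_ring p"
  have "\<exists>ab. V \<in> vecs ?R n \<longrightarrow> fst ab \<in> vecs ?R n \<and> snd ab \<in> vecs ?R n \<and> vsmult ?R n (iz p (p ^ k)) V =
      vadd ?R n (mvmult ?R n B (fst ab)) (vsmult ?R n (iz p (p ^ Suc k)) (snd ab))" for V
  proof (cases "V \<in> vecs ?R n")
    case True
    from H[OF this] obtain a b where "a \<in> vecs ?R n" "b \<in> vecs ?R n" "vsmult ?R n (iz p (p ^ k)) V =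
      vadd ?R n (mvmult ?R n B a) (vsmult ?R n (iz p (p ^ Suc k)) b)" by (elim bexE)
    then show ?thesis by (intro exI[of _ "(a, b)"]) simp
  qed simp
  then obtain f where f: "\<And>V. V \<in> vecs ?R n \<Longrightarrow> fst (f V) \<in> vecs ?R n \<and> snd (f V) \<in> vecs ?R n \<and> vsmult ?R n (iz p (p ^ k)) V =
      vadd ?R n (mvmult ?R n B (fst (f V))) (vsmult ?R n (iz p (p ^ Suc k)) (snd (f V)))" by metis
  \<comment> \<open>The remainders of the iteration; \<open>a m\<close> is the solution vector
    obtained for \<open>W m\<close>.\<close>
  define W where "W m = ((\<lambda>V. snd (f V)) ^^ m) V" for m
  define a where "a m = fst (f (W m))" for m
  have W: "W m \<in> vecs ?R n" for m by (induction m) (use V f in \<open>auto simp: W_def\<close>)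
  have a: "a m \<in> vecs ?R n" for m using f[OF W] by (simp add: a_def)
  have eq: "vsmult ?R n (iz p (p ^ k)) (W m) = vadd ?R n (mvmult ?R n B (a m)) (vsmult ?R n (iz p (p ^ Suc k)) (W (Suc m)))" for m
    using f[OF W[of m]] unfolding a_def by (simp add: W_def)
  have zc: "v j \<in> carrier ?R" if "v \<in> vecs ?R n" for v j
    using that p by (cases "j < n") (simp_all add: vecs_def Zp_simps)
  have mv: "mvmult ?R n B v i t = (\<Sum>j<n. B i j t * v j t) mod p ^ t" if v: "v \<in> vecs ?R n" and i: "i < n" for v i t
  proof -
    interpret aring ?R "p ^ t" "\<lambda>z. z t" "iz p" n by (rule aring_Zp[OF p R])
    show ?thesis using fun_cong[OF rv_mv[OF B v], of i] i by (simp add: rv_def red_def rm_def)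
  qed
  have lev: "[p ^ k * W m i t = (\<Sum>j<n. B i j t * a m j t) + p ^ Suc k * W (Suc m) i t] (mod p ^ t)" if i: "i < n" for m i t
  proof -
    have "vsmult ?R n (iz p (p ^ k)) (W m) i t = vadd ?R n (mvmult ?R n B (a m)) (vsmult ?R n (iz p (p ^ Suc k)) (W (Suc m))) i t"
      unfolding eq ..
    then show ?thesis using i mv[OF a i, of m t]
      by (simp add: vsmult_def vadd_def Zp_simps iz_def Cong.cong_def mod_simps)
  qed
  \<comment> \<open>The limit of the series. At level t the terms with m \<ge> t are multiples of
    p^t, so t summands suffice.\<close>
  define u where "u j t = (if j < n then (\<Sum>m<t. p ^ m * a m j t) mod p ^ t else 0)" for j t
  have u: "u \<in> vecs ?R n"
  proof -
    have "u j \<in> carrier ?R" if j: "j < n" for j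
    proof -
      have "u j (Suc t) mod p ^ t = u j t" for t
      proof -
        have "u j (Suc t) mod p ^ t = (\<Sum>m<Suc t. p ^ m * a m j (Suc t)) mod p ^ t"
          using j by (simp only: u_def if_True) (simp add: mod_mod_cancel)
        also have "\<dots> = (\<Sum>m<t. p ^ m * a m j (Suc t) mod p ^ t) mod p ^ t" by (simp add: mod_sum_eq)
        also have "\<dots> = (\<Sum>m<t. p ^ m * (a m j (Suc t) mod p ^ t) mod p ^ t) mod p ^ t" by (simp add: mod_mult_right_eq)
        also have "\<dots> = (\<Sum>m<t. p ^ m * a m j t mod p ^ t) mod p ^ t"
          using zc[OF a, of _ j] by (simp add: Zp_simps)
        also have "\<dots> = u j t" using j by (simp add: u_def mod_sum_eq)
        finally show ?thesis .
      qed
      then show ?thesis using p j by (simp add: Zp_simps u_def)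
    qed
    moreover have "u j = \<zero>\<^bsub>?R\<^esub>" if "n \<le> j" for j using that by (simp add: u_def fun_eq_iff Zp_simps)
    ultimately show ?thesis by (simp add: vecs_def)
  qed
  \<comment> \<open>After s rounds the error is p^(k + s) W s, which vanishes at level t for s =
    t.\<close>
  have tel: "[p ^ k * V i t = (\<Sum>m<s. p ^ m * (\<Sum>j<n. B i j t * a m j t)) + p ^ (k + s) * W s i t] (mod p ^ t)" if i: "i < n" for i t s
  proof (induction s)
    case 0
    then show ?case by (simp add: W_def)
  next
    case (Suc s)
    have "[p ^ s * (p ^ k * W s i t) = p ^ s * ((\<Sum>j<n. B i j t * a s j t) + p ^ Suc k * W (Suc s) i t)] (mod p ^ t)"
      by (rule cong_scalar_left[OF lev[OF i]])
    then have "[(\<Sum>m<s. p ^ m * (\<Sum>j<n. B i j t * a m j t)) + p ^ (k + s) * W s i t =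
      (\<Sum>m<s. p ^ m * (\<Sum>j<n. B i j t * a m j t)) + p ^ s * ((\<Sum>j<n. B i j t * a s j t) + p ^ Suc k * W (Suc s) i t)] (mod p ^ t)"
      by (intro cong_add cong_refl) (simp add: power_add mult_ac)
    from cong_trans[OF Suc.IH this] show ?case by (simp add: power_add algebra_simps)
  qed
  have "vsmult ?R n (iz p (p ^ k)) V = mvmult ?R n B u"
  proof (intro ext)
    fix i t
    show "vsmult ?R n (iz p (p ^ k)) V i t = mvmult ?R n B u i t"
    proof (cases "i < n")
      case False
      then show ?thesis by (simp add: vsmult_def mvmult_def)
    next
      case i: True
      have "vsmult ?R n (iz p (p ^ k)) V i t = (p ^ k * V i t) mod p ^ t"
        using i by (simp add: vsmult_def Zp_simps iz_def mod_simps)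
      also have "\<dots> = ((\<Sum>m<t. p ^ m * (\<Sum>j<n. B i j t * a m j t)) + p ^ (k + t) * W t i t) mod p ^ t"
        using tel[OF i, of t t] by (simp add: Cong.cong_def)
      also have "\<dots> = (\<Sum>m<t. p ^ m * (\<Sum>j<n. B i j t * a m j t)) mod p ^ t"
        by (simp add: power_add mod_add_eq[symmetric] mult.assoc mult.left_commute)
      also have "(\<Sum>m<t. p ^ m * (\<Sum>j<n. B i j t * a m j t)) = (\<Sum>j<n. B i j t * (\<Sum>m<t. p ^ m * a m j t))"
        unfolding sum_distrib_left by (subst sum.swap) (simp add: mult.left_commute)
      also have "\<dots> mod p ^ t = (\<Sum>j<n. B i j t * u j t mod p ^ t) mod p ^ t"
        by (simp add: u_def mod_mult_right_eq mod_sum_eq)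
      also have "\<dots> = mvmult ?R n B u i t" unfolding mv[OF u i] by (simp add: mod_sum_eq)
      finally show ?thesis .
    qed
  qed
  then show ?thesis using u by (rule image_eqI)
qed

lemma Zp_module_int:
  assumes p: "p > 0" and M: "module (Zp_ring p) G" and x: "x \<in> carrier G"
  shows "module.smult G (iz p k) x = add_pow G k x"
proof -
  interpret M: module "Zp_ring p" G by (rule M)
  interpret A: aring "Zp_ring p" "p ^ 0" "\<lambda>z. z 0" "iz p" 0 by (rule aring_Zp[OF p M.R.is_cring])
  show ?thesis
  proof (induction k rule: int_induct[where k = 0])
    case base
    then show ?case using x by simp
  next
    case (step1 k)
    then show ?case using x by (simp add: A.\<iota>_add A.\<iota>_1 M.smult_l_distr M.M.zm_add)
  next
    case (step2 k)
    let ?y = "module.smult G (iz p (k - 1)) x"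
    have y: "?y \<in> carrier G" using x by simp
    have "module.smult G (iz p ((k - 1) + 1)) x = ?y \<oplus>\<^bsub>G\<^esub> x"
      unfolding A.\<iota>_add A.\<iota>_1 using x by (simp add: M.smult_l_distr)
    then have "?y \<oplus>\<^bsub>G\<^esub> x = add_pow G k x" using step2 by simp
    then have "?y = add_pow G k x \<ominus>\<^bsub>G\<^esub> x" using x y by (subst M.M.add_eq_minus_iff[symmetric]) simp_all
    then show ?case using x by (simp add: M.M.zm_diff)
  qed
qed

text \<open>The inverse is the geometric series in p^c; as c > 0, its first k terms suffice at level
  k.\<close>

lemma Zp_one_minus_unit:
  assumes p: "p > 0" and c: "c > 0"
  shows "\<exists>e\<in>carrier (Zp_ring p). e \<otimes>\<^bsub>Zp_ring p\<^esub> iz p (1 - p ^ c) = \<one>\<^bsub>Zp_ring p\<^esub>"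
proof -
  define e where "e k = (\<Sum>m<k. (p ^ c) ^ m) mod p ^ k" for k
  have dv: "p ^ k dvd (p ^ c) ^ k" for k using c by (simp add: power_mult[symmetric] le_imp_power_dvd)
  have "e (Suc k) mod p ^ k = e k" for k
  proof -
    have "e (Suc k) mod p ^ k = ((\<Sum>m<k. (p ^ c) ^ m) + (p ^ c) ^ k) mod p ^ k"
      unfolding e_def by (simp add: mod_mod_cancel)
    also have "\<dots> = e k" unfolding e_def using dv[of k] by (metis add.right_neutral mod_add_right_eq mod_0_imp_dvd dvd_imp_mod_0)
    finally show ?thesis .
  qed
  then have ec: "e \<in> carrier (Zp_ring p)" using p by (simp add: Zp_simps e_def)
  have "e \<otimes>\<^bsub>Zp_ring p\<^esub> iz p (1 - p ^ c) = \<one>\<^bsub>Zp_ring p\<^esub>"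
  proof
    fix k
    have "(\<Sum>m<k. (p ^ c) ^ m) * (1 - p ^ c) = 1 - (p ^ c) ^ k"
      using one_diff_power_eq[of "p ^ c" k] by (simp add: mult.commute)
    moreover have "(1 - (p ^ c) ^ k) mod p ^ k = 1 mod p ^ k"
      using dv[of k] by (simp add: mod_eq_dvd_iff)
    ultimately show "(e \<otimes>\<^bsub>Zp_ring p\<^esub> iz p (1 - p ^ c)) k = \<one>\<^bsub>Zp_ring p\<^esub> k"
      by (simp add: Zp_simps iz_def e_def mod_mult_eq)
  qed
  then show ?thesis using ec by (rule bexI)
qed

text \<open>In a finite module p^i x = p^j x for some i < j, so (1 - p^(j-i)) p^i x = 0; as 1 -
  p^(j-i) is a unit of Z_p, p^i x = 0. All large exponents are allowed, so that one N can serve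
  several modules.\<close>

lemma Zp_finite_killed:
  assumes p: "p > 0" and M: "module (Zp_ring p) G" and fin: "finite (carrier G)"
  shows "\<exists>M0. \<forall>M\<ge>M0. \<forall>x\<in>carrier G. add_pow G (p ^ M) x = \<zero>\<^bsub>G\<^esub>"
proof -
  interpret M: module "Zp_ring p" G by (rule M)
  have "\<exists>i::nat. add_pow G (p ^ i) x = \<zero>\<^bsub>G\<^esub>" if x: "x \<in> carrier G" for x
  proof -
    have "\<not> inj (\<lambda>i::nat. add_pow G (p ^ i) x)"
    proof
      assume "inj (\<lambda>i::nat. add_pow G (p ^ i) x)"
      moreover have "range (\<lambda>i::nat. add_pow G (p ^ i) x) \<subseteq> carrier G" using x by blast
      ultimately show False using fin by (metis finite_imageD finite_subset infinite_UNIV_nat)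
    qed
    then obtain i j :: nat where ij: "i < j" "add_pow G (p ^ i) x = add_pow G (p ^ j) x"
      unfolding inj_def by (metis linorder_neqE_nat)
    define y c where "y = add_pow G (p ^ i) x" and "c = j - i"
    have y: "y \<in> carrier G" using x by (simp add: y_def)
    have "p ^ j = p ^ c * p ^ i" using ij(1) by (simp add: c_def power_add[symmetric])
    then have "y = add_pow G (p ^ c) y" using ij(2) x by (simp add: y_def M.M.zm_mult)
    then have z: "add_pow G (1 - p ^ c) y = \<zero>\<^bsub>G\<^esub>" using y by (simp add: M.M.zm_diff M.M.minus_eq_zero_iff)
    obtain e where e: "e \<in> carrier (Zp_ring p)" "e \<otimes>\<^bsub>Zp_ring p\<^esub> iz p (1 - p ^ c) = \<one>\<^bsub>Zp_ring p\<^esub>"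
      using Zp_one_minus_unit[OF p, of c] ij(1) by (auto simp: c_def)
    have "y = module.smult G (e \<otimes>\<^bsub>Zp_ring p\<^esub> iz p (1 - p ^ c)) y" unfolding e(2) using y by simp
    also have "\<dots> = module.smult G e (module.smult G (iz p (1 - p ^ c)) y)"
      by (rule M.smult_assoc1[OF e(1) iz_closed[OF p] y])
    also have "\<dots> = \<zero>\<^bsub>G\<^esub>" unfolding Zp_module_int[OF p M y] z using e(1) by simp
    finally show ?thesis unfolding y_def by blast
  qed
  then obtain f where f: "\<And>x. x \<in> carrier G \<Longrightarrow> add_pow G (p ^ (f x :: nat)) x = \<zero>\<^bsub>G\<^esub>" by metis
  have "add_pow G (p ^ N) x = \<zero>\<^bsub>G\<^esub>" if N: "N \<ge> Max (f ` carrier G)" and x: "x \<in> carrier G" for N x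
  proof -
    have "f x \<le> N" using fin x N by (meson Max_ge finite_imageI imageI order_trans)
    then have "p ^ N = p ^ (N - f x) * p ^ f x" by (simp add: power_add[symmetric])
    then show ?thesis using f[OF x] x by (simp add: M.M.zm_mult)
  qed
  then show ?thesis by blast
qed

text \<open>Split a at level N; the multiple of p^N dies on G. Thus the action of Z_p is determined
  by the group structure.\<close>

lemma Zp_smult_level:
  assumes p: "p > 0" and M: "module (Zp_ring p) G" and k: "\<And>x. x \<in> carrier G \<Longrightarrow> add_pow G (p ^ N) x = \<zero>\<^bsub>G\<^esub>"
    and a: "a \<in> carrier (Zp_ring p)" and x: "x \<in> carrier G"
  shows "module.smult G a x = add_pow G (a N) x"
proof -
  interpret M: module "Zp_ring p" G by (rule M)
  obtain b where b: "b \<in> carrier (Zp_ring p)" "a = iz p (a N) \<oplus>\<^bsub>Zp_ring p\<^esub> iz p (p ^ N) \<otimes>\<^bsub>Zp_ring p\<^esub> b"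
    using Zp_split[OF p a, of N] by (elim bexE)
  note ic = iz_closed[OF p]
  have bx: "module.smult G b x \<in> carrier G" using b(1) x by simp
  have "module.smult G a x = module.smult G (iz p (a N) \<oplus>\<^bsub>Zp_ring p\<^esub> iz p (p ^ N) \<otimes>\<^bsub>Zp_ring p\<^esub> b) x"
    using b(2) by (rule arg_cong)
  also have "\<dots> = add_pow G (a N) x \<oplus>\<^bsub>G\<^esub> module.smult G (iz p (p ^ N)) (module.smult G b x)"
    using ic b(1) x by (simp add: M.smult_l_distr M.smult_assoc1 Zp_module_int[OF p M])
  also have "\<dots> = add_pow G (a N) x" unfolding Zp_module_int[OF p M bx] k[OF bx] using x by simp
  finally show ?thesis .
qed

text \<open>An integral polynomial congruent to P modulo p^N. It acts like P on modules killed by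
  p^N, and for N \<ge> 1 its reduction modulo p is that of P.\<close>

definition lvlpoly :: "nat \<Rightarrow> (nat \<Rightarrow> int) list \<Rightarrow> int poly" where
  "lvlpoly N P = rpoly (length P) (\<lambda>m. pcoeff P m N)"

lemma Zp_poly_coeffs:
  assumes "P \<in> carrier (univ_poly (Zp_ring p) (carrier (Zp_ring p)))" "m < length P"
  shows "pcoeff P m \<in> carrier (Zp_ring p)"
proof -
  have "polynomial\<^bsub>Zp_ring p\<^esub> (carrier (Zp_ring p)) P" unfolding univ_poly_carrier by (rule assms(1))
  then have "set P \<subseteq> carrier (Zp_ring p)" using assms(2) by (auto simp: polynomial_def)
  then show ?thesis using assms(2) by (auto simp: pcoeff_def subset_iff)
qed

lemma poly_tmodule_tgroup:
  assumes "poly_tmodule R P G" shows "tgroup G"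
proof -
  have m: "module R G" using assms by (simp add: poly_tmodule_def)
  then interpret module R G .
  show ?thesis using assms
    by (intro tgroup.intro tgroup_axioms.intro M.abelian_group_axioms) (auto simp: poly_tmodule_def)
qed

lemma poly_tmodule_act:
  assumes p: "p > 0" and T: "poly_tmodule (Zp_ring p) P G"
    and P: "P \<in> carrier (univ_poly (Zp_ring p) (carrier (Zp_ring p)))"
    and k: "\<And>x. x \<in> carrier G \<Longrightarrow> add_pow G (p ^ N) x = \<zero>\<^bsub>G\<^esub>" and x: "x \<in> carrier G"
  shows "act G (lvlpoly N P) x = \<zero>\<^bsub>G\<^esub>"
proof -
  interpret G: tgroup G by (rule poly_tmodule_tgroup[OF T])
  have M: "module (Zp_ring p) G" using T by (simp add: poly_tmodule_def)
  have "act G (lvlpoly N P) x = (\<Oplus>\<^bsub>G\<^esub> m\<in>{..<length P}. add_pow G (Polynomial.coeff (lvlpoly N P) m) ((tact G ^^ m) x))"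
    using x by (intro G.act_eq_finsum) (simp_all add: lvlpoly_def coeff_rpoly)
  also have "\<dots> = (\<Oplus>\<^bsub>G\<^esub> m\<in>{..<length P}. module.smult G (pcoeff P m) ((tact G ^^ m) x))"
  proof (rule G.finsum_cong'[OF refl])
    show "(\<lambda>m. module.smult G (pcoeff P m) ((tact G ^^ m) x)) \<in> {..<length P} \<rightarrow> carrier G"
      using module.smult_closed[OF M Zp_poly_coeffs[OF P]] G.T_pow_closed[OF x] by (simp add: Pi_iff)
    fix m assume "m \<in> {..<length P}"
    then have m: "m < length P" by simp
    show "add_pow G (Polynomial.coeff (lvlpoly N P) m) ((tact G ^^ m) x) = module.smult G (pcoeff P m) ((tact G ^^ m) x)"
      using Zp_smult_level[OF p M k Zp_poly_coeffs[OF P m] G.T_pow_closed[OF x]] m by (simp add: lvlpoly_def coeff_rpoly)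
  qed
  also have "\<dots> = \<zero>\<^bsub>G\<^esub>" using T x by (simp add: poly_tmodule_def)
  finally show ?thesis .
qed

section \<open>The quotient G/pG as encoded by \<open>mod_p\<close>\<close>

definition pmul :: "int \<Rightarrow> ((nat \<Rightarrow> int), 'b, 'c) tmodule_scheme \<Rightarrow> 'b set" where
  "pmul p G = {module.smult G (Zp_p p) g | g. g \<in> carrier G}"

definition kap :: "int \<Rightarrow> ((nat \<Rightarrow> int), 'b, 'c) tmodule_scheme \<Rightarrow> 'b \<Rightarrow> 'b set" where
  "kap p G g = {g \<oplus>\<^bsub>G\<^esub> h | h. h \<in> pmul p G}"

locale zpmod = tgroup G for G :: "((nat \<Rightarrow> int), 'b, 'c) tmodule_scheme" (structure) +
  fixes p :: int
  assumes p: "Factorial_Ring.prime p" and M: "module (Zp_ring p) G" and finG: "finite (carrier G)"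
begin

lemma p0: "p > 0" and p1: "p > 1"
  using prime_gt_0_int[OF p] prime_gt_1_int[OF p] by auto

lemma pmul_eq: "pmul p G = (\<lambda>g. p \<diamondop> g) ` carrier G"
proof -
  have "pmul p G = module.smult G (Zp_p p) ` carrier G" unfolding pmul_def by blast
  also have "\<dots> = (\<lambda>g. p \<diamondop> g) ` carrier G"
    by (rule image_cong[OF refl]) (use Zp_module_int[OF p0 M, of _ p] in \<open>simp add: Zp_p_def iz_def\<close>)
  finally show ?thesis .
qed

lemma sgrp_pmul: "sgrp (pmul p G)"
proof -
  have a: "x \<oplus> y \<in> pmul p G" if xy: "x \<in> pmul p G" "y \<in> pmul p G" for x y
  proof -
    obtain a b where ab: "a \<in> carrier G" "x = p \<diamondop> a" "b \<in> carrier G" "y = p \<diamondop> b" using xy unfolding pmul_eq by blast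
    then have "x \<oplus> y = p \<diamondop> (a \<oplus> b)" by (simp add: zm_x_add)
    then show ?thesis unfolding pmul_eq using ab by blast
  qed
  have m: "\<ominus> x \<in> pmul p G" if xm: "x \<in> pmul p G" for x
  proof -
    obtain a where ab: "a \<in> carrier G" "x = p \<diamondop> a" using xm unfolding pmul_eq by blast
    then have "\<ominus> x = p \<diamondop> (\<ominus> a)" by (simp add: zm_x_neg)
    then show ?thesis unfolding pmul_eq using ab by blast
  qed
  have z: "\<zero> \<in> pmul p G" unfolding pmul_eq by (intro image_eqI[of _ _ "\<zero>"]) simp_all
  have s: "pmul p G \<subseteq> carrier G" unfolding pmul_eq by auto
  show ?thesis unfolding sgrp_def using a m z s by blast
qed

lemma kap_cl: "kap p G = cl (pmul p G)"
  by (simp add: kap_def cl_def fun_eq_iff)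

lemma modp_simps: "carrier (mod_p p G) = kap p G ` carrier G" "\<zero>\<^bsub>mod_p p G\<^esub> = pmul p G"
  "E \<oplus>\<^bsub>mod_p p G\<^esub> D = {a \<oplus> b | a b. a \<in> E \<and> b \<in> D}"
  "tact (mod_p p G) E = {tact G a \<oplus> w | a w. a \<in> E \<and> w \<in> pmul p G}"
  "module.smult (mod_p p G) a E = {module.smult G c g \<oplus> h | c g h. c \<in> carrier (Zp_ring p) \<and> red_p c = a \<and> g \<in> E \<and> h \<in> pmul p G}"
  by (simp_all add: mod_p_def Let_def kap_def pmul_def)

lemma T_pmul: "tact G ` pmul p G \<subseteq> pmul p G"
  unfolding pmul_eq by (auto simp: T_zm)

lemma tg_modp: "tgroup (mod_p p G)" and thom_kap: "thom G (mod_p p G) (kap p G)"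
  using quotient_tgroup[OF sgrp_pmul T_pmul, of "mod_p p G"] unfolding kap_cl[symmetric] modp_simps by blast+

lemma kap_ker: assumes x: "x \<in> carrier G" shows "kap p G x = \<zero>\<^bsub>mod_p p G\<^esub> \<longleftrightarrow> (\<exists>y\<in>carrier G. x = p \<diamondop> y)"
proof -
  have "kap p G x = \<zero>\<^bsub>mod_p p G\<^esub> \<longleftrightarrow> cl (pmul p G) x = cl (pmul p G) \<zero>"
    unfolding modp_simps kap_cl cl_zero[OF sgrp_pmul] ..
  also have "\<dots> \<longleftrightarrow> x \<ominus> \<zero> \<in> pmul p G" by (rule cl_eq_iff[OF sgrp_pmul x zero_closed])
  also have "x \<ominus> \<zero> = x" using x add_minus_cancel[of x \<zero>] by simp
  finally show ?thesis unfolding pmul_eq by blast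
qed

text \<open>Any lift c of a has the form a + p b with b in Z_p, and the contribution of p b is
  absorbed by pG; so a acts as an integer multiple.\<close>

lemma smult_modp:
  assumes a: "a \<in> carrier (residue_ring p)" and X: "E \<in> carrier (mod_p p G)"
  shows "module.smult (mod_p p G) a E = add_pow (mod_p p G) a E"
proof -
  interpret Mm: module "Zp_ring p" G by (rule M)
  obtain x where x: "x \<in> carrier G" "E = kap p G x" using X unfolding modp_simps by blast
  have a': "0 \<le> a" "a < p" using a by (auto simp: residue_ring_def)
  note S = sgrp_pmul[unfolded sgrp_def]
  have "module.smult (mod_p p G) a E = kap p G (a \<diamondop> x)"
  proof (intro subset_antisym subsetI)
    fix y assume "y \<in> module.smult (mod_p p G) a E"
    then obtain c g h where y: "y = module.smult G c g \<oplus> h" "c \<in> carrier (Zp_ring p)" "red_p c = a" "g \<in> E" "h \<in> pmul p G"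
      unfolding modp_simps by blast
    obtain i where i: "g = x \<oplus> i" "i \<in> pmul p G" using y(4) unfolding x(2) kap_def by blast
    then obtain z where z: "z \<in> carrier G" "i = p \<diamondop> z" unfolding pmul_eq by blast
    have gc: "g \<in> carrier G" using i z x by simp
    obtain b where b: "b \<in> carrier (Zp_ring p)" "c = iz p (c 1) \<oplus>\<^bsub>Zp_ring p\<^esub> iz p (p ^ 1) \<otimes>\<^bsub>Zp_ring p\<^esub> b"
      using Zp_split[OF p0 y(2), of 1] by (elim bexE)
    have c1: "c 1 = a" using y(3) by (simp add: red_p_def)
    have bg: "module.smult G b g \<in> carrier G" using b(1) gc by simp
    have "module.smult G c g = module.smult G (iz p (c 1) \<oplus>\<^bsub>Zp_ring p\<^esub> iz p (p ^ 1) \<otimes>\<^bsub>Zp_ring p\<^esub> b) g"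
      using b(2) by (rule arg_cong)
    also have "\<dots> = a \<diamondop> g \<oplus> p \<diamondop> module.smult G b g"
      unfolding c1 using iz_closed[OF p0] b(1) gc by (simp add: Mm.smult_l_distr Mm.smult_assoc1 Zp_module_int[OF p0 M])
    also have "a \<diamondop> g = a \<diamondop> x \<oplus> a \<diamondop> i" using i(1) x z by (simp add: zm_x_add)
    also have "a \<diamondop> i = p \<diamondop> (a \<diamondop> z)" using z by (simp add: zm_mult[symmetric] mult.commute)
    finally have "y = a \<diamondop> x \<oplus> (p \<diamondop> (a \<diamondop> z) \<oplus> p \<diamondop> module.smult G b g \<oplus> h)"
      using y(1,5) x z bg S by (simp add: a_assoc subset_iff)
    moreover have "p \<diamondop> (a \<diamondop> z) \<in> pmul p G" "p \<diamondop> module.smult G b g \<in> pmul p G" unfolding pmul_eq using z bg by blast+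
    then have "p \<diamondop> (a \<diamondop> z) \<oplus> p \<diamondop> module.smult G b g \<oplus> h \<in> pmul p G" using S y(5) by blast
    ultimately show "y \<in> kap p G (a \<diamondop> x)" unfolding kap_def by blast
  next
    fix y assume "y \<in> kap p G (a \<diamondop> x)"
    then obtain h where h: "h \<in> pmul p G" "y = a \<diamondop> x \<oplus> h" unfolding kap_def by blast
    have "y = module.smult G (iz p a) x \<oplus> h" using h(2) Zp_module_int[OF p0 M x(1)] by simp
    moreover have "red_p (iz p a) = a" using a' by (simp add: red_p_def iz_def)
    moreover have "x \<in> E" unfolding x(2) kap_cl by (rule cl_self[OF sgrp_pmul x(1)])
    ultimately show "y \<in> module.smult (mod_p p G) a E" unfolding modp_simps using iz_closed[OF p0] h(1) by blast
  qed
  also have "\<dots> = add_pow (mod_p p G) a E"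
    unfolding x(2) by (rule thom_maps(3)[OF tgroup_axioms tg_modp thom_kap x(1)])
  finally show ?thesis .
qed

lemma zp_sglq:
  assumes N: "N \<ge> 1" and k: "\<And>x. x \<in> carrier G \<Longrightarrow> p ^ (N - 1) \<diamondop> x = \<zero>"
    and irr: "irr_le2 p Q" and Q: "\<And>x. x \<in> carrier G \<Longrightarrow> act G Q x = \<zero>"
  shows "sglq G p N Q (mod_p p G) (kap p G)"
proof (intro sglq.intro sgl.intro sgl_axioms.intro sglq_axioms.intro tgroup_axioms finG p irr N k Q tg_modp thom_kap kap_ker)
  show "kap p G ` carrier G = carrier (mod_p p G)" by (simp add: modp_simps)
qed

end

lemma Zp_range: "z \<in> carrier (Zp_ring p) \<Longrightarrow> 0 \<le> z k \<and> z k < p ^ k"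
  by (simp add: Zp_simps)

section \<open>Irreducibility over F_p and its integral counterpart\<close>

lemma (in field) pirreducible_no_root:
  assumes f: "f \<in> carrier (poly_ring R)" and irr: "pirreducible (carrier R) f" and len: "length f = 3" and x: "x \<in> carrier R"
  shows "eval f x \<noteq> \<zero>"
proof
  assume "eval f x = \<zero>"
  moreover have "f \<noteq> []" using len by auto
  ultimately have "is_root f x" using x by (simp add: is_root_def)
  then have dv: "[\<one>, \<ominus> x] divides\<^bsub>poly_ring R\<^esub> f" using is_root_imp_pdivides[OF f] by (simp add: pdivides_def)
  have b: "[\<one>, \<ominus> x] \<in> carrier (poly_ring R)" using x by (simp add: univ_poly_carrier[symmetric] polynomial_def)
  \<comment> \<open>A divisor of an irreducible polynomial is a unit or an associate; the linear
    factor is a list of length 2, so it is neither.\<close>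
  from divides_pirreducible_condition[OF irr b dv] show False
  proof
    assume "[\<one>, \<ominus> x] \<in> Units (poly_ring R)"
    then show False using univ_poly_carrier_units_incl by auto
  next
    assume "[\<one>, \<ominus> x] \<sim>\<^bsub>poly_ring R\<^esub> f"
    then have "length [\<one>, \<ominus> x] = length f"
      by (rule associated_polynomials_imp_same_length[OF carrier_is_subring b f])
    then show False using len by simp
  qed
qed

text \<open>Levels N and 1 of a p-adic integer agree modulo p, so a root of
  \<open>lvlpoly N P\<close> modulo p would be a root of \<open>map red_p P\<close>, and an
  irreducible quadratic has none. Irreducibility also excludes constants, whence the lower bound on
  the length.\<close>

lemma irr_le2_lvlpoly:
  assumes p: "Factorial_Ring.prime p" and N: "N \<ge> 1"
    and P: "P \<in> carrier (univ_poly (Zp_ring p) (carrier (Zp_ring p)))" "P \<noteq> []" "hd P = \<one>\<^bsub>Zp_ring p\<^esub>" "length P - 1 \<le> 2"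
    and irr: "pirreducible\<^bsub>residue_ring p\<^esub> (carrier (residue_ring p)) (map red_p P)"
  shows "irr_le2 p (lvlpoly N P)" "Polynomial.degree (lvlpoly N P) = length P - 1" "length P \<ge> 2"
proof -
  \<comment> \<open>\<open>residues_prime\<close> takes the prime as a natural number.\<close>
  define pn where "pn = nat p"
  have pp: "p = int pn" "Factorial_Ring.prime pn" using p unfolding pn_def prime_int_nat_transfer by simp_all
  interpret F: residues_prime pn "residue_ring (int pn)" by (simp add: residues_prime_def pp(2))
  have p1: "p > 1" by (rule prime_gt_1_int[OF p])
  have coeffs: "pcoeff P m \<in> carrier (Zp_ring p)" if "m < length P" for m by (rule Zp_poly_coeffs[OF P(1) that])
  have hd1: "hd (map red_p P) = 1" using P(2,3) p1 by (simp add: hd_map red_p_def Zp_simps)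
  have setP: "set P \<subseteq> carrier (Zp_ring p)"
    using P(1,2) by (simp add: univ_poly_carrier[symmetric] polynomial_def)
  have setm: "set (map red_p P) \<subseteq> carrier (residue_ring p)"
  proof
    fix y assume "y \<in> set (map red_p P)"
    then obtain z where z: "z \<in> set P" "y = z 1" by (auto simp: red_p_def)
    then have "z \<in> carrier (Zp_ring p)" using setP by blast
    then have "0 \<le> z 1 \<and> z 1 < p ^ 1" by (rule Zp_range)
    then show "y \<in> carrier (residue_ring p)" using z(2) by (simp add: residue_ring_def)
  qed
  have mP: "map red_p P \<in> carrier (univ_poly (residue_ring p) (carrier (residue_ring p)))"
    using setm hd1 unfolding univ_poly_carrier[symmetric] polynomial_def by (simp add: residue_ring_def)
  have "Polynomials.degree (map red_p P) \<ge> 1"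
    using F.pirreducible_degree[OF F.carrier_is_subfield] mP irr unfolding pp(1) by blast
  then show len2: "length P \<ge> 2" by simp
  let ?Q = "lvlpoly N P" and ?d = "length P - 1"
  have cQ: "Polynomial.coeff ?Q m = (if m < length P then pcoeff P m N else 0)" for m
    by (simp add: lvlpoly_def coeff_rpoly)
  have lead: "Polynomial.coeff ?Q ?d = 1"
  proof -
    have "pcoeff P ?d = hd P" using P(2) by (simp add: pcoeff_def hd_conv_nth)
    then have "pcoeff P ?d N = 1 mod p ^ N" using P(3) by (simp add: Zp_simps)
    also have "\<dots> = 1" using p1 N by (simp add: one_less_power)
    finally show ?thesis using len2 by (simp add: cQ)
  qed
  show deg: "Polynomial.degree ?Q = ?d"
  proof (rule antisym)
    show "Polynomial.degree ?Q \<le> ?d" by (rule degree_le) (auto simp: cQ)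
    show "?d \<le> Polynomial.degree ?Q" by (rule le_degree) (use lead in simp)
  qed
  have "\<not> p dvd poly ?Q a" if l3: "length P = 3" for a
  proof
    assume dv: "p dvd poly ?Q a"
    define x where "x = a mod p"
    have x: "x \<in> carrier (residue_ring p)" using p1 by (simp add: x_def residue_ring_def zle_diff1_eq)
    obtain u v w where uvw: "P = [u, v, w]" using l3 by (auto simp: numeral_3_eq_3 length_Suc_conv)
    have pc: "pcoeff P 0 = w" "pcoeff P (Suc 0) = v" by (simp_all add: pcoeff_def uvw)
    have vw: "v \<in> carrier (Zp_ring p)" "w \<in> carrier (Zp_ring p)" using setP uvw by simp_all
    have m: "v N mod p = v 1" "w N mod p = w 1"
      using Zp_compat[OF vw(1) N] Zp_compat[OF vw(2) N] by simp_all
    have "?Q = [:w N, v N, 1:]"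
    proof (rule poly_eqI)
      fix m :: nat
      consider "m = 0" | "m = 1" | "m = 2" | "m > 2" by linarith
      then show "Polynomial.coeff ?Q m = Polynomial.coeff [:w N, v N, 1:] m"
        using lead by cases (auto simp: cQ l3 pc coeff_pCons numeral_2_eq_2 split: nat.splits)
    qed
    then have "poly ?Q a = w N + a * (v N + a)" by simp
    then have "(w N + a * (v N + a)) mod p = 0" using dv by (simp add: dvd_eq_mod_eq_0)
    moreover have "(w 1 + x * (v 1 + x)) mod p = (w N + a * (v N + a)) mod p"
      unfolding m[symmetric] x_def by (intro mod_add_cong mod_mult_cong) simp_all
    ultimately have z: "(w 1 + x * (v 1 + x)) mod p = 0" by simp
    have u1: "u 1 = 1" using hd1 by (simp add: uvw red_p_def)
    have xp: "x [^]\<^bsub>residue_ring p\<^esub> (Suc (Suc 0)) = (x * x) mod p" "x [^]\<^bsub>residue_ring p\<^esub> (Suc 0) = x"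
      "x [^]\<^bsub>residue_ring p\<^esub> (0::nat) = 1"
      using x p1 by (simp_all add: nat_pow_def residue_ring_def)
    have "ring.eval (residue_ring p) (map red_p P) x = (x * x + (v 1 * x + w 1)) mod p"
    proof -
      have "ring.eval (residue_ring p) [a, b, c] x = a \<otimes>\<^bsub>residue_ring p\<^esub> (x [^]\<^bsub>residue_ring p\<^esub> (Suc (Suc 0)))
        \<oplus>\<^bsub>residue_ring p\<^esub> (b \<otimes>\<^bsub>residue_ring p\<^esub> (x [^]\<^bsub>residue_ring p\<^esub> (Suc 0))
        \<oplus>\<^bsub>residue_ring p\<^esub> (c \<otimes>\<^bsub>residue_ring p\<^esub> (x [^]\<^bsub>residue_ring p\<^esub> (0::nat)) \<oplus>\<^bsub>residue_ring p\<^esub> \<zero>\<^bsub>residue_ring p\<^esub>))" for a b c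
        unfolding pp(1) by (simp only: F.eval.simps list.sel list.size add_0_right One_nat_def add_Suc_right diff_Suc_Suc diff_zero)
      then show ?thesis unfolding uvw list.map xp by (simp add: red_p_def u1[unfolded One_nat_def] residue_ring_def mod_simps)
    qed
    also have "x * x + (v 1 * x + w 1) = w 1 + x * (v 1 + x)" by (simp add: algebra_simps)
    finally have "ring.eval (residue_ring p) (map red_p P) x = \<zero>\<^bsub>residue_ring p\<^esub>" using z by (simp add: residue_ring_def)
    moreover have "ring.eval (residue_ring p) (map red_p P) x \<noteq> \<zero>\<^bsub>residue_ring p\<^esub>"
      using F.pirreducible_no_root[of "map red_p P" x] mP irr x l3 unfolding pp(1) by simp
    ultimately show False by contradiction
  qed
  moreover have "length P = 2 \<or> length P = 3" using len2 P(4) by linarith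
  ultimately show "irr_le2 p ?Q" unfolding irr_le2_def deg using lead by auto
qed

text \<open>If p divided the difference, the leading coefficient 1 would force equal lengths, and
  compatibility of the levels would make all coefficients agree at level 1.\<close>

lemma lvlpoly_distinct:
  assumes p: "Factorial_Ring.prime p" and N: "N \<ge> 1"
    and P: "P \<in> carrier (univ_poly (Zp_ring p) (carrier (Zp_ring p)))" "irr_le2 p (lvlpoly N P)" "Polynomial.degree (lvlpoly N P) = length P - 1" "length P \<ge> 2"
    and P': "P' \<in> carrier (univ_poly (Zp_ring p) (carrier (Zp_ring p)))" "irr_le2 p (lvlpoly N P')" "Polynomial.degree (lvlpoly N P') = length P' - 1" "length P' \<ge> 2"
    and ne: "map red_p P \<noteq> map red_p P'"
  shows "comax p (lvlpoly N P) (lvlpoly N P')"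
proof (rule comax_distinct[OF p P(2) P'(2)])
  let ?Q = "lvlpoly N P" and ?Q' = "lvlpoly N P'"
  have np: "\<not> p dvd 1" "\<not> p dvd - 1" using p by (metis not_prime_unit, metis not_prime_unit dvd_minus_iff)
  have l: "Polynomial.coeff ?Q (length P - 1) = 1" "Polynomial.coeff ?Q' (length P' - 1) = 1"
    using P(2,3) P'(2,3) by (simp_all add: irr_le2_def)
  have c: "Polynomial.coeff (lvlpoly N P) m = (if m < length P then pcoeff P m N else 0)" for m P
    by (simp add: lvlpoly_def coeff_rpoly)
  show "\<not> (\<forall>m. p dvd Polynomial.coeff (?Q - ?Q') m)"
  proof
    assume d: "\<forall>m. p dvd Polynomial.coeff (?Q - ?Q') m"
    consider "length P < length P'" | "length P' < length P" | "length P = length P'" by linarith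
    then show False
    proof cases
      case 1
      then have "Polynomial.coeff (?Q - ?Q') (length P' - 1) = - 1" using l(2) P(4) P'(4) by (simp add: c)
      then show False using d np by metis
    next
      case 2
      then have "Polynomial.coeff (?Q - ?Q') (length P - 1) = 1" using l(1) P(4) P'(4) by (simp add: c)
      then show False using d np by metis
    next
      case 3
      have "map red_p P = map red_p P'"
      proof (rule nth_equalityI)
        fix i assume "i < length (map red_p P)"
        then have i: "i < length P" by simp
        let ?m = "length P - 1 - i"
        have m: "?m < length P" using P(4) by linarith
        have e: "pcoeff P ?m = P ! i" "pcoeff P' ?m = P' ! i" using i 3 by (simp_all add: pcoeff_def)
        have "p dvd Polynomial.coeff ?Q ?m - Polynomial.coeff ?Q' ?m" using d by (metis coeff_diff)
        then have "pcoeff P ?m N mod p = pcoeff P' ?m N mod p" using m 3 by (simp add: c mod_eq_dvd_iff)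
        then have "pcoeff P ?m 1 = pcoeff P' ?m 1"
          using Zp_compat[OF Zp_poly_coeffs[OF P(1) m] N] Zp_compat[OF Zp_poly_coeffs[OF P'(1), of ?m] N] m 3 by simp
        then show "map red_p P ! i = map red_p P' ! i" using e i 3 by (simp add: red_p_def)
      qed (use 3 in simp)
      then show False using ne by simp
    qed
  qed
qed

section \<open>The two events expressed by good pairs\<close>

lemma Zp_event:
  assumes p: "Factorial_Ring.prime p" and N: "N \<ge> 1"
    and P: "P \<in> carrier (univ_poly (Zp_ring p) (carrier (Zp_ring p)))"
    and T: "poly_tmodule (Zp_ring p) P G"
    and k: "\<And>x. x \<in> carrier G \<Longrightarrow> add_pow G (p ^ (N - 1)) x = \<zero>\<^bsub>G\<^esub>"
    and Y: "Y \<in> mats (Zp_ring p) n"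
  shows "tmod_iso (Zp_ring p) (cok (Zp_ring p) n (mpoly_eval (Zp_ring p) n P Y) Y) G \<longleftrightarrow>
    (\<exists>g\<in>{..<n} \<rightarrow>\<^sub>E carrier G. gpair (p ^ N) n (lvlpoly N P) G (\<lambda>i j. Y i j N) g)"
proof -
  let ?R = "Zp_ring p" and ?B = "mpoly_eval (Zp_ring p) n P Y"
  interpret G: tgroup G by (rule poly_tmodule_tgroup[OF T])
  have M: "module ?R G" using T by (simp add: poly_tmodule_def)
  interpret M: module ?R G by (rule M)
  have p0: "p > 0" using prime_gt_0_int[OF p] .
  have R: "cring ?R" by (rule M.R.is_cring)
  interpret A: aring ?R "p ^ N" "\<lambda>z. z N" "iz p" n by (rule aring_Zp[OF p0 R])
  have cf: "\<And>m. m < length P \<Longrightarrow> pcoeff P m \<in> carrier ?R" by (rule Zp_poly_coeffs[OF P])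
  have B: "?B \<in> mats ?R n" by (rule A.mpoly_mats[OF Y cf])
  have pN: "p ^ N = p * p ^ (N - 1)" using N by (cases N) auto
  have kN: "add_pow G (p ^ N) x = \<zero>\<^bsub>G\<^esub>" if "x \<in> carrier G" for x
    unfolding pN using that k[OF that] by (simp add: G.zm_mult)
  interpret C: coksit ?R "p ^ N" "\<lambda>z. z N" "iz p" n Y ?B "lvlpoly N P"
  proof
    show "Y \<in> mats ?R n" "?B \<in> mats ?R n" by (rule Y, rule B)
    fix v assume v: "v \<in> vecs ?R n"
    show "mvmult ?R n Y (mvmult ?R n ?B v) = mvmult ?R n ?B (mvmult ?R n Y v)" by (rule Zp_comm[OF p0 R Y cf v])
    show "A.rv (mvmult ?R n ?B v) = red (p ^ N) (act (VM 0 n (A.rm Y)) (lvlpoly N P) (A.rv v))"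
    proof (rule A.rv_mpoly[OF Y cf v])
      show "Polynomial.coeff (lvlpoly N P) m mod p ^ N = pcoeff P m N" if "m < length P" for m
        using that A.\<rho>_mod[OF cf[OF that]] by (simp add: lvlpoly_def coeff_rpoly)
    qed (simp_all add: lvlpoly_def coeff_rpoly)
  qed
  have rm: "A.rm Y = (\<lambda>i j. Y i j N)" by (simp add: A.rm_def)
  have sm: "module.smult G a x = add_pow G (a N) x" if "a \<in> carrier ?R" "x \<in> carrier G" for a x
    by (rule Zp_smult_level[OF p0 M kN that])
  show ?thesis
  proof
    assume "tmod_iso ?R (cok ?R n ?B Y) G"
    then show "\<exists>g\<in>{..<n} \<rightarrow>\<^sub>E carrier G. gpair (p ^ N) n (lvlpoly N P) G (\<lambda>i j. Y i j N) g"
      using C.iso_imp_gpair[OF G.tgroup_axioms sm] unfolding rm by blast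
  next
    assume "\<exists>g\<in>{..<n} \<rightarrow>\<^sub>E carrier G. gpair (p ^ N) n (lvlpoly N P) G (\<lambda>i j. Y i j N) g"
    then obtain g where gE: "g \<in> {..<n} \<rightarrow>\<^sub>E carrier G" and gp: "gpair (p ^ N) n (lvlpoly N P) G (A.rm Y) g"
      unfolding rm by (elim bexE)
    have g: "g \<in> {..<n} \<rightarrow> carrier G" using gE by (simp add: PiE_iff Pi_iff)
    \<comment> \<open>F kills p^(N-1) V because p^(N-1) kills G, so p^(N-1) V lies in the image of
      P(Y) plus p^N Z_p^n. Nakayama absorbs the last summand; hence level N determines the p-adic
      event.\<close>
    have nak: "vsmult ?R n (iz p (p ^ (N - 1))) V \<in> mvmult ?R n ?B ` vecs ?R n" if V: "V \<in> vecs ?R n" for V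
    proof (rule Zp_nakayama[OF p0 R B _ V])
      fix V assume V: "V \<in> vecs ?R n"
      have S: "Suc (N - 1) = N" using N by simp
      have W: "vsmult ?R n (iz p (p ^ (N - 1))) V \<in> vecs ?R n" by (rule A.vs_closed[OF A.\<iota>_closed V])
      have "Fm G n g (A.rv (vsmult ?R n (iz p (p ^ (N - 1))) V)) = Fm G n g (\<lambda>i. p ^ (N - 1) * A.rv V i)"
        unfolding A.rv_smult[OF V A.\<iota>_closed]
        by (rule G.Fm_eq_mod[OF g kN]) (simp_all add: red_def A.\<rho>\<iota> mod_simps)
      also have "\<dots> = \<zero>\<^bsub>G\<^esub>" unfolding G.Fm_scale[OF g] by (rule k[OF G.Fm_closed[OF g]])
      finally show "\<exists>a\<in>vecs ?R n. \<exists>b\<in>vecs ?R n. vsmult ?R n (iz p (p ^ (N - 1))) V =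
        vadd ?R n (mvmult ?R n ?B a) (vsmult ?R n (iz p (p ^ Suc (N - 1))) b)"
        unfolding S by (rule C.gpair_kernel[OF gp W])
    qed
    have qI: "vsmult ?R n (iz p (p ^ N)) u \<in> C.I" if u: "u \<in> vecs ?R n" for u
    proof -
      have "vsmult ?R n (iz p (p ^ N)) u = vsmult ?R n (iz p (p ^ (N - 1))) (vsmult ?R n (iz p p) u)"
        unfolding pN mult.commute[of p] A.\<iota>_mult using u A.vecsD(1)[OF u]
        by (auto simp: vsmult_def fun_eq_iff M.R.m_assoc)
      then show ?thesis unfolding C.I_def using nak[OF A.vs_closed[OF A.\<iota>_closed u]] by simp
    qed
    show "tmod_iso ?R (cok ?R n ?B Y) G"
      by (rule C.gpair_imp_iso[OF G.tgroup_axioms sm kN poly_tmodule_act[OF p0 T P kN] g gp qI])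
  qed
qed

lemma mats_residue: "mats (residue_ring p) n = IM p n"
  by (auto simp: mats_def IM_def residue_ring_def)

lemma res_event:
  assumes p: "Factorial_Ring.prime p" and N: "N \<ge> 1"
    and P: "P \<in> carrier (univ_poly (Zp_ring p) (carrier (Zp_ring p)))"
    and G: "tgroup G" and pG: "\<And>x. x \<in> carrier G \<Longrightarrow> add_pow G p x = \<zero>\<^bsub>G\<^esub>"
    and PG: "\<And>x. x \<in> carrier G \<Longrightarrow> act G (lvlpoly N P) x = \<zero>\<^bsub>G\<^esub>"
    and sm: "\<And>a x. \<lbrakk>a \<in> carrier (residue_ring p); x \<in> carrier G\<rbrakk> \<Longrightarrow> module.smult G a x = add_pow G a x"
    and Y: "Y \<in> mats (residue_ring p) n"
  shows "tmod_iso (residue_ring p) (cok (residue_ring p) n (mpoly_eval (residue_ring p) n (map red_p P) Y) Y) G \<longleftrightarrow>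
    (\<exists>g\<in>{..<n} \<rightarrow>\<^sub>E carrier G. gpair p n (lvlpoly N P) G Y g)"
proof -
  let ?R = "residue_ring p" and ?P = "map red_p P"
  let ?B = "mpoly_eval ?R n ?P Y"
  interpret G: tgroup G by (rule G)
  have p1: "p > 1" using prime_gt_1_int[OF p] .
  have resc: "a \<in> carrier ?R \<longleftrightarrow> 0 \<le> a \<and> a < p" for a by (auto simp: residue_ring_def)
  have resm: "(p mod p) \<otimes>\<^bsub>?R\<^esub> z = \<zero>\<^bsub>?R\<^esub>" for z by (simp add: residue_ring_def)
  interpret A: aring ?R p "\<lambda>z. z" "\<lambda>k. k mod p" n by (rule aring_res[OF p1])
  have pcm: "pcoeff ?P m = pcoeff P m 1" if "m < length P" for m
    using that by (simp add: pcoeff_def red_p_def)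
  have cf: "pcoeff ?P m \<in> carrier ?R" if "m < length ?P" for m
  proof -
    have m: "m < length P" using that by simp
    have "0 \<le> pcoeff P m 1 \<and> pcoeff P m 1 < p ^ 1" by (rule Zp_range[OF Zp_poly_coeffs[OF P m]])
    then show ?thesis unfolding pcm[OF m] resc power_one_right .
  qed
  have B: "?B \<in> mats ?R n" by (rule A.mpoly_mats[OF Y cf])
  have rm: "A.rm Y = Y" by (simp add: A.rm_def)
  interpret C: coksit ?R p "\<lambda>z. z" "\<lambda>k. k mod p" n Y ?B "lvlpoly N P"
  proof
    show "Y \<in> mats ?R n" "?B \<in> mats ?R n" by (rule Y, rule B)
    fix v assume v: "v \<in> vecs ?R n"
    show "mvmult ?R n Y (mvmult ?R n ?B v) = mvmult ?R n ?B (mvmult ?R n Y v)"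
      using A.rv_comm[OF Y cf v] unfolding A.rv_def .
    show "A.rv (mvmult ?R n ?B v) = red p (act (VM 0 n (A.rm Y)) (lvlpoly N P) (A.rv v))"
    proof (rule A.rv_mpoly[OF Y cf v])
      show "Polynomial.coeff (lvlpoly N P) m mod p = pcoeff ?P m" if "m < length ?P" for m
        using that Zp_compat[OF Zp_poly_coeffs[OF P] N, of m] pcm[of m] by (simp add: lvlpoly_def coeff_rpoly)
    qed (simp_all add: lvlpoly_def coeff_rpoly)
  qed
  \<comment> \<open>Here q = p is zero in the ring, so the inclusion is that of the zero
    vector.\<close>
  have qI: "vsmult ?R n (p mod p) u \<in> C.I" if u: "u \<in> vecs ?R n" for u
  proof -
    have "vsmult ?R n (p mod p) u = (\<lambda>_. \<zero>\<^bsub>?R\<^esub>)" unfolding vsmult_def resm by (simp only: if_cancel)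
    moreover have "(\<lambda>_. \<zero>\<^bsub>?R\<^esub>) \<in> C.I" using C.sgrp_I unfolding C.V.sgrp_def A.VG_simps by blast
    ultimately show ?thesis by simp
  qed
  show ?thesis
  proof
    assume "tmod_iso ?R (cok ?R n ?B Y) G"
    then show "\<exists>g\<in>{..<n} \<rightarrow>\<^sub>E carrier G. gpair p n (lvlpoly N P) G Y g"
      using C.iso_imp_gpair[OF G sm] unfolding rm by blast
  next
    assume "\<exists>g\<in>{..<n} \<rightarrow>\<^sub>E carrier G. gpair p n (lvlpoly N P) G Y g"
    then obtain g where gE: "g \<in> {..<n} \<rightarrow>\<^sub>E carrier G" and gp: "gpair p n (lvlpoly N P) G (A.rm Y) g"
      unfolding rm by (elim bexE)
    have g: "g \<in> {..<n} \<rightarrow> carrier G" using gE by (simp add: PiE_iff Pi_iff)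
    show "tmod_iso ?R (cok ?R n ?B Y) G"
      by (rule C.gpair_imp_iso[OF G sm pG PG g gp qI])
  qed
qed

section \<open>Haar measure in terms of digits\<close>

lemma digit_sum_range:
  fixes p :: int assumes "p > 0" "\<And>m. m < N \<Longrightarrow> 0 \<le> x m \<and> x m < p"
  shows "0 \<le> (\<Sum>m<N. x m * p ^ m) \<and> (\<Sum>m<N. x m * p ^ m) < p ^ N"
  using assms(2)
proof (induction N)
  case (Suc N)
  then have IH: "0 \<le> (\<Sum>m<N. x m * p ^ m)" "(\<Sum>m<N. x m * p ^ m) < p ^ N" by auto
  have xN: "0 \<le> x N" "x N + 1 \<le> p" using Suc.prems[of N] by auto
  have "(x N + 1) * p ^ N \<le> p * p ^ N" using xN(2) assms(1) by (intro mult_right_mono) auto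
  then show ?case using IH xN(1) assms(1) by (simp add: algebra_simps)
qed simp

text \<open>The lowest digit is the residue modulo p; subtract it, divide by p and repeat.\<close>

lemma digit_sum_inj:
  fixes p :: int
  assumes "p > 0" "\<And>m. m < N \<Longrightarrow> 0 \<le> x m \<and> x m < p" "\<And>m. m < N \<Longrightarrow> 0 \<le> y m \<and> y m < p"
    "(\<Sum>m<N. x m * p ^ m) = (\<Sum>m<N. y m * p ^ m)" "m < N"
  shows "x m = y m"
  using assms(2-5)
proof (induction N arbitrary: x y m)
  case (Suc N)
  have s: "(\<Sum>m<Suc N. z m * p ^ m) = z 0 + p * (\<Sum>m<N. z (Suc m) * p ^ m)" for z :: "nat \<Rightarrow> int"
    by (simp only: sum.lessThan_Suc_shift) (simp add: sum_distrib_left mult.left_commute)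
  have e: "x 0 + p * (\<Sum>m<N. x (Suc m) * p ^ m) = y 0 + p * (\<Sum>m<N. y (Suc m) * p ^ m)"
    using Suc.prems(3) unfolding s .
  have r: "0 \<le> x 0" "x 0 < p" "0 \<le> y 0" "y 0 < p" using Suc.prems(1,2)[of 0] by auto
  have "(x 0 + p * (\<Sum>m<N. x (Suc m) * p ^ m)) mod p = (y 0 + p * (\<Sum>m<N. y (Suc m) * p ^ m)) mod p" using e by simp
  then have x0: "x 0 = y 0" using r by simp
  then have "(\<Sum>m<N. x (Suc m) * p ^ m) = (\<Sum>m<N. y (Suc m) * p ^ m)" using e assms(1) by simp
  then have "x (Suc k) = y (Suc k)" if "k < N" for k
    using Suc.IH[of "\<lambda>m. x (Suc m)" "\<lambda>m. y (Suc m)" k] Suc.prems(1,2) that by simp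
  then show ?case using x0 Suc.prems(4) by (cases m) auto
qed simp

text \<open>The matrix formed from the first N digits. The reduction modulo p^N makes it an element
  of \<open>IM (p ^ N) n\<close> also for digits outside the standard range.\<close>

definition lev :: "int \<Rightarrow> nat \<Rightarrow> nat \<Rightarrow> (nat \<times> nat \<times> nat \<Rightarrow> int) \<Rightarrow> nat \<Rightarrow> nat \<Rightarrow> int" where
  "lev p n N d = (\<lambda>i j. if i < n \<and> j < n then (\<Sum>m<N. d (i, j, m) * p ^ m) mod p ^ N else 0)"

text \<open>Injective by uniqueness of base-p expansions, and onto by counting.\<close>

lemma lev_bij:
  assumes p: "p > 0"
  shows "bij_betw (lev p n N) (({..<n} \<times> {..<n} \<times> {..<N}) \<rightarrow>\<^sub>E {0..<p}) (IM (p ^ N) n)"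
proof -
  let ?J = "{..<n} \<times> {..<n} \<times> {..<N}"
  let ?D = "?J \<rightarrow>\<^sub>E {0..<p}"
  have fin: "finite ?D" by (intro finite_PiE) auto
  have sub: "lev p n N ` ?D \<subseteq> IM (p ^ N) n" using p by (intro image_subsetI) (simp add: IM_def lev_def)
  have inj: "inj_on (lev p n N) ?D"
  proof (rule inj_onI)
    fix x y assume xy: "x \<in> ?D" "y \<in> ?D" "lev p n N x = lev p n N y"
    have "x t = y t" if t: "t \<in> ?J" for t
    proof -
      obtain i j m where ijm: "t = (i, j, m)" "i < n" "j < n" "m < N" using t by auto
      have rx: "0 \<le> z (i, j, m) \<and> z (i, j, m) < p" if "z \<in> ?D" "m < N" for z m
        using PiE_mem[OF that(1), of "(i, j, m)"] ijm that(2) by simp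
      have "(\<Sum>m<N. x (i, j, m) * p ^ m) mod p ^ N = (\<Sum>m<N. y (i, j, m) * p ^ m) mod p ^ N"
        using fun_cong[OF fun_cong[OF xy(3), of i], of j] ijm by (simp add: lev_def)
      then have "(\<Sum>m<N. x (i, j, m) * p ^ m) = (\<Sum>m<N. y (i, j, m) * p ^ m)"
        using digit_sum_range[OF p, of N "\<lambda>m. x (i, j, m)"] digit_sum_range[OF p, of N "\<lambda>m. y (i, j, m)"] rx[OF xy(1)] rx[OF xy(2)] by simp
      then show ?thesis unfolding ijm(1)
        using digit_sum_inj[OF p, of N "\<lambda>m. x (i, j, m)" "\<lambda>m. y (i, j, m)" m] rx[OF xy(1)] rx[OF xy(2)] ijm(4) by simp
    qed
    then show "x = y" by (rule PiE_ext[OF xy(1,2)])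
  qed
  have c: "card ?D = card (IM (p ^ N) n)"
  proof -
    have "card ?D = nat p ^ (N * (n * n))" by (simp add: card_PiE card_cartesian_product mult_ac)
    moreover have "card (IM (p ^ N) n) = nat p ^ (N * (n * n))"
      using card_IM(2)[of "p ^ N" n] p by (simp add: nat_power_eq power_mult)
    ultimately show ?thesis by simp
  qed
  have "lev p n N ` ?D = IM (p ^ N) n"
    by (rule card_subset_eq) (use card_IM(1)[of "p ^ N" n] p sub card_image[OF inj] c in auto)
  then show ?thesis using inj by (simp add: bij_betw_def)
qed

text \<open>The event depends on finitely many digits, so it is a cylinder and its measure is that
  of its base in a finite product. There all admissible digit patterns have the same mass p^(-N
  n^2), and \<open>lev_bij\<close> turns patterns into matrices.\<close>

lemma digit_measure:
  assumes p: "p > 0"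
  shows "measure (digit_space p n) {d \<in> space (digit_space p n). E (lev p n N d)} =
    real (card {A \<in> IM (p ^ N) n. E A}) / real (card (IM (p ^ N) n))"
proof -
  let ?I = "{..<n} \<times> {..<n} \<times> (UNIV :: nat set)" and ?J = "{..<n} \<times> {..<n} \<times> {..<N}"
  let ?q = "pmf_of_set {0..<p}" and ?D = "({..<n} \<times> {..<n} \<times> {..<N}) \<rightarrow>\<^sub>E {0..<p}"
  let ?M = "\<lambda>_ :: nat \<times> nat \<times> nat. measure_pmf (pmf_of_set {0..<p})"
  interpret P: product_prob_space ?M ?I
    by (intro product_prob_spaceI) (rule prob_space_measure_pmf)
  interpret F: finite_product_prob_space ?M ?J by unfold_locales auto
  have JI: "?J \<subseteq> ?I" "finite ?J" by auto
  \<comment> \<open>A finite product of countable discrete spaces is discrete, hence every set of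
    patterns is measurable.\<close>
  have setsJ: "sets (PiM ?J ?M) = Pow (?J \<rightarrow>\<^sub>E UNIV)"
  proof -
    have "sets (PiM ?J ?M) = sets (PiM ?J (\<lambda>_. count_space (UNIV :: int set)))" by (intro sets_PiM_cong) auto
    also have "PiM ?J (\<lambda>_. count_space (UNIV :: int set)) = count_space (?J \<rightarrow>\<^sub>E UNIV)" by (intro count_space_PiM_finite) auto
    finally show ?thesis by simp
  qed
  let ?S = "{x \<in> ?J \<rightarrow>\<^sub>E UNIV. E (lev p n N x)}"
  have S: "?S \<in> sets (PiM ?J ?M)" unfolding setsJ by blast
  have levr: "lev p n N (restrict d ?J) = lev p n N d" for d by (simp add: lev_def fun_eq_iff)
  have "{d \<in> space (digit_space p n). E (lev p n N d)} = prod_emb ?I ?M ?J ?S"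
    unfolding digit_space_def prod_emb_def space_PiM by (auto simp: levr)
  then have "measure (digit_space p n) {d \<in> space (digit_space p n). E (lev p n N d)} = measure (PiM ?J ?M) ?S"
    unfolding digit_space_def measure_def using P.emeasure_PiM_emb'[OF JI S] by simp
  \<comment> \<open>Points of the space have arbitrary integers as digits; the admissible patterns
    \<open>?D\<close> have probability 1, so the rest can be cut off.\<close>
  also have "\<dots> = measure (PiM ?J ?M) (?S \<inter> ?D)"
  proof -
    have D: "?D \<in> sets (PiM ?J ?M)" unfolding setsJ by auto
    have "measure (PiM ?J ?M) ?D = (\<Prod>i\<in>?J. measure_pmf.prob ?q {0..<p})" by (rule F.prob_times) simp
    also have "\<dots> = 1" using p by (simp add: measure_pmf_of_set)
    finally have D1: "measure (PiM ?J ?M) ?D = 1" .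
    have "measure (PiM ?J ?M) ((?S \<inter> ?D) \<union> (?S - ?D)) = measure (PiM ?J ?M) (?S \<inter> ?D) + measure (PiM ?J ?M) (?S - ?D)"
      by (rule F.P.finite_measure_Union) (use S D in auto)
    moreover have "(?S \<inter> ?D) \<union> (?S - ?D) = ?S" by blast
    moreover have "measure (PiM ?J ?M) (?S - ?D) \<le> measure (PiM ?J ?M) (space (PiM ?J ?M) - ?D)"
    proof (rule F.P.finite_measure_mono)
      show "?S - ?D \<subseteq> space (PiM ?J ?M) - ?D" using sets.sets_into_space[OF S] by blast
      show "space (PiM ?J ?M) - ?D \<in> sets (PiM ?J ?M)" using D by blast
    qed
    moreover have "measure (PiM ?J ?M) (space (PiM ?J ?M) - ?D) = 0" using F.P.prob_compl[OF D] D1 by simp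
    moreover have "measure (PiM ?J ?M) (?S - ?D) \<ge> 0" by (rule measure_nonneg)
    ultimately show ?thesis by simp
  qed
  also have "\<dots> = (\<Sum>x\<in>?S \<inter> ?D. measure (PiM ?J ?M) {x})"
  proof (rule F.P.finite_measure_eq_sum_singleton)
    have "finite ?D" by (intro finite_PiE) auto
    then show "finite (?S \<inter> ?D)" by simp
    show "{x} \<in> sets (PiM ?J ?M)" if "x \<in> ?S \<inter> ?D" for x unfolding setsJ using that by auto
  qed
  also have "\<dots> = (\<Sum>x\<in>?S \<inter> ?D. (1 / real_of_int p) ^ card ?J)"
  proof (rule sum.cong[OF refl])
    fix x assume x: "x \<in> ?S \<inter> ?D"
    then have "{x} = (\<Pi>\<^sub>E i\<in>?J. {x i})" by (intro PiE_singleton[symmetric]) (auto simp: PiE_def)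
    then have "measure (PiM ?J ?M) {x} = measure (PiM ?J ?M) (\<Pi>\<^sub>E i\<in>?J. {x i})" by simp
    also have "\<dots> = (\<Prod>i\<in>?J. measure_pmf.prob ?q {x i})" by (rule F.prob_times) simp
    also have "\<dots> = (\<Prod>i\<in>?J. 1 / real_of_int p)"
    proof (rule prod.cong[OF refl])
      fix i assume "i \<in> ?J"
      then have "x i \<in> {0..<p}" using x PiE_mem[of x ?J "\<lambda>_. {0..<p}" i] by blast
      then show "measure_pmf.prob ?q {x i} = 1 / real_of_int p" using p by (simp add: measure_pmf_of_set)
    qed
    finally show "measure (PiM ?J ?M) {x} = (1 / real_of_int p) ^ card ?J" by simp
  qed
  also have "\<dots> = real (card (?S \<inter> ?D)) * (1 / real_of_int p) ^ card ?J" by simp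
  also have "card (?S \<inter> ?D) = card {A \<in> IM (p ^ N) n. E A}"
  proof (rule bij_betw_same_card)
    have b: "bij_betw (lev p n N) ?D (IM (p ^ N) n)" by (rule lev_bij[OF p])
    show "bij_betw (lev p n N) (?S \<inter> ?D) {A \<in> IM (p ^ N) n. E A}"
    proof (rule bij_betw_subset[OF b])
      show "?S \<inter> ?D \<subseteq> ?D" by blast
      have "?D \<subseteq> ?J \<rightarrow>\<^sub>E UNIV" by (rule PiE_mono) simp
      then have "?S \<inter> ?D = {x \<in> ?D. E (lev p n N x)}" by blast
      moreover have "lev p n N ` {x \<in> ?D. E (lev p n N x)} = {A \<in> lev p n N ` ?D. E A}" by blast
      ultimately show "lev p n N ` (?S \<inter> ?D) = {A \<in> IM (p ^ N) n. E A}"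
        using bij_betw_imp_surj_on[OF b] by simp
    qed
  qed
  also have "(1 / real_of_int p) ^ card ?J = 1 / real (card (IM (p ^ N) n))"
  proof -
    have "card ?J = N * (n * n)" by (simp add: card_cartesian_product mult_ac)
    moreover have "real (card (IM (p ^ N) n)) = real_of_int p ^ (N * (n * n))"
      using card_IM(2)[of "p ^ N" n] p by (simp add: nat_power_eq power_mult)
    ultimately show ?thesis by (simp only: power_one_over)
  qed
  finally show ?thesis by simp
qed

definition redm :: "int \<Rightarrow> (nat \<Rightarrow> nat \<Rightarrow> nat \<Rightarrow> int) \<Rightarrow> nat \<Rightarrow> nat \<Rightarrow> nat \<Rightarrow> int" where
  "redm p Y = (\<lambda>i j k. Y i j k mod p ^ k)"

text \<open>Digits outside the range from 0 to p-1 have probability 0 but still have to be dealt with for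
  measurability; the ring operations reduce them.\<close>
lemma cok_redm:
  "cok (Zp_ring p) n (mpoly_eval (Zp_ring p) n P Y) Y =
   cok (Zp_ring p) n (mpoly_eval (Zp_ring p) n P (redm p Y)) (redm p Y)"
proof -
  have mv: "mvmult (Zp_ring p) n Y = mvmult (Zp_ring p) n (redm p Y)"
  proof -
    have e: "Y i j \<otimes>\<^bsub>Zp_ring p\<^esub> z = redm p Y i j \<otimes>\<^bsub>Zp_ring p\<^esub> z" for i j z
      by (simp add: Zp_simps redm_def mod_simps)
    show ?thesis by (rule ext) (simp only: mvmult_def e)
  qed
  have mm: "mmult (Zp_ring p) n B Y = mmult (Zp_ring p) n B (redm p Y)" for B
  proof -
    have e: "z \<otimes>\<^bsub>Zp_ring p\<^esub> Y i j = z \<otimes>\<^bsub>Zp_ring p\<^esub> redm p Y i j" for i j z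
      by (simp add: Zp_simps redm_def mod_simps)
    show ?thesis by (simp only: mmult_def e)
  qed
  have mp: "mpow (Zp_ring p) n Y k = mpow (Zp_ring p) n (redm p Y) k" for k
    by (induction k) (simp_all add: mm)
  have "mpoly_eval (Zp_ring p) n P Y = mpoly_eval (Zp_ring p) n P (redm p Y)"
    by (simp only: mpoly_eval_def mp)
  then show ?thesis by (simp add: cok_def mv)
qed

lemma redm_digits:
  assumes p: "p > 0"
  shows "redm p (mat_of_digits p n d) \<in> mats (Zp_ring p) n"
    "(\<lambda>i j. redm p (mat_of_digits p n d) i j N) = lev p n N d"
proof -
  have "(\<Sum>m<Suc k. d (i, j, m) * p ^ m) mod p ^ k = (\<Sum>m<k. d (i, j, m) * p ^ m) mod p ^ k" for i j k
    by simp
  then have "(\<lambda>k. (\<Sum>m<k. d (i, j, m) * p ^ m) mod p ^ k) \<in> carrier (Zp_ring p)" for i j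
    using p unfolding Zp_simps by (auto simp: mod_mod_cancel)
  then show "redm p (mat_of_digits p n d) \<in> mats (Zp_ring p) n"
    by (auto simp: mats_def redm_def mat_of_digits_def Zp_simps(5))
  show "(\<lambda>i j. redm p (mat_of_digits p n d) i j N) = lev p n N d"
    by (auto simp: redm_def mat_of_digits_def lev_def fun_eq_iff)
qed

section \<open>Automorphism groups and the order of GL_r\<close>

lemma tmod_aut_TIso:
  assumes G: "tgroup G"
    and sm: "\<And>a x. \<lbrakk>a \<in> carrier R; x \<in> carrier G\<rbrakk> \<Longrightarrow> module.smult G a x = add_pow G (\<rho> a :: int) x"
  shows "tmod_aut R G = TIso G G"
proof (intro subset_antisym subsetI)
  fix \<phi> assume "\<phi> \<in> tmod_aut R G"
  then show "\<phi> \<in> TIso G G" by (auto simp: tmod_aut_def TIso_def THom_def thom_def PiE_def)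
next
  fix \<phi> assume f: "\<phi> \<in> TIso G G"
  then have t: "thom G G \<phi>" and e: "\<phi> \<in> carrier G \<rightarrow>\<^sub>E carrier G" and b: "bij_betw \<phi> (carrier G) (carrier G)"
    by (simp_all add: TIso_def THom_def)
  have "\<phi> (module.smult G a x) = module.smult G a (\<phi> x)" if "a \<in> carrier R" "x \<in> carrier G" for a x
    using sm[OF that] sm[OF that(1) thomD(1)[OF t that(2)]] thom_maps(3)[OF G G t that(2)] by simp
  then show "\<phi> \<in> tmod_aut R G" unfolding tmod_aut_def using e b thomD[OF t] by simp
qed

text \<open>For a prime power q this is the order of GL_r over the field with q elements. A factor
  q^r is taken out of each difference, and i is replaced by r - i.\<close>

lemma prod_q_diff:
  fixes q :: nat assumes "q > 0"
  shows "real (\<Prod>i<r. q ^ r - q ^ i) = real q ^ r\<^sup>2 * (\<Prod>i\<in>{1..r}. 1 - 1 / real q ^ i)"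
proof -
  have "real (\<Prod>i<r. q ^ r - q ^ i) = (\<Prod>i<r. real q ^ r * (1 - 1 / real q ^ (r - i)))"
  proof (simp only: of_nat_prod, rule prod.cong[OF refl])
    fix i assume "i \<in> {..<r}"
    then have i: "i < r" by simp
    have "q ^ i \<le> q ^ r" using assms i by (intro power_increasing) auto
    moreover have "real q ^ r = real q ^ (r - i) * real q ^ i" using i by (simp add: power_add[symmetric])
    ultimately show "real (q ^ r - q ^ i) = real q ^ r * (1 - 1 / real q ^ (r - i))"
      using assms by (simp add: of_nat_diff field_simps)
  qed
  also have "\<dots> = real q ^ r\<^sup>2 * (\<Prod>i<r. 1 - 1 / real q ^ (r - i))"
    by (simp add: prod.distrib power2_eq_square power_mult)
  also have "(\<Prod>i<r. 1 - 1 / real q ^ (r - i)) = (\<Prod>i\<in>{1..r}. 1 - 1 / real q ^ i)"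
    by (rule prod.reindex_bij_witness[of _ "\<lambda>i. r - i" "\<lambda>i. r - i"]) auto
  finally show ?thesis .
qed

theorem theorem1p4:
  fixes p :: int and n l :: nat
    and P :: "nat \<Rightarrow> (nat \<Rightarrow> int) list"
    and G :: "nat \<Rightarrow> ((nat \<Rightarrow> int), 'b) tmodule"
  assumes "Factorial_Ring.prime p" and "n \<ge> 1"
    and "\<forall>j\<in>{1..l}. P j \<in> carrier (univ_poly (Zp_ring p) (carrier (Zp_ring p)))
                    \<and> P j \<noteq> [] \<and> hd (P j) = \<one>\<^bsub>Zp_ring p\<^esub> \<and> (length (P j) - 1) \<le> 2"
    and "\<forall>j\<in>{1..l}. pirreducible\<^bsub>residue_ring p\<^esub> (carrier (residue_ring p)) (map red_p (P j))"
    and "inj_on (\<lambda>j. map red_p (P j)) {1..l}"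
    and "\<forall>j\<in>{1..l}. poly_tmodule (Zp_ring p) (P j) (G j) \<and> finite (carrier (G j))"
  shows "haar_prob_mat p n (\<lambda>Y. \<forall>j\<in>{1..l}.
             tmod_iso (Zp_ring p) (cok (Zp_ring p) n (mpoly_eval (Zp_ring p) n (P j) Y) Y) (G j))
       = (\<Prod>j\<in>{1..l}.
            let q = real_of_int p ^ (length (P j) - 1); r = r_q p (P j) (G j) in
            q ^ (r ^ 2) * (\<Prod>i\<in>{1..r}. (1 - 1 / q ^ i) ^ 2) / real (card (tmod_aut (Zp_ring p) (G j))))
         * unif_prob_mat p n (\<lambda>Xb. \<forall>j\<in>{1..l}.
             tmod_iso (residue_ring p)
               (cok (residue_ring p) n (mpoly_eval (residue_ring p) n (map red_p (P j)) Xb) Xb)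
               (mod_p p (G j)))"
proof -
  let ?Zp = "Zp_ring p" and ?F = "residue_ring p"
  have p: "Factorial_Ring.prime p" by fact
  have p0: "p > 0" using prime_gt_0_int[OF p] .
  define J where "J = {1..l}"
  have J: "finite J" by (simp add: J_def)
  have P: "P j \<in> carrier (univ_poly ?Zp (carrier ?Zp))" "P j \<noteq> []" "hd (P j) = \<one>\<^bsub>?Zp\<^esub>" "length (P j) - 1 \<le> 2" if "j \<in> J" for j
    using assms(3) that by (auto simp: J_def)
  have irrP: "pirreducible\<^bsub>?F\<^esub> (carrier ?F) (map red_p (P j))" if "j \<in> J" for j using assms(4) that by (simp add: J_def)
  have T: "poly_tmodule ?Zp (P j) (G j)" and finG: "finite (carrier (G j))" if "j \<in> J" for j
    using assms(6) that by (auto simp: J_def)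
  have tg: "tgroup (G j)" and M: "module ?Zp (G j)" if "j \<in> J" for j
    using poly_tmodule_tgroup[OF T[OF that]] T[OF that] by (auto simp: poly_tmodule_def)
  have "\<forall>j\<in>J. \<exists>M0. \<forall>m\<ge>M0. \<forall>x\<in>carrier (G j). add_pow (G j) (p ^ m) x = \<zero>\<^bsub>G j\<^esub>"
    using Zp_finite_killed[OF p0 M finG] by (intro ballI)
  from bchoice[OF this] obtain M0 where M0: "\<forall>j\<in>J. \<forall>m\<ge>M0 j. \<forall>x\<in>carrier (G j). add_pow (G j) (p ^ m) x = \<zero>\<^bsub>G j\<^esub>"
    by (elim exE)
  \<comment> \<open>The sum dominates every \<open>M0 j\<close>, so p^(N-1) kills all G_j at once;
    \<open>Suc\<close> provides the spare level, and N \<ge> 1 also for l = 0.\<close>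
  define N where "N = Suc (\<Sum>j\<in>J. M0 j)"
  have N: "N \<ge> 1" by (simp add: N_def)
  have M0le: "M0 j \<le> N - 1" if "j \<in> J" for j using member_le_sum[OF that, of M0] J by (simp add: N_def)
  have k1: "add_pow (G j) (p ^ (N - 1)) x = \<zero>\<^bsub>G j\<^esub>" if "j \<in> J" "x \<in> carrier (G j)" for j x
    using M0 M0le[OF that(1)] that by blast
  have kN: "add_pow (G j) (p ^ N) x = \<zero>\<^bsub>G j\<^esub>" if "j \<in> J" "x \<in> carrier (G j)" for j x
  proof -
    have "M0 j \<le> N" using M0le[OF that(1)] by simp
    then show ?thesis using M0 that by blast
  qed
  define Q where "Q j = lvlpoly N (P j)" for j
  have irr: "irr_le2 p (Q j)" "Polynomial.degree (Q j) = length (P j) - 1" "length (P j) \<ge> 2" if "j \<in> J" for j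
    unfolding Q_def by (rule irr_le2_lvlpoly[OF p N P[OF that] irrP[OF that]])+
  have QG: "act (G j) (Q j) x = \<zero>\<^bsub>G j\<^esub>" if "j \<in> J" "x \<in> carrier (G j)" for j x
    unfolding Q_def by (rule poly_tmodule_act[OF p0 T[OF that(1)] P(1)[OF that(1)] kN[OF that(1)] that(2)])
  have zp: "zpmod (G j) p" if "j \<in> J" for j
    by (intro zpmod.intro zpmod_axioms.intro tg[OF that] p M[OF that] finG[OF that])
  let ?Gb = "\<lambda>j. mod_p p (G j)" and ?\<kappa> = "\<lambda>j. kap p (G j)"
  have sq: "sglq (G j) p N (Q j) (?Gb j) (?\<kappa> j)" if "j \<in> J" for j
    by (rule zpmod.zp_sglq[OF zp[OF that] N k1[OF that] irr(1)[OF that] QG[OF that]])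
  have cop: "comax p (Q j) (Q i)" if "i \<in> J" "j \<in> J" "i \<noteq> j" for i j
  proof -
    have "map red_p (P j) \<noteq> map red_p (P i)" using assms(5) that unfolding inj_on_def J_def by metis
    then show ?thesis unfolding Q_def
      using lvlpoly_distinct[OF p N P(1)[OF that(2)] irr[OF that(2), unfolded Q_def] P(1)[OF that(1)] irr[OF that(1), unfolded Q_def]] by blast
  qed
  interpret multi p n N J G Q ?Gb ?\<kappa> by (rule multi.intro[OF J p N sq cop])
  define q r where "q j = nat p ^ Polynomial.degree (Q j)" and "r j = r_q p (P j) (G j)" for j
  have fqGb: "fqspace (?Gb j) p (Q j)" if "j \<in> J" for j by (rule sglq.fq_Gb[OF sq[OF that]])
  have smGb: "module.smult (?Gb j) a x = add_pow (?Gb j) a x" if "j \<in> J" "a \<in> carrier ?F" "x \<in> carrier (?Gb j)" for j a x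
    by (rule zpmod.smult_modp[OF zp[OF that(1)] that(2,3)])
  have cardGb: "card (carrier (?Gb j)) = (nat p ^ Polynomial.degree (Q j)) ^ r j" if "j \<in> J" for j
  proof -
    have "carrier ?F = {0..<p}" "\<zero>\<^bsub>?F\<^esub> = 0" by (auto simp: residue_ring_def)
    from card_fq_dim[OF fqGb[OF that] smGb[OF that] this] show ?thesis
      unfolding r_def r_q_def irr(2)[OF that] by simp
  qed
  have q0: "q j > 0" for j using p0 by (simp add: q_def)
  define EN E1 where "EN = {A \<in> IM (p ^ N) n. \<forall>j\<in>J. \<exists>g\<in>{..<n} \<rightarrow>\<^sub>E carrier (G j). gpair (p ^ N) n (Q j) (G j) A g}"
    and "E1 = {A \<in> IM p n. \<forall>j\<in>J. \<exists>g\<in>{..<n} \<rightarrow>\<^sub>E carrier (?Gb j). gpair p n (Q j) (?Gb j) A g}"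
  let ?aut = "\<lambda>j. card (tmod_aut ?Zp (G j))" and ?gl = "\<lambda>j. \<Prod>i<r j. q j ^ r j - q j ^ i"
  have aut: "tmod_aut ?Zp (G j) = TIso (G j) (G j)" if "j \<in> J" for j
    by (rule tmod_aut_TIso[OF tg[OF that] Zp_smult_level[OF p0 M[OF that] kN[OF that]]])
  have "card (goods (p ^ N) n J Q G) = card EN * (\<Prod>j\<in>J. card (TIso (G j) (G j)))"
    unfolding EN_def by (rule card_goods[OF J p_pos(2)]) (use tg finG kN QG in auto)
  then have gN: "card (goods (p ^ N) n J Q G) = card EN * (\<Prod>j\<in>J. ?aut j)" using aut by simp
  have "card (goods p n J Q ?Gb) = card E1 * (\<Prod>j\<in>J. card (TIso (?Gb j) (?Gb j)))"
    unfolding E1_def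
  proof (rule card_goods[OF J p_pos(1)])
    fix j assume j: "j \<in> J"
    show "tgroup (?Gb j) \<and> finite (carrier (?Gb j))" using fqspace.axioms(1)[OF fqGb[OF j]] fqspace.fin[OF fqGb[OF j]] by blast
    show "add_pow (?Gb j) p x = \<zero>\<^bsub>?Gb j\<^esub>" "act (?Gb j) (Q j) x = \<zero>\<^bsub>?Gb j\<^esub>" if "x \<in> carrier (?Gb j)" for x
      by (rule fqspace.p_tors[OF fqGb[OF j] that], rule fqspace.P_tors[OF fqGb[OF j] that])
  qed
  \<comment> \<open>G_j / p G_j is a space of dimension r_j over the field with q_j elements, so its
    automorphisms are counted by the order of GL_r.\<close>
  moreover have "card (TIso (?Gb j) (?Gb j)) = ?gl j" if "j \<in> J" for j
    unfolding q_def by (rule card_THom_TIso(2)[OF fqGb[OF that] fqGb[OF that] cardGb[OF that] cardGb[OF that]])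
  ultimately have g1: "card (goods p n J Q ?Gb) = card E1 * (\<Prod>j\<in>J. ?gl j)" by simp
  \<comment> \<open>One factor \<open>?gl\<close> counts the automorphisms of G_j / p G_j, the other
    the bijective connecting maps; the power q^(r^2) on the left counts all possible connecting
    maps.\<close>
  have main: "card EN * (\<Prod>j\<in>J. ?aut j) * (\<Prod>j\<in>J. q j ^ ((r j)\<^sup>2)) * card (IM p n) =
    card E1 * (\<Prod>j\<in>J. ?gl j) * card (IM (p ^ N) n) * (\<Prod>j\<in>J. ?gl j)"
    using card_goods_ratio[OF cardGb] unfolding gN g1 q_def by simp
  have haar: "haar_prob_mat p n (\<lambda>Y. \<forall>j\<in>{1..l}. tmod_iso ?Zp (cok ?Zp n (mpoly_eval ?Zp n (P j) Y) Y) (G j)) =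
    real (card EN) / real (card (IM (p ^ N) n))"
  proof -
    have "(\<forall>j\<in>J. tmod_iso ?Zp (cok ?Zp n (mpoly_eval ?Zp n (P j) (mat_of_digits p n d)) (mat_of_digits p n d)) (G j)) \<longleftrightarrow>
       (\<forall>j\<in>J. \<exists>g\<in>{..<n} \<rightarrow>\<^sub>E carrier (G j). gpair (p ^ N) n (Q j) (G j) (lev p n N d) g)" for d
    proof (rule ball_cong[OF refl])
      fix j assume j: "j \<in> J"
      show "tmod_iso ?Zp (cok ?Zp n (mpoly_eval ?Zp n (P j) (mat_of_digits p n d)) (mat_of_digits p n d)) (G j) \<longleftrightarrow>
        (\<exists>g\<in>{..<n} \<rightarrow>\<^sub>E carrier (G j). gpair (p ^ N) n (Q j) (G j) (lev p n N d) g)"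
        unfolding cok_redm[of p n _ "mat_of_digits p n d"] Q_def redm_digits(2)[OF p0, symmetric]
        by (rule Zp_event[OF p N P(1)[OF j] T[OF j] k1[OF j] redm_digits(1)[OF p0]])
    qed
    then show ?thesis unfolding haar_prob_mat_def EN_def J_def[symmetric]
      using digit_measure[OF p0, of n "\<lambda>A. \<forall>j\<in>J. \<exists>g\<in>{..<n} \<rightarrow>\<^sub>E carrier (G j). gpair (p ^ N) n (Q j) (G j) A g" N] by simp
  qed
  have unif: "unif_prob_mat p n (\<lambda>Xb. \<forall>j\<in>{1..l}. tmod_iso ?F (cok ?F n (mpoly_eval ?F n (map red_p (P j)) Xb) Xb) (?Gb j)) =
    real (card E1) / real (card (IM p n))"
  proof -
    have "{A \<in> mats ?F n. \<forall>j\<in>J. tmod_iso ?F (cok ?F n (mpoly_eval ?F n (map red_p (P j)) A) A) (?Gb j)} = E1"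
      unfolding E1_def mats_residue
    proof (rule Collect_cong, rule conj_cong[OF refl], rule ball_cong[OF refl])
      fix A j assume A: "A \<in> IM p n" and j: "j \<in> J"
      interpret B: fqspace "?Gb j" p "Q j" by (rule fqGb[OF j])
      show "tmod_iso ?F (cok ?F n (mpoly_eval ?F n (map red_p (P j)) A) A) (?Gb j) \<longleftrightarrow>
        (\<exists>g\<in>{..<n} \<rightarrow>\<^sub>E carrier (?Gb j). gpair p n (Q j) (?Gb j) A g)"
        unfolding Q_def
        by (rule res_event[OF p N P(1)[OF j] B.tgroup_axioms B.p_tors B.P_tors[unfolded Q_def] smGb[OF j] A[folded mats_residue]])
    qed
    then show ?thesis unfolding unif_prob_mat_def mats_residue J_def by simp
  qed
  have autpos: "?aut j > 0" if j: "j \<in> J" for j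
  proof -
    have "restrict id (carrier (G j)) \<in> TIso (G j) (G j)"
    proof -
      interpret G: tgroup "G j" by (rule tg[OF j])
      have "bij_betw (restrict id (carrier (G j))) (carrier (G j)) (carrier (G j))" by (rule bij_betw_byWitness[where f' = id]) auto
      then show ?thesis by (simp add: TIso_def THom_def thom_def)
    qed
    moreover have "finite (TIso (G j) (G j))"
      by (rule finite_subset[of _ "carrier (G j) \<rightarrow>\<^sub>E carrier (G j)"]) (auto simp: TIso_def THom_def intro!: finite_PiE finG[OF j])
    ultimately show ?thesis unfolding aut[OF j] by (metis card_gt_0_iff empty_iff)
  qed
  have ipos: "real (card (IM p n)) > 0" "real (card (IM (p ^ N) n)) > 0"
    using card_IM(2)[OF p_pos(1)] card_IM(2)[OF p_pos(2)] p_pos by simp_all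
  let ?w = "\<lambda>j. \<Prod>i\<in>{1..r j}. 1 - 1 / real (q j) ^ i"
  have gl: "real (?gl j) = real (q j) ^ (r j)\<^sup>2 * ?w j" for j by (rule prod_q_diff[OF q0])
  let ?A = "\<Prod>j\<in>J. real (?aut j)" and ?H = "\<Prod>j\<in>J. real (q j) ^ (r j)\<^sup>2" and ?W = "\<Prod>j\<in>J. ?w j"
  have A0: "?A \<noteq> 0" using autpos J by simp
  have H0: "?H \<noteq> 0" using q0 J by simp
  have "real (card EN) * ?A * ?H * real (card (IM p n)) = real (card E1) * (?H * ?W) * real (card (IM (p ^ N) n)) * (?H * ?W)"
    using arg_cong[OF main, of real] by (simp only: of_nat_mult of_nat_prod[of _ J] gl prod.distrib of_nat_power)
  \<comment> \<open>Each \<open>?gl\<close> is q^(r^2) times the product of the 1 - q^(-i). One of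
    the two powers cancels against the number of possible connecting maps, the other survives in the
    formula.\<close>
  then have "(real (card EN) * ?A * real (card (IM p n))) * ?H = (real (card E1) * real (card (IM (p ^ N) n)) * (?H * ?W\<^sup>2)) * ?H"
    by (simp only: power2_eq_square mult_ac)
  then have eq: "real (card EN) * ?A * real (card (IM p n)) = real (card E1) * real (card (IM (p ^ N) n)) * (?H * ?W\<^sup>2)"
    by (rule mult_right_cancel[OF H0, THEN iffD1])
  have "real (card EN) / real (card (IM (p ^ N) n)) = ?H * ?W\<^sup>2 / ?A * (real (card E1) / real (card (IM p n)))"
  proof -
    have "x / k = h / a * (e / i)" if "x * a * i = e * k * h" "a \<noteq> 0" "i > 0" "k > 0" for x k h a e i :: real
      using that by (simp add: divide_simps mult_ac)
    from this[OF eq A0 ipos] show ?thesis .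
  qed
  also have "?H * ?W\<^sup>2 / ?A = (\<Prod>j\<in>J. real (q j) ^ (r j)\<^sup>2 * (?w j)\<^sup>2 / real (?aut j))"
    by (simp only: prod.distrib prod_dividef prod_power_distrib)
  also have "\<dots> = (\<Prod>j\<in>{1..l}. let q = real_of_int p ^ (length (P j) - 1); r = r_q p (P j) (G j) in
            q ^ (r ^ 2) * (\<Prod>i\<in>{1..r}. (1 - 1 / q ^ i) ^ 2) / real (?aut j))"
  proof (unfold J_def[symmetric], rule prod.cong[OF refl])
    fix j assume j: "j \<in> J"
    have "real (q j) = real_of_int p ^ (length (P j) - 1)" unfolding q_def irr(2)[OF j] using p0 by simp
    then show "real (q j) ^ (r j)\<^sup>2 * (?w j)\<^sup>2 / real (?aut j) =
      (let q = real_of_int p ^ (length (P j) - 1); r = r_q p (P j) (G j) in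
            q ^ (r ^ 2) * (\<Prod>i\<in>{1..r}. (1 - 1 / q ^ i) ^ 2) / real (?aut j))"
      by (simp only: Let_def r_def prod_power_distrib)
  qed
  finally show ?thesis unfolding haar unif .
qed

end
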